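(* Let $K$ be a field of characteristic different from $2$ and let $(A,\sigma)$ be a finite-dimensional $K$-algebra with involution. Let $q_{A,\sigma}:A\to K$ be the quadratic form $q_{A,\sigma}(x)=\mathrm{Tr}_{A/K}(x^\sigma x)$. Then the following conditions are equivalent: (a) $n\times(A,\sigma)$ is hyperbolic for some $n\in\mathbb{N}$. (b) $\mathrm{sgn}\,q_{A,\sigma}=0$. When these conditions hold, the minimal $n$ for which (a) holds is a power of $2$.
   Context: $\mathbb{N}$ denotes the positive integers, and $1=2^0$ counts as a power of $2$. A $K$-algebra with involution is a pair $(A,\sigma)$ with $A$ a (unital, associative) $K$-algebra and $\sigma:A\to A$ a $K$-linear involution (anti-automorphism with $\sigma^2=\mathrm{id}$). $\mathrm{Tr}_{A/K}(a)$ is the trace of the $K$-linear map $x\mapsto ax$ on $A$. $n\times(A,\sigma)=(\mathrm{M}_n(A),n\times\sigma)$, where $n\times\sigma$ is the involution $(a_{ij})\mapsto(a_{ji}^\sigma)$. The pair $(A,\sigma)$ (or just $\sigma$) is hyperbolic if there is an idempotent $e\in A$ with $e^\sigma+e=1$. For an ordering $P$ of $K$ and a possibly degenerate quadratic form $q$, $\mathrm{sgn}_P q$ is the largest dimension of a subspace on which $q$ is positive definite relative to $P$ minus the largest dimension of a subspace on which it is negative definite. $\mathrm{sgn}\,q$ is the function $P\mapsto\mathrm{sgn}_P q$ on the set of all orderings of $K$; $\mathrm{sgn}\,q=0$ means it is identically zero (vacuous if $K$ has no orderings). *)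

theory Defs
  imports "Jordan_Normal_Form.Matrix"
begin

section \<open>Orderings of a field and signatures of quadratic forms\<close>

text \<open>An ordering is given by its set of nonnegative elements.\<close>

definition field_ordering :: "'k::field set \<Rightarrow> bool" where
  "field_ordering P \<longleftrightarrow>
     (\<forall>x\<in>P. \<forall>y\<in>P. x + y \<in> P) \<and> (\<forall>x\<in>P. \<forall>y\<in>P. x * y \<in> P) \<and>
     P \<union> uminus ` P = UNIV \<and> P \<inter> uminus ` P = {0}"

definition pos_def_on :: "'k::field set \<Rightarrow> ('v::zero \<Rightarrow> 'k) \<Rightarrow> 'v set \<Rightarrow> bool" where
  "pos_def_on P q U \<longleftrightarrow> (\<forall>x\<in>U. x \<noteq> 0 \<longrightarrow> q x \<in> P - {0})"

definition neg_def_on :: "'k::field set \<Rightarrow> ('v::zero \<Rightarrow> 'k) \<Rightarrow> 'v set \<Rightarrow> bool" where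
  "neg_def_on P q U \<longleftrightarrow> (\<forall>x\<in>U. x \<noteq> 0 \<longrightarrow> - q x \<in> P - {0})"

locale fin_dim_space = vector_space scale
  for scale :: "'k::field \<Rightarrow> 'v::ab_group_add \<Rightarrow> 'v" +
  assumes finite_dim: "\<exists>B. finite B \<and> span B = UNIV"
begin

text \<open>Both sets of dimensions are finite and contain the dimension of the zero subspace.\<close>

definition sgn_form :: "'k set \<Rightarrow> ('v \<Rightarrow> 'k) \<Rightarrow> int" where
  "sgn_form P q =
     int (Max {dim U | U. subspace U \<and> pos_def_on P q U}) -
     int (Max {dim U | U. subspace U \<and> neg_def_on P q U})"


section \<open>Trace of an endomorphism\<close>

text \<open>\<open>extend_basis {}\<close> is some basis of the whole space; \<open>lin_trace_eq\<close> below shows that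
  the choice of the basis does not matter.\<close>

definition lin_trace :: "('v \<Rightarrow> 'v) \<Rightarrow> 'k" where
  "lin_trace f = (\<Sum>b\<in>extend_basis {}. representation (extend_basis {}) (f b) b)"

lemma basis_trace_independent:
  assumes f: "Vector_Spaces.linear scale scale f"
    and B: "finite B" "independent B" "span B = UNIV"
    and C: "finite C" "independent C" "span C = UNIV"
  shows "(\<Sum>b\<in>B. representation B (f b) b) = (\<Sum>c\<in>C. representation C (f c) c)"
proof -
  interpret f: Vector_Spaces.linear scale scale f by (fact f)
  have expand: "(\<Sum>d\<in>D. scale (representation D v d) d) = v"
    if "finite D" "independent D" "span D = UNIV" for D v
    using that by (intro sum_representation_eq) auto
  have "representation B (f b) b = (\<Sum>c\<in>C. representation C b c * representation B (f c) b)" for b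
  proof -
    have "f b = f (\<Sum>c\<in>C. scale (representation C b c) c)"
      by (simp add: expand[OF C])
    also have "\<dots> = (\<Sum>c\<in>C. scale (representation C b c) (f c))"
      by (simp add: f.sum f.scale)
    finally have "representation B (f b) b =
        representation B (\<Sum>c\<in>C. scale (representation C b c) (f c)) b" by simp
    also have "\<dots> = (\<Sum>c\<in>C. representation C b c * representation B (f c) b)"
      using B by (simp add: representation_sum representation_scale)
    finally show ?thesis .
  qed
  hence "(\<Sum>b\<in>B. representation B (f b) b) =
      (\<Sum>b\<in>B. \<Sum>c\<in>C. representation C b c * representation B (f c) b)" by simp
  also have "\<dots> = (\<Sum>c\<in>C. \<Sum>b\<in>B. representation B (f c) b * representation C b c)"
    by (subst sum.swap) (simp add: mult.commute)
  also have "\<dots> = (\<Sum>c\<in>C. representation C (\<Sum>b\<in>B. scale (representation B (f c) b) b) c)"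
    using C by (simp add: representation_sum representation_scale)
  also have "\<dots> = (\<Sum>c\<in>C. representation C (f c) c)"
    by (simp add: expand[OF B])
  finally show ?thesis .
qed

lemma lin_trace_eq:
  assumes "Vector_Spaces.linear scale scale f"
    and B: "finite B" "independent B" "span B = UNIV"
  shows "lin_trace f = (\<Sum>b\<in>B. representation B (f b) b)"
proof -
  have E: "independent (extend_basis {})" "span (extend_basis {}) = UNIV"
    using independent_extend_basis[of "{}"] span_extend_basis[of "{}"] independent_empty by auto
  have "finite (extend_basis {})"
    using independent_span_bound[of B "extend_basis {}"] B E by auto
  thus ?thesis
    unfolding lin_trace_def using assms E by (intro basis_trace_independent) auto
qed

end


section \<open>Finite-dimensional algebras with involution\<close>

text \<open>The sort \<open>{ring, monoid_mult}\<close> is used instead of \<open>ring_1\<close> because the latter demands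
  \<open>0 \<noteq> 1\<close> and so would exclude the zero algebra.\<close>

locale fin_dim_algebra = fin_dim_space scale
  for scale :: "'k::field \<Rightarrow> 'a::{ring, monoid_mult} \<Rightarrow> 'a" +
  assumes scale_mult_left: "scale c x * y = scale c (x * y)"
    and scale_mult_right: "x * scale c y = scale c (x * y)"
begin

definition alg_trace :: "'a \<Rightarrow> 'k" where
  "alg_trace a = lin_trace (\<lambda>x. a * x)"

end

locale algebra_with_involution = fin_dim_algebra scale
  for scale :: "'k::field \<Rightarrow> 'a::{ring, monoid_mult} \<Rightarrow> 'a" +
  fixes \<sigma> :: "'a \<Rightarrow> 'a"
  assumes involution_linear: "Vector_Spaces.linear scale scale \<sigma>"
    and involution_mult: "\<sigma> (x * y) = \<sigma> y * \<sigma> x"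
    and involution_involutive: "\<sigma> (\<sigma> x) = x"
begin

definition inv_trace_form :: "'a \<Rightarrow> 'k" where
  "inv_trace_form x = alg_trace (\<sigma> x * x)"

end


section \<open>Hyperbolicity and multiples\<close>

definition hyperbolic :: "('a, 'm) ring_scheme \<Rightarrow> ('a \<Rightarrow> 'a) \<Rightarrow> bool" where
  "hyperbolic R \<tau> \<longleftrightarrow>
     (\<exists>e\<in>carrier R. e \<otimes>\<^bsub>R\<^esub> e = e \<and> \<tau> e \<oplus>\<^bsub>R\<^esub> e = \<one>\<^bsub>R\<^esub>)"

text \<open>The same record as \<open>ring_mat\<close>, which is restricted to \<open>semiring_1\<close>.\<close>

definition matrix_algebra :: "nat \<Rightarrow> 'a::{ring, monoid_mult} mat ring" where
  "matrix_algebra n =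
     \<lparr>carrier = carrier_mat n n, mult = (*), one = 1\<^sub>m n, zero = 0\<^sub>m n n, add = (+)\<rparr>"

definition matrix_involution :: "('a \<Rightarrow> 'a) \<Rightarrow> 'a mat \<Rightarrow> 'a mat" where
  "matrix_involution \<sigma> M = map_mat \<sigma> (transpose_mat M)"

definition multiple_hyperbolic :: "nat \<Rightarrow> ('a::{ring, monoid_mult} \<Rightarrow> 'a) \<Rightarrow> bool" where
  "multiple_hyperbolic n \<sigma> \<longleftrightarrow> hyperbolic (matrix_algebra n) (matrix_involution \<sigma>)"

end

theory Submission
  imports Defs "HOL-Library.Function_Algebras" "HOL-Computational_Algebra.Formal_Power_Series"
    "HOL-Algebra.Algebraic_Closure_Type"
begin

text \<open>
  If \<open>e\<close> is a hyperbolic idempotent of \<open>n \<times> (A, \<sigma>)\<close>, then multiplication by \<open>2 e - 1\<close> is an anti-isometry of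
  the \<open>n\<close>-fold trace form, so all signatures vanish.

  Conversely, suppose that no \<open>2\<^sup>k\<close>-fold multiple of \<open>(A, \<sigma>)\<close> is hyperbolic, and use Zorn's lemma to
  choose a subfield \<open>L\<close> of the algebraic closure of \<open>K\<close> that contains \<open>K\<close> and is maximal with this property after extension of
  scalars. Hyperbolic idempotents over quadratic extensions and over extensions of odd degree of \<open>L\<close> can be transferred to \<open>L\<close>,
  and hyperbolic summands can be cancelled (Witt). By maximality the squares form an ordering of \<open>L\<close> and
  polynomials of odd degree over \<open>L\<close> have roots in \<open>L\<close>, so all nonconstant polynomials over \<open>L\<close> have roots in
  \<open>L(\<surd>(-1))\<close>. Now \<open>A\<^sub>L\<close> splits up to its radical into a hyperbolic part, a part on which \<open>-1\<close> is the
  square of a symmetric element, and a part on which the trace form is positive definite. If the signature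
  at the ordering of \<open>L\<close> were not positive, the last part would be zero and \<open>2 \<times> (A\<^sub>L, \<sigma>)\<close> hyperbolic.
  Hence the ordering that \<open>L\<close> induces on \<open>K\<close> has positive signature.

  Finally, if \<open>n\<close> is minimal and the \<open>2\<^sup>k\<close>-fold multiple is hyperbolic, then cancellation makes the
  \<open>(2\<^sup>k mod n)\<close>-fold multiple hyperbolic as well, so \<open>n\<close> divides \<open>2\<^sup>k\<close>.
\<close>

section \<open>Witt decomposition in rings with involution\<close>

text \<open>No structure theory of semisimple algebras enters, and \<open>A\<close> may have a
  radical: Witt's theorems are proved for any ring with involution whose right ideals have bounded
  length, by finding idempotents modulo the radical and lifting them. The powers of 2 come from the
  transfer. If \<open>a\<close> and \<open>-a\<close> are both nonsquares in \<open>L\<close>,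
  hyperbolicity over the two quadratic extensions descends to \<open>L\<close> as hyperbolicity with
  respect to the forms <1, a> and <1, -a>; in the sum <1, a, 1, -a> the plane <a, -a> cancels and
  <1, 1> remains, so the multiple doubles. An extension of odd degree leaves <1> and costs nothing.
  All fields are subsets of one algebraic closure and the algebras over them are sets of coordinate
  functions, so that extending scalars enlarges a set and never changes a type. The trace is that of
  left multiplication, which the involution need not preserve; therefore its bilinear form has to be
  symmetrized.\<close>

locale nassoc =
  fixes m :: "'v::ab_group_add \<Rightarrow> 'v \<Rightarrow> 'v" (infixl "\<cdot>" 70)
  assumes assoc: "(x \<cdot> y) \<cdot> z = x \<cdot> (y \<cdot> z)"
    and add_left: "(x + y) \<cdot> z = x \<cdot> z + y \<cdot> z"
    and add_right: "x \<cdot> (y + z) = x \<cdot> y + x \<cdot> z"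
begin

lemma zero_left [simp]: "0 \<cdot> x = 0"
  using add_left[of 0 0 x] by simp

lemma zero_right [simp]: "x \<cdot> 0 = 0"
  using add_right[of x 0 0] by simp

lemma minus_left: "(- x) \<cdot> y = - (x \<cdot> y)"
  using add_left[of x "- x" y] by (simp add: eq_neg_iff_add_eq_0 add.commute)

lemma minus_right: "x \<cdot> (- y) = - (x \<cdot> y)"
  using add_right[of x y "- y"] by (simp add: eq_neg_iff_add_eq_0 add.commute)

lemma diff_left: "(x - y) \<cdot> z = x \<cdot> z - y \<cdot> z"
  using add_left[of x "- y" z] by (simp add: minus_left)

lemma diff_right: "x \<cdot> (y - z) = x \<cdot> y - x \<cdot> z"
  using add_right[of x y "- z"] by (simp add: minus_right)

lemmas expand = assoc add_left add_right minus_left minus_right diff_left diff_right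

lemma prefix: "a \<cdot> b = c \<Longrightarrow> a \<cdot> (b \<cdot> x) = c \<cdot> x"
  by (simp flip: assoc)

end

text \<open>The ring is a set \<open>B\<close> inside a larger type, so that the field of scalars
  and the index set of matrices can vary within one type. \<open>rk\<close> stands for the dimension
  of right ideals: being strictly increasing with natural values, it provides both chain conditions.
  \<open>hf\<close> is division by 2 without scalars.\<close>

locale star_ring = nassoc m for m :: "'v::ab_group_add \<Rightarrow> 'v \<Rightarrow> 'v" (infixl "\<cdot>" 70) +
  fixes B :: "'v set" and E :: 'v and st :: "'v \<Rightarrow> 'v" and hf :: "'v \<Rightarrow> 'v"
    and rk :: "'v set \<Rightarrow> nat"
  assumes B_zero: "0 \<in> B" and B_add: "x \<in> B \<Longrightarrow> y \<in> B \<Longrightarrow> x + y \<in> B"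
    and B_minus: "x \<in> B \<Longrightarrow> - x \<in> B"
    and B_mult: "x \<in> B \<Longrightarrow> y \<in> B \<Longrightarrow> x \<cdot> y \<in> B" and B_st: "x \<in> B \<Longrightarrow> st x \<in> B"
    and B_unit: "E \<in> B" and unit_left: "x \<in> B \<Longrightarrow> E \<cdot> x = x" and unit_right: "x \<in> B \<Longrightarrow> x \<cdot> E = x"
    and st_add: "x \<in> B \<Longrightarrow> y \<in> B \<Longrightarrow> st (x + y) = st x + st y"
    and st_mult: "x \<in> B \<Longrightarrow> y \<in> B \<Longrightarrow> st (x \<cdot> y) = st y \<cdot> st x"
    and st_st: "x \<in> B \<Longrightarrow> st (st x) = x"
    and B_hf: "x \<in> B \<Longrightarrow> hf x \<in> B" and hf_hf: "x \<in> B \<Longrightarrow> hf x + hf x = x"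
    and double_eq_0: "x \<in> B \<Longrightarrow> x + x = 0 \<Longrightarrow> x = 0"
    and rk_less: "\<lbrakk>I \<subset> I'; I' \<subseteq> B; 0 \<in> I; \<And>x y. x \<in> I \<Longrightarrow> y \<in> I \<Longrightarrow> x + y \<in> I;
          \<And>x y. x \<in> I \<Longrightarrow> y \<in> B \<Longrightarrow> x \<cdot> y \<in> I; 0 \<in> I'; \<And>x y. x \<in> I' \<Longrightarrow> y \<in> I' \<Longrightarrow> x + y \<in> I';
          \<And>x y. x \<in> I' \<Longrightarrow> y \<in> B \<Longrightarrow> x \<cdot> y \<in> I'\<rbrakk> \<Longrightarrow> rk I < rk I'"
begin

lemma B_diff: "x \<in> B \<Longrightarrow> y \<in> B \<Longrightarrow> x - y \<in> B"
  using B_add[of x "- y"] B_minus[of y] by simp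

lemmas Bs = B_zero B_add B_minus B_mult B_st B_unit B_hf B_diff

definition rideal :: "'v set \<Rightarrow> bool" where
  "rideal I \<longleftrightarrow> I \<subseteq> B \<and> 0 \<in> I \<and> (\<forall>x\<in>I. \<forall>y\<in>I. x + y \<in> I) \<and> (\<forall>x\<in>I. \<forall>y\<in>B. x \<cdot> y \<in> I)"

lemma rk_strict: "rideal I \<Longrightarrow> rideal I' \<Longrightarrow> I \<subset> I' \<Longrightarrow> rk I < rk I'"
  unfolding rideal_def by (intro rk_less) auto

lemma rk_mono: "rideal I \<Longrightarrow> rideal I' \<Longrightarrow> I \<subseteq> I' \<Longrightarrow> rk I \<le> rk I'"
  using rk_strict[of I I'] by (cases "I = I'") (auto simp: psubset_eq)

lemma rideal_B: "rideal B"
  unfolding rideal_def by (auto simp: Bs)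

lemma rideal_minus: "rideal I \<Longrightarrow> x \<in> I \<Longrightarrow> - x \<in> I"
proof -
  assume "rideal I" "x \<in> I"
  hence "x \<cdot> (- E) \<in> I" "x \<in> B" unfolding rideal_def by (auto simp: Bs)
  thus ?thesis by (simp add: minus_right unit_right)
qed

lemma rideal_diff: "rideal I \<Longrightarrow> x \<in> I \<Longrightarrow> y \<in> I \<Longrightarrow> x - y \<in> I"
  using rideal_minus[of I y] unfolding rideal_def by force

definition princ :: "'v \<Rightarrow> 'v set" where "princ u = (\<lambda>y. u \<cdot> y) ` B"

lemma princ_rideal: "u \<in> B \<Longrightarrow> rideal (princ u)"
  unfolding rideal_def princ_def
proof (intro conjI ballI)
  assume u: "u \<in> B"
  show "(\<cdot>) u ` B \<subseteq> B" using u by (auto simp: Bs)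
  show "0 \<in> (\<cdot>) u ` B" by (rule image_eqI[of _ _ 0]) (auto simp: Bs)
  fix x y assume x: "x \<in> (\<cdot>) u ` B"
  { assume "y \<in> (\<cdot>) u ` B"
    with x show "x + y \<in> (\<cdot>) u ` B" by (auto simp: Bs simp flip: add_right) }
  { assume "y \<in> B"
    with x show "x \<cdot> y \<in> (\<cdot>) u ` B" by (auto simp: Bs assoc) }
qed

lemma st_minus: "x \<in> B \<Longrightarrow> st (- x) = - st x"
proof -
  have "st 0 = 0" using st_add[of 0 0] by (simp add: Bs)
  moreover assume "x \<in> B"
  ultimately show ?thesis using st_add[of x "- x"] by (simp add: Bs eq_neg_iff_add_eq_0 add.commute)
qed

lemma st_zero [simp]: "st 0 = 0" using st_add[of 0 0] by (simp add: Bs)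

lemma st_diff: "x \<in> B \<Longrightarrow> y \<in> B \<Longrightarrow> st (x - y) = st x - st y"
  using st_add[of x "- y"] by (simp add: Bs st_minus)

lemma st_unit [simp]: "st E = E"
  by (metis B_st B_unit st_mult st_st unit_left)

lemma hf_unique: "x \<in> B \<Longrightarrow> y \<in> B \<Longrightarrow> y + y = x \<Longrightarrow> hf x = y"
proof -
  assume *: "x \<in> B" "y \<in> B" "y + y = x"
  hence "(hf x - y) + (hf x - y) = 0" using hf_hf[of x] by (simp add: algebra_simps)
  with * show ?thesis using double_eq_0[of "hf x - y"] by (simp add: Bs)
qed

lemma hf_add: "x \<in> B \<Longrightarrow> y \<in> B \<Longrightarrow> hf (x + y) = hf x + hf y"
  by (rule hf_unique) (auto simp: Bs algebra_simps, metis add.left_commute add.assoc hf_hf)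

lemma hf_minus: "x \<in> B \<Longrightarrow> hf (- x) = - hf x"
  by (metis B_hf B_minus hf_hf hf_unique minus_add_distrib)

lemma hf_diff: "x \<in> B \<Longrightarrow> y \<in> B \<Longrightarrow> hf (x - y) = hf x - hf y"
  using hf_add[of x "- y"] by (simp add: Bs hf_minus)

lemma hf_right: "x \<in> B \<Longrightarrow> y \<in> B \<Longrightarrow> x \<cdot> hf y = hf (x \<cdot> y)"
  by (rule hf_unique[symmetric]) (auto simp: Bs hf_hf simp flip: add_right)

lemma hf_left: "x \<in> B \<Longrightarrow> y \<in> B \<Longrightarrow> hf x \<cdot> y = hf (x \<cdot> y)"
  by (rule hf_unique[symmetric]) (auto simp: Bs hf_hf simp flip: add_left)

lemma hf_zero [simp]: "hf 0 = 0"
  by (rule hf_unique) (auto simp: Bs)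

lemma st_hf: "x \<in> B \<Longrightarrow> st (hf x) = hf (st x)"
  by (rule hf_unique[symmetric]) (auto simp: Bs hf_hf simp flip: st_add)

lemmas st_simps = st_add st_mult st_st st_diff st_minus st_hf
lemmas hf_simps = hf_add hf_diff hf_minus hf_left hf_right

primrec pw :: "'v \<Rightarrow> nat \<Rightarrow> 'v" where
  "pw x 0 = E"
| "pw x (Suc n) = x \<cdot> pw x n"

lemma pw_in [simp]: "x \<in> B \<Longrightarrow> pw x n \<in> B"
  by (induction n) (auto simp: Bs)

lemma pw_add: "x \<in> B \<Longrightarrow> pw x (a + b) = pw x a \<cdot> pw x b"
  by (induction a) (auto simp: assoc unit_left)

lemma pw_Suc2: "x \<in> B \<Longrightarrow> pw x (Suc n) = pw x n \<cdot> x"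
  using pw_add[of x n 1] by (simp add: unit_right)

lemma st_pw: "x \<in> B \<Longrightarrow> pw (st x) n = st (pw x n)"
proof (induction n)
  case (Suc n)
  have "st (pw x (Suc n)) = st (pw x n \<cdot> x)" using Suc.prems by (simp only: pw_Suc2)
  with Suc show ?case by (simp add: st_mult)
qed simp

definition nilp :: "'v \<Rightarrow> bool" where "nilp x \<longleftrightarrow> (\<exists>n. pw x n = 0)"

lemma pw_rot: "b \<in> B \<Longrightarrow> c \<in> B \<Longrightarrow> pw (b \<cdot> c) (Suc n) = b \<cdot> pw (c \<cdot> b) n \<cdot> c"
  by (induction n) (auto simp: Bs assoc unit_left unit_right)

lemma nilp_rot: "b \<in> B \<Longrightarrow> c \<in> B \<Longrightarrow> nilp (c \<cdot> b) \<Longrightarrow> nilp (b \<cdot> c)"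
  unfolding nilp_def by (metis pw_rot zero_left zero_right)

lemma nilp_st: "x \<in> B \<Longrightarrow> nilp x \<Longrightarrow> nilp (st x)"
  unfolding nilp_def by (metis st_pw st_zero)

text \<open>The right ideals generated by the powers of \<open>x\<close> decrease, so they are
  constant from an exponent of least rank on; \<open>pw x k\<close> then lies in the right ideal of
  its own square.\<close>

lemma power_stable:
  assumes x: "x \<in> B"
  shows "\<exists>k0. \<forall>k\<ge>k0. \<exists>z\<in>B. pw x k = pw x (k + k) \<cdot> z"
proof -
  let ?f = "\<lambda>n. rk (princ (pw x n))"
  have anti: "princ (pw x b) \<subseteq> princ (pw x a)" if "a \<le> b" for a b
  proof -
    from that obtain c where "b = a + c" using le_Suc_ex by blast
    thus ?thesis using x unfolding princ_def by (auto simp: pw_add assoc Bs)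
  qed
  obtain k0 where k0: "\<And>n. ?f k0 \<le> ?f n"
    using ex_has_least_nat[of "\<lambda>_. True" 0 ?f] by auto
  have eq: "princ (pw x n) = princ (pw x k0)" if "n \<ge> k0" for n
    using anti[OF that] k0[of n] rk_strict[of "princ (pw x n)" "princ (pw x k0)"] x
    by (metis princ_rideal psubsetI pw_in linorder_not_less)
  have "\<exists>z\<in>B. pw x k = pw x (k + k) \<cdot> z" if "k \<ge> k0" for k
  proof -
    have "pw x k \<in> princ (pw x k)" unfolding princ_def
      by (rule image_eqI[of _ _ E]) (auto simp: Bs unit_right x)
    also have "\<dots> = princ (pw x (k + k))" using eq[of k] eq[of "k + k"] that by simp
    finally show ?thesis unfolding princ_def by auto
  qed
  thus ?thesis by blast
qed

text \<open>Fitting's lemma: a power of \<open>x\<close> generates the same left and the same right ideal as an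
  idempotent.\<close>

lemma idempotent_of_nonnilp:
  assumes x: "x \<in> B" and nn: "\<not> nilp x"
  obtains p y w where "p \<in> B" "p \<noteq> 0" "p \<cdot> p = p" "y \<in> B" "p = x \<cdot> y" "w \<in> B" "p = w \<cdot> x"
    "st x = x \<Longrightarrow> st p = p"
proof -
  obtain k1 where k1: "\<And>k. k \<ge> k1 \<Longrightarrow> \<exists>z\<in>B. pw x k = pw x (k + k) \<cdot> z"
    using power_stable[OF x] by blast
  \<comment> \<open>Only right ideals have a rank, so the factorization on the left is read off from
    the powers of \<open>st x\<close>.\<close>
  obtain k2 where k2: "\<And>k. k \<ge> k2 \<Longrightarrow> \<exists>z\<in>B. pw (st x) k = pw (st x) (k + k) \<cdot> z"
    using power_stable[OF B_st[OF x]] by blast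
  define n where "n = k1 + k2"
  define a where "a = pw x (Suc n)"
  have aB: "a \<in> B" and a0: "a \<noteq> 0" using x nn unfolding a_def nilp_def by (auto simp del: pw.simps)
  have aa: "pw x (Suc n + Suc n) = a \<cdot> a" unfolding a_def using pw_add[OF x] by blast
  obtain z where z: "z \<in> B" "a = a \<cdot> a \<cdot> z"
    using k1[of "Suc n"] aa unfolding a_def n_def by auto
  obtain z' where z': "z' \<in> B" "st a = st (a \<cdot> a) \<cdot> z'"
    using k2[of "Suc n"] aa st_pw[OF x] unfolding a_def n_def by (metis add_Suc_right le_add2 trans_le_add2 le_SucI)
  \<comment> \<open>For symmetric \<open>x\<close> the left factor has to be \<open>st z\<close>:
    then \<open>p = a \<cdot> z = w \<cdot> a\<close> equals its own image under
    \<open>st\<close>.\<close>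
  define w where "w = (if st x = x then st z else st z')"
  have wB: "w \<in> B" using z z' unfolding w_def by (auto simp: Bs)
  have sa: "st a = a" if "st x = x" using st_pw[OF x, of "Suc n"] that unfolding a_def by simp
  have wa: "a = w \<cdot> (a \<cdot> a)"
  proof (cases "st x = x")
    case True
    have "st a = st z \<cdot> (st a \<cdot> st a)" using arg_cong[OF z(2), of st] z(1) aB by (simp add: st_mult Bs)
    with True sa show ?thesis unfolding w_def by simp
  next
    case False
    have "st (st a) = st z' \<cdot> (a \<cdot> a)" using arg_cong[OF z'(2), of st] z'(1) aB by (simp add: st_mult st_st Bs)
    with False aB show ?thesis unfolding w_def by (simp add: st_st)
  qed
  have e: "w \<cdot> a = a \<cdot> z"
    using wa z(2) by (metis assoc)
  define p where "p = a \<cdot> z"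
  show ?thesis
  proof
    show "p \<in> B" unfolding p_def using aB z by (simp add: Bs)
    show "p \<cdot> p = p" unfolding p_def by (metis assoc e z(2))
    show "p \<noteq> 0" using a0 wa by (metis assoc e p_def zero_left)
    show "pw x n \<cdot> z \<in> B" using x z by (simp add: Bs)
    show "p = x \<cdot> (pw x n \<cdot> z)" unfolding p_def a_def by (simp add: assoc)
    show "w \<cdot> pw x n \<in> B" using x wB by (simp add: Bs)
    show "p = w \<cdot> pw x n \<cdot> x" 
      using e pw_Suc2[OF x, of n] unfolding p_def a_def by (metis assoc)
    assume sx: "st x = x"
    thus "st p = p" using sa aB z e unfolding p_def by (simp add: st_mult w_def)
  qed
qed

text \<open>Under the chain conditions this is the Jacobson radical. Described by nilpotent
  products, it is stable under multiplication on both sides and under \<open>st\<close> simply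
  because products can be rotated; only closure under addition takes an argument.\<close>

definition rad :: "'v set" where "rad = {x \<in> B. \<forall>y\<in>B. nilp (x \<cdot> y)}"

lemma rad_in: "x \<in> rad \<Longrightarrow> x \<in> B" unfolding rad_def by simp

lemma rad_nilp: "x \<in> rad \<Longrightarrow> nilp x" unfolding rad_def using unit_right B_unit by fastforce

lemma rad_right: "x \<in> rad \<Longrightarrow> y \<in> B \<Longrightarrow> x \<cdot> y \<in> rad"
  unfolding rad_def by (auto simp: Bs assoc)

lemma rad_left: "x \<in> rad \<Longrightarrow> y \<in> B \<Longrightarrow> y \<cdot> x \<in> rad"
  unfolding rad_def
proof (clarsimp simp: Bs, goal_cases)
  case (1 z)
  have "nilp ((x \<cdot> z) \<cdot> y)" using 1 by (simp add: assoc Bs)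
  thus ?case using nilp_rot[of y "x \<cdot> z"] 1 by (simp add: assoc Bs)
qed

lemma rad_st: "x \<in> rad \<Longrightarrow> st x \<in> rad"
proof -
  assume x: "x \<in> rad"
  have "nilp (st x \<cdot> y)" if y: "y \<in> B" for y
  proof -
    have "nilp (st y \<cdot> x)" using rad_left[OF x, of "st y"] y rad_nilp by (simp add: Bs)
    thus ?thesis using nilp_st[of "st y \<cdot> x"] x y by (simp add: Bs rad_in st_simps)
  qed
  thus ?thesis unfolding rad_def using x by (auto simp: Bs rad_in)
qed

lemma rad_minus: "x \<in> rad \<Longrightarrow> - x \<in> rad"
  using rad_right[of x "- E"] by (simp add: Bs minus_right unit_right rad_in)

lemma rad_zero: "0 \<in> rad"
  unfolding rad_def nilp_def by (auto simp: Bs intro: exI[of _ 1])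

lemma idem_pw: "p \<in> B \<Longrightarrow> p \<cdot> p = p \<Longrightarrow> pw p (Suc n) = p"
  by (induction n) (auto simp: unit_right)

lemma idem_rad: "p \<in> rad \<Longrightarrow> p \<cdot> p = p \<Longrightarrow> p = 0"
proof -
  assume p: "p \<in> rad" "p \<cdot> p = p"
  then obtain n where "pw p n = 0" using rad_nilp unfolding nilp_def by blast
  hence "pw p (Suc n) = 0" by simp
  thus ?thesis using idem_pw p rad_in by metis
qed

text \<open>Otherwise an idempotent \<open>p = (x + y) \<cdot> c \<cdot> d\<close> is a sum
  \<open>r + q\<close> of two radical elements of the corner of \<open>p\<close>. The last nonzero
  \<open>p \<cdot> pw r k\<close> is killed by \<open>r\<close>, so it is fixed by
  \<open>q = p - r\<close>, which is impossible for a nilpotent \<open>q\<close>.\<close>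

lemma rad_add:
  assumes x: "x \<in> rad" and y: "y \<in> rad"
  shows "x + y \<in> rad"
proof -
  have "nilp ((x + y) \<cdot> c)" if c: "c \<in> B" for c
  proof (rule ccontr)
    assume "\<not> nilp ((x + y) \<cdot> c)"
    then obtain p d where p: "p \<in> B" "p \<noteq> 0" "p \<cdot> p = p" "d \<in> B" "p = (x + y) \<cdot> c \<cdot> d"
      using idempotent_of_nonnilp[of "(x + y) \<cdot> c"] x y c by (metis B_add B_mult rad_in)
    define r where "r = p \<cdot> (x \<cdot> (c \<cdot> d)) \<cdot> p"
    define q where "q = p \<cdot> (y \<cdot> (c \<cdot> d)) \<cdot> p"
    have cd: "c \<cdot> d \<in> B" using c p(4) by (simp add: Bs)
    have rJ: "r \<in> rad" unfolding r_def using rad_right[OF rad_left[OF rad_right[OF x cd] p(1)] p(1)] .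
    have qJ: "q \<in> rad" unfolding q_def using rad_right[OF rad_left[OF rad_right[OF y cd] p(1)] p(1)] .
    have pp: "x \<cdot> (c \<cdot> d) + y \<cdot> (c \<cdot> d) = p"
      using p(5) by (simp add: assoc add_left)
    have "r + q = p \<cdot> (x \<cdot> (c \<cdot> d) + y \<cdot> (c \<cdot> d)) \<cdot> p"
      unfolding r_def q_def by (simp add: add_left add_right)
    also have "\<dots> = p" using pp p(3) by (simp add: assoc)
    finally have rq: "q = p - r" by (simp add: algebra_simps)
    have pr: "p \<cdot> r = r" unfolding r_def using p(3) by (simp flip: assoc)
    define n where "n = (LEAST n. p \<cdot> pw r n = 0)"
    have ex: "\<exists>n. p \<cdot> pw r n = 0" using rad_nilp[OF rJ] unfolding nilp_def by (metis zero_right)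
    have n0: "p \<cdot> pw r n = 0" unfolding n_def using ex by (rule LeastI_ex)
    obtain k where k: "n = Suc k" using n0 p by (cases n) (auto simp: unit_right)
    have nk: "p \<cdot> pw r k \<noteq> 0" using not_less_Least[of k "\<lambda>n. p \<cdot> pw r n = 0"] k unfolding n_def by auto
    have rk: "r \<cdot> pw r k = 0" using n0 k pr by (simp add: prefix[OF pr])
    have rp: "r \<cdot> p = r" unfolding r_def using p(3) by (simp add: assoc)
    have step: "q \<cdot> (p \<cdot> pw r k) = p \<cdot> pw r k"
      unfolding rq using rk by (simp add: diff_left prefix[OF p(3)] prefix[OF rp])
    have "pw q j \<cdot> (p \<cdot> pw r k) = p \<cdot> pw r k" for j
      by (induction j) (use rJ p(1) in \<open>auto simp: assoc step unit_left Bs rad_in\<close>)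
    thus False using rad_nilp[OF qJ] nk unfolding nilp_def by (metis zero_left)
  qed
  thus ?thesis unfolding rad_def using x y by (auto simp: Bs rad_in)
qed

lemma rad_diff: "x \<in> rad \<Longrightarrow> y \<in> rad \<Longrightarrow> x - y \<in> rad"
  using rad_add[of x "- y"] rad_minus[of y] by simp

lemma idempotent_of_nonrad:
  assumes "x \<in> B" "x \<notin> rad"
  obtains p y where "p \<in> B" "p \<notin> rad" "p \<noteq> 0" "p \<cdot> p = p" "y \<in> B" "p = x \<cdot> y"
proof -
  obtain c where c: "c \<in> B" "\<not> nilp (x \<cdot> c)" using assms unfolding rad_def by auto
  obtain p y where p: "p \<in> B" "p \<noteq> 0" "p \<cdot> p = p" "y \<in> B" "p = x \<cdot> c \<cdot> y"
    using idempotent_of_nonnilp[of "x \<cdot> c"] c assms by (metis B_mult)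
  show ?thesis by (rule that[of p "c \<cdot> y"]) (use p(1-4) idem_rad c in \<open>auto simp: Bs p(5) simp flip: assoc\<close>)
qed

text \<open>Take the idempotent \<open>p\<close> in \<open>I\<close> whose space \<open>R p\<close>
  of vectors fixed modulo the radical is largest. If it misses some \<open>x\<close> of
  \<open>I\<close>, the right ideal of \<open>x - p \<cdot> x\<close> contains an idempotent
  \<open>q\<close> with \<open>p \<cdot> q = 0\<close>, by which \<open>p\<close> can be
  enlarged.\<close>

lemma rideal_rad_idempotent:
  assumes I: "rideal I" and J: "rad \<subseteq> I"
  obtains p where "p \<in> I" "p \<cdot> p = p" "\<And>x. x \<in> I \<Longrightarrow> x - p \<cdot> x \<in> rad"
proof -
  define R where "R p = {x \<in> B. x - p \<cdot> x \<in> rad}" for p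
  have R: "rideal (R p)" if "p \<in> B" for p
  proof -
    have "x + y - p \<cdot> (x + y) \<in> rad" if "x - p \<cdot> x \<in> rad" "y - p \<cdot> y \<in> rad" for x y
      using rad_add[OF that] by (simp add: add_right algebra_simps)
    moreover have "x \<cdot> y - p \<cdot> (x \<cdot> y) \<in> rad" if "x - p \<cdot> x \<in> rad" "y \<in> B" for x y
      using rad_right[OF that] by (simp add: diff_left assoc)
    ultimately show ?thesis unfolding rideal_def R_def using that by (auto simp: Bs rad_zero)
  qed
  have "0 \<in> I \<and> 0 \<cdot> 0 = 0" using I unfolding rideal_def by simp
  moreover have "\<forall>p. p \<in> I \<and> p \<cdot> p = p \<longrightarrow> rk (R p) < Suc (rk B)"
    using rk_mono[OF R rideal_B] I unfolding rideal_def R_def by (auto simp: less_Suc_eq_le)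
  ultimately have "\<exists>p. (p \<in> I \<and> p \<cdot> p = p) \<and> (\<forall>q. q \<in> I \<and> q \<cdot> q = q \<longrightarrow> rk (R q) \<le> rk (R p))"
    by (rule ex_has_greatest_nat)
  then obtain p where p: "p \<in> I \<and> p \<cdot> p = p" and
    max: "\<And>q. q \<in> I \<and> q \<cdot> q = q \<Longrightarrow> rk (R q) \<le> rk (R p)" by auto
  have pB: "p \<in> B" using p I unfolding rideal_def by auto
  show ?thesis
  proof (rule that[of p])
    show "p \<in> I" "p \<cdot> p = p" using p by auto
    fix x assume x: "x \<in> I"
    hence xB: "x \<in> B" using I unfolding rideal_def by auto
    show "x - p \<cdot> x \<in> rad"
    proof (rule ccontr)
      assume n: "x - p \<cdot> x \<notin> rad"
      have yI: "x - p \<cdot> x \<in> I" using x p xB rideal_diff[OF I] I unfolding rideal_def by blast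
      obtain q c where q: "q \<in> B" "q \<notin> rad" "q \<cdot> q = q" "c \<in> B" "q = (x - p \<cdot> x) \<cdot> c"
        using idempotent_of_nonrad[OF B_diff[OF xB B_mult[OF pB xB]] n] by blast
      have qI: "q \<in> I" using yI q I unfolding rideal_def by blast
      have pp: "p \<cdot> p = p" using p by simp
      have pq: "p \<cdot> q = 0" unfolding q(5) by (simp add: expand prefix[OF pp] pp)
      \<comment> \<open>\<open>q \<cdot> p\<close> need not vanish, so \<open>p + q\<close> may fail
        to be idempotent; with \<open>q \<cdot> p\<close> subtracted, \<open>p'\<close> fixes both
        \<open>p\<close> and \<open>q\<close> from the left.\<close>
      define p' where "p' = p + q - q \<cdot> p"
      have p'I: "p' \<in> I" unfolding p'_def using p qI pB I rideal_diff[OF I]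
        unfolding rideal_def by blast
      have p'p: "p' \<cdot> p = p" unfolding p'_def by (simp add: expand pp)
      have p'q: "p' \<cdot> q = q" unfolding p'_def by (simp add: expand pq q(3) prefix[OF pq])
      have p'p': "p' \<cdot> p' = p'" by (subst (2) p'_def) (simp add: expand p'p p'q prefix[OF p'q], simp add: p'_def)
      have "R p \<subseteq> R p'"
      proof
        fix z assume z: "z \<in> R p"
        hence zB: "z \<in> B" and zJ: "z - p \<cdot> z \<in> rad" unfolding R_def by auto
        have "(z - p \<cdot> z) - p' \<cdot> (z - p \<cdot> z) \<in> rad"
          by (intro rad_diff rad_left zJ) (use p'I I in \<open>auto simp: rideal_def\<close>)
        also have "(z - p \<cdot> z) - p' \<cdot> (z - p \<cdot> z) = z - p' \<cdot> z"
          by (simp add: diff_right prefix[OF p'p])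
        finally show "z \<in> R p'" unfolding R_def using zB by auto
      qed
      moreover have "q \<in> R p'" "q \<notin> R p" unfolding R_def using q(1,2) p'q pq rad_zero by auto
      moreover have "p' \<in> B" using p'I I unfolding rideal_def by auto
      ultimately have "rk (R p) < rk (R p')" using rk_strict[OF R[OF pB] R[of p']] by blast
      thus False using max[of p'] p'I p'p' by auto
    qed
  qed
qed

end

section \<open>Isotropic idempotents, Witt decomposition and cancellation\<close>

context star_ring
begin

definition cg :: "'v \<Rightarrow> 'v \<Rightarrow> bool" (infix "\<doteq>" 50) where "x \<doteq> y \<longleftrightarrow> x - y \<in> rad"

lemma cg_refl [simp]: "x \<doteq> x" unfolding cg_def by (simp add: rad_zero)

lemma cg_trans [trans]: "x \<doteq> y \<Longrightarrow> y \<doteq> z \<Longrightarrow> x \<doteq> z"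
  unfolding cg_def using rad_add[of "x - y" "y - z"] by simp

lemma cg_zero: "x \<doteq> 0 \<longleftrightarrow> x \<in> rad" unfolding cg_def by simp

lemma cg_add: "x \<doteq> x' \<Longrightarrow> y \<doteq> y' \<Longrightarrow> x + y \<doteq> x' + y'"
  unfolding cg_def using rad_add[of "x - x'" "y - y'"] by (simp add: algebra_simps)

lemma cg_left: "x \<doteq> y \<Longrightarrow> c \<in> B \<Longrightarrow> c \<cdot> x \<doteq> c \<cdot> y"
  unfolding cg_def using rad_left[of "x - y" c] by (simp add: expand)

lemma cg_right: "x \<doteq> y \<Longrightarrow> c \<in> B \<Longrightarrow> x \<cdot> c \<doteq> y \<cdot> c"
  unfolding cg_def using rad_right[of "x - y" c] by (simp add: expand)

lemma cg_mult: "x \<doteq> x' \<Longrightarrow> y \<doteq> y' \<Longrightarrow> x \<in> B \<Longrightarrow> y' \<in> B \<Longrightarrow> x \<cdot> y \<doteq> x' \<cdot> y'"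
  using cg_left[of y y' x] cg_right[of x x' y'] cg_trans by blast

lemma cg_st: "x \<doteq> y \<Longrightarrow> x \<in> B \<Longrightarrow> y \<in> B \<Longrightarrow> st x \<doteq> st y"
  unfolding cg_def using rad_st[of "x - y"] by (simp add: st_simps)

definition symid :: "'v \<Rightarrow> bool" where "symid f \<longleftrightarrow> f \<in> B \<and> f \<cdot> f = f \<and> st f = f"

text \<open>The two vanishing products make \<open>u\<close> and \<open>st u\<close> orthogonal
  idempotents, so that \<open>u + st u\<close> is a symmetric idempotent: the hyperbolic part that
  \<open>u\<close> splits off from the corner of \<open>f\<close>.\<close>

definition isoid :: "'v \<Rightarrow> 'v \<Rightarrow> bool" where
  "isoid f u \<longleftrightarrow> u \<in> B \<and> u \<cdot> u = u \<and> st u \<cdot> u = 0 \<and> u \<cdot> st u = 0 \<and> f \<cdot> u = u \<and> u \<cdot> f = u"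

text \<open>Isotropy is tested modulo the radical, since a radical element can have norm
  \<open>st x \<cdot> x = 0\<close> without ever yielding a nonzero idempotent.\<close>

definition aniso :: "'v \<Rightarrow> bool" where
  "aniso f \<longleftrightarrow> symid f \<and> (\<forall>x\<in>B. f \<cdot> x = x \<longrightarrow> st x \<cdot> x \<in> rad \<longrightarrow> x \<in> rad)"

text \<open>Solves \<open>(1 - c)\<^sup>2 = 1 - j\<close> for nilpotent \<open>j\<close> by iterating \<open>c \<mapsto> (j + c\<^sup>2) / 2\<close>.\<close>

lemma radical_sqrt:
  assumes j: "j \<in> rad" and sj: "st j = j"
  obtains c y where "c \<in> rad" "st c = c" "c + c = j + c \<cdot> c" "y \<in> B" "c = j \<cdot> y" "c = y \<cdot> j"
    "\<And>z. z \<in> B \<Longrightarrow> j \<cdot> z = z \<cdot> j \<Longrightarrow> c \<cdot> z = z \<cdot> c"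
proof -
  have jB: "j \<in> B" using j by (rule rad_in)
  \<comment> \<open>\<open>cj\<close> is the double commutant of \<open>j\<close>. All iterates stay
    in it, so they commute with one another and differences of their squares factor.\<close>
  define cj where "cj x \<longleftrightarrow> x \<in> B \<and> (\<forall>y\<in>B. j \<cdot> y = y \<cdot> j \<longrightarrow> x \<cdot> y = y \<cdot> x)" for x
  have cjB: "cj x \<Longrightarrow> x \<in> B" for x unfolding cj_def by blast
  have cj_j: "cj x \<Longrightarrow> x \<cdot> j = j \<cdot> x" for x unfolding cj_def using jB by blast
  have cj_comm: "cj x \<Longrightarrow> cj y \<Longrightarrow> x \<cdot> y = y \<cdot> x" for x y using cj_j[of y] unfolding cj_def by auto
  have cj1: "cj j" "cj E" "cj 0" unfolding cj_def using jB by (auto simp: Bs unit_left unit_right)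
  have cj_add: "cj x \<Longrightarrow> cj y \<Longrightarrow> cj (x + y)" for x y
    unfolding cj_def by (auto simp: Bs add_left add_right)
  have cj_hf: "cj x \<Longrightarrow> cj (hf x)" for x
    unfolding cj_def by (auto simp: Bs hf_left hf_right)
  have cj_mult: "cj (x \<cdot> y)" if "cj x" "cj y" for x y
  proof -
    have "x \<cdot> y \<cdot> z = z \<cdot> (x \<cdot> y)" if "z \<in> B" "j \<cdot> z = z \<cdot> j" for z
    proof -
      have "x \<cdot> z = z \<cdot> x" "y \<cdot> z = z \<cdot> y" using that \<open>cj x\<close> \<open>cj y\<close> unfolding cj_def by auto
      thus ?thesis by (metis assoc)
    qed
    thus ?thesis using that unfolding cj_def by (auto simp: Bs)
  qed
  define ph where "ph n = ((\<lambda>x. hf (j + x \<cdot> x)) ^^ n) 0" for n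
  have ph0: "ph 0 = 0" and phS: "ph (Suc n) = hf (j + ph n \<cdot> ph n)" for n
    unfolding ph_def by auto
  have ph: "st (ph n) = ph n \<and> (\<exists>c. cj c \<and> ph n = j \<cdot> c)" for n
  proof (induction n)
    case 0
    show ?case using cj1 by (auto simp: ph0 intro!: exI[of _ 0])
  next
    case (Suc n)
    then obtain c where c: "cj c" "ph n = j \<cdot> c" by blast
    have phB: "ph n \<in> B" using c cjB jB by (auto simp: Bs)
    have "ph (Suc n) = j \<cdot> hf (E + c \<cdot> (j \<cdot> c))" unfolding phS c(2)
      using c(1) cjB jB by (auto simp: Bs hf_right expand unit_right)
    moreover have "st (ph (Suc n)) = ph (Suc n)" unfolding phS using Suc phB sj jB by (simp add: st_simps Bs)
    ultimately show ?case using c cj1 by (meson cj_add cj_hf cj_mult)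
  qed
  have phB: "ph n \<in> B" for n using ph[of n] cjB jB by (auto simp: Bs)
  have cjp: "cj (ph n)" for n using ph[of n] cj_mult cj1 by metis
  \<comment> \<open>Consecutive iterates differ by a multiple of a power of \<open>j\<close> that
    grows with \<open>n\<close>; nilpotency of \<open>j\<close> stops the iteration.\<close>
  have d: "\<exists>c. cj c \<and> ph (Suc n) - ph n = pw j (Suc n) \<cdot> c" for n
  proof (induction n)
    case 0
    have "ph (Suc 0) - ph 0 = pw j (Suc 0) \<cdot> hf E" using jB by (simp add: ph0 phS Bs hf_right unit_right)
    thus ?case using cj1 cj_hf by blast
  next
    case (Suc n)
    then obtain c where c: "cj c" "ph (Suc n) - ph n = pw j (Suc n) \<cdot> c" by blast
    obtain a b where ab: "cj a" "ph n = j \<cdot> a" "cj b" "ph (Suc n) = j \<cdot> b" using ph by metis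
    have "ph (Suc (Suc n)) - ph (Suc n) = hf (ph (Suc n) \<cdot> ph (Suc n) - ph n \<cdot> ph n)"
      unfolding phS[of "Suc n"] by (subst phS[of n]) (simp add: hf_diff[symmetric] Bs phB jB)
    also have "ph (Suc n) \<cdot> ph (Suc n) - ph n \<cdot> ph n = (ph (Suc n) - ph n) \<cdot> (ph (Suc n) + ph n)"
      using cj_comm[OF cjp[of n] cjp[of "Suc n"]] by (simp add: expand)
    also have "\<dots> = pw j (Suc n) \<cdot> (c \<cdot> j \<cdot> (a + b))" unfolding c(2) using ab by (simp only: expand add.commute)
    also have "c \<cdot> j = j \<cdot> c" by (rule cj_j[OF c(1)])
    also have "pw j (Suc n) \<cdot> (j \<cdot> c \<cdot> (a + b)) = pw j (Suc (Suc n)) \<cdot> (c \<cdot> (a + b))"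
      using pw_Suc2[OF jB, of "Suc n"] by (simp only: assoc)
    also have "hf \<dots> = pw j (Suc (Suc n)) \<cdot> hf (c \<cdot> (a + b))"
      using c ab cjB jB by (simp add: hf_right Bs del: pw.simps)
    finally show ?case using c ab by (meson cj_hf cj_mult cj_add)
  qed
  obtain N where "pw j N = 0" using rad_nilp[OF j] unfolding nilp_def by blast
  hence N: "pw j (Suc N) = 0" by simp
  with d[of N] have "ph (Suc N) = ph N" by auto
  hence e: "ph N = hf (j + ph N \<cdot> ph N)" by (simp add: phS)
  obtain c where c: "cj c" "ph N = j \<cdot> c" using ph by blast
  show ?thesis
  proof (rule that[of "ph N" c])
    show "ph N \<in> rad" using c cjB j rad_right by auto
    show "st (ph N) = ph N" using ph by blast
    show "ph N + ph N = j + ph N \<cdot> ph N" using e hf_hf[of "j + ph N \<cdot> ph N"] phB jB by (simp add: Bs)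
    show "c \<in> B" "ph N = j \<cdot> c" "ph N = c \<cdot> j" using c cjB cj_j by auto
    show "ph N \<cdot> z = z \<cdot> ph N" if "z \<in> B" "j \<cdot> z = z \<cdot> j" for z
      using cjp[of N] that unfolding cj_def by blast
  qed
qed

text \<open>An idempotent \<open>p\<close> in the right ideal of \<open>x\<close> satisfies
  \<open>f \<cdot> p = p\<close>, so multiplying it by \<open>f\<close> on the right moves it into
  the corner of \<open>f\<close> and keeps it idempotent.\<close>

lemma idem_cut:
  assumes f: "symid f" and x: "x \<in> B" "f \<cdot> x = x" "x \<notin> rad"
  obtains v c where "v \<in> B" "v \<cdot> v = v" "f \<cdot> v = v" "v \<cdot> f = v" "v \<notin> rad" "v \<noteq> 0" "c \<in> B" "v = x \<cdot> c"
proof -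
  have fB: "f \<in> B" using f unfolding symid_def by simp
  obtain p y where p: "p \<in> B" "p \<notin> rad" "p \<noteq> 0" "p \<cdot> p = p" "y \<in> B" "p = x \<cdot> y"
    using idempotent_of_nonrad[OF x(1,3)] by blast
  have fp: "f \<cdot> p = p" unfolding p(6) using x(2) by (simp add: prefix)
  have vp: "p \<cdot> f \<cdot> p = p" using fp p by (simp add: assoc)
  show ?thesis
  proof (rule that[of "p \<cdot> f" "y \<cdot> f"])
    show "p \<cdot> f \<cdot> (p \<cdot> f) = p \<cdot> f" using vp by (simp flip: assoc)
    show "f \<cdot> (p \<cdot> f) = p \<cdot> f" using fp by (simp flip: assoc)
    show "p \<cdot> f \<cdot> f = p \<cdot> f" using f by (simp add: assoc symid_def)
    show "p \<cdot> f \<notin> rad" using vp p rad_right by metis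
    show "p \<cdot> f \<noteq> 0" using vp p by auto
    show "p \<cdot> f = x \<cdot> (y \<cdot> f)" using p(6) by (simp add: assoc)
  qed (use p fB in \<open>auto simp: Bs\<close>)
qed

text \<open>Three corrections lead from \<open>x\<close> to \<open>u\<close>: an idempotent
  \<open>v\<close> in the right ideal of \<open>x\<close>, whose norm is still radical; a square
  root of \<open>1 - st v \<cdot> v\<close>, which makes the norm exactly zero; and half of
  \<open>a \<cdot> st a\<close>, which kills the product in the other order.\<close>

lemma isotropic_idempotent:
  assumes f: "symid f" and x: "x \<in> B" "f \<cdot> x = x" "x \<notin> rad" and xx: "st x \<cdot> x \<in> rad"
  obtains v where "isoid f v" "v \<noteq> 0"
proof -
  have fB: "f \<in> B" and ff: "f \<cdot> f = f" and sf: "st f = f" using f unfolding symid_def by auto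
  obtain v c where v: "v \<in> B" "v \<cdot> v = v" "f \<cdot> v = v" "v \<cdot> f = v" "v \<notin> rad" "c \<in> B" "v = x \<cdot> c"
    using idem_cut[OF f x] by metis
  define j where "j = st v \<cdot> v"
  have "j = st c \<cdot> (st x \<cdot> x) \<cdot> c" unfolding j_def v(7) using v x by (simp add: st_simps assoc)
  hence jJ: "j \<in> rad" using rad_left[OF xx] rad_right v by (simp add: Bs)
  have sj: "st j = j" unfolding j_def using v by (simp add: st_simps Bs)
  obtain d y where d: "d \<in> rad" "st d = d" "d + d = j + d \<cdot> d" "y \<in> B" "d = j \<cdot> y" "d = y \<cdot> j"
    using radical_sqrt[OF jJ sj] by blast
  have dB: "d \<in> B" using d rad_in by blast
  have jv: "j \<cdot> v = j" unfolding j_def using v by (simp add: assoc)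
  have dv: "d \<cdot> v = d" unfolding d(6) using jv by (simp add: assoc)
  have vd: "st v \<cdot> d = d" using arg_cong[OF dv, of st] d dB v by (simp add: st_simps)
  have fsv: "f \<cdot> st v = st v" using arg_cong[OF v(4), of st] v(1) fB sf by (simp add: st_simps)
  have fd: "f \<cdot> d = d" using vd fsv by (metis assoc)
  \<comment> \<open>The square of \<open>E - d\<close> is \<open>E - j\<close>, so the norm of
    \<open>v - d\<close> is \<open>j - (d + d) + d \<cdot> d = 0\<close>.\<close>
  define w where "w = v - d"
  have wB: "w \<in> B" unfolding w_def using v dB by (simp add: Bs)
  have ww: "st w \<cdot> w = 0" unfolding w_def using v(1) d(3) dB
    by (simp add: st_simps expand j_def[symmetric] d(2) vd dv algebra_simps)
  have fw: "f \<cdot> w = w" unfolding w_def using v(3) fd by (simp add: expand)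
  have wJ: "w \<notin> rad" using rad_add[of w d] d v unfolding w_def by auto
  obtain a b where a: "a \<in> B" "a \<cdot> a = a" "f \<cdot> a = a" "a \<cdot> f = a" "a \<noteq> 0" "b \<in> B" "a = w \<cdot> b"
    using idem_cut[OF f wB fw wJ] by metis
  have aa: "st a \<cdot> a = 0" unfolding a(7) using a(6) wB by (simp add: st_simps assoc prefix[OF ww])
  have sa: "st a \<in> B" using a(1) by (simp add: Bs)
  have fsa: "f \<cdot> st a = st a" "st a \<cdot> f = st a" using arg_cong[OF a(4), of st] arg_cong[OF a(3), of st] a(1) fB sf by (simp_all add: st_simps)
  have sasa: "st a \<cdot> st a = st a" using arg_cong[OF a(2), of st] a(1) by (simp add: st_simps)
  \<comment> \<open>Because of \<open>st a \<cdot> a = 0\<close>, subtracting half of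
    \<open>a \<cdot> st a\<close> leaves an idempotent \<open>u\<close> with
    \<open>st u \<cdot> u = 0\<close> and cancels \<open>u \<cdot> st u\<close>.\<close>
  define u where "u = a - hf (a \<cdot> st a)"
  have h: "hf (a \<cdot> st a) + hf (a \<cdot> st a) = a \<cdot> st a" using hf_hf a(1) sa by (simp add: Bs)
  have su: "st u = st a - hf (a \<cdot> st a)" unfolding u_def using a(1) sa by (simp add: st_simps Bs)
  have "isoid f u"
    unfolding isoid_def
  proof (intro conjI)
    show "u \<in> B" unfolding u_def using a(1) sa by (simp add: Bs)
    show "u \<cdot> u = u" unfolding u_def using a(1) sa
      by (simp add: expand hf_simps Bs a(2) aa prefix[OF a(2)] prefix[OF aa])
    show "st u \<cdot> u = 0" unfolding su using a(1) sa
      by (simp add: u_def expand hf_simps Bs a(2) aa prefix[OF a(2)] prefix[OF aa] sasa prefix[OF sasa])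
    show "u \<cdot> st u = 0" unfolding su using a(1) sa h
      by (simp add: u_def expand hf_simps Bs a(2) aa prefix[OF a(2)] prefix[OF aa] sasa prefix[OF sasa] algebra_simps)
    show "f \<cdot> u = u" "u \<cdot> f = u" unfolding u_def using a(1) sa fB
      by (auto simp add: expand hf_simps Bs a(3,4) prefix[OF a(3)] fsa)
  qed
  moreover have "u \<cdot> a = a" unfolding u_def using a(1) sa aa by (simp add: expand hf_simps Bs a(2))
  hence "u \<noteq> 0" using a(5) by auto
  ultimately show ?thesis using that by blast
qed

lemma isoid_st: "isoid f u \<Longrightarrow> symid f \<Longrightarrow> f \<cdot> st u = st u \<and> st u \<cdot> f = st u \<and> st u \<cdot> st u = st u \<and> st u \<in> B"
  unfolding isoid_def symid_def by (metis B_st st_mult)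

lemma symid_rest:
  assumes "isoid f u" "symid f"
  shows "symid (f - u - st u)" "f \<cdot> (f - u - st u) = f - u - st u" "(f - u - st u) \<cdot> f = f - u - st u"
    "u \<cdot> (f - u - st u) = 0" "(f - u - st u) \<cdot> u = 0" "st u \<cdot> (f - u - st u) = 0" "(f - u - st u) \<cdot> st u = 0"
  using isoid_st[OF assms] assms unfolding isoid_def symid_def
  by (auto simp: Bs expand st_simps)

text \<open>Take \<open>u\<close> with right ideal of largest rank. An isotropic element of the
  remaining corner would give an isotropic idempotent \<open>v\<close> orthogonal to
  \<open>u\<close> and \<open>st u\<close>, and \<open>u + v\<close> would have larger rank.\<close>

lemma witt_decomposition:
  assumes f: "symid f"
  obtains u where "isoid f u" "aniso (f - u - st u)"
proof -
  have fB: "f \<in> B" and ff: "f \<cdot> f = f" using f unfolding symid_def by auto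
  have pr: "rideal (princ u)" if "isoid f u" for u using that princ_rideal unfolding isoid_def by blast
  have "isoid f 0" unfolding isoid_def by (simp add: Bs)
  moreover have "\<forall>u. isoid f u \<longrightarrow> rk (princ u) < Suc (rk B)"
    using rk_mono[OF pr rideal_B] pr unfolding rideal_def by (auto simp: less_Suc_eq_le)
  ultimately have "\<exists>u. isoid f u \<and> (\<forall>v. isoid f v \<longrightarrow> rk (princ v) \<le> rk (princ u))"
    by (rule ex_has_greatest_nat)
  then obtain u where u: "isoid f u" and max: "\<And>v. isoid f v \<Longrightarrow> rk (princ v) \<le> rk (princ u)" by blast
  define f' where "f' = f - u - st u"
  note r = symid_rest[OF u f, folded f'_def]
  have "aniso f'"
    unfolding aniso_def
  proof (intro conjI ballI impI r, rule ccontr)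
    fix x assume x: "x \<in> B" "f' \<cdot> x = x" "st x \<cdot> x \<in> rad" "x \<notin> rad"
    obtain v where v: "isoid f' v" "v \<noteq> 0" using isotropic_idempotent[OF r(1) x(1,2,4,3)] by blast
    have vB: "v \<in> B" "v \<cdot> v = v" "st v \<cdot> v = 0" "v \<cdot> st v = 0" "f' \<cdot> v = v" "v \<cdot> f' = v"
      using v unfolding isoid_def by auto
    have uB: "u \<in> B" "u \<cdot> u = u" "st u \<cdot> u = 0" "u \<cdot> st u = 0" "f \<cdot> u = u" "u \<cdot> f = u"
      using u unfolding isoid_def by auto
    have sv: "f' \<cdot> st v = st v" "st v \<cdot> f' = st v" "st v \<in> B" using isoid_st[OF v(1) r(1)] by auto
    have z: "u \<cdot> v = 0" "v \<cdot> u = 0" "st u \<cdot> v = 0" "v \<cdot> st u = 0" "st v \<cdot> u = 0" "u \<cdot> st v = 0"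
      "f \<cdot> v = v" "v \<cdot> f = v"
      using r vB(5,6) sv by (metis assoc zero_left zero_right)+
    have "isoid f (u + v)"
      unfolding isoid_def using uB vB z by (simp add: Bs st_simps expand)
    hence "rk (princ (u + v)) \<le> rk (princ u)" by (rule max)
    moreover have "princ u \<subseteq> princ (u + v)"
    proof
      fix y assume "y \<in> princ u"
      then obtain c where c: "c \<in> B" "y = u \<cdot> c" unfolding princ_def by auto
      have "y = (u + v) \<cdot> (u \<cdot> c)" using c z uB by (simp add: add_left prefix)
      thus "y \<in> princ (u + v)" unfolding princ_def using c uB by (auto simp: Bs)
    qed
    moreover have "v = (u + v) \<cdot> v" using z vB by (simp add: add_left)
    hence "v \<in> princ (u + v)" unfolding princ_def using vB by auto
    moreover have "v \<notin> princ u"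
    proof
      assume "v \<in> princ u"
      then obtain c where "v = u \<cdot> c" unfolding princ_def by auto
      hence "u \<cdot> v = v" using uB by (simp add: prefix)
      thus False using z v by simp
    qed
    ultimately show False using rk_strict[of "princ u" "princ (u + v)"] pr[OF u] pr[OF \<open>isoid f (u + v)\<close>]
      by (metis leD psubsetI)
  qed
  thus ?thesis using that u unfolding f'_def by blast
qed

text \<open>Uniqueness of the anisotropic part. Modulo the radical every right ideal is generated by an
  idempotent; this is applied to the sum of the Lagrangian \<open>gB\<close> and the isotropic ideal \<open>uB\<close>.\<close>

lemma aniso_part_hyperbolic:
  assumes g: "g \<in> B" "g \<cdot> g - g \<in> rad" "g + st g = E" and u: "isoid E u" and f: "aniso (E - u - st u)"
  shows "E = u + st u"
proof -
  define f' where "f' = E - u - st u"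
  have sE: "symid E" unfolding symid_def by (simp add: Bs unit_left)
  note r = symid_rest[OF u sE, folded f'_def]
  have uB: "u \<in> B" "u \<cdot> u = u" "st u \<cdot> u = 0" "u \<cdot> st u = 0" using u unfolding isoid_def by auto
  have suB: "st u \<in> B" "st g \<in> B" using uB g by (auto simp: Bs)
  have fB: "f' \<in> B" "f' \<cdot> f' = f'" "st f' = f'" using r unfolding symid_def by auto
  have sg: "st g = E - g" using g(3) by (simp add: algebra_simps)
  have "st g \<cdot> g = - (g \<cdot> g - g)" unfolding sg using g by (simp add: expand unit_left)
  hence gg: "st g \<cdot> g \<in> rad" using rad_minus[OF g(2)] by simp
  \<comment> \<open>Such an \<open>x\<close> is orthogonal to the Lagrangian \<open>g B\<close>,
    hence lies in it modulo the radical and is isotropic. It is also orthogonal to \<open>u\<close>,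
    so passing to \<open>f' \<cdot> x\<close> does not change the norm modulo the radical, and
    anisotropy applies.\<close>
  have key: "f' \<cdot> x \<in> rad" if x: "x \<in> B" "st g \<cdot> x \<in> rad" "st u \<cdot> x \<in> rad" for x
  proof -
    have xg: "x \<doteq> g \<cdot> x"
    proof -
      have "x - g \<cdot> x = st g \<cdot> x" unfolding sg using x by (simp add: expand unit_left)
      thus ?thesis using x unfolding cg_def by simp
    qed
    have "st x \<cdot> x \<doteq> st (g \<cdot> x) \<cdot> (g \<cdot> x)"
      by (rule cg_mult[OF cg_st[OF xg] xg]) (use x g in \<open>auto simp: Bs\<close>)
    also have "st (g \<cdot> x) \<cdot> (g \<cdot> x) = st x \<cdot> (st g \<cdot> g) \<cdot> x" using x g by (simp add: st_simps assoc)
    also have "\<dots> \<doteq> 0" unfolding cg_zero by (intro rad_right rad_left gg) (use x in \<open>auto simp: Bs\<close>)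
    finally have xx: "st x \<cdot> x \<in> rad" by (simp add: cg_zero)
    have xu: "st x \<cdot> u \<in> rad" using rad_st[OF x(3)] x uB suB by (simp add: st_simps)
    have "st (f' \<cdot> x) \<cdot> (f' \<cdot> x) = st x \<cdot> (f' \<cdot> x)" using x fB by (simp add: st_simps assoc prefix[OF fB(2)])
    also have "\<dots> = st x \<cdot> x - st x \<cdot> u \<cdot> x - st x \<cdot> (st u \<cdot> x)"
      unfolding f'_def using x by (simp add: expand unit_left)
    also have "\<dots> \<in> rad" by (intro rad_diff xx rad_right[OF xu] rad_left[OF x(3)]) (use x in \<open>auto simp: Bs\<close>)
    finally have "st (f' \<cdot> x) \<cdot> (f' \<cdot> x) \<in> rad" .
    moreover have "f' \<cdot> (f' \<cdot> x) = f' \<cdot> x" by (rule prefix[OF fB(2)])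
    ultimately show ?thesis using f fB x unfolding aniso_def f'_def[symmetric] by (auto simp: Bs)
  qed
  \<comment> \<open>Modulo the radical this is \<open>g B + u B\<close>, because
    \<open>st g = E - g\<close>. Written with congruences it contains \<open>rad\<close>, as
    required for generating it by an idempotent.\<close>
  define M where "M = {x \<in> B. \<exists>a\<in>B. \<exists>b\<in>B. st g \<cdot> a \<in> rad \<and> b - u \<cdot> b \<in> rad \<and> x = a + b}"
  have MI: "x \<in> M" if "a \<in> B" "b \<in> B" "st g \<cdot> a \<in> rad" "b - u \<cdot> b \<in> rad" "x = a + b" for x a b
    using that unfolding M_def by (auto simp: Bs)
  have M: "rideal M"
    unfolding rideal_def
  proof (intro conjI ballI)
    show "M \<subseteq> B" unfolding M_def by auto
    show "0 \<in> M" by (rule MI[of 0 0]) (auto simp: Bs rad_zero)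
    fix x y assume "x \<in> M"
    then obtain a b where ab: "a \<in> B" "b \<in> B" "st g \<cdot> a \<in> rad" "b - u \<cdot> b \<in> rad" "x = a + b"
      unfolding M_def by auto
    { assume "y \<in> M"
      then obtain a' b' where ab': "a' \<in> B" "b' \<in> B" "st g \<cdot> a' \<in> rad" "b' - u \<cdot> b' \<in> rad" "y = a' + b'"
        unfolding M_def by auto
      show "x + y \<in> M"
        by (rule MI[of "a + a'" "b + b'"])
          (use ab ab' rad_add[OF ab(3) ab'(3)] rad_add[OF ab(4) ab'(4)] in \<open>auto simp: Bs expand algebra_simps\<close>) }
    { assume y: "y \<in> B"
      show "x \<cdot> y \<in> M"
        by (rule MI[of "a \<cdot> y" "b \<cdot> y"])
          (use ab y rad_right[OF ab(3) y] rad_right[OF ab(4) y] in \<open>auto simp: Bs expand\<close>) }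
  qed
  have JM: "rad \<subseteq> M"
    by (rule subsetI, rule_tac a = 0 and b = x in MI) (use uB in \<open>auto simp: Bs rad_in rad_zero rad_diff rad_left\<close>)
  obtain p where p: "p \<in> M" "p \<cdot> p = p" "\<And>x. x \<in> M \<Longrightarrow> x - p \<cdot> x \<in> rad"
    using rideal_rad_idempotent[OF M JM] by blast
  have pB: "p \<in> B" using p M unfolding rideal_def by auto
  \<comment> \<open>\<open>z\<close> is orthogonal to all of \<open>M\<close>, hence
    \<open>f' \<cdot> z\<close> is radical. Applying \<open>st\<close> shows that \<open>f'\<close>
    is congruent to \<open>p \<cdot> f'\<close>, so it lies in \<open>M\<close>.\<close>
  define z where "z = E - st p"
  have zB: "z \<in> B" unfolding z_def using pB by (simp add: Bs)
  have perp: "st x \<cdot> z \<in> rad" if "x \<in> M" for x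
  proof -
    have xB: "x \<in> B" using that M unfolding rideal_def by auto
    have "st (x - p \<cdot> x) = st x \<cdot> z" unfolding z_def using xB pB by (simp add: st_simps expand Bs unit_right)
    thus ?thesis using rad_st[OF p(3)[OF that]] by simp
  qed
  have gM: "g \<in> M" by (rule MI[of g 0]) (use g gg in \<open>auto simp: Bs rad_zero\<close>)
  have uM: "u \<in> M" by (rule MI[of 0 u]) (use uB in \<open>auto simp: Bs rad_zero\<close>)
  have "f' \<cdot> z \<in> rad" by (rule key[OF zB perp[OF gM] perp[OF uM]])
  hence "st (f' \<cdot> z) \<in> rad" by (rule rad_st)
  hence "f' - p \<cdot> f' \<in> rad" unfolding z_def using fB pB by (simp add: st_simps expand Bs unit_left)
  moreover have "p \<cdot> f' \<in> M" using p fB M unfolding rideal_def by auto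
  ultimately have "f' \<in> M" using JM M unfolding rideal_def by (metis diff_add_cancel subsetD)
  then obtain a b where ab: "a \<in> B" "b \<in> B" "st g \<cdot> a \<in> rad" "b - u \<cdot> b \<in> rad" "f' = a + b"
    unfolding M_def by auto
  have a: "a = f' - b" using ab by simp
  have ub: "b \<doteq> u \<cdot> b" using ab unfolding cg_def by simp
  have "st u \<cdot> b \<doteq> st u \<cdot> (u \<cdot> b)" by (rule cg_left[OF ub]) (use suB in auto)
  hence "st u \<cdot> b \<in> rad" by (simp add: prefix[OF uB(3)] cg_zero)
  \<comment> \<open>Since \<open>f'\<close> and \<open>b\<close> are orthogonal to \<open>u\<close>,
    so is \<open>a\<close>; thus \<open>key\<close> applies to \<open>a\<close>, while
    \<open>b\<close> is killed by \<open>f'\<close> directly.\<close>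
  hence "st u \<cdot> a \<in> rad" unfolding a using rad_minus by (simp add: expand r)
  hence fa: "f' \<cdot> a \<in> rad" using key ab by blast
  have "f' \<cdot> b \<doteq> f' \<cdot> (u \<cdot> b)" by (rule cg_left[OF ub]) (use fB in auto)
  hence "f' \<cdot> b \<in> rad" by (simp add: prefix[OF r(5)] cg_zero)
  hence "f' \<cdot> a + f' \<cdot> b \<in> rad" using fa rad_add by blast
  hence "f' \<in> rad" using ab(5) fB by (simp flip: add_right)
  hence "f' = 0" using idem_rad fB by blast
  thus ?thesis unfolding f'_def by (simp add: algebra_simps)
qed

text \<open>Decompose the complement of \<open>u\<close> and add its isotropic part \<open>v\<close>
  to \<open>u\<close>. Both decompositions have the same anisotropic part, which vanishes in a
  hyperbolic ring, so \<open>v\<close> and \<open>st v\<close> fill the complement.\<close>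

theorem hyperbolic_cancel:
  assumes g: "g \<in> B" "g \<cdot> g - g \<in> rad" "g + st g = E"
    and u: "isoid E u"
  obtains v where "v \<in> B" "v \<cdot> v = v" "v + st v = E - u - st u"
    "(E - u - st u) \<cdot> v = v" "v \<cdot> (E - u - st u) = v"
proof -
  define f where "f = E - u - st u"
  have sE: "symid E" unfolding symid_def by (simp add: Bs unit_left)
  note r = symid_rest[OF u sE, folded f_def]
  have uB: "u \<in> B" "u \<cdot> u = u" "st u \<cdot> u = 0" "u \<cdot> st u = 0" using u unfolding isoid_def by auto
  obtain v where v: "isoid f v" "aniso (f - v - st v)" using witt_decomposition[OF r(1)] by blast
  have vB: "v \<in> B" "v \<cdot> v = v" "st v \<cdot> v = 0" "v \<cdot> st v = 0" "f \<cdot> v = v" "v \<cdot> f = v"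
    using v unfolding isoid_def by auto
  have sv: "f \<cdot> st v = st v" "st v \<cdot> f = st v" "st v \<in> B" using isoid_st[OF v(1) r(1)] by auto
  have z: "u \<cdot> v = 0" "v \<cdot> u = 0" "st u \<cdot> v = 0" "v \<cdot> st u = 0" "st v \<cdot> u = 0" "u \<cdot> st v = 0"
    using r vB(5,6) sv by (metis assoc zero_left zero_right)+
  have "isoid E (u + v)"
    unfolding isoid_def using uB vB z by (simp add: Bs st_simps expand unit_left unit_right)
  moreover have "E - (u + v) - st (u + v) = f - v - st v" unfolding f_def using uB vB by (simp add: st_simps)
  ultimately have "E = u + v + st (u + v)" using aniso_part_hyperbolic[OF g, of "u + v"] v(2) by metis
  hence "v + st v = f" unfolding f_def using uB vB by (simp add: st_simps algebra_simps)
  thus ?thesis using that[of v] vB unfolding f_def by blast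
qed

end

section \<open>Trace forms over euclidean fields\<close>

text \<open>Fields of scalars are subsets of one field, so that Zorn's lemma and extension of
  scalars take place inside a single type.\<close>

definition subfld :: "'c::field set \<Rightarrow> bool" where
  "subfld L \<longleftrightarrow> 0 \<in> L \<and> 1 \<in> L \<and> (\<forall>x\<in>L. \<forall>y\<in>L. x + y \<in> L) \<and> (\<forall>x\<in>L. - x \<in> L) \<and>
     (\<forall>x\<in>L. \<forall>y\<in>L. x * y \<in> L) \<and> (\<forall>x\<in>L. inverse x \<in> L)"

lemma subfldD:
  assumes "subfld L"
  shows "0 \<in> L" "1 \<in> L" "x \<in> L \<Longrightarrow> y \<in> L \<Longrightarrow> x + y \<in> L" "x \<in> L \<Longrightarrow> - x \<in> L"
    "x \<in> L \<Longrightarrow> y \<in> L \<Longrightarrow> x * y \<in> L" "x \<in> L \<Longrightarrow> inverse x \<in> L" "x \<in> L \<Longrightarrow> y \<in> L \<Longrightarrow> x - y \<in> L"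
    "x \<in> L \<Longrightarrow> y \<in> L \<Longrightarrow> x / y \<in> L"
  using assms unfolding subfld_def by (auto simp: divide_inverse) (metis add_uminus_conv_diff)

lemma subfld_sum: "subfld L \<Longrightarrow> (\<And>x. x \<in> A \<Longrightarrow> f x \<in> L) \<Longrightarrow> sum f A \<in> L"
  by (induction A rule: infinite_finite_induct) (auto simp: subfldD)

definition sqs :: "'c::field set \<Rightarrow> 'c set" where "sqs L = {b * b | b. b \<in> L}"

definition euclidean :: "'c::field set \<Rightarrow> bool" where
  "euclidean L \<longleftrightarrow> subfld L \<and> (\<forall>x\<in>sqs L. \<forall>y\<in>sqs L. x + y \<in> sqs L) \<and>
     (\<forall>x\<in>L. x \<in> sqs L \<or> - x \<in> sqs L) \<and> (\<forall>x. x \<in> sqs L \<longrightarrow> - x \<in> sqs L \<longrightarrow> x = 0)"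

lemma euclideanD:
  assumes "euclidean L"
  shows "subfld L" "x \<in> sqs L \<Longrightarrow> y \<in> sqs L \<Longrightarrow> x + y \<in> sqs L" "x \<in> L \<Longrightarrow> x \<in> sqs L \<or> - x \<in> sqs L"
    "x \<in> sqs L \<Longrightarrow> - x \<in> sqs L \<Longrightarrow> x = 0"
  using assms unfolding euclidean_def by auto

lemma sqs_mult: "subfld L \<Longrightarrow> x \<in> sqs L \<Longrightarrow> y \<in> sqs L \<Longrightarrow> x * y \<in> sqs L"
proof -
  assume L: "subfld L" and "x \<in> sqs L" "y \<in> sqs L"
  then obtain a b where "a \<in> L" "b \<in> L" "x = a * a" "y = b * b" unfolding sqs_def by auto
  hence "x * y = (a * b) * (a * b)" "a * b \<in> L" using L by (auto simp: subfldD)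
  thus ?thesis unfolding sqs_def by blast
qed

lemma sqs_sub: "subfld L \<Longrightarrow> x \<in> sqs L \<Longrightarrow> x \<in> L" unfolding sqs_def by (auto simp: subfldD)

lemma sqs_one: "subfld L \<Longrightarrow> 1 \<in> sqs L" unfolding sqs_def by (rule CollectI, rule exI[of _ 1]) (auto simp: subfldD)

lemma sqs_zero: "subfld L \<Longrightarrow> 0 \<in> sqs L" unfolding sqs_def by (rule CollectI, rule exI[of _ 0]) (auto simp: subfldD)

context star_ring
begin

lemma unipotent_inverse:
  assumes c: "c \<in> rad"
  obtains r where "r \<in> B" "(E - c) \<cdot> r = E" "r \<cdot> (E - c) = E"
proof -
  have cB: "c \<in> B" using c rad_in by blast
  define S where "S n = (\<Sum>i<n. pw c i)" for n
  have SB: "S n \<in> B" for n unfolding S_def by (induction n) (auto simp: Bs cB)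
  have c1: "(E - c) \<cdot> S n = E - pw c n" for n
    unfolding S_def by (induction n) (auto simp: expand unit_left pw_in[OF cB] Bs)
  have c2: "S n \<cdot> (E - c) = E - pw c n" for n
  proof (induction n)
    case (Suc n)
    have "S (Suc n) \<cdot> (E - c) = S n \<cdot> (E - c) + pw c n \<cdot> (E - c)"
      unfolding S_def by (simp add: add_left)
    also have "\<dots> = E - pw c n \<cdot> c" unfolding Suc by (simp add: diff_right unit_right pw_in[OF cB])
    finally show ?case using pw_Suc2[OF cB] by simp
  qed (simp add: S_def)
  obtain n where "pw c n = 0" using rad_nilp[OF c] unfolding nilp_def by blast
  thus ?thesis using that[OF SB[of n]] c1[of n] c2[of n] by simp
qed

definition negsq :: "'v \<Rightarrow> bool" where
  "negsq p \<longleftrightarrow> (\<exists>y\<in>B. st y = y \<and> p \<cdot> y = y \<and> y \<cdot> p = y \<and> y \<cdot> y = - p)"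

text \<open>For the error \<open>j = y \<cdot> y + p\<close> let \<open>c\<close> solve
  \<open>(E - c)^2 = E - j\<close>. It commutes with \<open>y\<close>, so dividing \<open>y\<close>
  by \<open>E - c\<close> turns the approximate square root of \<open>- p\<close> into an exact one
  and keeps it symmetric.\<close>

lemma negsq_lift:
  assumes p: "symid p" and y: "y \<in> B" "st y = y" "p \<cdot> y = y" "y \<cdot> p = y" and yy: "y \<cdot> y + p \<in> rad"
  shows "negsq p"
proof -
  have pB: "p \<in> B" "p \<cdot> p = p" "st p = p" using p unfolding symid_def by auto
  define j where "j = y \<cdot> y + p"
  have jJ: "j \<in> rad" "j \<in> B" using yy rad_in unfolding j_def by auto
  have sj: "st j = j" unfolding j_def using y pB by (simp add: st_simps Bs)
  have pj: "p \<cdot> j = j" "j \<cdot> y = y \<cdot> j" unfolding j_def using y pB by (simp_all add: expand prefix[OF y(3)])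
  obtain c z where c: "c \<in> rad" "st c = c" "c + c = j + c \<cdot> c" "z \<in> B" "c = j \<cdot> z"
    "\<And>z. z \<in> B \<Longrightarrow> j \<cdot> z = z \<cdot> j \<Longrightarrow> c \<cdot> z = z \<cdot> c"
    using radical_sqrt[OF jJ(1) sj] by metis
  have cB: "c \<in> B" using c rad_in by blast
  have cy: "c \<cdot> y = y \<cdot> c" using c(6) y pj by blast
  obtain r where r: "r \<in> B" "(E - c) \<cdot> r = E" "r \<cdot> (E - c) = E" using unipotent_inverse[OF c(1)] .
  have sr: "st r \<cdot> (E - c) = E" using arg_cong[OF r(2), of st] r(1) cB c(2) by (simp add: st_simps Bs)
  have sr: "st r = r" using sr r by (metis B_st assoc unit_left unit_right)
  have "y \<cdot> (E - c) = (E - c) \<cdot> y" using cy y by (simp add: expand unit_left unit_right)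
  hence "r \<cdot> (y \<cdot> (E - c)) \<cdot> r = r \<cdot> ((E - c) \<cdot> y) \<cdot> r" by simp
  hence ry: "r \<cdot> y = y \<cdot> r" using r y
    by (simp only: assoc r(2)) (simp only: r(3) unit_left unit_right Bs flip: assoc)
  have yc: "y \<cdot> y = - (p \<cdot> ((E - c) \<cdot> (E - c)))"
  proof -
    have "p \<cdot> c = c" unfolding c(5) by (simp add: prefix[OF pj(1)])
    hence "p \<cdot> ((E - c) \<cdot> (E - c)) = p - (c + c) + c \<cdot> c" using cB pB
      by (simp add: expand unit_left unit_right B_unit prefix[OF \<open>p \<cdot> c = c\<close>] algebra_simps)
    also have "\<dots> = - (y \<cdot> y)" unfolding c(3) j_def by simp
    finally show ?thesis by simp
  qed
  have "y \<cdot> r \<cdot> (y \<cdot> r) = y \<cdot> y \<cdot> r \<cdot> r" using ry by (metis assoc)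
  also have "\<dots> = - (p \<cdot> ((E - c) \<cdot> ((E - c) \<cdot> r) \<cdot> r))" unfolding yc by (simp only: minus_left assoc)
  also have "(E - c) \<cdot> ((E - c) \<cdot> r) \<cdot> r = E" unfolding r(2) using r(2) cB by (simp add: unit_right Bs)
  also have "- (p \<cdot> E) = - p" using pB by (simp add: unit_right)
  finally have "y \<cdot> r \<cdot> (y \<cdot> r) = - p" .
  moreover have "st (y \<cdot> r) = y \<cdot> r" using y r sr ry by (simp add: st_simps)
  moreover have "p \<cdot> (y \<cdot> r) = y \<cdot> r" by (rule prefix[OF y(3)])
  moreover have "y \<cdot> r \<cdot> p = y \<cdot> r" using y(4) by (metis assoc ry)
  moreover have "y \<cdot> r \<in> B" using y r by (simp add: Bs)
  ultimately show ?thesis unfolding negsq_def by blast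
qed

text \<open>For symmetric \<open>y\<close> the product \<open>pw y k \<cdot> pw y k\<close> is the
  norm of \<open>pw y k\<close>, so anisotropy passes from exponent \<open>2 k\<close> to
  \<open>k\<close>; \<open>k\<close> is half of \<open>n\<close>, rounded up.\<close>

lemma aniso_sym_nilp:
  assumes f: "aniso f" and y: "y \<in> B" "st y = y" "f \<cdot> y = y" and n: "pw y n \<in> rad"
  shows "y \<in> rad"
  using n
proof (induction n rule: less_induct)
  case (less n)
  show ?case
  proof (cases "n \<le> 1")
    case True
    hence "n = 0 \<or> n = 1" by auto
    thus ?thesis
    proof
      assume "n = 0"
      hence "E \<in> rad" using less.prems by simp
      thus ?thesis using rad_right[of E y] y by (simp add: unit_left)
    qed (use less.prems y in \<open>simp add: unit_right\<close>)
  next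
    case False
    define k where "k = Suc ((n - 1) div 2)"
    have k: "k < n" "n \<le> k + k" using False unfolding k_def by auto
    then obtain t where t: "k + k = n + t" using le_Suc_ex by blast
    have "pw y k \<cdot> pw y k \<in> rad"
      using t pw_add[OF y(1), of n t] pw_add[OF y(1), of k k] rad_right[OF less.prems pw_in[OF y(1), of t]] by simp
    moreover have "st (pw y k) = pw y k" using st_pw[OF y(1)] y by metis
    moreover have "f \<cdot> pw y k = pw y k" unfolding k_def by (simp add: prefix[OF y(3)])
    ultimately have "pw y k \<in> rad" using f y unfolding aniso_def by auto
    thus ?thesis using less.IH k by blast
  qed
qed

definition minid :: "'v \<Rightarrow> bool" where
  "minid c \<longleftrightarrow> symid c \<and> c \<noteq> 0 \<and> (\<forall>p. symid p \<longrightarrow> c \<cdot> p = p \<longrightarrow> p = 0 \<or> p = c)"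

lemma aniso_sub: "aniso f \<Longrightarrow> symid c \<Longrightarrow> f \<cdot> c = c \<Longrightarrow> aniso c"
  unfolding aniso_def by (metis prefix)

text \<open>In other words, the corner of \<open>c\<close> is a division ring modulo the radical.
  The norm \<open>st x \<cdot> x\<close> is symmetric and not nilpotent, so it generates a symmetric
  idempotent below \<open>c\<close>, which is \<open>c\<close> by minimality.\<close>

lemma minid_left_inverse:
  assumes c: "minid c" "aniso c" and x: "x \<in> B" "c \<cdot> x = x" "x \<cdot> c = x" "x \<notin> rad"
  obtains z where "z \<in> B" "z \<cdot> x = c"
proof -
  have cs: "symid c" using c unfolding minid_def by simp
  hence cB: "c \<in> B" "st c = c" unfolding symid_def by auto
  define y where "y = st x \<cdot> x"
  have yB: "y \<in> B" "st y = y" unfolding y_def using x by (auto simp: Bs st_simps)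
  have "st (x \<cdot> c) = c \<cdot> st x" using x(1) cB by (simp add: st_simps)
  hence "c \<cdot> st x = st x" using x(3) by simp
  hence cy: "c \<cdot> y = y" unfolding y_def by (rule prefix)
  have "y \<notin> rad" using c x unfolding y_def aniso_def by blast
  hence "\<not> nilp y" using aniso_sym_nilp[OF c(2) yB cy] rad_zero unfolding nilp_def by metis
  then obtain p a w where p: "p \<in> B" "p \<noteq> 0" "p \<cdot> p = p" "a \<in> B" "p = y \<cdot> a" "w \<in> B" "p = w \<cdot> y" "st p = p"
    using idempotent_of_nonnilp[OF yB(1)] yB(2) by metis
  have "c \<cdot> p = p" unfolding p(5) by (rule prefix[OF cy])
  hence "p = c" using c(1) p unfolding minid_def symid_def by blast
  hence "w \<cdot> st x \<cdot> x = c" using p(7) unfolding y_def by (simp add: assoc)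
  thus ?thesis using that[of "w \<cdot> st x"] p x by (simp add: Bs)
qed

end

text \<open>\<open>T\<close> is modelled on the trace of left multiplication and is not assumed to
  be invariant under \<open>st\<close>. The assumption \<open>alg\<close> is how the algebraic
  closedness of \<open>L(i)\<close> enters: every element is annihilated by a product of polynomials
  \<open>(X - a)^2 + b^2\<close> over \<open>L\<close>.\<close>

locale real_star_ring = star_ring m B E st hf rk
  for m :: "'v::ab_group_add \<Rightarrow> 'v \<Rightarrow> 'v" (infixl "\<cdot>" 70) and B E st hf rk +
  fixes L :: "'c::field set" and sc :: "'c \<Rightarrow> 'v \<Rightarrow> 'v" and T :: "'v \<Rightarrow> 'c"
  assumes euclidean: "euclidean L" and two: "(2::'c) \<noteq> 0"
    and sc_in: "c \<in> L \<Longrightarrow> x \<in> B \<Longrightarrow> sc c x \<in> B"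
    and sc_add: "sc c (x + y) = sc c x + sc c y" and sc_add2: "sc (a + b) x = sc a x + sc b x"
    and sc_sc: "sc a (sc b x) = sc (a * b) x" and sc_one: "sc 1 x = x"
    and sc_left: "sc c x \<cdot> y = sc c (x \<cdot> y)" and sc_right: "x \<cdot> sc c y = sc c (x \<cdot> y)"
    and sc_st: "st (sc c x) = sc c (st x)"
    and T_in: "x \<in> B \<Longrightarrow> T x \<in> L" and T_add: "T (x + y) = T x + T y" and T_sc: "T (sc c x) = c * T x"
    and T_comm: "x \<in> B \<Longrightarrow> y \<in> B \<Longrightarrow> T (x \<cdot> y) = T (y \<cdot> x)"
    and T_nilp: "x \<in> B \<Longrightarrow> nilp x \<Longrightarrow> T x = 0"
    and T_idem: "p \<in> B \<Longrightarrow> p \<cdot> p = p \<Longrightarrow> p \<noteq> 0 \<Longrightarrow> T p \<in> sqs L \<and> T p \<noteq> 0"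
    and alg: "y \<in> B \<Longrightarrow> \<exists>qs. set qs \<subseteq> L \<times> L \<and>
       foldr (\<lambda>(a, b) z. ((y - sc a E) \<cdot> (y - sc a E) + sc (b * b) E) \<cdot> z) qs E = 0"
begin

lemmas L = euclideanD(1)[OF euclidean]
lemmas Ls = subfldD[OF L]

lemma sc_zero [simp]: "sc c 0 = 0" using sc_add[of c 0 0] by simp
lemma sc_zero2 [simp]: "sc 0 x = 0" using sc_add2[of 0 0 x] by simp
lemma sc_minus: "sc c (- x) = - sc c x" using sc_add[of c x "- x"] by (simp add: eq_neg_iff_add_eq_0 add.commute)
lemma sc_minus2: "sc (- c) x = - sc c x" using sc_add2[of c "- c" x] by (simp add: eq_neg_iff_add_eq_0 add.commute)
lemma sc_diff: "sc c (x - y) = sc c x - sc c y" using sc_add[of c x "- y"] by (simp add: sc_minus)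
lemma T_zero [simp]: "T 0 = 0" using T_sc[of 0 0] by simp
lemma T_minus: "T (- x) = - T x" using T_add[of x "- x"] by (simp add: eq_neg_iff_add_eq_0 add.commute)
lemma T_diff: "T (x - y) = T x - T y" using T_add[of x "- y"] by (simp add: T_minus)
lemma T_rad: "x \<in> rad \<Longrightarrow> T x = 0" using T_nilp rad_nilp rad_in by blast
lemma T_cg: "x \<doteq> y \<Longrightarrow> T x = T y" unfolding cg_def using T_rad T_diff by fastforce

lemma sc_rad: "c \<in> L \<Longrightarrow> x \<in> rad \<Longrightarrow> sc c x \<in> rad"
  using rad_right[of x "sc c E"] by (simp add: sc_in Bs sc_right unit_right rad_in)

lemmas scs = sc_left sc_right sc_sc sc_add sc_diff sc_minus

text \<open>Modulo the radical the corner of \<open>c\<close> is a division ring, so one of the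
  quadratic factors already vanishes there at \<open>y\<close>. With \<open>b \<noteq> 0\<close> it
  would make \<open>- c\<close> the square of a symmetric element; with \<open>b = 0\<close>
  anisotropy shows that \<open>y\<close> is congruent to \<open>sc a c\<close>.\<close>

lemma minid_scalar:
  assumes c: "minid c" "aniso c" "\<not> negsq c" and y: "y \<in> B" "st y = y" "c \<cdot> y = y" "y \<cdot> c = y"
  obtains l where "l \<in> L" "y \<doteq> sc l c"
proof -
  have cs: "symid c" using c unfolding minid_def by simp
  hence cB: "c \<in> B" "st c = c" "c \<cdot> c = c" unfolding symid_def by auto
  have cJ: "c \<notin> rad" using idem_rad cB c unfolding minid_def by blast
  define F where "F = (\<lambda>(a, b) z. ((y - sc a E) \<cdot> (y - sc a E) + sc (b * b) E) \<cdot> z)"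
  obtain qs where qs: "set qs \<subseteq> L \<times> L" "foldr F qs E = 0"
    using alg[OF y(1), folded F_def] by blast
  have *: "\<exists>(a, b)\<in>set qs. (y - sc a c) \<cdot> (y - sc a c) + sc (b * b) c \<in> rad"
    if "set qs \<subseteq> L \<times> L" "c \<cdot> foldr F qs E \<in> rad" "foldr F qs E \<in> B" for qs
    using that
  proof (induction qs)
    case Nil
    thus ?case using cJ cB by (simp add: unit_right)
  next
    case (Cons ab qs)
    obtain a b where ab: "ab = (a, b)" by fastforce
    have abL: "a \<in> L" "b \<in> L" using Cons.prems ab by auto
    define q where "q = (y - sc a c) \<cdot> (y - sc a c) + sc (b * b) c"
    have qB: "q \<in> B" "c \<cdot> q = q" "q \<cdot> c = q" unfolding q_def using abL y cB
      by (auto simp: Bs sc_in Ls expand scs prefix[OF y(3)] prefix[OF cB(3)])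
    have rB: "foldr F qs E \<in> B"
    proof -
      have "set qs \<subseteq> L \<times> L" using Cons.prems by auto
      thus ?thesis by (induction qs) (use y in \<open>auto simp: F_def Bs sc_in Ls\<close>)
    qed
    define R where "R = foldr F qs E"
    have RB: "R \<in> B" using rB unfolding R_def .
    have "foldr F (ab # qs) E = ((y - sc a E) \<cdot> (y - sc a E) + sc (b * b) E) \<cdot> R"
      unfolding R_def ab by (simp add: F_def)
    hence "c \<cdot> foldr F (ab # qs) E = q \<cdot> (c \<cdot> R)"
      unfolding q_def using y cB RB
      by (simp add: Bs expand scs prefix[OF y(3)] prefix[OF y(4)] prefix[OF cB(3)] unit_left unit_right)
    hence "c \<cdot> foldr F (ab # qs) E = q \<cdot> (c \<cdot> foldr F qs E)" unfolding R_def .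
    hence e: "q \<cdot> (c \<cdot> foldr F qs E) \<in> rad" using Cons.prems by simp
    show ?case
    proof (cases "q \<in> rad")
      case True
      thus ?thesis unfolding q_def ab by auto
    next
      case False
      obtain z where z: "z \<in> B" "z \<cdot> q = c" using minid_left_inverse[OF c(1,2) qB False] .
      have "z \<cdot> (q \<cdot> (c \<cdot> foldr F qs E)) \<in> rad" using rad_left e z by blast
      hence "c \<cdot> foldr F qs E \<in> rad" by (simp add: prefix[OF z(2)] prefix[OF cB(3)])
      thus ?thesis using Cons rB by auto
    qed
  qed
  then obtain a b where ab: "a \<in> L" "b \<in> L" "(y - sc a c) \<cdot> (y - sc a c) + sc (b * b) c \<in> rad"
    using qs rad_zero by (fastforce simp: Bs)
  define t where "t = y - sc a c"
  have t: "t \<in> B" "st t = t" "c \<cdot> t = t" "t \<cdot> c = t" unfolding t_def using ab y cB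
    by (auto simp: Bs sc_in st_simps sc_st expand scs)
  have tt: "t \<cdot> t + sc (b * b) c \<in> rad" using ab(3) unfolding t_def .
  have "b = 0"
  proof (rule ccontr)
    assume b: "b \<noteq> 0"
    have "sc (1 / (b * b)) (t \<cdot> t + sc (b * b) c) \<in> rad" using ab by (intro sc_rad tt) (auto simp: Ls)
    hence "sc (1 / b) t \<cdot> sc (1 / b) t + c \<in> rad" using b by (simp add: scs sc_one)
    hence "negsq c" using negsq_lift[OF cs, of "sc (1 / b) t"] t ab by (simp add: sc_in Ls sc_st scs)
    thus False using c by simp
  qed
  hence "st t \<cdot> t \<in> rad" using tt t by simp
  hence "t \<in> rad" using c(2) t unfolding aniso_def by blast
  thus ?thesis using that[of a] ab unfolding t_def cg_def by blast
qed

text \<open>The norm of \<open>x\<close> is congruent to a multiple \<open>l\<close> of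
  \<open>c\<close>. For negative \<open>l\<close> some combination of \<open>c\<close> and
  \<open>x\<close> is isotropic and hence radical; then \<open>x\<close> is congruent to a multiple
  of \<open>c\<close>, and its trace norm is a square times \<open>T c\<close> after all.\<close>

lemma minid_positive:
  assumes c: "minid c" "\<not> negsq c" and h: "aniso h" "h \<cdot> c = c" and x: "x \<in> B" "h \<cdot> x = x" "x \<cdot> c = x"
  shows "T (st x \<cdot> x) \<in> sqs L"
proof -
  have cs: "symid c" using c unfolding minid_def by simp
  hence cB: "c \<in> B" "st c = c" "c \<cdot> c = c" unfolding symid_def by auto
  have c0: "c \<noteq> 0" using c unfolding minid_def by auto
  have cJ: "c \<notin> rad" using idem_rad cB c0 by blast
  have ca: "aniso c" using aniso_sub h cs by blast
  have hB: "h \<in> B" "st h = h" "h \<cdot> h = h" using h unfolding aniso_def symid_def by auto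
  have csx: "c \<cdot> st x = st x" using arg_cong[OF x(3), of st] x(1) cB by (simp add: st_simps)
  have sxh: "st x \<cdot> h = st x" using arg_cong[OF x(2), of st] x(1) hB by (simp add: st_simps)
  have ch: "c \<cdot> h = c" using arg_cong[OF h(2), of st] cB hB by (simp add: st_simps)
  obtain l where l: "l \<in> L" "st x \<cdot> x \<doteq> sc l c"
    by (rule minid_scalar[OF c(1) ca c(2), of "st x \<cdot> x"]) (use x csx in \<open>auto simp: Bs st_simps assoc prefix\<close>)
  have Tx: "T (st x \<cdot> x) = l * T c" using T_cg[OF l(2)] by (simp add: T_sc)
  have Tc: "T c \<in> sqs L" using T_idem cB c0 by blast
  show ?thesis
  proof (cases "l \<in> sqs L")
    case True
    thus ?thesis unfolding Tx using Tc sqs_mult[OF L] by blast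
  next
    case False
    hence nl: "- l \<in> sqs L" "l \<noteq> 0" using euclideanD(3)[OF euclidean l(1)] sqs_zero[OF L] by auto
    define s where "s = c \<cdot> x + st x \<cdot> c"
    obtain u where u: "u \<in> L" "s \<doteq> sc u c"
      by (rule minid_scalar[OF c(1) ca c(2), of s])
        (use x cB csx in \<open>auto simp: s_def Bs st_simps expand prefix[OF cB(3)] prefix[OF csx] add.commute\<close>)
    have four: "(4::'c) \<in> sqs L" "(4::'c) \<noteq> 0"
    proof -
      have "(4::'c) = 2 * 2" by simp
      thus "(4::'c) \<in> sqs L" unfolding sqs_def using Ls(3)[OF Ls(2,2)] by (auto intro!: exI[of _ 2])
      show "(4::'c) \<noteq> 0" using two \<open>(4::'c) = 2 * 2\<close> by (metis mult_eq_0_iff)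
    qed
    \<comment> \<open>The discriminant \<open>u^2 - 4 l\<close> is a sum of squares because
      \<open>l\<close> is negative.\<close>
    have "u * u \<in> sqs L" unfolding sqs_def using u by blast
    hence "u * u + 4 * (- l) \<in> sqs L"
      using euclideanD(2)[OF euclidean] sqs_mult[OF L] four nl by blast
    then obtain w where w: "w \<in> L" "w * w = u * u - 4 * l" unfolding sqs_def by auto
    text \<open>\<open>c + t x\<close> is isotropic for the root \<open>t\<close> of \<open>1 + u t + l t\<^sup>2\<close>.\<close>
    define t where "t = (- u + w) / (2 * l)"
    have two_L: "(2::'c) \<in> L" using Ls(3)[OF Ls(2,2)] by simp
    have tL: "t \<in> L" unfolding t_def using u w l two_L by (auto simp: Ls)
    have tq: "1 + u * t + l * (t * t) = 0"
    proof -
      have "4 * l * (1 + u * t + l * (t * t)) = (2 * l * t + u) * (2 * l * t + u) - (u * u - 4 * l)"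
        by (simp add: algebra_simps)
      also have "2 * l * t + u = w" unfolding t_def using nl two by simp
      finally show ?thesis using w nl four by simp
    qed
    have t0: "t \<noteq> 0" using tq by auto
    define v where "v = c + sc t x"
    have vB: "v \<in> B" unfolding v_def using cB x tL by (simp add: Bs sc_in)
    have "st v \<cdot> v = c + sc t s + sc (t * t) (st x \<cdot> x)" unfolding v_def s_def using cB x tL
      by (simp add: st_simps Bs sc_in sc_st expand scs)
    also have "\<dots> \<doteq> c + sc t (sc u c) + sc (t * t) (sc l c)"
    proof (intro cg_add cg_refl)
      have scg: "sc k a \<doteq> sc k b" if "k \<in> L" "a \<doteq> b" for k a b
        using that sc_rad[of k "a - b"] unfolding cg_def by (simp add: sc_diff)
      show "sc t s \<doteq> sc t (sc u c)" "sc (t * t) (st x \<cdot> x) \<doteq> sc (t * t) (sc l c)"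
        using scg u l tL by (auto simp: Ls)
    qed
    also have "\<dots> = sc (1 + u * t + l * (t * t)) c" by (simp add: sc_add2 sc_sc sc_one mult.commute)
    also have "\<dots> = 0" using tq by simp
    finally have "st v \<cdot> v \<in> rad" by (simp add: cg_zero)
    moreover have "h \<cdot> v = v" unfolding v_def using h x by (simp add: expand scs)
    ultimately have "v \<in> rad" using h(1) vB unfolding aniso_def by blast
    hence "sc (1 / t) v \<in> rad" using tL by (intro sc_rad) (auto simp: Ls)
    hence xc: "x \<doteq> - sc (1 / t) c" unfolding cg_def v_def using t0 by (simp add: scs sc_one add.commute)
    have "st x \<cdot> x \<doteq> st (- sc (1 / t) c) \<cdot> (- sc (1 / t) c)"
      by (rule cg_mult[OF cg_st[OF xc] xc]) (use x cB tL in \<open>auto simp: Bs sc_in Ls\<close>)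
    also have "\<dots> = sc (1 / (t * t)) c" using cB tL by (simp add: st_simps sc_in Ls sc_st expand scs)
    finally have "T (st x \<cdot> x) = 1 / t * (1 / t) * T c" using T_cg by (simp add: T_sc)
    moreover have "1 / t * (1 / t) \<in> sqs L" unfolding sqs_def using tL by (auto simp: Ls intro!: exI[of _ "1 / t"])
    ultimately show ?thesis using sqs_mult[OF L] Tc by presburger
  qed
qed

text \<open>Induction on the rank of \<open>c\<close>. A proper symmetric idempotent
  \<open>p\<close> below \<open>c\<close> splits the trace norm of \<open>x\<close> into those of
  \<open>x \<cdot> p\<close> and \<open>x \<cdot> (c - p)\<close>, by cyclicity of \<open>T\<close>;
  minimal \<open>c\<close> are settled already.\<close>

lemma psd_anisotropic:
  assumes h: "aniso h" and nn: "\<And>c. symid c \<Longrightarrow> h \<cdot> c = c \<Longrightarrow> c \<noteq> 0 \<Longrightarrow> \<not> negsq c"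
  shows "symid c \<Longrightarrow> h \<cdot> c = c \<Longrightarrow> x \<in> B \<Longrightarrow> h \<cdot> x = x \<Longrightarrow> x \<cdot> c = x \<Longrightarrow> T (st x \<cdot> x) \<in> sqs L"
proof (induction "rk (princ c)" arbitrary: c x rule: less_induct)
  case less
  have cB: "c \<in> B" "st c = c" "c \<cdot> c = c" using less.prems unfolding symid_def by auto
  show ?case
  proof (cases "c = 0 \<or> minid c")
    case True
    thus ?thesis
    proof
      assume "c = 0"
      hence "x = 0" using less.prems by simp
      thus ?thesis using sqs_zero[OF L] by simp
    next
      assume "minid c"
      thus ?thesis using minid_positive[OF _ _ h] nn less.prems minid_def by metis
    qed
  next
    case False
    then obtain p where p: "symid p" "c \<cdot> p = p" "p \<noteq> 0" "p \<noteq> c" using less.prems unfolding minid_def by blast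
    have pB: "p \<in> B" "st p = p" "p \<cdot> p = p" using p unfolding symid_def by auto
    have pc: "p \<cdot> c = p" using arg_cong[OF p(2), of st] cB pB by (simp add: st_simps)
    have hc: "symid (c - p)" "c \<cdot> (c - p) = c - p" unfolding symid_def using cB pB p pc
      by (auto simp: Bs st_simps expand)
    have lt: "rk (princ q) < rk (princ c)" if q: "symid q" "c \<cdot> q = q" "q \<noteq> c" for q
    proof (rule rk_strict)
      have qB: "q \<in> B" "st q = q" "q \<cdot> q = q" using q unfolding symid_def by auto
      have qc: "q \<cdot> c = q" using arg_cong[OF q(2), of st] cB qB by (simp add: st_simps)
      show "rideal (princ q)" "rideal (princ c)" using princ_rideal qB cB by auto
      have "princ q \<subseteq> princ c" unfolding princ_def
      proof
        fix w assume "w \<in> (\<cdot>) q ` B"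
        then obtain a where "a \<in> B" "w = q \<cdot> a" by auto
        hence "w = c \<cdot> (q \<cdot> a)" "q \<cdot> a \<in> B" using q(2) qB by (auto simp: prefix Bs)
        thus "w \<in> (\<cdot>) c ` B" by blast
      qed
      moreover have "c \<in> princ c" unfolding princ_def using cB by (metis imageI)
      moreover have "c \<notin> princ q"
      proof
        assume "c \<in> princ q"
        then obtain a where "c = q \<cdot> a" unfolding princ_def by auto
        hence "q \<cdot> c = c" using qB by (simp add: prefix)
        thus False using qc q by simp
      qed
      ultimately show "princ q \<subset> princ c" by blast
    qed
    have part: "T (st (x \<cdot> q) \<cdot> (x \<cdot> q)) \<in> sqs L" if q: "symid q" "c \<cdot> q = q" "q \<noteq> c" for q
    proof (rule less.hyps[OF lt[OF q] q(1)])
      have qB: "q \<in> B" "st q = q" "q \<cdot> q = q" using q unfolding symid_def by auto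
      show "h \<cdot> q = q" using q(2) less.prems(2) by (metis assoc)
      show "x \<cdot> q \<in> B" "h \<cdot> (x \<cdot> q) = x \<cdot> q" "x \<cdot> q \<cdot> q = x \<cdot> q" using less.prems qB
        by (auto simp: Bs assoc prefix)
    qed
    have Tq: "T (st (x \<cdot> q) \<cdot> (x \<cdot> q)) = T (st x \<cdot> x \<cdot> q)" if "symid q" for q
    proof -
      have qB: "q \<in> B" "st q = q" "q \<cdot> q = q" using that unfolding symid_def by auto
      have "T (st (x \<cdot> q) \<cdot> (x \<cdot> q)) = T (q \<cdot> (st x \<cdot> x \<cdot> q))" using qB less.prems by (simp add: st_simps assoc)
      also have "\<dots> = T (st x \<cdot> x \<cdot> q \<cdot> q)" by (rule T_comm) (use qB less.prems in \<open>auto simp: Bs\<close>)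
      finally show ?thesis using qB by (simp add: assoc)
    qed
    have "T (st x \<cdot> x) = T (st x \<cdot> x \<cdot> p) + T (st x \<cdot> x \<cdot> (c - p))"
      using less.prems by (simp add: assoc flip: T_add add_right)
    also have "\<dots> = T (st (x \<cdot> p) \<cdot> (x \<cdot> p)) + T (st (x \<cdot> (c - p)) \<cdot> (x \<cdot> (c - p)))"
      using Tq p hc by simp
    also have "\<dots> \<in> sqs L"
      by (intro euclideanD(2)[OF euclidean] part p hc) (use p in auto)
    finally show ?thesis .
  qed
qed

text \<open>The unit splits into a hyperbolic part \<open>u + st u\<close>, a part on which \<open>-1\<close> is the square of a
  symmetric element \<open>y\<close>, and a part \<open>h\<close> on which the trace form is positive semidefinite.\<close>

theorem real_decomposition:
  obtains u y h where "isoid E u" "symid h" "h \<cdot> u = 0" "h \<cdot> st u = 0" "y \<in> B" "st y = y"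
    "y \<cdot> y = - (E - u - st u - h)" "y \<cdot> u = 0" "y \<cdot> st u = 0" "u \<cdot> y = 0" "st u \<cdot> y = 0" "h \<cdot> y = 0" "y \<cdot> h = 0"
    "\<And>x. x \<in> B \<Longrightarrow> h \<cdot> x = x \<Longrightarrow> x \<cdot> h = x \<Longrightarrow> T (st x \<cdot> x) \<in> sqs L"
proof -
  have sE: "symid E" unfolding symid_def by (simp add: Bs unit_left)
  obtain u where u: "isoid E u" "aniso (E - u - st u)" using witt_decomposition[OF sE] by blast
  define f where "f = E - u - st u"
  note r = symid_rest[OF u(1) sE, folded f_def]
  have fB: "f \<in> B" "st f = f" "f \<cdot> f = f" using r unfolding symid_def by auto
  \<comment> \<open>Orthogonal sums preserve \<open>N\<close>, so for \<open>p\<close> of largest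
    rank no nonzero idempotent of this kind is left below \<open>h = f - p\<close>.\<close>
  define N where "N p \<longleftrightarrow> symid p \<and> f \<cdot> p = p \<and> negsq p" for p
  have "N 0" unfolding N_def negsq_def symid_def by (auto simp: Bs intro!: bexI[of _ 0])
  moreover have "\<forall>p. N p \<longrightarrow> rk (princ p) < Suc (rk B)"
    using rk_mono[OF princ_rideal rideal_B] princ_rideal unfolding rideal_def N_def symid_def
    by (auto simp: less_Suc_eq_le)
  ultimately have "\<exists>p. N p \<and> (\<forall>q. N q \<longrightarrow> rk (princ q) \<le> rk (princ p))" by (rule ex_has_greatest_nat)
  then obtain p where p: "N p" and max: "\<And>q. N q \<Longrightarrow> rk (princ q) \<le> rk (princ p)" by blast
  have pB: "p \<in> B" "st p = p" "p \<cdot> p = p" "f \<cdot> p = p" using p unfolding N_def symid_def by auto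
  have pf: "p \<cdot> f = p" using arg_cong[OF pB(4), of st] pB(1,2) fB by (simp add: st_simps)
  obtain y where y: "y \<in> B" "st y = y" "p \<cdot> y = y" "y \<cdot> p = y" "y \<cdot> y = - p" using p unfolding N_def negsq_def by blast
  define h where "h = f - p"
  have h: "symid h" "f \<cdot> h = h" "h \<cdot> f = h" "h \<cdot> p = 0" "p \<cdot> h = 0"
    unfolding symid_def h_def using fB pB pf by (auto simp: Bs st_simps expand)
  have ha: "aniso h" using aniso_sub[OF u(2)] h unfolding f_def by blast
  have nn: "\<not> negsq c" if c: "symid c" "h \<cdot> c = c" "c \<noteq> 0" for c
  proof
    assume "negsq c"
    then obtain z where z: "z \<in> B" "st z = z" "c \<cdot> z = z" "z \<cdot> c = z" "z \<cdot> z = - c" unfolding negsq_def by blast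
    have cB: "c \<in> B" "st c = c" "c \<cdot> c = c" using c unfolding symid_def by auto
    have ch: "c \<cdot> h = c" using arg_cong[OF c(2), of st] cB h(1) unfolding symid_def by (simp add: st_simps)
    have pc: "p \<cdot> c = 0" "c \<cdot> p = 0" using c(2) ch h by (metis assoc zero_left zero_right)+
    have yz: "p \<cdot> z = 0" "z \<cdot> p = 0" "c \<cdot> y = 0" "y \<cdot> c = 0" using pc y z by (metis assoc zero_left zero_right)+
    have yz2: "y \<cdot> z = 0" "z \<cdot> y = 0" using yz y z by (metis assoc zero_left zero_right)+
    have "negsq (p + c)" unfolding negsq_def
      by (rule bexI[of _ "y + z"]) (use y z yz yz2 in \<open>auto simp: Bs st_simps expand\<close>)
    moreover have fc: "f \<cdot> c = c" using c(2) h by (metis assoc)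
    hence "symid (p + c)" "f \<cdot> (p + c) = p + c" unfolding symid_def using pB cB pc by (auto simp: Bs st_simps expand)
    ultimately have "rk (princ (p + c)) \<le> rk (princ p)" using max unfolding N_def by blast
    moreover have "rk (princ p) < rk (princ (p + c))"
    proof (rule rk_strict)
      show "rideal (princ p)" "rideal (princ (p + c))" using princ_rideal pB cB by (auto simp: Bs)
      have e: "(p + c) \<cdot> p = p" "(p + c) \<cdot> c = c" using pB cB pc by (auto simp: expand)
      have "princ p \<subseteq> princ (p + c)" unfolding princ_def
      proof
        fix w assume "w \<in> (\<cdot>) p ` B"
        then obtain a where "a \<in> B" "w = p \<cdot> a" by auto
        hence "w = (p + c) \<cdot> (p \<cdot> a)" "p \<cdot> a \<in> B" using e pB by (auto simp: prefix Bs)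
        thus "w \<in> (\<cdot>) (p + c) ` B" by blast
      qed
      moreover have "c \<in> princ (p + c)" unfolding princ_def using e(2) cB by (metis imageI)
      moreover have "c \<notin> princ p"
      proof
        assume "c \<in> princ p"
        then obtain a where "c = p \<cdot> a" unfolding princ_def by auto
        hence "p \<cdot> c = c" using pB by (simp add: prefix)
        thus False using pc c by simp
      qed
      ultimately show "princ p \<subset> princ (p + c)" by blast
    qed
    ultimately show False by simp
  qed
  have hB: "h \<in> B" "h \<cdot> h = h" "st h = h" using h unfolding symid_def by auto
  have yf: "f \<cdot> y = y" "y \<cdot> f = y" using y pB pf by (metis assoc)+
  show ?thesis
  proof (rule that[of u h y])
    show "isoid E u" "symid h" "y \<in> B" "st y = y" using u h y by auto
    show "h \<cdot> u = 0" "h \<cdot> st u = 0" using r h(3) by (metis assoc zero_right)+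
    show "y \<cdot> y = - (E - u - st u - h)" unfolding y(5) h_def f_def by simp
    show "y \<cdot> u = 0" "y \<cdot> st u = 0" "u \<cdot> y = 0" "st u \<cdot> y = 0" using r yf by (metis assoc zero_right zero_left)+
    show "h \<cdot> y = 0" "y \<cdot> h = 0" using h y by (metis assoc zero_right zero_left)+
    fix x assume "x \<in> B" "h \<cdot> x = x" "x \<cdot> h = x"
    thus "T (st x \<cdot> x) \<in> sqs L" using psd_anisotropic[OF ha nn h(1) hB(2)] by blast
  qed
qed

end

text \<open>Gaussian elimination, carried out inside the subfield so that the solution has its
  coefficients in \<open>L\<close>.\<close>

lemma linear_system:
  fixes a :: "'x \<Rightarrow> 'y \<Rightarrow> 'c::field"
  assumes L: "subfld L" and Xa: "finite Xa"
  shows "finite Y \<Longrightarrow> card Xa < card Y \<Longrightarrow> (\<And>x y. x \<in> Xa \<Longrightarrow> y \<in> Y \<Longrightarrow> a x y \<in> L) \<Longrightarrow>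
    \<exists>c. (\<forall>y\<in>Y. c y \<in> L) \<and> (\<exists>y\<in>Y. c y \<noteq> 0) \<and> (\<forall>x\<in>Xa. (\<Sum>y\<in>Y. a x y * c y) = 0)"
  using Xa
proof (induction Xa arbitrary: Y a rule: finite_induct)
  case empty
  hence "\<exists>y. y \<in> Y" by (metis card_gt_0_iff all_not_in_conv card.empty)
  thus ?case using subfldD(2)[OF L] by (intro exI[of _ "\<lambda>_. 1"]) auto
next
  case (insert x Xa)
  show ?case
  proof (cases "\<forall>y\<in>Y. a x y = 0")
    case True
    have "\<exists>c. (\<forall>y\<in>Y. c y \<in> L) \<and> (\<exists>y\<in>Y. c y \<noteq> 0) \<and> (\<forall>x\<in>Xa. (\<Sum>y\<in>Y. a x y * c y) = 0)"
      using insert by (intro insert.IH) auto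
    thus ?thesis using True by auto
  next
    case False
    then obtain y0 where y0: "y0 \<in> Y" "a x y0 \<noteq> 0" by blast
    define a' where "a' x' y = a x' y - a x' y0 * a x y / a x y0" for x' y
    have "\<exists>c. (\<forall>y\<in>Y - {y0}. c y \<in> L) \<and> (\<exists>y\<in>Y - {y0}. c y \<noteq> 0) \<and>
        (\<forall>x\<in>Xa. (\<Sum>y\<in>Y - {y0}. a' x y * c y) = 0)"
      using insert y0 by (intro insert.IH) (auto simp: a'_def subfldD[OF L])
    then obtain c where c: "\<forall>y\<in>Y - {y0}. c y \<in> L" "\<exists>y\<in>Y - {y0}. c y \<noteq> 0"
      "\<And>x. x \<in> Xa \<Longrightarrow> (\<Sum>y\<in>Y - {y0}. a' x y * c y) = 0" by blast
    define s where "s = (\<Sum>y\<in>Y - {y0}. a x y * c y)"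
    define c' where "c' = c(y0 := - s / a x y0)"
    have split: "(\<Sum>y\<in>Y. a z y * c' y) = a z y0 * c' y0 + (\<Sum>y\<in>Y - {y0}. a z y * c y)" for z
      using y0(1) insert.prems(1) by (subst sum.remove[of _ y0]) (auto simp: c'_def intro!: sum.cong)
    have "(\<Sum>y\<in>Y. a z y * c' y) = 0" if "z \<in> insert x Xa" for z
    proof (cases "z = x")
      case True
      thus ?thesis unfolding split using y0(2) by (simp add: c'_def s_def)
    next
      case False
      hence "0 = (\<Sum>y\<in>Y - {y0}. a' z y * c y)" using c(3) that by simp
      also have "\<dots> = (\<Sum>y\<in>Y - {y0}. a z y * c y) - a z y0 / a x y0 * s"
        unfolding a'_def s_def sum_distrib_left sum_subtractf[symmetric] by (intro sum.cong) (auto simp: field_simps)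
      finally show ?thesis unfolding split by (simp add: c'_def)
    qed
    moreover have "s \<in> L" unfolding s_def using c insert.prems by (intro subfld_sum[OF L]) (auto simp: subfldD[OF L])
    hence "\<forall>y\<in>Y. c' y \<in> L" using c insert.prems y0 unfolding c'_def by (auto simp: subfldD[OF L])
    moreover have "\<exists>y\<in>Y. c' y \<noteq> 0" using c(2) unfolding c'_def by auto
    ultimately show ?thesis by blast
  qed
qed

context real_star_ring
begin

lemma B_sum: "(\<And>y. y \<in> Y \<Longrightarrow> f y \<in> B) \<Longrightarrow> sum f Y \<in> B"
  by (induction Y rule: infinite_finite_induct) (auto simp: Bs)

abbreviation "q x \<equiv> T (st x \<cdot> x)"

text \<open>Such \<open>a\<close> and \<open>b\<close> make two copies of the ring hyperbolic: the matrix with rows \<open>(a, b)\<close> and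
  \<open>(- b, a)\<close> is skew and has square \<open>1\<close>.\<close>

theorem signature_positive:
  assumes Y: "finite Y" "\<And>y. y \<in> Y \<Longrightarrow> v y \<in> B"
    and neg: "\<And>c. (\<forall>y\<in>Y. c y \<in> L) \<Longrightarrow> q (\<Sum>y\<in>Y. sc (c y) (v y)) \<in> sqs L \<Longrightarrow> \<forall>y\<in>Y. c y = 0"
    and Xa: "finite Xa" "\<And>i x. i \<in> Xa \<Longrightarrow> x \<in> B \<Longrightarrow> \<phi> i x \<in> L"
      "\<And>i x y. \<phi> i (x + y) = \<phi> i x + \<phi> i y" "\<And>i c x. \<phi> i (sc c x) = c * \<phi> i x"
    and npos: "\<And>x. x \<in> B \<Longrightarrow> (\<forall>i\<in>Xa. \<phi> i x = 0) \<Longrightarrow> - q x \<in> sqs L"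
    and card: "card Xa \<le> card Y"
  obtains a b where "a \<in> B" "b \<in> B" "st a = - a" "st b = b" "a \<cdot> b = 0" "b \<cdot> a = 0" "a \<cdot> a - b \<cdot> b = E"
proof (rule ccontr)
  assume nt: "\<not> thesis"
  obtain u y h where d: "isoid E u" "symid h" "h \<cdot> u = 0" "h \<cdot> st u = 0" "y \<in> B" "st y = y"
    "y \<cdot> y = - (E - u - st u - h)" "y \<cdot> u = 0" "y \<cdot> st u = 0" "u \<cdot> y = 0" "st u \<cdot> y = 0" "h \<cdot> y = 0" "y \<cdot> h = 0"
    "\<And>x. x \<in> B \<Longrightarrow> h \<cdot> x = x \<Longrightarrow> x \<cdot> h = x \<Longrightarrow> T (st x \<cdot> x) \<in> sqs L"
    using real_decomposition by metis
  have sE: "symid E" unfolding symid_def by (simp add: Bs unit_left)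
  have uB: "u \<in> B" "u \<cdot> u = u" "st u \<cdot> u = 0" "u \<cdot> st u = 0" using d(1) unfolding isoid_def by auto
  have su: "st u \<cdot> st u = st u" "st u \<in> B" using isoid_st[OF d(1) sE] by auto
  have hB: "h \<in> B" "h \<cdot> h = h" "st h = h" using d(2) unfolding symid_def by auto
  have uh: "u \<cdot> h = 0" "st u \<cdot> h = 0"
    using arg_cong[OF d(4), of st] arg_cong[OF d(3), of st] uB hB su(2) by (simp_all add: st_simps)
  \<comment> \<open>Without a positive part the whole unit splits: the square of
    \<open>u - st u\<close> is \<open>u + st u\<close>, and \<open>- (y \<cdot> y)\<close> is the
    rest.\<close>
  have h0: "h \<noteq> 0"
  proof
    assume h0: "h = 0"
    have thesis
      by (rule that[of "u - st u" y]) (use h0 uB su d(5-13) in \<open>auto simp: Bs st_simps expand\<close>)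
    with nt show False ..
  qed
  define k where "k = E - h"
  define t where "t = u - st u + y"
  have tB: "t \<in> B" unfolding t_def using uB su d by (simp add: Bs)
  have stt: "st t = st u - u + y" unfolding t_def using uB su d(5,6) by (simp add: Bs st_simps)
  have tt: "st t \<cdot> t = - k" "t \<cdot> st t = - k" unfolding stt k_def
    using uB su d(7-11) by (simp_all add: t_def expand)
  have ht: "h \<cdot> t = 0" "t \<cdot> h = 0" "st t \<cdot> h = 0" "h \<cdot> st t = 0" unfolding stt unfolding t_def
    using d(3,4,12,13) uh by (simp_all add: expand)
  \<comment> \<open>Multiplication by \<open>t\<close> reverses the sign of the norm on the
    complement \<open>k\<close> of \<open>h\<close>. Thus \<open>P\<close> keeps the block
    \<open>h \<cdot> x \<cdot> h\<close> and reverses the form on the other blocks, which is the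
    content of \<open>qP\<close>.\<close>
  define P where "P x = h \<cdot> x \<cdot> h + t \<cdot> x + h \<cdot> x \<cdot> t" for x
  have P_B: "x \<in> B \<Longrightarrow> P x \<in> B" for x unfolding P_def using hB tB by (simp add: Bs)
  have P_lin: "P (x + z) = P x + P z" "P (sc c x) = sc c (P x)" for x z c
    unfolding P_def by (simp_all add: expand scs)
  have cyc: "T (x \<cdot> z) = T (z \<cdot> x)" if "x \<in> B" "z \<in> B" for x z using T_comm that .
  have qP: "q x + q (P x) = 2 * q (h \<cdot> x \<cdot> h)" if x: "x \<in> B" for x
  proof -
    have sx: "st x \<in> B" "st t \<in> B" "k \<in> B" using x tB hB unfolding k_def by (simp_all add: Bs)
    have e: "st (P x) \<cdot> P x = h \<cdot> st x \<cdot> h \<cdot> x \<cdot> h + h \<cdot> st x \<cdot> h \<cdot> x \<cdot> t - st x \<cdot> (k \<cdot> x) +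
       st t \<cdot> st x \<cdot> h \<cdot> x \<cdot> h + st t \<cdot> (st x \<cdot> h \<cdot> x \<cdot> t)"
      unfolding P_def using x hB sx tB
      by (simp add: st_simps Bs) (simp add: expand ht prefix[OF ht(1)] prefix[OF ht(2)] prefix[OF ht(3)]
          prefix[OF ht(4)] prefix[OF hB(2)] tt(1) prefix[OF tt(1)])
    have 1: "T (h \<cdot> st x \<cdot> h \<cdot> x \<cdot> t) = 0"
      by (subst cyc) (use x hB sx tB in \<open>auto simp: Bs prefix[OF ht(2)] assoc\<close>)
    have 2: "T (st t \<cdot> st x \<cdot> h \<cdot> x \<cdot> h) = 0"
      by (subst cyc) (use x hB sx tB in \<open>auto simp: Bs prefix[OF ht(4)] assoc\<close>)
    have 3: "T (st t \<cdot> (st x \<cdot> h \<cdot> x \<cdot> t)) = - T (st x \<cdot> h \<cdot> x \<cdot> k)"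
      by (subst cyc) (use x hB sx tB in \<open>auto simp: Bs tt(2) assoc T_minus minus_right\<close>)
    have 4: "q (h \<cdot> x \<cdot> h) = T (h \<cdot> st x \<cdot> h \<cdot> x \<cdot> h)"
      using x hB by (simp add: st_simps Bs assoc prefix[OF hB(2)])
    have 5: "T (h \<cdot> st x \<cdot> h \<cdot> x \<cdot> h) = T (st x \<cdot> h \<cdot> x \<cdot> h)"
      using cyc[of h "st x \<cdot> h \<cdot> x \<cdot> h"] x hB sx by (simp add: Bs assoc)
    have "st x \<cdot> x = st x \<cdot> (k \<cdot> x) + (st x \<cdot> h \<cdot> x \<cdot> h + st x \<cdot> h \<cdot> x \<cdot> k)"
      unfolding k_def using x hB sx by (simp add: expand unit_left unit_right Bs)
    hence "q x = T (st x \<cdot> (k \<cdot> x)) + (T (st x \<cdot> h \<cdot> x \<cdot> h) + T (st x \<cdot> h \<cdot> x \<cdot> k))" by (simp add: T_add)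
    moreover have "q (P x) = T (h \<cdot> st x \<cdot> h \<cdot> x \<cdot> h) - T (st x \<cdot> (k \<cdot> x)) - T (st x \<cdot> h \<cdot> x \<cdot> k)"
      unfolding e using 1 2 3 by (simp add: T_add T_diff)
    ultimately show ?thesis unfolding 4 5 by simp
  qed
  \<comment> \<open>\<open>b\<close> is the polar form of \<open>q\<close> against \<open>h\<close>,
    see \<open>qh\<close>. It has two separate terms because \<open>T\<close> need not be invariant
    under \<open>st\<close>.\<close>
  define b where "b x = T (h \<cdot> x) + T (st x \<cdot> h)" for x
  have b_lin: "b (x + z) = b x + b z" if "x \<in> B" "z \<in> B" for x z
    unfolding b_def using that by (simp add: st_add expand T_add)
  have b_sc: "b (sc c x) = c * b x" for x c unfolding b_def by (simp add: sc_st scs T_sc distrib_left)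
  have bP: "b (P x) = b x" if x: "x \<in> B" for x
  proof -
    have sx: "st x \<in> B" "st t \<in> B" using x tB by (simp_all add: Bs)
    have "h \<cdot> P x = h \<cdot> x \<cdot> h + h \<cdot> x \<cdot> t" unfolding P_def
      by (simp add: expand prefix[OF hB(2)] prefix[OF ht(1)])
    moreover have "T (h \<cdot> x \<cdot> t) = 0" by (subst cyc) (use x hB tB in \<open>auto simp: Bs prefix[OF ht(2)]\<close>)
    moreover have "T (h \<cdot> x \<cdot> h) = T (h \<cdot> x)"
      using cyc[of "h \<cdot> x" h] x hB by (simp add: Bs prefix)
    ultimately have 1: "T (h \<cdot> P x) = T (h \<cdot> x)" by (simp add: T_add)
    have "st (P x) \<cdot> h = h \<cdot> st x \<cdot> h + st t \<cdot> st x \<cdot> h" unfolding P_def using x hB tB sx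
      by (simp add: st_simps Bs expand ht hB)
    moreover have "T (st t \<cdot> st x \<cdot> h) = 0" by (subst cyc) (use sx hB in \<open>auto simp: Bs assoc prefix[OF ht(4)]\<close>)
    moreover have "T (h \<cdot> st x \<cdot> h) = T (st x \<cdot> h)"
      using cyc[of h "st x \<cdot> h"] sx hB by (simp add: Bs assoc)
    ultimately have 2: "T (st (P x) \<cdot> h) = T (st x \<cdot> h)" by (simp add: T_add)
    show ?thesis unfolding b_def 1 2 ..
  qed
  have qh: "q (x + sc c h) = q x + c * b x + c * c * T h" if "x \<in> B" "c \<in> L" for x c
    unfolding b_def using that hB by (simp add: st_simps sc_in sc_st expand scs T_add T_sc distrib_left)
  have Th: "T h \<in> sqs L" "T h \<noteq> 0" using T_idem hB h0 by auto
  have bh: "b h = 2 * T h" unfolding b_def using hB by simp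
  \<comment> \<open>\<open>r\<close> projects onto the orthogonal complement of \<open>h\<close>, in
    view of \<open>b h = 2 * T h\<close>; by \<open>bP\<close> the map \<open>P\<close> respects
    this complement.\<close>
  define r where "r x = x - sc (b x / (2 * T h)) h" for x
  have two_L: "(2::'c) \<in> L" using Ls(3)[OF Ls(2,2)] by simp
  have b_L: "x \<in> B \<Longrightarrow> b x \<in> L" for x unfolding b_def using hB by (auto simp: Ls T_in Bs)
  have c_L: "x \<in> B \<Longrightarrow> b x / (2 * T h) \<in> L" for x using b_L sqs_sub[OF L] Th two_L by (auto simp: Ls)
  have rB: "x \<in> B \<Longrightarrow> r x \<in> B" for x unfolding r_def using c_L hB by (auto simp: Bs sc_in)
  have br: "b (r x) = 0" if "x \<in> B" for x
  proof -
    have "b (r x) = b x + b (sc (- (b x / (2 * T h))) h)"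
      unfolding r_def using b_lin[of x "sc (- (b x / (2 * T h))) h"] that c_L hB by (simp add: sc_minus2 Bs sc_in)
    thus ?thesis unfolding b_sc bh using Th two by simp
  qed
  have r_lin: "r (x + z) = r x + r z" if "x \<in> B" "z \<in> B" for x z
    unfolding r_def using that by (simp add: b_lin add_divide_distrib sc_add2)
  have r_sc: "r (sc c x) = sc c (r x)" for x c unfolding r_def by (simp add: b_sc sc_diff sc_sc)
  have r0: "r 0 = 0" using r_sc[of 0 0] by simp
  have P0: "P 0 = 0" unfolding P_def by simp
  \<comment> \<open>The vectors \<open>P (r (v y))\<close> together with \<open>h\<close>, which has
    the index \<open>None\<close>, outnumber the functionals, so a nontrivial combination
    \<open>w\<close> is killed by all of them.\<close>
  define W where "W = insert None (Some ` Y)"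
  have cW: "card W = Suc (card Y)" "finite W" unfolding W_def using Y by (auto simp: card_image)
  define co where "co i w = (case w of None \<Rightarrow> \<phi> i h | Some y \<Rightarrow> \<phi> i (P (r (v y))))" for i w
  have "\<exists>c. (\<forall>w\<in>W. c w \<in> L) \<and> (\<exists>w\<in>W. c w \<noteq> 0) \<and> (\<forall>i\<in>Xa. (\<Sum>w\<in>W. co i w * c w) = 0)"
    by (rule linear_system[OF L Xa(1)]) (use cW card Xa Y hB P_B rB in \<open>auto simp: W_def co_def\<close>)
  then obtain c where c: "\<And>w. w \<in> W \<Longrightarrow> c w \<in> L" "\<exists>w\<in>W. c w \<noteq> 0"
    "\<And>i. i \<in> Xa \<Longrightarrow> (\<Sum>w\<in>W. co i w * c w) = 0" by blast
  have cL: "c None \<in> L" "y \<in> Y \<Longrightarrow> c (Some y) \<in> L" for y using c(1) unfolding W_def by auto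
  define x where "x = (\<Sum>y\<in>Y. sc (c (Some y)) (v y))"
  have xB: "x \<in> B" unfolding x_def using cL Y by (intro B_sum) (auto simp: sc_in)
  define w where "w = P (r x) + sc (c None) h"
  have wB: "w \<in> B" unfolding w_def using xB rB P_B cL hB by (auto simp: Bs sc_in)
  have w0: "\<phi> i w = 0" if i: "i \<in> Xa" for i
  proof -
    have "\<phi> i 0 = 0" using Xa(4)[of i 0 0] by simp
    have "\<phi> i (P (r (\<Sum>y\<in>Y'. sc (c (Some y)) (v y)))) = (\<Sum>y\<in>Y'. c (Some y) * \<phi> i (P (r (v y))))" if "Y' \<subseteq> Y" for Y'
      using finite_subset[OF that Y(1)] that
    proof (induction Y' rule: finite_induct)
      case (insert y Y')
      have "(\<Sum>y\<in>Y'. sc (c (Some y)) (v y)) \<in> B" using insert cL Y by (intro B_sum) (auto simp: sc_in)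
      thus ?case using insert Y cL by (simp add: r_lin r_sc P_lin Xa sc_in)
    qed (simp add: r0 P0 \<open>\<phi> i 0 = 0\<close>)
    from this[of Y] have "\<phi> i w = (\<Sum>y\<in>Y. c (Some y) * \<phi> i (P (r (v y)))) + c None * \<phi> i h"
      unfolding w_def x_def by (simp add: Xa)
    also have "\<dots> = (\<Sum>w\<in>W. co i w * c w)" unfolding W_def using Y(1)
      by (subst sum.insert) (auto simp: sum.reindex co_def mult.commute intro!: sum.cong)
    finally show ?thesis using c(3)[OF i] by simp
  qed
  have nq: "- q w \<in> sqs L" using npos[OF wB] w0 by blast
  define a where "a = b x / (2 * T h)"
  have aL: "a \<in> L" unfolding a_def using c_L[OF xB] .
  have xr: "x = r x + sc a h" unfolding r_def a_def by simp
  have qx: "q x = q (r x) + a * a * T h"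
    using qh[OF rB[OF xB] aL] xr br[OF xB] by simp
  have qw: "q w = q (P (r x)) + c None * c None * T h"
    unfolding w_def using qh[OF P_B[OF rB[OF xB]] cL(1)] bP[OF rB[OF xB]] br[OF xB] by simp
  have sq2: "z * z \<in> sqs L" if "z \<in> L" for z using that unfolding sqs_def by blast
  have q1: "q (h \<cdot> r x \<cdot> h) \<in> sqs L"
    by (rule d(14)) (use rB[OF xB] hB in \<open>auto simp: Bs assoc prefix[OF hB(2)]\<close>)
  \<comment> \<open>As \<open>q w\<close> is not positive, every summand on the right is a square.
    So \<open>q x\<close> is a square, and \<open>neg\<close> makes the coefficients of
    \<open>x\<close> vanish.\<close>
  have "q x = q (h \<cdot> r x \<cdot> h) + q (h \<cdot> r x \<cdot> h) + a * a * T h + c None * c None * T h + (- q w)"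
    using qP[OF rB[OF xB]] qx qw by (simp add: algebra_simps)
  also have "\<dots> \<in> sqs L" by (intro euclideanD(2)[OF euclidean] sqs_mult[OF L] q1 nq sq2 Th aL cL)
  finally have cz: "\<forall>y\<in>Y. c (Some y) = 0" using neg[of "\<lambda>y. c (Some y)"] cL unfolding x_def by blast
  hence "x = 0" unfolding x_def by simp
  hence "q w = c None * c None * T h" using qw r0 P0 by simp
  hence "c None * c None * T h = 0"
    using nq euclideanD(4)[OF euclidean] sqs_mult[OF L sq2[OF cL(1)] Th(1)] by metis
  hence "c None = 0" using Th by simp
  with cz c(2) show False unfolding W_def by auto
qed

end

section \<open>Extension of scalars by structure constants\<close>

text \<open>The number of pivots, the positions of first nonzero coordinates, is the dimension over
  \<open>L\<close>; it will serve as \<open>rk\<close>. If \<open>I\<close> had as many pivots as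
  \<open>I'\<close>, multiples of elements of \<open>I\<close> could clear the coordinates of an
  element of \<open>I' - I\<close> one after another until it became zero.\<close>

lemma pivot_less:
  fixes co :: "nat \<Rightarrow> 'v::ab_group_add \<Rightarrow> 'c::field"
  assumes L: "subfld L" and sub: "I \<subset> I'" and zero: "0 \<in> I"
    and I: "\<And>x y. x \<in> I \<Longrightarrow> y \<in> I \<Longrightarrow> x + y \<in> I" "\<And>c x. c \<in> L \<Longrightarrow> x \<in> I \<Longrightarrow> sc c x \<in> I"
    and I': "\<And>x y. x \<in> I' \<Longrightarrow> y \<in> I' \<Longrightarrow> x + y \<in> I'" "\<And>c x. c \<in> L \<Longrightarrow> x \<in> I' \<Longrightarrow> sc c x \<in> I'"
    and co: "\<And>k x y. co k (x + y) = co k x + co k y" "\<And>k c x. co k (sc c x) = c * co k x"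
      "\<And>k x. x \<in> I' \<Longrightarrow> co k x \<in> L" "\<And>x. x \<in> I' \<Longrightarrow> (\<forall>k<n. co k x = 0) \<Longrightarrow> x = 0"
    and sc: "\<And>c x. sc (- c) x + sc c x = 0"
  shows "card {k. k < n \<and> (\<exists>x\<in>I. co k x \<noteq> 0 \<and> (\<forall>i<k. co i x = 0))}
       < card {k. k < n \<and> (\<exists>x\<in>I'. co k x \<noteq> 0 \<and> (\<forall>i<k. co i x = 0))}" (is "card ?A < card ?B")
proof (rule ccontr)
  assume "\<not> card ?A < card ?B"
  moreover have "?A \<subseteq> ?B" using sub by blast
  ultimately have eq: "?A = ?B" by (intro card_subset_eq) (auto simp: card_mono not_less intro: le_antisym)
  obtain x0 where x0: "x0 \<in> I'" "x0 \<notin> I" using sub by blast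
  have "\<exists>x\<in>I'. x \<notin> I \<and> (\<forall>i<k. co i x = 0)" if "k \<le> n" for k
    using that
  proof (induction k)
    case 0
    show ?case using x0 by auto
  next
    case (Suc k)
    then obtain x where x: "x \<in> I'" "x \<notin> I" "\<forall>i<k. co i x = 0" by auto
    show ?case
    proof (cases "co k x = 0")
      case True
      thus ?thesis using x by (auto simp: less_Suc_eq intro!: bexI[of _ x])
    next
      case False
      hence "k \<in> ?B" using x Suc.prems by auto
      hence "k \<in> ?A" using eq by simp
      then obtain y where y: "y \<in> I" "co k y \<noteq> 0" "\<forall>i<k. co i y = 0" by auto
      have yI': "y \<in> I'" using y sub by auto
      define c where "c = co k x / co k y"
      have cL: "c \<in> L" unfolding c_def using co(3) x yI' by (auto simp: subfldD[OF L])
      define z where "z = x + sc (- c) y"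
      have "z \<in> I'" unfolding z_def by (intro I' x yI' subfldD(4)[OF L] cL)
      moreover have "z \<notin> I"
      proof
        assume "z \<in> I"
        hence "z + sc c y \<in> I" using I y cL by blast
        thus False using x sc[of c y] unfolding z_def by (simp add: add.assoc)
      qed
      moreover have "\<forall>i<Suc k. co i z = 0" unfolding z_def
        using x y by (auto simp: co less_Suc_eq c_def)
      ultimately show ?thesis by blast
    qed
  qed
  from this[of n] obtain x where "x \<in> I'" "x \<notin> I" "\<forall>i<n. co i x = 0" by auto
  thus False using co(4) zero by metis
qed

text \<open>Vectors are functions on all of \<open>nat\<close>; cutting off at \<open>d\<close>
  keeps the coordinates beyond \<open>d\<close> zero, so that equality of vectors is equality of
  functions.\<close>

definition ma :: "nat \<Rightarrow> (nat \<Rightarrow> nat \<Rightarrow> nat \<Rightarrow> 'c::field) \<Rightarrow> (nat \<Rightarrow> 'c) \<Rightarrow> (nat \<Rightarrow> 'c) \<Rightarrow> nat \<Rightarrow> 'c" where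
  "ma d g x y = (\<lambda>k. if k < d then \<Sum>i<d. \<Sum>j<d. x i * y j * g i j k else 0)"

definition sa :: "nat \<Rightarrow> (nat \<Rightarrow> nat \<Rightarrow> 'c::field) \<Rightarrow> (nat \<Rightarrow> 'c) \<Rightarrow> nat \<Rightarrow> 'c" where
  "sa d s x = (\<lambda>k. if k < d then \<Sum>i<d. x i * s i k else 0)"

text \<open>\<open>ma\<close> and \<open>sa\<close> describe an algebra with involution over \<open>K0\<close> by its structure constants; extension of
  scalars to a subfield \<open>L\<close> means taking coordinates in \<open>L\<close>.\<close>

locale coalg =
  fixes d :: nat and g :: "nat \<Rightarrow> nat \<Rightarrow> nat \<Rightarrow> 'c::field" and s :: "nat \<Rightarrow> nat \<Rightarrow> 'c"
    and e :: "nat \<Rightarrow> 'c" and K0 :: "'c set"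
  assumes two: "(2::'c) \<noteq> 0" and K0: "subfld K0"
    and g_K0: "g i j k \<in> K0" and s_K0: "s i k \<in> K0" and e_K0: "e k \<in> K0"
    and e_supp: "k \<ge> d \<Longrightarrow> e k = 0"
    and ma_assoc: "ma d g (ma d g x y) z = ma d g x (ma d g y z)"
    and ma_unit: "(\<forall>k\<ge>d. x k = 0) \<Longrightarrow> ma d g e x = x" "(\<forall>k\<ge>d. x k = 0) \<Longrightarrow> ma d g x e = x"
    and sa_ma: "sa d s (ma d g x y) = ma d g (sa d s y) (sa d s x)"
    and sa_sa: "(\<forall>k\<ge>d. x k = 0) \<Longrightarrow> sa d s (sa d s x) = x"
begin

abbreviation "mA \<equiv> ma d g"
abbreviation "sA \<equiv> sa d s"

lemma mA_add: "mA (\<lambda>k. x k + x' k) y k = mA x y k + mA x' y k" "mA x (\<lambda>k. y k + y' k) k = mA x y k + mA x y' k"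
  unfolding ma_def by (simp_all add: sum.distrib[symmetric] algebra_simps)

lemma mA_scale: "mA (\<lambda>k. c * x k) y k = c * mA x y k" "mA x (\<lambda>k. c * y k) k = c * mA x y k"
  unfolding ma_def by (simp_all add: sum_distrib_left algebra_simps)

lemma mA_zero: "mA (\<lambda>k. 0) y k = 0" "mA x (\<lambda>k. 0) k = 0" unfolding ma_def by simp_all

lemma mA_sum: "mA (\<lambda>k. \<Sum>p\<in>P. f p k) y k = (\<Sum>p\<in>P. mA (f p) y k)"
    "mA x (\<lambda>k. \<Sum>p\<in>P. f p k) k = (\<Sum>p\<in>P. mA x (f p) k)"
  by (induction P rule: infinite_finite_induct) (simp_all add: mA_add mA_zero)

lemma sA_add: "sA (\<lambda>k. x k + x' k) k = sA x k + sA x' k"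
  unfolding sa_def by (simp add: sum.distrib[symmetric] algebra_simps)

lemma sA_scale: "sA (\<lambda>k. c * x k) k = c * sA x k"
  unfolding sa_def by (simp add: sum_distrib_left algebra_simps)

lemma sA_zero: "sA (\<lambda>k. 0) k = 0" unfolding sa_def by simp

lemma sA_sum: "sA (\<lambda>k. \<Sum>p\<in>P. f p k) k = (\<Sum>p\<in>P. sA (f p) k)"
  by (induction P rule: infinite_finite_induct) (simp_all add: sA_add sA_zero)

lemma sA_unit: "sA e = e"
proof -
  have *: "\<forall>k\<ge>d. sA e k = 0" "\<forall>k\<ge>d. e k = 0" by (simp_all add: sa_def e_supp)
  have "sA e = mA e (sA e)" using ma_unit(1)[OF *(1)] by simp
  also have "\<dots> = mA (sA (sA e)) (sA e)" using sa_sa[OF *(2)] by simp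
  also have "\<dots> = sA (mA e (sA e))" by (simp add: sa_ma)
  also have "\<dots> = sA (sA e)" using ma_unit(1)[OF *(1)] by simp
  finally show ?thesis using sa_sa[OF *(2)] by simp
qed

definition mm :: "'i set \<Rightarrow> ('i \<Rightarrow> 'i \<Rightarrow> nat \<Rightarrow> 'c) \<Rightarrow> ('i \<Rightarrow> 'i \<Rightarrow> nat \<Rightarrow> 'c) \<Rightarrow> 'i \<Rightarrow> 'i \<Rightarrow> nat \<Rightarrow> 'c" where
  "mm I Xa Y = (\<lambda>i j k. \<Sum>l\<in>I. mA (Xa i l) (Y l j) k)"

text \<open>Entries outside \<open>I\<close> and coordinates beyond \<open>d\<close> vanish, so
  matrices for a smaller field or index set are literally matrices for a larger one.\<close>

definition Bm :: "'c set \<Rightarrow> 'i set \<Rightarrow> ('i \<Rightarrow> 'i \<Rightarrow> nat \<Rightarrow> 'c) set" where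
  "Bm L I = {Xa. (\<forall>i j k. Xa i j k \<in> L) \<and> (\<forall>i j k. i \<notin> I \<or> j \<notin> I \<or> k \<ge> d \<longrightarrow> Xa i j k = 0)}"

definition smat :: "'i set \<Rightarrow> ('i \<Rightarrow> 'i \<Rightarrow> 'c) \<Rightarrow> 'i \<Rightarrow> 'i \<Rightarrow> nat \<Rightarrow> 'c" where
  "smat I h = (\<lambda>i j k. if i \<in> I \<and> j \<in> I then h i j * e k else 0)"

definition Em :: "'i set \<Rightarrow> 'i \<Rightarrow> 'i \<Rightarrow> nat \<Rightarrow> 'c" where
  "Em I = (\<lambda>i j k. if i = j \<and> i \<in> I then e k else 0)"

definition sm :: "('i \<Rightarrow> 'i \<Rightarrow> nat \<Rightarrow> 'c) \<Rightarrow> 'i \<Rightarrow> 'i \<Rightarrow> nat \<Rightarrow> 'c" where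
  "sm Xa = (\<lambda>i j. sA (Xa j i))"

definition hm :: "('i \<Rightarrow> 'i \<Rightarrow> nat \<Rightarrow> 'c) \<Rightarrow> 'i \<Rightarrow> 'i \<Rightarrow> nat \<Rightarrow> 'c" where
  "hm Xa = (\<lambda>i j k. Xa i j k / 2)"

definition scm :: "'c \<Rightarrow> ('i \<Rightarrow> 'i \<Rightarrow> nat \<Rightarrow> 'c) \<Rightarrow> 'i \<Rightarrow> 'i \<Rightarrow> nat \<Rightarrow> 'c" where
  "scm c Xa = (\<lambda>i j k. c * Xa i j k)"

definition hyp :: "'c set \<Rightarrow> 'i set \<Rightarrow> bool" where
  "hyp L I \<longleftrightarrow> (\<exists>v\<in>Bm L I. mm I v v = v \<and> v + sm v = Em I)"

lemma mm_nassoc: "nassoc (mm I)"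
proof
  fix Xa Y Z :: "'a \<Rightarrow> 'a \<Rightarrow> nat \<Rightarrow> 'c"
  show "mm I (mm I Xa Y) Z = mm I Xa (mm I Y Z)"
  proof (intro ext)
    fix i j k
    have "mm I (mm I Xa Y) Z i j k = (\<Sum>l\<in>I. \<Sum>p\<in>I. mA (mA (Xa i p) (Y p l)) (Z l j) k)"
      unfolding mm_def by (simp add: mA_sum)
    also have "\<dots> = (\<Sum>p\<in>I. \<Sum>l\<in>I. mA (Xa i p) (mA (Y p l) (Z l j)) k)"
      by (subst sum.swap) (simp add: ma_assoc)
    also have "\<dots> = mm I Xa (mm I Y Z) i j k" unfolding mm_def by (simp add: mA_sum)
    finally show "mm I (mm I Xa Y) Z i j k = mm I Xa (mm I Y Z) i j k" .
  qed
  have pf: "(f + h :: nat \<Rightarrow> 'c) = (\<lambda>k. f k + h k)" for f h by auto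
  show "mm I (Xa + Y) Z = mm I Xa Z + mm I Y Z" "mm I Xa (Y + Z) = mm I Xa Y + mm I Xa Z"
    unfolding mm_def by (auto simp: fun_eq_iff pf mA_add sum.distrib)
qed

lemma mm_supp: "Xa \<in> Bm L J \<Longrightarrow> J \<subseteq> I \<Longrightarrow> finite I \<Longrightarrow> mm I Xa Y = mm J Xa Y"
  unfolding mm_def Bm_def
  by (intro ext sum.mono_neutral_right) (auto simp: ma_def)

lemma mA_in: "subfld L \<Longrightarrow> K0 \<subseteq> L \<Longrightarrow> (\<And>k. x k \<in> L) \<Longrightarrow> (\<And>k. y k \<in> L) \<Longrightarrow> mA x y k \<in> L"
  unfolding ma_def using g_K0 by (auto simp: subfldD subset_iff intro!: subfld_sum)

lemma sA_in: "subfld L \<Longrightarrow> K0 \<subseteq> L \<Longrightarrow> (\<And>k. x k \<in> L) \<Longrightarrow> sA x k \<in> L"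
  unfolding sa_def using s_K0 by (auto simp: subfldD subset_iff intro!: subfld_sum)

lemma Em_mult:
  assumes "Xa \<in> Bm L I" "finite I"
  shows "mm I (Em I) Xa = Xa" "mm I Xa (Em I) = Xa"
proof -
  have Xa: "\<forall>k\<ge>d. Xa i j k = 0" for i j using assms unfolding Bm_def by auto
  have e0: "Em I i l = (if l = i \<and> i \<in> I then e else (\<lambda>_. 0))" for i l unfolding Em_def by auto
  have 1: "mA (Em I i l) (Xa l j) k = (if l = i then if i \<in> I then Xa i j k else 0 else 0)" for i l j k
    unfolding e0 by (auto simp: ma_unit(1)[OF Xa] mA_zero)
  have 2: "mA (Xa i l) (Em I l j) k = (if l = j then if j \<in> I then Xa i j k else 0 else 0)" for i l j k
    unfolding e0 by (auto simp: ma_unit(2)[OF Xa] mA_zero)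
  have 3: "i \<notin> I \<or> j \<notin> I \<Longrightarrow> Xa i j k = 0" for i j k using assms unfolding Bm_def by auto
  show "mm I (Em I) Xa = Xa" "mm I Xa (Em I) = Xa"
    unfolding mm_def 1 2 using assms(2) 3 by (auto simp: fun_eq_iff)
qed

lemma smat_in: "subfld L \<Longrightarrow> K0 \<subseteq> L \<Longrightarrow> (\<And>i j. i \<in> I \<Longrightarrow> j \<in> I \<Longrightarrow> h i j \<in> L) \<Longrightarrow> smat I h \<in> Bm L I"
  unfolding smat_def Bm_def using e_K0 by (auto simp: subfldD e_supp subset_iff)

lemma Em_smat: "Em I = smat I (\<lambda>i j. if i = j then 1 else 0)"
  unfolding Em_def smat_def by (auto simp: fun_eq_iff)

lemma scm_mult: "mm I (scm c Xa) Y = scm c (mm I Xa Y)" "mm I Xa (scm c Y) = scm c (mm I Xa Y)"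
  unfolding mm_def scm_def by (simp_all add: mA_scale sum_distrib_left)

lemma scm_in: "subfld L \<Longrightarrow> c \<in> L \<Longrightarrow> Xa \<in> Bm L I \<Longrightarrow> scm c Xa \<in> Bm L I"
  unfolding Bm_def scm_def by (auto simp: subfldD)

lemma matrix_star_ring:
  fixes I :: "'i set"
  assumes L: "subfld L" and KL: "K0 \<subseteq> L" and I: "finite I"
  shows "\<exists>rk. star_ring (mm I) (Bm L I) (Em I) sm hm rk"
proof -
  have two_L: "(2::'c) \<in> L" using subfldD(3)[OF L subfldD(2)[OF L] subfldD(2)[OF L]] by simp
  obtain N h where h: "bij_betw h {0..<N::nat} (I \<times> I \<times> {..<d})"
    using ex_bij_betw_nat_finite[of "I \<times> I \<times> {..<d}"] I by auto
  define co where "co n Xa = (case h n of (i, j, k) \<Rightarrow> Xa i j k)" for n and Xa :: "'i \<Rightarrow> 'i \<Rightarrow> nat \<Rightarrow> 'c"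
  define rk where "rk W = card {k. k < N \<and> (\<exists>x\<in>W. co k x \<noteq> 0 \<and> (\<forall>i<k. co i x = 0))}" for W
  have co0: "Xa = 0" if "Xa \<in> Bm L I" "\<forall>k<N. co k Xa = 0" for Xa
  proof (intro ext)
    fix i j k
    show "Xa i j k = 0 i j k"
    proof (cases "i \<in> I \<and> j \<in> I \<and> k < d")
      case True
      hence "(i, j, k) \<in> h ` {0..<N}" using h unfolding bij_betw_def by auto
      then obtain n where "n < N" "h n = (i, j, k)" by force
      thus ?thesis using that(2) unfolding co_def by (metis (no_types, lifting) case_prod_conv zero_fun_apply)
    next
      case False
      thus ?thesis using that(1) unfolding Bm_def by auto
    qed
  qed
  interpret nassoc "mm I" by (rule mm_nassoc)
  have pf: "(f + f' :: nat \<Rightarrow> 'c) = (\<lambda>k. f k + f' k)" for f f' by auto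
  have EB: "Em I \<in> Bm L I" unfolding Em_smat by (rule smat_in) (auto simp: L KL subfldD[OF L])
  have mB: "mm I Xa Y \<in> Bm L I" if "Xa \<in> Bm L I" "Y \<in> Bm L I" for Xa Y
    using that mA_in[OF L KL] unfolding Bm_def mm_def
    by (auto simp: subfldD[OF L] ma_def intro!: subfld_sum[OF L] sum.neutral)
  have "star_ring (mm I) (Bm L I) (Em I) sm hm rk"
  proof (unfold_locales, goal_cases)
    case 1 show ?case unfolding Bm_def by (auto simp: subfldD[OF L])
  next
    case 2 thus ?case unfolding Bm_def by (auto simp: subfldD[OF L])
  next
    case 3 thus ?case unfolding Bm_def by (auto simp: subfldD[OF L])
  next
    case 4 thus ?case by (rule mB)
  next
    case (5 x) thus ?case using sA_in[OF L KL] unfolding Bm_def sm_def by (auto simp: sa_def)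
  next
    case 6 show ?case by (rule EB)
  next
    case 7 thus ?case using Em_mult I by blast
  next
    case 8 thus ?case using Em_mult I by blast
  next
    case 9 show ?case unfolding sm_def by (auto simp: fun_eq_iff pf sA_add)
  next
    case (10 x y) show ?case unfolding sm_def mm_def by (auto simp: fun_eq_iff sA_sum sa_ma)
  next
    case (11 x) thus ?case unfolding sm_def Bm_def by (auto simp: fun_eq_iff sa_sa)
  next
    case 12 thus ?case unfolding Bm_def hm_def by (auto simp: subfldD[OF L] two_L)
  next
    case (13 x)
    have "a / 2 + a / 2 = a" for a :: 'c using two by (simp add: field_simps flip: mult_2)
    thus ?case unfolding hm_def by (auto simp: fun_eq_iff)
  next
    case (14 x)
    have *: "a = 0" if "a + a = 0" for a :: 'c using that two by (metis mult_2 mult_eq_0_iff)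
    have "x i j k = 0" for i j k
      by (rule *) (use fun_cong[OF fun_cong[OF fun_cong[OF 14(2), of i], of j], of k] in simp)
    thus ?case by (simp add: fun_eq_iff)
  next
    case (15 W W')
    \<comment> \<open>Scaling is right multiplication by a scalar matrix, so right ideals are
      \<open>L\<close>-subspaces and their pivots can be counted.\<close>
    have scE: "scm c x = mm I x (scm c (Em I))" if "x \<in> Bm L I" for c x
      using Em_mult(2)[OF that I] by (simp add: scm_mult)
    have scW: "scm c x \<in> Z" if "Z \<subseteq> Bm L I" "\<And>x y. x \<in> Z \<Longrightarrow> y \<in> Bm L I \<Longrightarrow> mm I x y \<in> Z" "c \<in> L" "x \<in> Z" for c x Z
      using that scE scm_in[OF L _ EB] by fastforce
    show ?case unfolding rk_def
    proof (rule pivot_less[OF L 15(1), where sc = scm])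
      show "\<And>c x. c \<in> L \<Longrightarrow> x \<in> W \<Longrightarrow> scm c x \<in> W" by (rule scW[OF subset_trans[OF psubset_imp_subset[OF 15(1)] 15(2)] 15(5)])
      show "\<And>c x. c \<in> L \<Longrightarrow> x \<in> W' \<Longrightarrow> scm c x \<in> W'" by (rule scW[OF 15(2) 15(8)])
      show "\<And>k x. x \<in> W' \<Longrightarrow> co k x \<in> L" using 15(2) unfolding co_def Bm_def by (auto split: prod.split)
      show "\<And>x. x \<in> W' \<Longrightarrow> \<forall>k<N. co k x = 0 \<Longrightarrow> x = 0" using 15(2) co0 by blast
      show "\<And>x y. x \<in> W \<Longrightarrow> y \<in> W \<Longrightarrow> x + y \<in> W" by (rule 15(4))
      show "\<And>x y. x \<in> W' \<Longrightarrow> y \<in> W' \<Longrightarrow> x + y \<in> W'" by (rule 15(7))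
      show "0 \<in> W" by (rule 15(3))
    qed (auto simp: co_def scm_def fun_eq_iff split: prod.split)
  qed
  thus ?thesis by blast
qed

lemma smat_mult:
  assumes I: "finite I" and Xa: "Xa \<in> Bm L I"
  shows "mm I (smat I h) Xa = (\<lambda>i j k. if i \<in> I then \<Sum>l\<in>I. h i l * Xa l j k else 0)"
    "mm I Xa (smat I h) = (\<lambda>i j k. if j \<in> I then \<Sum>l\<in>I. Xa i l k * h l j else 0)"
proof -
  have Xa: "\<forall>k\<ge>d. Xa i j k = 0" for i j using Xa unfolding Bm_def by auto
  have e0: "smat I h i l = (\<lambda>k. (if i \<in> I \<and> l \<in> I then h i l else 0) * e k)" for i l unfolding smat_def by auto
  show "mm I (smat I h) Xa = (\<lambda>i j k. if i \<in> I then \<Sum>l\<in>I. h i l * Xa l j k else 0)"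
    unfolding mm_def e0 mA_scale ma_unit(1)[OF Xa] by (auto simp: fun_eq_iff intro!: sum.cong)
  show "mm I Xa (smat I h) = (\<lambda>i j k. if j \<in> I then \<Sum>l\<in>I. Xa i l k * h l j else 0)"
    unfolding mm_def e0 mA_scale ma_unit(2)[OF Xa] by (auto simp: fun_eq_iff mult.commute intro!: sum.cong)
qed

lemma smat_smat: "subfld L \<Longrightarrow> K0 \<subseteq> L \<Longrightarrow> finite I \<Longrightarrow> (\<And>i j. i \<in> I \<Longrightarrow> j \<in> I \<Longrightarrow> h' i j \<in> L) \<Longrightarrow>
  mm I (smat I h) (smat I h') = smat I (\<lambda>i j. \<Sum>l\<in>I. h i l * h' l j)"
  by (subst smat_mult(1)[OF _ smat_in]) (auto simp: smat_def fun_eq_iff sum_distrib_right mult.assoc intro!: sum.cong)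

lemma smat_st: "sm (smat I h) = smat I (\<lambda>i j. h j i)"
proof -
  have e0: "smat I h i l = (\<lambda>k. (if i \<in> I \<and> l \<in> I then h i l else 0) * e k)" for i l unfolding smat_def by auto
  show ?thesis unfolding sm_def e0 by (auto simp: fun_eq_iff sA_scale sA_unit smat_def)
qed

lemma hyp_reindex:
  assumes f: "bij_betw f I J" and h: "hyp L J"
  shows "hyp L I"
proof -
  obtain v where v: "v \<in> Bm L J" "mm J v v = v" "v + sm v = Em J" using h unfolding hyp_def by blast
  define w where "w i j = (if i \<in> I \<and> j \<in> I then v (f i) (f j) else (\<lambda>_. 0))" for i j
  have fi: "i \<in> I \<Longrightarrow> f i \<in> J" for i using f unfolding bij_betw_def by auto
  have finj: "i \<in> I \<Longrightarrow> j \<in> I \<Longrightarrow> f i = f j \<longleftrightarrow> i = j" for i j using f unfolding bij_betw_def inj_on_def by auto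
  \<comment> \<open>\<open>L\<close> is only a set here; its zero is found as a coordinate of
    \<open>v\<close> at the place \<open>d\<close>, beyond the dimension.\<close>
  have L0: "0 \<in> L" 
  proof -
    obtain i :: 'b where True by blast
    have "v i i d \<in> L" "v i i d = 0" using v(1) unfolding Bm_def by blast+
    thus ?thesis by simp
  qed
  have wB: "w \<in> Bm L I" using v(1) L0 unfolding w_def Bm_def by auto
  have "mm I w w i j k = w i j k" for i j k
  proof (cases "i \<in> I \<and> j \<in> I")
    case True
    have "mm I w w i j k = (\<Sum>l\<in>I. mA (v (f i) (f l)) (v (f l) (f j)) k)" unfolding mm_def w_def using True by (intro sum.cong) auto
    also have "\<dots> = (\<Sum>l\<in>J. mA (v (f i) l) (v l (f j)) k)" by (rule sum.reindex_bij_betw[OF f])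
    also have "\<dots> = v (f i) (f j) k" using fun_cong[OF fun_cong[OF fun_cong[OF v(2)]]] unfolding mm_def by metis
    finally show ?thesis using True by (simp add: w_def)
  next
    case False
    thus ?thesis unfolding mm_def w_def by (auto simp: mA_zero intro!: sum.neutral)
  qed
  moreover have "(w + sm w) i j k = Em I i j k" for i j k
  proof (cases "i \<in> I \<and> j \<in> I")
    case True
    have "(v + sm v) (f i) (f j) k = Em J (f i) (f j) k" using v(3) by simp
    thus ?thesis using True fi finj by (simp add: w_def sm_def Em_def)
  next
    case False
    thus ?thesis by (auto simp: w_def sm_def Em_def sA_zero)
  qed
  ultimately show ?thesis unfolding hyp_def using wB by (intro bexI[of _ w] conjI ext)
qed

lemma hyp_card: "finite I \<Longrightarrow> hyp L I \<longleftrightarrow> hyp L {..<card I}"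
  using ex_bij_betw_nat_finite[of I] hyp_reindex bij_betw_inv by (metis lessThan_atLeast0)

end

context star_ring
begin

text \<open>Cancellation for the involution \<open>x \<mapsto> G x\<^sup>* H\<close>, \<open>G = H\<inverse>\<close>, adjoint to the
  hermitian form \<open>H\<close>.\<close>

lemma twisted_cancel:
  assumes H: "H \<in> B" "G \<in> B" "st H = H" "H \<cdot> G = E" "G \<cdot> H = E"
    and g: "x \<in> B" "x \<cdot> x = x" "H \<cdot> x + st x \<cdot> H = H"
    and u: "u \<in> B" "u \<cdot> u = u" "st u \<cdot> (H \<cdot> u) = 0" "u \<cdot> (G \<cdot> st u) = 0"
    and f: "E - u - G \<cdot> st u \<cdot> H = f" "st f = f" "H \<cdot> f = f"
  obtains v where "v \<in> B" "v \<cdot> v = v" "v + st v = f" "f \<cdot> v = v" "v \<cdot> f = v"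
proof -
  have fB: "f \<in> B" unfolding f(1)[symmetric] using u H by (simp add: Bs)
  have sG: "st G = G"
  proof -
    have "H \<cdot> st G = st (G \<cdot> H)" "st G \<cdot> H = st (H \<cdot> G)" using H(1-3) by (simp_all add: st_simps)
    hence "H \<cdot> st G = E" "st G \<cdot> H = E" using H(4,5) by simp_all
    thus ?thesis using H by (metis B_st assoc unit_left unit_right)
  qed
  define tw where "tw x = G \<cdot> st x \<cdot> H" for x
  interpret t: star_ring m B E tw hf rk
  proof (unfold_locales, goal_cases)
    case 5 thus ?case unfolding tw_def using H by (simp add: Bs)
  next
    case (9 x y) thus ?case unfolding tw_def by (simp add: st_simps expand)
  next
    case (10 x y)
    thus ?case unfolding tw_def using H by (simp add: st_simps expand prefix[OF H(4)] unit_left Bs)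
  next
    case (11 x)
    thus ?case unfolding tw_def using H sG
      by (simp add: st_simps Bs expand prefix[OF H(5)] unit_left unit_right)
  qed (rule Bs; assumption | rule unit_left unit_right hf_hf double_eq_0; assumption | rule rk_less; assumption)+
  have "G \<cdot> (H \<cdot> x + st x \<cdot> H) = G \<cdot> H" using g by simp
  hence gE: "x + tw x = E" 
    unfolding tw_def using g(1) H(5) by (simp only: add_right prefix[OF H(5)] unit_left assoc)
  have "tw u \<cdot> u = 0" unfolding tw_def by (simp add: assoc u(3))
  moreover have "u \<cdot> tw u = u \<cdot> (G \<cdot> st u) \<cdot> H" unfolding tw_def by (simp add: assoc)
  hence "u \<cdot> tw u = 0" unfolding u(4) by simp
  ultimately have "t.isoid E u" unfolding t.isoid_def using u(1,2) by (simp add: unit_left unit_right)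
  then obtain v where v: "v \<in> B" "v \<cdot> v = v" "v + tw v = E - u - tw u" "(E - u - tw u) \<cdot> v = v" "v \<cdot> (E - u - tw u) = v"
    using t.hyperbolic_cancel[of x u] g gE t.rad_zero by (metis diff_self)
  have fe: "E - u - tw u = f" unfolding tw_def by (rule f(1))
  \<comment> \<open>On the corner of \<open>f\<close> the form \<open>H\<close> acts as the unit
    form, so \<open>tw\<close> and \<open>st\<close> agree there.\<close>
  have fH: "f \<cdot> H = f" using arg_cong[OF f(3), of st] fB H f(2) by (simp add: st_simps)
  have Gf: "G \<cdot> f = f" using f(3) prefix[OF H(5), of f] fB by (simp add: unit_left)
  have "f \<cdot> st v = st v" "st v \<cdot> f = st v"
    using arg_cong[OF v(5)[unfolded fe], of st] arg_cong[OF v(4)[unfolded fe], of st] v(1) fB f(2) by (simp_all add: st_simps)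
  hence "tw v = st v" unfolding tw_def by (metis Gf fH assoc)
  thus ?thesis using that[of v] v unfolding fe by simp
qed

end

section \<open>Change of the index set and descent of hyperbolicity along field extensions\<close>

context coalg
begin

lemma Bm_mono: "I \<subseteq> J \<Longrightarrow> Bm L I \<subseteq> Bm L J"
  unfolding Bm_def by blast

lemma mm_disjoint: "Xa \<in> Bm L J1 \<Longrightarrow> Y \<in> Bm L J2 \<Longrightarrow> J1 \<inter> J2 = {} \<Longrightarrow> mm J Xa Y = 0"
proof (intro ext)
  fix i j k assume a: "Xa \<in> Bm L J1" "Y \<in> Bm L J2" "J1 \<inter> J2 = {}"
  have "mA (Xa i l) (Y l j) k = 0" for l
  proof (cases "l \<in> J1")
    case True
    hence "Y l j k = 0" for k using a unfolding Bm_def by blast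
    hence "Y l j = (\<lambda>_. 0)" by blast
    thus ?thesis by (simp add: mA_zero)
  next
    case False
    hence "Xa i l k = 0" for k using a unfolding Bm_def by blast
    hence "Xa i l = (\<lambda>_. 0)" by blast
    thus ?thesis by (simp add: mA_zero)
  qed
  thus "mm J Xa Y i j k = 0 i j k" unfolding mm_def by simp
qed

lemma hyp_mult:
  assumes "hyp L I" "finite I" "finite R" "0 \<in> L"
  shows "hyp L (I \<times> R)"
proof -
  obtain v where v: "v \<in> Bm L I" "mm I v v = v" "v + sm v = Em I" using assms unfolding hyp_def by blast
  define w where "w a b = (if snd a = snd b \<and> snd a \<in> R then v (fst a) (fst b) else (\<lambda>_. 0))" for a b :: "'a \<times> 'b"
  have wB: "w \<in> Bm L (I \<times> R)" using v(1) assms(4) unfolding Bm_def w_def by (auto simp: mem_Times_iff)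
  have "mm (I \<times> R) w w a b k = w a b k" for a b k
  proof (cases "snd a = snd b \<and> snd a \<in> R")
    case True
    have "mm (I \<times> R) w w a b k = (\<Sum>i\<in>I. \<Sum>r\<in>R. mA (w a (i, r)) (w (i, r) b) k)"
      unfolding mm_def by (simp add: sum.cartesian_product case_prod_unfold)
    also have "\<dots> = (\<Sum>i\<in>I. \<Sum>r\<in>R. if r = snd a then mA (v (fst a) i) (v i (fst b)) k else 0)"
      using True by (intro sum.cong) (auto simp: w_def mA_zero)
    also have "\<dots> = mm I v v (fst a) (fst b) k" using True assms unfolding mm_def by auto
    finally show ?thesis using True v(2) by (auto simp: w_def)
  next
    case False
    have "mA (w a l) (w l b) k = 0" for l using False unfolding w_def by (auto simp: mA_zero)
    thus ?thesis using False unfolding mm_def by (auto simp: w_def)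
  qed
  moreover have "(w + sm w) a b k = Em (I \<times> R) a b k" for a b k
  proof (cases "snd a = snd b \<and> snd a \<in> R")
    case True
    have "(v + sm v) (fst a) (fst b) k = Em I (fst a) (fst b) k" using v by simp
    thus ?thesis using True by (auto simp: w_def sm_def Em_def prod_eq_iff mem_Times_iff)
  next
    case False
    hence "w a b = (\<lambda>_. 0)" "w b a = (\<lambda>_. 0)" unfolding w_def by auto
    thus ?thesis using False by (auto simp: sm_def Em_def sA_zero)
  qed
  ultimately show ?thesis unfolding hyp_def using wB by (intro bexI[of _ w] conjI ext)
qed

text \<open>The Kronecker product of the identity on the first index with \<open>h\<close>, that is,
  the form \<open>h\<close> on the multiplicity space.\<close>

definition bl :: "(nat \<Rightarrow> nat \<Rightarrow> 'c) \<Rightarrow> 'i \<times> nat \<Rightarrow> 'i \<times> nat \<Rightarrow> 'c" where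
  "bl h a b = (if fst a = fst b then h (snd a) (snd b) else 0)"

lemma bl_sum:
  assumes "finite I" "a \<in> I \<times> R" and F: "\<And>b. F (fst a, b) = f b"
  shows "(\<Sum>c\<in>I \<times> R. bl h a c * F c) = (\<Sum>p\<in>R. h (snd a) p * f p)"
    "(\<Sum>c\<in>I \<times> R. F c * bl h c a) = (\<Sum>p\<in>R. f p * h p (snd a))"
proof -
  have *: "(\<Sum>i\<in>I. \<Sum>r\<in>R. if i = fst a then h (snd a) r * f r else 0) = (\<Sum>p\<in>R. h (snd a) p * f p)"
    using assms(1,2) by (subst sum.swap) auto
  have "(\<Sum>c\<in>I \<times> R. bl h a c * F c) = (\<Sum>i\<in>I. \<Sum>r\<in>R. bl h a (i, r) * F (i, r))"
    by (simp add: sum.cartesian_product case_prod_unfold)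
  also have "\<dots> = (\<Sum>i\<in>I. \<Sum>r\<in>R. if i = fst a then h (snd a) r * f r else 0)"
    by (intro sum.cong) (auto simp: bl_def F)
  finally show "(\<Sum>c\<in>I \<times> R. bl h a c * F c) = (\<Sum>p\<in>R. h (snd a) p * f p)" using * by simp
  have **: "(\<Sum>i\<in>I. \<Sum>r\<in>R. if i = fst a then f r * h r (snd a) else 0) = (\<Sum>p\<in>R. f p * h p (snd a))"
    using assms(1,2) by (subst sum.swap) auto
  have "(\<Sum>c\<in>I \<times> R. F c * bl h c a) = (\<Sum>i\<in>I. \<Sum>r\<in>R. F (i, r) * bl h (i, r) a)"
    by (simp add: sum.cartesian_product case_prod_unfold)
  also have "\<dots> = (\<Sum>i\<in>I. \<Sum>r\<in>R. if i = fst a then f r * h r (snd a) else 0)"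
    by (intro sum.cong) (auto simp: bl_def F)
  finally show "(\<Sum>c\<in>I \<times> R. F c * bl h c a) = (\<Sum>p\<in>R. f p * h p (snd a))" using ** by simp
qed

lemma bl_mult:
  assumes "subfld L" "K0 \<subseteq> L" "finite I" "finite R" "\<And>k l. k \<in> R \<Longrightarrow> l \<in> R \<Longrightarrow> h' k l \<in> L"
  shows "mm (I \<times> R) (smat (I \<times> R) (bl h)) (smat (I \<times> R) (bl h')) = smat (I \<times> R) (bl (\<lambda>k l. \<Sum>p\<in>R. h k p * h' p l))"
proof -
  have "(\<Sum>c\<in>I \<times> R. bl h a c * bl h' c b) = bl (\<lambda>k l. \<Sum>p\<in>R. h k p * h' p l) a b" if "a \<in> I \<times> R" for a b
  proof (cases "fst a = fst b")
    case True
    thus ?thesis using bl_sum(1)[OF assms(3) that, of "\<lambda>c. bl h' c b" "\<lambda>p. h' p (snd b)" h]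
      by (simp add: bl_def)
  next
    case False
    hence "(\<Sum>c\<in>I \<times> R. bl h a c * bl h' c b) = 0" by (intro sum.neutral) (auto simp: bl_def)
    thus ?thesis using False by (simp add: bl_def)
  qed
  moreover have "bl h' a b \<in> L" if "a \<in> I \<times> R" "b \<in> I \<times> R" for a b
    using that assms subfldD(1)[OF assms(1)] unfolding bl_def by auto
  ultimately show ?thesis using assms by (subst smat_smat[of L]) (auto simp: smat_def fun_eq_iff)
qed

lemma smat_bl_cong: "(\<And>k l. k \<in> R \<Longrightarrow> l \<in> R \<Longrightarrow> h k l = h' k l) \<Longrightarrow> smat (I \<times> R) (bl h) = smat (I \<times> R) (bl h')"
  unfolding smat_def bl_def by (auto simp: fun_eq_iff)

text \<open>\<open>h\<close> is the Gram matrix of a symmetric form on \<open>L^R\<close> with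
  inverse \<open>h'\<close>, and \<open>u0\<close> projects onto a totally isotropic subspace.
  Together with its adjoint it fills a hyperbolic part, whose complement is the unit form on
  \<open>R0\<close>. If the multiple twisted by \<open>h\<close> is hyperbolic, cancelling this part
  leaves the multiple by \<open>R0\<close>.\<close>

lemma hyp_cancel:
  fixes R R0 :: "nat set" and I :: "'i set"
  assumes L: "subfld L" "K0 \<subseteq> L" and fin: "finite I" "finite R" and R0: "R0 \<subseteq> R"
    and hL: "\<And>k l. k \<in> R \<Longrightarrow> l \<in> R \<Longrightarrow> h k l \<in> L" "\<And>k l. k \<in> R \<Longrightarrow> l \<in> R \<Longrightarrow> h' k l \<in> L"
      "\<And>k l. k \<in> R \<Longrightarrow> l \<in> R \<Longrightarrow> u0 k l \<in> L"
    and hs: "\<And>k l. k \<in> R \<Longrightarrow> l \<in> R \<Longrightarrow> h k l = h l k"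
    and hh': "\<And>k l. k \<in> R \<Longrightarrow> l \<in> R \<Longrightarrow> (\<Sum>p\<in>R. h k p * h' p l) = (if k = l then 1 else 0)"
      "\<And>k l. k \<in> R \<Longrightarrow> l \<in> R \<Longrightarrow> (\<Sum>p\<in>R. h' k p * h p l) = (if k = l then 1 else 0)"
    and uu: "\<And>k l. k \<in> R \<Longrightarrow> l \<in> R \<Longrightarrow> (\<Sum>p\<in>R. u0 k p * u0 p l) = u0 k l"
    and uhu: "\<And>k l. k \<in> R \<Longrightarrow> l \<in> R \<Longrightarrow> (\<Sum>p\<in>R. u0 p k * (\<Sum>q\<in>R. h p q * u0 q l)) = 0"
    and uh'u: "\<And>k l. k \<in> R \<Longrightarrow> l \<in> R \<Longrightarrow> (\<Sum>p\<in>R. u0 k p * (\<Sum>q\<in>R. h' p q * u0 l q)) = 0"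
    and f: "\<And>k l. k \<in> R \<Longrightarrow> l \<in> R \<Longrightarrow> (if k = l then 1 else 0) - u0 k l -
        (\<Sum>q\<in>R. (\<Sum>p\<in>R. h' k p * u0 q p) * h q l) = (if k = l \<and> k \<in> R0 then 1 else 0)"
    and hf: "\<And>k l. k \<in> R \<Longrightarrow> l \<in> R0 \<Longrightarrow> h k l = (if k = l then 1 else 0)"
    and x: "x \<in> Bm L (I \<times> R)" "mm (I \<times> R) x x = x"
      "mm (I \<times> R) (smat (I \<times> R) (bl h)) x + mm (I \<times> R) (sm x) (smat (I \<times> R) (bl h)) = smat (I \<times> R) (bl h)"
  shows "hyp L (I \<times> R0)"
proof -
  let ?J = "I \<times> R"
  let ?S = "\<lambda>h. smat ?J (bl h)"
  have J: "finite ?J" using fin by simp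
  obtain rk where "star_ring (mm ?J) (Bm L ?J) (Em ?J) sm hm rk" using matrix_star_ring[OF L J] by blast
  then interpret star_ring "mm ?J" "Bm L ?J" "Em ?J" sm hm rk .
  have SB: "?S a \<in> Bm L ?J" if "\<And>k l. k \<in> R \<Longrightarrow> l \<in> R \<Longrightarrow> a k l \<in> L" for a
    by (rule smat_in[OF L]) (use that subfldD(1)[OF L(1)] in \<open>auto simp: bl_def\<close>)
  have SS: "mm ?J (?S a) (?S b) = ?S (\<lambda>k l. \<Sum>p\<in>R. a k p * b p l)" if "\<And>k l. k \<in> R \<Longrightarrow> l \<in> R \<Longrightarrow> b k l \<in> L" for a b
    by (rule bl_mult[OF L fin that])
  have St: "sm (?S a) = ?S (\<lambda>k l. a l k)" for a
    unfolding smat_st by (auto simp: smat_def bl_def fun_eq_iff)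
  have E: "Em ?J = ?S (\<lambda>k l. if k = l then 1 else 0)"
    unfolding Em_smat by (auto simp: smat_def bl_def fun_eq_iff)
  have Z: "?S (\<lambda>k l. 0) = 0" unfolding smat_def bl_def by (auto simp: fun_eq_iff)
  have D: "?S a - ?S b = ?S (\<lambda>k l. a k l - b k l)" for a b unfolding smat_def bl_def by (auto simp: fun_eq_iff algebra_simps)
  define f0 where "f0 = (\<lambda>k l. if k = l \<and> k \<in> R0 then 1 else (0::'c))"
  have sumL: "(\<Sum>p\<in>R. a p * b p) \<in> L" if "\<And>p. p \<in> R \<Longrightarrow> a p \<in> L" "\<And>p. p \<in> R \<Longrightarrow> b p \<in> L" for a b
    by (rule subfld_sum[OF L(1)]) (use that in \<open>auto simp: subfldD[OF L(1)]\<close>)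
  obtain v where v: "v \<in> Bm L ?J" "mm ?J v v = v" "v + sm v = ?S f0" "mm ?J (?S f0) v = v" "mm ?J v (?S f0) = v"
  proof (rule twisted_cancel[of "?S h" "?S h'" x "?S u0" "?S f0"])
    show "?S h \<in> Bm L ?J" "?S h' \<in> Bm L ?J" "?S u0 \<in> Bm L ?J" using SB hL by auto
    show "sm (?S h) = ?S h" unfolding St by (rule smat_bl_cong) (use hs in auto)
    show "mm ?J (?S h) (?S h') = Em ?J" "mm ?J (?S h') (?S h) = Em ?J"
      unfolding E by (subst SS, use hL in simp, rule smat_bl_cong, use hh' in simp)+
    show "mm ?J (?S u0) (?S u0) = ?S u0" by (subst SS, use hL in simp, rule smat_bl_cong, use uu in simp)
    show "mm ?J (sm (?S u0)) (mm ?J (?S h) (?S u0)) = 0"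
      unfolding Z[symmetric] St by (subst SS, use hL in simp, subst SS, use hL sumL in simp, rule smat_bl_cong, use uhu in simp)
    show "mm ?J (?S u0) (mm ?J (?S h') (sm (?S u0))) = 0"
      unfolding Z[symmetric] St by (subst SS, use hL in simp, subst SS, use hL sumL in simp, rule smat_bl_cong, use uh'u in simp)
    show "Em ?J - ?S u0 - mm ?J (mm ?J (?S h') (sm (?S u0))) (?S h) = ?S f0"
      unfolding E St f0_def by (subst SS, use hL in simp, subst SS, use hL sumL in simp, subst D, subst D, rule smat_bl_cong, use f in simp)
    show "sm (?S f0) = ?S f0" unfolding St by (rule smat_bl_cong) (auto simp: f0_def)
    have "(\<Sum>p\<in>R. h k p * f0 p l) = f0 k l" if kl: "k \<in> R" "l \<in> R" for k l
    proof -
      have "(\<Sum>p\<in>R. h k p * f0 p l) = (\<Sum>p\<in>R. if p = l then (if l \<in> R0 then h k l else 0) else 0)"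
        by (intro sum.cong) (auto simp: f0_def)
      also have "\<dots> = f0 k l" using kl fin hf[OF kl(1), of l] by (auto simp: f0_def)
      finally show ?thesis .
    qed
    thus "mm ?J (?S h) (?S f0) = ?S f0"
      by (subst SS, use subfldD(1,2)[OF L(1)] in \<open>simp add: f0_def\<close>, intro smat_bl_cong) simp
  qed (use x in auto)
  have R0f: "finite R0" using R0 fin finite_subset by blast
  have vB0: "v \<in> Bm L (I \<times> R0)"
  proof -
    have "v a b k = 0" if "a \<notin> I \<times> R0" for a b k
    proof (cases "a \<in> ?J")
      case True
      have "v a b k = (\<Sum>l\<in>?J. bl f0 a l * v l b k)"
        using True fun_cong[OF fun_cong[OF fun_cong[OF v(4), of a], of b], of k] unfolding smat_mult(1)[OF J v(1)] by simp
      also have "\<dots> = 0" using that True by (intro sum.neutral) (auto simp: bl_def f0_def)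
      finally show ?thesis .
    next
      case False
      thus ?thesis using v(1) unfolding Bm_def by blast
    qed
    moreover have "v a b k = 0" if "b \<notin> I \<times> R0" for a b k
    proof (cases "b \<in> ?J")
      case True
      have "v a b k = (\<Sum>l\<in>?J. v a l k * bl f0 l b)"
        using True fun_cong[OF fun_cong[OF fun_cong[OF v(5), of a], of b], of k] unfolding smat_mult(2)[OF J v(1)] by simp
      also have "\<dots> = 0" using that True by (intro sum.neutral) (auto simp: bl_def f0_def)
      finally show ?thesis .
    next
      case False
      thus ?thesis using v(1) unfolding Bm_def by blast
    qed
    ultimately show ?thesis using v(1) unfolding Bm_def by blast
  qed
  have "mm (I \<times> R0) v v = v" using mm_supp[OF vB0 _ J, of v] R0 v(2) by (metis Sigma_mono order_refl)
  moreover have "?S f0 = Em (I \<times> R0)" unfolding smat_def bl_def f0_def Em_def using R0 by (auto simp: fun_eq_iff)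
  ultimately show ?thesis unfolding hyp_def using v(3) vB0 by metis
qed

text \<open>Scharlau's transfer. Writing multiplication in \<open>L'\<close> in the basis
  \<open>be\<close> turns a matrix over \<open>L'\<close> into a larger one over \<open>L\<close>.
  The involution turns into the one adjoint to the Gram matrix of the form \<open>lam (x y)\<close>,
  so a hyperbolic idempotent over \<open>L'\<close> becomes one for this twisted involution over
  \<open>L\<close>.\<close>

lemma transfer_hyp:
  fixes R :: "nat set" and I :: "'i set"
  assumes L: "subfld L" "K0 \<subseteq> L" and L': "subfld L'" "L \<subseteq> L'" and fin: "finite I" "finite R"
    and be: "\<And>k. k \<in> R \<Longrightarrow> be k \<in> L'"
    and cf: "\<And>k x. k \<in> R \<Longrightarrow> x \<in> L' \<Longrightarrow> cf k x \<in> L" "\<And>k x y. k \<in> R \<Longrightarrow> x \<in> L' \<Longrightarrow> y \<in> L' \<Longrightarrow> cf k (x + y) = cf k x + cf k y"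
      "\<And>k c x. k \<in> R \<Longrightarrow> c \<in> L \<Longrightarrow> x \<in> L' \<Longrightarrow> cf k (c * x) = c * cf k x"
      "\<And>x. x \<in> L' \<Longrightarrow> x = (\<Sum>k\<in>R. cf k x * be k)"
    and lam: "\<And>x y. x \<in> L' \<Longrightarrow> y \<in> L' \<Longrightarrow> lam (x + y) = lam x + lam y"
      "\<And>c x. c \<in> L \<Longrightarrow> x \<in> L' \<Longrightarrow> lam (c * x) = c * lam x"
    and h: "\<And>k l. k \<in> R \<Longrightarrow> l \<in> R \<Longrightarrow> h k l = lam (be k * be l)"
    and hyp: "hyp L' I"
  obtains x where "x \<in> Bm L (I \<times> R)" "mm (I \<times> R) x x = x"
      "mm (I \<times> R) (smat (I \<times> R) (bl h)) x + mm (I \<times> R) (sm x) (smat (I \<times> R) (bl h)) = smat (I \<times> R) (bl h)"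
proof -
  obtain v where v: "v \<in> Bm L' I" "mm I v v = v" "v + sm v = Em I" using hyp unfolding hyp_def by blast
  note Ls = subfldD[OF L(1)] and Ls' = subfldD[OF L'(1)]
  have KL': "K0 \<subseteq> L'" using L L' by blast
  have gL: "g i j k \<in> L" "s i k \<in> L" "e k \<in> L" for i j k using g_K0 s_K0 e_K0 L by auto
  have vL: "v i j k \<in> L'" for i j k using v(1) unfolding Bm_def by auto
  have cf0: "cf k 0 = 0" if "k \<in> R" for k using cf(3)[OF that Ls(1) Ls'(1)] by simp
  have lam0: "lam 0 = 0" using lam(2)[OF Ls(1) Ls'(1)] by simp
  have cf_sum: "cf k (\<Sum>a\<in>A. F a) = (\<Sum>a\<in>A. cf k (F a))" if "k \<in> R" "\<And>a. a \<in> A \<Longrightarrow> F a \<in> L'" for k A and F :: "'b \<Rightarrow> 'c"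
    using that(2)
  proof (induction A rule: infinite_finite_induct)
    case (insert a A)
    have "sum F A \<in> L'" using insert by (intro subfld_sum[OF L'(1)]) auto
    thus ?case using insert cf(2)[OF that(1), of "F a" "sum F A"] by simp
  qed (use that(1) cf0 in auto)
  have lam_sum: "lam (\<Sum>a\<in>A. F a) = (\<Sum>a\<in>A. lam (F a))" if "\<And>a. a \<in> A \<Longrightarrow> F a \<in> L'" for A and F :: "nat \<Rightarrow> 'c"
    using that
  proof (induction A rule: infinite_finite_induct)
    case (insert a A)
    have "sum F A \<in> L'" using insert by (intro subfld_sum[OF L'(1)]) auto
    thus ?case using insert lam(1)[of "F a" "sum F A"] by simp
  qed (use lam0 in auto)
  have cf_mA: "mA (\<lambda>t. cf k (a t)) b t = cf k (mA a b t)" if "k \<in> R" "\<And>t. a t \<in> L'" "\<And>t. b t \<in> L" for k a b t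
  proof (cases "t < d")
    case True
    have bL': "b t \<in> L'" for t using that L' by auto
    have gL': "g i j k \<in> L'" for i j k using gL L' by auto
    have "cf k (mA a b t) = (\<Sum>i<d. \<Sum>j<d. cf k (a i * b j * g i j t))"
      unfolding ma_def using True that(1) bL' gL' that(2) by (simp add: cf_sum Ls' subfld_sum[OF L'(1)])
    also have "\<dots> = (\<Sum>i<d. \<Sum>j<d. cf k (a i) * b j * g i j t)"
    proof (intro sum.cong refl)
      fix i j
      have e: "a i * b j * g i j t = (b j * g i j t) * a i" by simp
      show "cf k (a i * b j * g i j t) = cf k (a i) * b j * g i j t"
        unfolding e using cf(3)[OF that(1), of "b j * g i j t" "a i"] that gL by (simp add: Ls)
    qed
    finally show ?thesis unfolding ma_def using True by simp
  qed (use cf0 that in \<open>simp add: ma_def\<close>)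
  have cf_sA: "sA (\<lambda>t. cf k (a t)) t = cf k (sA a t)" if "k \<in> R" "\<And>t. a t \<in> L'" for k a t
  proof (cases "t < d")
    case True
    have sL': "s i k \<in> L'" for i k using gL L' by auto
    have "cf k (sA a t) = (\<Sum>i<d. cf k (a i * s i t))"
      unfolding sa_def using True that sL' by (simp add: cf_sum Ls')
    also have "\<dots> = (\<Sum>i<d. cf k (a i) * s i t)"
      by (intro sum.cong refl) (metis cf(3) gL(2) mult.commute that)
    finally show ?thesis unfolding sa_def using True by simp
  qed (use cf0 that in \<open>simp add: sa_def\<close>)
  \<comment> \<open>Every entry of \<open>v\<close> is replaced by the matrix of multiplication by
    it: column \<open>l\<close> holds the coordinates of the entry times
    \<open>be l\<close>.\<close>
  define S where "S a b = (if snd a \<in> R \<and> snd b \<in> R then (\<lambda>t. cf (snd a) (v (fst a) (fst b) t * be (snd b))) else (\<lambda>_. 0))"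
    for a b :: "'i \<times> nat"
  let ?J = "I \<times> R"
  have J: "finite ?J" using fin by simp
  have vbL: "v i j t * be k \<in> L'" if "k \<in> R" for i j t k using vL be that by (simp add: Ls')
  have SB: "S \<in> Bm L ?J"
    using v(1) vbL cf(1) cf0 Ls unfolding Bm_def S_def by (auto simp: mem_Times_iff)
  have SL: "S a b t \<in> L" for a b t using SB unfolding Bm_def by blast
  have "mm ?J S S a b t = S a b t" for a b t
  proof (cases "snd a \<in> R \<and> snd b \<in> R")
    case True
    define k q where "k = snd a" and "q = snd b"
    have kq: "k \<in> R" "q \<in> R" using True unfolding k_def q_def by auto
    have "mm ?J S S a b t = (\<Sum>j\<in>I. \<Sum>l\<in>R. mA (S a (j, l)) (S (j, l) b) t)"
      unfolding mm_def by (simp add: sum.cartesian_product case_prod_unfold)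
    also have "\<dots> = (\<Sum>j\<in>I. \<Sum>l\<in>R. cf k (mA (v (fst a) j) (\<lambda>t. be l * S (j, l) b t) t))"
    proof (intro sum.cong refl)
      fix j l assume l: "l \<in> R"
      have "mA (S a (j, l)) (S (j, l) b) t = mA (\<lambda>t. cf k (v (fst a) j t * be l)) (S (j, l) b) t"
        using l kq unfolding S_def k_def by simp
      also have "\<dots> = cf k (mA (\<lambda>t. be l * v (fst a) j t) (S (j, l) b) t)"
        by (subst cf_mA) (use kq vbL[OF l] SL in \<open>auto simp: mult.commute\<close>)
      finally show "mA (S a (j, l)) (S (j, l) b) t = cf k (mA (v (fst a) j) (\<lambda>t. be l * S (j, l) b t) t)"
        by (simp add: mA_scale)
    qed
    also have "\<dots> = cf k (\<Sum>j\<in>I. \<Sum>l\<in>R. mA (v (fst a) j) (\<lambda>t. be l * S (j, l) b t) t)"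
    proof -
      have "mA (v (fst a) j) (\<lambda>t. be l * S (j, l) b t) t \<in> L'" if "l \<in> R" for j l
        by (rule mA_in[OF L'(1) KL']) (use vL SL L' be that in \<open>auto simp: Ls' subset_iff\<close>)
      thus ?thesis using kq by (subst cf_sum, auto intro!: subfld_sum[OF L'(1)])
          (intro sum.cong refl, subst cf_sum, auto)
    qed
    also have "(\<Sum>j\<in>I. \<Sum>l\<in>R. mA (v (fst a) j) (\<lambda>t. be l * S (j, l) b t) t) =
        (\<Sum>j\<in>I. mA (v (fst a) j) (\<lambda>t. be q * v j (fst b) t) t)"
    proof (intro sum.cong refl)
      fix j
      have "(\<Sum>l\<in>R. be l * S (j, l) b t) = be q * v j (fst b) t" for t
        using cf(4)[OF vbL[OF kq(2), of j "fst b" t]] True unfolding S_def q_def by (simp add: mult.commute)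
      thus "(\<Sum>l\<in>R. mA (v (fst a) j) (\<lambda>t. be l * S (j, l) b t) t) = mA (v (fst a) j) (\<lambda>t. be q * v j (fst b) t) t"
        by (simp flip: mA_sum)
    qed
    also have "\<dots> = be q * mm I v v (fst a) (fst b) t" unfolding mm_def mA_scale by (simp add: sum_distrib_left)
    finally show ?thesis using v(2) True unfolding S_def k_def q_def by (simp add: mult.commute)
  next
    case False
    have "mA (S a l) (S l b) t = 0" for l using False unfolding S_def by (auto simp: mA_zero)
    thus ?thesis using False unfolding mm_def by (auto simp: S_def)
  qed
  hence SS: "mm ?J S S = S" by (intro ext)
  have sSB: "sm S \<in> Bm L ?J" using matrix_star_ring[OF L J] star_ring.B_st[OF _ SB] by blast
  have "(mm ?J (smat ?J (bl h)) S + mm ?J (sm S) (smat ?J (bl h))) a b t = smat ?J (bl h) a b t" for a b t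
  proof (cases "a \<in> ?J \<and> b \<in> ?J")
    case True
    define k l i j where "k = snd a" and "l = snd b" and "i = fst a" and "j = fst b"
    have kl: "k \<in> R" "l \<in> R" "i \<in> I" "j \<in> I" "a = (i, k)" "b = (j, l)" using True unfolding k_def l_def i_def j_def by auto
    \<comment> \<open>A row of the Gram matrix applied to the coordinates of \<open>x\<close>
      evaluates \<open>lam\<close> at a product with \<open>x\<close>. Both summands of the twisted
      identity become values of \<open>lam\<close>, and \<open>v + sm v = Em I\<close> joins
      them.\<close>
    have Lx: "(\<Sum>p\<in>R. lam (be q * be p) * cf p x) = lam (be q * x)" if "x \<in> L'" "q \<in> R" for x q
    proof -
      have cbL: "cf p x * be p \<in> L'" if "p \<in> R" for p using cf(1)[OF that \<open>x \<in> L'\<close>] L' be[OF that] by (auto simp: Ls')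
      have "be q * x = (\<Sum>p\<in>R. be q * (cf p x * be p))" using cf(4)[OF that(1)] by (metis sum_distrib_left)
      hence "lam (be q * x) = (\<Sum>p\<in>R. lam (be q * (cf p x * be p)))"
        using lam_sum[of R "\<lambda>p. be q * (cf p x * be p)"] cbL be[OF that(2)] by (simp add: Ls')
      also have "\<dots> = (\<Sum>p\<in>R. lam (be q * be p) * cf p x)"
      proof (intro sum.cong refl)
        fix p assume p: "p \<in> R"
        have "lam (cf p x * (be q * be p)) = cf p x * lam (be q * be p)"
          by (rule lam(2)) (use cf(1)[OF p that(1)] be p that in \<open>auto simp: Ls'\<close>)
        thus "lam (be q * (cf p x * be p)) = lam (be q * be p) * cf p x" by (simp add: ac_simps)
      qed
      finally show ?thesis ..
    qed
    have "mm ?J (smat ?J (bl h)) S a b t = (\<Sum>c\<in>?J. bl h a c * S c b t)"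
      unfolding smat_mult(1)[OF J SB] using True by simp
    also have "\<dots> = (\<Sum>p\<in>R. h k p * S (i, p) b t)"
      using bl_sum(1)[OF fin(1), of a R "\<lambda>c. S c b t" "\<lambda>p. S (i, p) b t" h] True unfolding k_def i_def by simp
    also have "\<dots> = (\<Sum>p\<in>R. lam (be k * be p) * cf p (v i j t * be l))"
      by (intro sum.cong) (auto simp: S_def kl h)
    also have "\<dots> = lam (be k * (v i j t * be l))" using kl by (intro Lx vbL)
    finally have 1: "mm ?J (smat ?J (bl h)) S a b t = lam (be k * (v i j t * be l))" .
    have "mm ?J (sm S) (smat ?J (bl h)) a b t = (\<Sum>c\<in>?J. sm S a c t * bl h c b)"
      unfolding smat_mult(2)[OF J sSB] using True by simp
    also have "\<dots> = (\<Sum>p\<in>R. sm S a (j, p) t * h p l)"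
      using bl_sum(2)[OF fin(1), of b R "\<lambda>c. sm S a c t" "\<lambda>p. sm S a (j, p) t" h] True unfolding l_def j_def by simp
    also have "\<dots> = (\<Sum>p\<in>R. lam (be l * be p) * cf p (sm v i j t * be k))"
    proof (intro sum.cong refl)
      fix p assume p: "p \<in> R"
      have "sm S a (j, p) t = sA (\<lambda>t. cf p (v j i t * be k)) t" unfolding sm_def S_def using p kl by simp
      also have "\<dots> = cf p (sA (\<lambda>t. be k * v j i t) t)" by (subst cf_sA) (use p kl vbL in \<open>auto simp: mult.commute\<close>)
      finally show "sm S a (j, p) t * h p l = lam (be l * be p) * cf p (sm v i j t * be k)"
        using h p kl by (simp add: sA_scale sm_def mult.commute)
    qed
    also have "\<dots> = lam (be l * (sm v i j t * be k))"
      by (rule Lx) (use kl be sA_in[OF L'(1) KL'] vL in \<open>auto simp: sm_def Ls'\<close>)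
    finally have 2: "mm ?J (sm S) (smat ?J (bl h)) a b t = lam (be l * (sm v i j t * be k))" .
    have smL: "sm v i j t \<in> L'" unfolding sm_def by (rule sA_in[OF L'(1) KL' vL])
    have "lam (be k * (v i j t * be l)) + lam (be l * (sm v i j t * be k)) = lam ((v + sm v) i j t * (be k * be l))"
      using lam(1)[of "be k * (v i j t * be l)" "be l * (sm v i j t * be k)"] be kl vL smL
      by (simp add: Ls' algebra_simps)
    also have "\<dots> = lam (Em I i j t * (be k * be l))" using v(3) by simp
    also have "\<dots> = Em I i j t * lam (be k * be l)"
      by (rule lam(2)) (use be kl gL Ls in \<open>auto simp: Ls' Em_def\<close>)
    also have "\<dots> = smat ?J (bl h) a b t" using kl h by (auto simp: Em_def smat_def bl_def)
    finally show ?thesis using 1 2 by simp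
  next
    case False
    have "S c b t = 0" if "b \<notin> ?J" for c using that SB unfolding Bm_def by blast
    moreover have "sm S a c t = 0" if "a \<notin> ?J" for c using that sSB unfolding Bm_def by blast
    ultimately show ?thesis using False unfolding plus_fun_apply smat_mult(1)[OF J SB] smat_mult(2)[OF J sSB]
      by (auto simp: smat_def)
  qed
  hence "mm ?J (smat ?J (bl h)) S + mm ?J (sm S) (smat ?J (bl h)) = smat ?J (bl h)" by (intro ext)
  thus ?thesis using that SB SS by blast
qed

end

section \<open>Roots over almost real closed fields\<close>

lemma subfld_power: "subfld L \<Longrightarrow> x \<in> L \<Longrightarrow> x ^ n \<in> L"
  by (induction n) (auto simp: subfldD)

lemma subfld_of_nat: "subfld L \<Longrightarrow> of_nat n \<in> L"
  by (induction n) (auto simp: subfldD)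

text \<open>Compare coefficients in \<open>F' = - F P\<close>, where \<open>P\<close> is the
  generating series of the power sums: this is the logarithmic derivative of the product.\<close>

lemma newton_identity:
  fixes xs :: "'c::field list"
  defines "F \<equiv> prod_list (map (\<lambda>a. 1 - fps_const a * fps_X) xs)"
  shows "of_nat (Suc n) * fps_nth F (Suc n) = - (\<Sum>i=0..n. fps_nth F i * (\<Sum>a\<leftarrow>xs. a ^ Suc (n - i)))"
proof -
  define P where "P xs = Abs_fps (\<lambda>n. \<Sum>a\<leftarrow>xs. a ^ Suc n)" for xs :: "'c list"
  have geo: "(1 - fps_const a * fps_X) * Abs_fps (\<lambda>n. a ^ Suc n) = fps_const a" for a :: 'c
  proof (rule fps_ext)
    fix n
    show "fps_nth ((1 - fps_const a * fps_X) * Abs_fps (\<lambda>n. a ^ Suc n)) n = fps_nth (fps_const a) n"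
      by (cases n) (simp_all add: left_diff_distrib mult.assoc)
  qed
  have "fps_deriv (prod_list (map (\<lambda>a. 1 - fps_const a * fps_X) xs)) =
      - (prod_list (map (\<lambda>a. 1 - fps_const a * fps_X) xs) * P xs)"
  proof (induction xs)
    case Nil
    show ?case by (simp add: P_def fps_zero_def[symmetric])
  next
    case (Cons a xs)
    let ?G = "prod_list (map (\<lambda>a. 1 - fps_const a * fps_X) xs)"
    have P: "P (a # xs) = Abs_fps (\<lambda>n. a ^ Suc n) + P xs" unfolding P_def by (simp add: fps_eq_iff)
    have "fps_deriv ((1 - fps_const a * fps_X) * ?G) = (1 - fps_const a * fps_X) * fps_deriv ?G - fps_const a * ?G"
      by (simp add: algebra_simps)
    also have "\<dots> = - ((1 - fps_const a * fps_X) * ?G * P xs) - (1 - fps_const a * fps_X) * Abs_fps (\<lambda>n. a ^ Suc n) * ?G"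
      unfolding Cons geo by simp
    also have "\<dots> = - ((1 - fps_const a * fps_X) * ?G * P (a # xs))" unfolding P by (simp add: algebra_simps)
    finally show ?case by simp
  qed
  hence "fps_nth (fps_deriv F) n = fps_nth (- (F * P xs)) n" unfolding F_def by simp
  thus ?thesis by (simp add: fps_mult_nth P_def)
qed

lemma degree_prod_roots: "degree (prod_list (map (\<lambda>a. [:- a, 1:]) xs)) = length (xs :: 'c::field list)"
proof (induction xs)
  case (Cons a xs)
  have "prod_list (map (\<lambda>a. [:- a, 1:]) xs) \<noteq> 0" by (auto simp: prod_list_zero_iff)
  thus ?case using Cons by (simp add: degree_mult_eq del: mult_pCons_left)
qed simp

lemma prod_roots_reverse:
  fixes xs :: "'c::field list"
  shows "fps_nth (prod_list (map (\<lambda>a. 1 - fps_const a * fps_X) xs)) k =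
    (if k \<le> length xs then coeff (prod_list (map (\<lambda>a. [:- a, 1:]) xs)) (length xs - k) else 0)"
proof (induction xs arbitrary: k)
  case (Cons a xs)
  let ?F = "prod_list (map (\<lambda>a. 1 - fps_const a * fps_X) xs)"
  let ?p = "prod_list (map (\<lambda>a. [:- a, 1:]) xs)"
  have lead: "coeff ?p (Suc (length xs)) = 0"
    by (rule coeff_eq_0) (simp add: degree_prod_roots)
  show ?case
  proof (cases k)
    case 0
    have "fps_nth ((1 - fps_const a * fps_X) * ?F) 0 = fps_nth ?F 0" by simp
    thus ?thesis using 0 Cons[of 0] lead by simp
  next
    case (Suc j)
    have "fps_nth ((1 - fps_const a * fps_X) * ?F) k = fps_nth ?F k - a * fps_nth ?F j"
      using Suc by (simp add: left_diff_distrib mult.assoc)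
    moreover have "coeff ([:- a, 1:] * ?p) (Suc (length xs) - k) = coeff ?p (length xs - k) - a * coeff ?p (length xs - j)" if "k \<le> length xs"
      using Suc that by (simp add: Suc_diff_le flip: Suc_diff_Suc)
    ultimately show ?thesis using Suc Cons[of k] Cons[of j] by (auto simp: not_le le_Suc_eq)
  qed
qed simp

definition pol :: "'c::field set \<Rightarrow> 'c poly \<Rightarrow> bool" where "pol L p \<longleftrightarrow> (\<forall>n. coeff p n \<in> L)"

text \<open>In characteristic 0 Newton's identities determine coefficients and power sums
  recursively from each other. This takes the place of the theorem on symmetric polynomials: whether
  a polynomial given by its roots lies over \<open>L\<close> is decided by computing power
  sums.\<close>

lemma pol_iff_power_sums:
  fixes xs :: "'c::field list"
  assumes L: "subfld L" and ch0: "\<And>n. of_nat (Suc n) \<noteq> (0::'c)"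
  shows "pol L (prod_list (map (\<lambda>a. [:- a, 1:]) xs)) \<longleftrightarrow> (\<forall>k. (\<Sum>a\<leftarrow>xs. a ^ Suc k) \<in> L)"
proof -
  define F where "F = prod_list (map (\<lambda>a. 1 - fps_const a * fps_X) xs)"
  let ?p = "prod_list (map (\<lambda>a. [:- a, 1:]) xs)"
  define S where "S k = (\<Sum>a\<leftarrow>xs. a ^ Suc k)" for k
  note Ls = subfldD[OF L]
  have F: "fps_nth F k = (if k \<le> length xs then coeff ?p (length xs - k) else 0)" for k
    unfolding F_def by (rule prod_roots_reverse)
  have N: "of_nat (Suc n) * fps_nth F (Suc n) = - (\<Sum>i=0..n. fps_nth F i * S (n - i))" for n
    unfolding F_def S_def by (rule newton_identity)
  have F0: "fps_nth F 0 = 1" unfolding F_def by (induction xs) auto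
  have deg: "degree ?p = length xs" by (rule degree_prod_roots)
  have "pol L ?p \<longleftrightarrow> (\<forall>k. fps_nth F k \<in> L)"
  proof
    assume "pol L ?p" thus "\<forall>k. fps_nth F k \<in> L" using Ls unfolding F pol_def by auto
  next
    assume a: "\<forall>k. fps_nth F k \<in> L"
    show "pol L ?p" unfolding pol_def
    proof
      fix n show "coeff ?p n \<in> L"
      proof (cases "n \<le> length xs")
        case True
        thus ?thesis using a F[of "length xs - n"] by (metis diff_diff_cancel diff_le_self)
      qed (use deg Ls coeff_eq_0[of ?p n] in auto)
    qed
  qed
  also have "\<dots> \<longleftrightarrow> (\<forall>k. S k \<in> L)"
  proof
    assume a: "\<forall>k. fps_nth F k \<in> L"
    show "\<forall>k. S k \<in> L"
    proof
      fix k show "S k \<in> L"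
      proof (induction k rule: less_induct)
        case (less n)
        have "(\<Sum>i=0..n. fps_nth F i * S (n - i)) = S n + (\<Sum>i=1..n. fps_nth F i * S (n - i))"
          by (subst sum.atLeast_Suc_atMost) (auto simp: F0)
        hence "S n = - (of_nat (Suc n) * fps_nth F (Suc n)) - (\<Sum>i=1..n. fps_nth F i * S (n - i))"
          unfolding N by simp
        also have "\<dots> \<in> L" using a less subfld_of_nat[OF L, of "Suc n"]
          by (intro Ls(7) Ls(4) Ls(5) subfld_sum[OF L]) auto
        finally show ?case .
      qed
    qed
  next
    assume a: "\<forall>k. S k \<in> L"
    show "\<forall>k. fps_nth F k \<in> L"
    proof
      fix k show "fps_nth F k \<in> L"
      proof (induction k rule: less_induct)
        case (less n)
        show ?case
        proof (cases n)
          case (Suc j)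
          have "fps_nth F (Suc j) = - (\<Sum>i=0..j. fps_nth F i * S (j - i)) / of_nat (Suc j)"
            using N[of j] ch0[of j] by (simp add: field_simps del: of_nat_Suc)
          also have "\<dots> \<in> L" using a less Suc subfld_of_nat[OF L, of "Suc j"]
            by (intro Ls(8) Ls(4) subfld_sum[OF L] Ls(5)) auto
          finally show ?thesis using Suc by simp
        qed (use F0 Ls in simp)
      qed
    qed
  qed
  finally show ?thesis unfolding S_def .
qed

text \<open>Polynomials are represented by lists of their roots, the form in which power sums and
  Laplace's argument use them.\<close>

locale almost_real_closed =
  fixes L :: "'c::field set" and ii :: 'c
  assumes euc: "euclidean L" and ch0: "\<And>n. of_nat (Suc n) \<noteq> (0::'c)" and ii: "ii * ii = - 1"
    and odd_root: "\<And>xs. odd (length xs) \<Longrightarrow> pol L (prod_list (map (\<lambda>a. [:- a, 1:]) xs)) \<Longrightarrow> \<exists>a\<in>set xs. a \<in> L"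
begin

lemmas L = euclideanD(1)[OF euc]
lemmas Ls = subfldD[OF L]

lemma two0: "(2::'c) \<noteq> 0" using ch0[of 1] by simp

lemma of_nat_eq: "of_nat a = (of_nat b :: 'c) \<Longrightarrow> a = b"
proof (induction a b rule: linorder_wlog)
  case (le a b)
  then obtain c where c: "b = a + c" using le_Suc_ex by blast
  with le ch0 show ?case by (cases c) auto
qed auto

definition M :: "'c set" where "M = {a + b * ii | a b. a \<in> L \<and> b \<in> L}"

lemma L_M: "a \<in> L \<Longrightarrow> a \<in> M" unfolding M_def using Ls(1) by (intro CollectI exI[of _ a] exI[of _ 0]) simp

lemma M_add: "x \<in> M \<Longrightarrow> y \<in> M \<Longrightarrow> x + y \<in> M"
  unfolding M_def
proof safe
  fix a b c d assume "a \<in> L" "b \<in> L" "c \<in> L" "d \<in> L"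
  thus "\<exists>a' b'. a + b * ii + (c + d * ii) = a' + b' * ii \<and> a' \<in> L \<and> b' \<in> L"
    by (intro exI[of _ "a + c"] exI[of _ "b + d"]) (auto simp: Ls algebra_simps)
qed

lemma M_mult: "x \<in> M \<Longrightarrow> y \<in> M \<Longrightarrow> x * y \<in> M"
  unfolding M_def
proof safe
  fix a b c d assume "a \<in> L" "b \<in> L" "c \<in> L" "d \<in> L"
  moreover have "(a + b * ii) * (c + d * ii) = a * c + b * d * (ii * ii) + (a * d + b * c) * ii"
    by (simp add: algebra_simps)
  ultimately show "\<exists>a' b'. (a + b * ii) * (c + d * ii) = a' + b' * ii \<and> a' \<in> L \<and> b' \<in> L"
    unfolding ii by (intro exI[of _ "a * c - b * d"] exI[of _ "a * d + b * c"]) (auto simp: Ls)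
qed

lemma M_minus: "x \<in> M \<Longrightarrow> - x \<in> M"
  using M_mult[of "- 1" x] L_M[of "- 1"] by (simp add: Ls)

lemma M_diff: "x \<in> M \<Longrightarrow> y \<in> M \<Longrightarrow> x - y \<in> M"
  using M_add[of x "- y"] M_minus[of y] by simp

text \<open>The classical formula: with \<open>r\<close> the nonnegative root of
  \<open>a^2 + b^2\<close>, real and imaginary part of the root are square roots of
  \<open>(r + a) / 2\<close> and \<open>(r - a) / 2\<close>.\<close>

lemma M_sqrt: assumes "z \<in> M" shows "\<exists>w\<in>M. w * w = z"
proof -
  obtain a b where ab: "a \<in> L" "b \<in> L" "z = a + b * ii" using assms unfolding M_def by auto
  note Q = euclideanD[OF euc]
  have sq: "x * x \<in> sqs L" if "x \<in> L" for x using that unfolding sqs_def by blast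
  have two: "(2::'c) \<in> sqs L" using Q(2)[OF sqs_one[OF L] sqs_one[OF L]] by simp
  have "2 * (1/2 * (1/2)) = (1/2::'c)" using two0 by (simp only: mult.assoc[symmetric]) simp
  hence half: "(1/2::'c) \<in> sqs L" using sqs_mult[OF L two sq[of "1/2"]] sqs_sub[OF L two] by (metis Ls(2,8))
  obtain r0 where r0: "r0 \<in> L" "r0 * r0 = a * a + b * b"
    using Q(2)[OF sq[OF ab(1)] sq[OF ab(2)]] unfolding sqs_def by auto
  obtain r where r: "r \<in> sqs L" "r * r = a * a + b * b"
    using Q(3)[OF r0(1)] r0 by (metis minus_mult_minus)
  have rL: "r \<in> L" using r sqs_sub[OF L] by blast
  \<comment> \<open>\<open>r + c\<close> and \<open>r - c\<close> have a square as product and the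
    nonnegative \<open>2 r\<close> as sum, so neither of them is negative.\<close>
  have key: "r + c \<in> sqs L" if c: "c \<in> L" "(r + c) * (r - c) = b * b" for c
  proof (rule ccontr)
    assume n: "r + c \<notin> sqs L"
    hence n1: "- (r + c) \<in> sqs L" using Q(3)[of "r + c"] rL c by (simp add: Ls)
    have "- (r - c) \<in> sqs L"
    proof (rule ccontr)
      assume n': "- (r - c) \<notin> sqs L"
      hence "r - c \<in> sqs L" using Q(3)[of "r - c"] rL c by (simp add: Ls)
      hence "- (r + c) * (r - c) \<in> sqs L" using n1 sqs_mult[OF L] by blast
      moreover have "- (r + c) * (r - c) = - (b * b)" using c by (metis mult_minus_left)
      ultimately have "- (b * b) \<in> sqs L" by simp
      hence "b * b = 0" using Q(4)[OF sq[OF ab(2)]] by blast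
      hence "r + c = 0 \<or> r - c = 0" using c by simp
      thus False using n n' sqs_zero[OF L] by auto
    qed
    hence "- (r + c) + - (r - c) \<in> sqs L" using n1 Q(2) by blast
    hence "- (2 * r) \<in> sqs L" by (simp add: algebra_simps)
    hence "2 * r = 0" using Q(4)[OF sqs_mult[OF L two r(1)]] by blast
    hence r0: "r = 0" using two0 by simp
    have "a * a = - (b * b)" using r r0 by (simp add: eq_neg_iff_add_eq_0)
    hence "b * b = 0" using Q(4)[OF sq[OF ab(2)]] sq[OF ab(1)] by metis
    hence "c = 0" using c r0 by simp
    thus False using n r0 sqs_zero[OF L] by simp
  qed
  have rr: "(r + a) * (r - a) = b * b" using r by (simp add: algebra_simps)
  obtain c where c: "c \<in> L" "c * c = (r + a) * (1/2)"
    using sqs_mult[OF L key[OF ab(1) rr] half] unfolding sqs_def by auto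
  have "r + - a \<in> sqs L" by (rule key) (use ab rr in \<open>auto simp: Ls algebra_simps\<close>)
  hence "(r - a) * (1/2) \<in> sqs L" using sqs_mult[OF L _ half, of "r - a"] by simp
  then obtain d where d: "d \<in> L" "d * d = (r - a) * (1/2)" unfolding sqs_def by (smt (verit) mem_Collect_eq)
  have "2 * (z * (1/2)) = z" for z :: 'c using two0 by simp
  hence "(2 * (c * c)) * (2 * (d * d)) = (r + a) * (r - a)" unfolding c d by metis
  moreover have "(2 * c * d) * (2 * c * d) = (2 * (c * c)) * (2 * (d * d))" by (simp only: ac_simps)
  ultimately have "(2 * c * d) * (2 * c * d) = b * b" using rr by metis
  hence "2 * c * d = b \<or> 2 * c * d = - b" by (simp only: square_eq_iff)
  \<comment> \<open>The sign of \<open>d\<close> is chosen so that the imaginary part becomes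
    \<open>b\<close> and not \<open>- b\<close>.\<close>
  then obtain d' where d': "d' \<in> L" "d' * d' = (r - a) * (1/2)" "2 * c * d' = b"
  proof
    assume "2 * c * d = - b" thus thesis using that[of "- d"] d by (simp add: Ls)
  qed (use that d in blast)
  have "(c + d' * ii) * (c + d' * ii) = c * c + (d' * d') * (ii * ii) + 2 * c * d' * ii" by (simp add: algebra_simps)
  also have "\<dots> = (1/2) * (2 * a) + b * ii" 
  proof -
    have *: "(r + a) * h + (r - a) * h * (- 1) = h * (2 * a)" for h :: 'c by (simp add: algebra_simps)
    show ?thesis unfolding c d' ii * ..
  qed
  also have "\<dots> = z" unfolding ab using two0 by simp
  finally show ?thesis using c d' unfolding M_def by blast
qed

text \<open>Laplace's argument. If \<open>2\<close> divides the number of roots \<open>x i\<close>, the products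
  \<open>(t + x i) (t + x j)\<close> are the roots of a polynomial over \<open>L\<close> whose degree is less divisible by 2; if
  one of them is in \<open>M\<close> for two values of \<open>t\<close>, then \<open>x i + x j\<close> and \<open>x i * x j\<close> are in \<open>M\<close>.\<close>

lemma laplace:
  "\<lbrakk>n = 2 ^ k * (m::nat); odd m; \<forall>j. (\<Sum>i<n. x i ^ Suc j) \<in> L\<rbrakk> \<Longrightarrow> \<exists>i<n. x i \<in> M"
proof (induction k arbitrary: n m x)
  case 0
  let ?xs = "map x [0..<n]"
  have S: "(\<Sum>a\<leftarrow>?xs. a ^ Suc k) = (\<Sum>i<n. x i ^ Suc k)" for k
    by (simp add: interv_sum_list_conv_sum_set_nat lessThan_atLeast0 comp_def del: power_Suc)
  have "pol L (prod_list (map (\<lambda>a. [:- a, 1:]) ?xs))"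
    unfolding pol_iff_power_sums[OF L ch0] S using 0 by blast
  moreover have "odd (length ?xs)" using 0 by simp
  ultimately obtain a where "a \<in> set ?xs" "a \<in> L" using odd_root by blast
  thus ?case using L_M by auto
next
  case (Suc k)
  have n2: "even n" "n > 0" using Suc.prems by (auto intro!: Nat.gr0I)
  \<comment> \<open>There are \<open>n (n - 1) / 2\<close> pairs; as \<open>n\<close> is even,
    \<open>n - 1\<close> is odd and exactly one factor 2 is lost.\<close>
  define A where "A = {(i, j). i < j \<and> j < n}"
  have fA: "finite A" by (rule finite_subset[of _ "{..<n} \<times> {..<n}"]) (auto simp: A_def)
  have cA: "2 * card {(i, j). i < j \<and> j < n} = n * (n - 1)" for n :: nat
  proof (induction n)
    case (Suc n)
    have e: "{(i, j). i < j \<and> j < Suc n} = {(i, j). i < j \<and> j < n} \<union> (\<lambda>i. (i, n)) ` {..<n}" by auto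
    have f: "finite {(i, j). i < j \<and> j < n}" by (rule finite_subset[of _ "{..<n} \<times> {..<n}"]) auto
    have "card {(i, j). i < j \<and> j < Suc n} = card {(i, j). i < j \<and> j < n} + n"
      unfolding e by (subst card_Un_disjoint) (auto simp: f card_image inj_on_def)
    thus ?case using Suc by (cases n) auto
  qed simp
  have card: "card A = 2 ^ k * (m * (n - 1))" using cA[of n] Suc.prems(1) unfolding A_def[symmetric] by simp
  have odd': "odd (m * (n - 1))" using Suc.prems(2) n2 by auto
  obtain h where h: "bij_betw h {0..<card A} A" using ex_bij_betw_nat_finite[OF fA] by blast
  define y where "y t = (\<lambda>(i, j). (of_nat t + x i) * (of_nat t + x j))" for t
  have shift: "(\<Sum>i<n. (of_nat t + x i) ^ Suc j) \<in> L" for t j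
  proof -
    have pL: "(\<Sum>i<n. x i ^ l) \<in> L" for l
      using Suc.prems(3) subfld_of_nat[OF L, of n] by (cases l) auto
    have "(\<Sum>i<n. (of_nat t + x i) ^ Suc j) = (\<Sum>i<n. \<Sum>l\<le>Suc j. of_nat (Suc j choose l) * of_nat t ^ l * x i ^ (Suc j - l))"
      by (simp only: binomial_ring)
    also have "\<dots> = (\<Sum>l\<le>Suc j. of_nat (Suc j choose l) * of_nat t ^ l * (\<Sum>i<n. x i ^ (Suc j - l)))"
      by (subst sum.swap) (simp only: sum_distrib_left)
    also have "\<dots> \<in> L" by (intro subfld_sum[OF L] Ls(5) pL subfld_power[OF L] subfld_of_nat[OF L])
    finally show ?thesis .
  qed
  have two: "(2::'c) \<in> L" using subfld_of_nat[OF L, of 2] by simp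
  \<comment> \<open>The square of a power sum of the shifted roots counts every unordered pair twice
    and the diagonal once, and the diagonal is again a power sum of them.\<close>
  have pairs: "(\<Sum>p\<in>A. y t p ^ Suc j) \<in> L" for t j
  proof -
    define u where "u i = (of_nat t + x i) ^ Suc j" for i
    have yu: "y t p ^ Suc j = u (fst p) * u (snd p)" for p unfolding y_def u_def by (simp only: case_prod_unfold power_mult_distrib)
    have "(\<Sum>i<n. u i) * (\<Sum>i<n. u i) = (\<Sum>p\<in>{..<n} \<times> {..<n}. u (fst p) * u (snd p))"
      by (simp add: sum_product sum.cartesian_product case_prod_unfold)
    also have "{..<n} \<times> {..<n} = A \<union> (\<lambda>(i, j). (j, i)) ` A \<union> (\<lambda>i. (i, i)) ` {..<n}"
      unfolding A_def by (auto simp: image_iff)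
    also have "(\<Sum>p\<in>\<dots>. u (fst p) * u (snd p)) = (\<Sum>p\<in>A. u (fst p) * u (snd p)) +
        (\<Sum>p\<in>(\<lambda>(i, j). (j, i)) ` A. u (fst p) * u (snd p)) + (\<Sum>p\<in>(\<lambda>i. (i, i)) ` {..<n}. u (fst p) * u (snd p))"
      by (subst sum.union_disjoint, use fA in \<open>auto simp: A_def\<close>)+
    also have "(\<Sum>p\<in>(\<lambda>(i, j). (j, i)) ` A. u (fst p) * u (snd p)) = (\<Sum>p\<in>A. u (fst p) * u (snd p))"
      by (subst sum.reindex) (auto simp: inj_on_def case_prod_unfold mult.commute)
    also have "(\<Sum>p\<in>(\<lambda>i. (i, i)) ` {..<n}. u (fst p) * u (snd p)) = (\<Sum>i<n. (of_nat t + x i) ^ Suc (2 * j + 1))"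
    proof (subst sum.reindex)
      have "Suc (2 * j + 1) = Suc j + Suc j" by simp
      hence "u i * u i = (of_nat t + x i) ^ Suc (2 * j + 1)" for i unfolding u_def by (simp only: power_add)
      thus "sum ((\<lambda>p. u (fst p) * u (snd p)) \<circ> (\<lambda>i. (i, i))) {..<n} = (\<Sum>i<n. (of_nat t + x i) ^ Suc (2 * j + 1))"
        by simp
    qed (auto simp: inj_on_def)
    finally have "(\<Sum>p\<in>A. y t p ^ Suc j) = ((\<Sum>i<n. u i) * (\<Sum>i<n. u i) - (\<Sum>i<n. (of_nat t + x i) ^ Suc (2 * j + 1))) / 2"
      unfolding yu using two0 by (simp add: field_simps)
    also have "\<dots> \<in> L" unfolding u_def by (intro Ls(8) Ls(7) Ls(5) shift two)
    finally show ?thesis .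
  qed
  have ex: "\<exists>p\<in>A. y t p \<in> M" for t
  proof -
    have "(\<Sum>i<card A. y t (h i) ^ Suc j) = (\<Sum>p\<in>A. y t p ^ Suc j)" for j
      using sum.reindex_bij_betw[OF h, of "\<lambda>p. y t p ^ Suc j"] by (simp only: lessThan_atLeast0)
    hence "\<exists>i<card A. y t (h i) \<in> M" using pairs by (intro Suc.IH[OF card odd']) simp
    thus ?thesis using h unfolding bij_betw_def by auto
  qed
  then obtain c where c: "\<And>t. c t \<in> A \<and> y t (c t) \<in> M" by metis
  \<comment> \<open>There are finitely many pairs but infinitely many shifts \<open>t\<close>, so
    two different shifts share a pair.\<close>
  have "\<exists>a0\<in>UNIV. infinite {a \<in> UNIV. c a = c a0}"
    by (rule pigeonhole_infinite) (use c fA finite_subset[of "range c" A] in auto)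
  then obtain t0 where inf: "infinite {t. c t = c t0}" by auto
  obtain i j where ij: "c t0 = (i, j)" by fastforce
  have ijn: "i < n" "j < n" using c[of t0] ij unfolding A_def by auto
  obtain t1 where t1: "c t1 = c t0" "t1 \<noteq> t0"
    using infinite_remove[OF inf, of t0] by (metis (mono_tags, lifting) DiffD1 DiffD2 all_not_in_conv finite.emptyI insertI1 mem_Collect_eq)
  have y0: "y t0 (i, j) \<in> M" "y t1 (i, j) \<in> M" using c[of t0] c[of t1] t1 ij by auto
  define s p where "s = x i + x j" and "p = x i * x j"
  have yt: "y t (i, j) = of_nat t * of_nat t + of_nat t * s + p" for t
    unfolding y_def s_def p_def by (simp add: algebra_simps)
  define D where "D = (of_nat t1 - of_nat t0 :: 'c)"
  have D0: "D \<noteq> 0" unfolding D_def using t1 of_nat_eq by auto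
  have tM: "of_nat t \<in> M" for t using subfld_of_nat[OF L] L_M by blast
  have "y t1 (i, j) - y t0 (i, j) - (of_nat t1 * of_nat t1 - of_nat t0 * of_nat t0) = D * s"
    unfolding yt D_def by (simp add: algebra_simps)
  moreover have "y t1 (i, j) - y t0 (i, j) - (of_nat t1 * of_nat t1 - of_nat t0 * of_nat t0) \<in> M"
    by (intro M_diff M_mult y0 tM)
  ultimately have "D * s \<in> M" by simp
  moreover have "1 / D \<in> M" unfolding D_def using subfld_of_nat[OF L] by (intro L_M Ls(8) Ls(2) Ls(7)) auto
  ultimately have sM: "s \<in> M" using M_mult[of "1 / D" "D * s"] D0 by simp
  have "p = y t0 (i, j) - of_nat t0 * of_nat t0 - of_nat t0 * s" unfolding yt by simp
  hence pM: "p \<in> M" using y0 tM sM M_diff M_mult by metis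
  \<comment> \<open>This is the discriminant of the quadratic polynomial with the roots
    \<open>x i\<close> and \<open>x j\<close>.\<close>
  have "s * s - (2 * 2) * p \<in> M" using sM pM two L_M by (intro M_diff M_mult) auto
  then obtain w where w: "w \<in> M" "w * w = s * s - (2 * 2) * p" using M_sqrt by metis
  have "(2 * x i - s) * (2 * x i - s) = w * w" unfolding w s_def p_def by (simp add: algebra_simps)
  hence "2 * x i - s = w \<or> 2 * x i - s = - w" by (simp only: square_eq_iff)
  hence "2 * x i = s + w \<or> 2 * x i = s - w" by (auto simp: algebra_simps)
  hence "2 * x i \<in> M" using sM w M_add M_diff by auto
  moreover have "1 / 2 \<in> M" using two by (intro L_M Ls(8) Ls(2))
  ultimately have "x i \<in> M" using M_mult[of "1 / 2" "2 * x i"] two0 by simp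
  thus ?case using ijn by blast
qed

lemma root_in_M:
  assumes "xs \<noteq> []" "pol L (prod_list (map (\<lambda>a. [:- a, 1:]) xs))"
  shows "\<exists>a\<in>set xs. a \<in> M"
proof -
  define n where "n = length xs"
  have "n > 0" using assms unfolding n_def by simp
  obtain k m where km: "n = 2 ^ k * m" "odd m" using \<open>n > 0\<close>
  proof (induction n arbitrary: thesis rule: less_induct)
    case (less n)
    show ?case
    proof (cases "odd n")
      case True thus ?thesis using less.prems(1)[of 0 n] by simp
    next
      case False
      then obtain h where h: "n = 2 * h" by auto
      obtain k m where "h = 2 ^ k * m" "odd m" using less.IH[of h] h less.prems by auto
      thus ?thesis using less.prems(1)[of "Suc k" m] h by simp
    qed
  qed
  have "(\<Sum>a\<leftarrow>xs. a ^ Suc j) = (\<Sum>i<n. (xs ! i) ^ Suc j)" for j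
    unfolding n_def by (simp add: sum_list_sum_nth lessThan_atLeast0 del: power_Suc)
  hence "\<forall>j. (\<Sum>i<n. (xs ! i) ^ Suc j) \<in> L" using assms(2) unfolding pol_iff_power_sums[OF L ch0] by metis
  from laplace[OF km this] show ?thesis unfolding n_def by auto
qed

end

section \<open>Simple extensions\<close>

lemma pol_simps:
  assumes L: "subfld L"
  shows "pol L 0" "pol L p \<Longrightarrow> pol L q \<Longrightarrow> pol L (p + q)" "pol L p \<Longrightarrow> pol L q \<Longrightarrow> pol L (p - q)"
    "c \<in> L \<Longrightarrow> pol L p \<Longrightarrow> pol L (smult c p)" "c \<in> L \<Longrightarrow> pol L (monom c n)"
    "pol L (pCons c p) \<longleftrightarrow> c \<in> L \<and> pol L p" "pol L p \<Longrightarrow> pol L q \<Longrightarrow> pol L (p * q)"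
proof -
  note Ls = subfldD[OF L]
  show 0: "pol L 0" and add: "pol L p \<Longrightarrow> pol L q \<Longrightarrow> pol L (p + q)" and "pol L p \<Longrightarrow> pol L q \<Longrightarrow> pol L (p - q)"
    "c \<in> L \<Longrightarrow> pol L p \<Longrightarrow> pol L (smult c p)" "c \<in> L \<Longrightarrow> pol L (monom c n)" for p q c
    unfolding pol_def by (auto simp: Ls)
  show "pol L (pCons c p) \<longleftrightarrow> c \<in> L \<and> pol L p"
    unfolding pol_def by (metis coeff_pCons_0 coeff_pCons_Suc not0_implies_Suc)
  show "pol L p \<Longrightarrow> pol L q \<Longrightarrow> pol L (p * q)"
    unfolding pol_def coeff_mult by (auto intro!: subfld_sum[OF L] Ls)
qed

lemma pol_division:
  assumes L: "subfld L" and q: "pol L q" "lead_coeff q = 1"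
  shows "pol L p \<Longrightarrow> \<exists>s t. pol L s \<and> pol L t \<and> p = q * s + t \<and> (t = 0 \<or> degree t < degree q)"
proof (induction "degree p" arbitrary: p rule: less_induct)
  case less
  show ?case
  proof (cases "p = 0 \<or> degree p < degree q")
    case True
    thus ?thesis using less.prems pol_simps(1)[OF L] by (intro exI[of _ 0] exI[of _ p]) auto
  next
    case False
    define m where "m = monom (lead_coeff p) (degree p - degree q)"
    have mL: "pol L m" unfolding m_def using less.prems by (intro pol_simps(5)[OF L]) (simp add: pol_def)
    define p' where "p' = p - q * m"
    have p'L: "pol L p'" unfolding p'_def by (intro pol_simps[OF L] less.prems q mL)
    have "lead_coeff p \<noteq> 0" using False by simp
    hence dm: "degree m = degree p - degree q" "lead_coeff m = lead_coeff p" unfolding m_def by (simp_all add: degree_monom_eq)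
    have q0: "q \<noteq> 0" "m \<noteq> 0" using q(2) dm(2) \<open>lead_coeff p \<noteq> 0\<close> by auto
    have dqm: "degree (q * m) = degree p" using False dm q0 by (simp add: degree_mult_eq)
    have "coeff (q * m) (degree p) = lead_coeff p" using lead_coeff_mult[of q m] dqm q dm by simp
    hence "coeff p' (degree p) = 0" unfolding p'_def by simp
    moreover have "degree p' \<le> degree p" unfolding p'_def by (rule degree_diff_le) (use dqm in auto)
    ultimately have "p' = 0 \<or> degree p' < degree p" by (metis leading_coeff_0_iff le_neq_implies_less)
    then obtain s t where "pol L s" "pol L t" "p' = q * s + t" "t = 0 \<or> degree t < degree q"
    proof
      assume "p' = 0"
      thus thesis using that[of 0 0] pol_simps(1)[OF L] by simp
    qed (use less.hyps[OF _ p'L] that in blast)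
    thus ?thesis using mL pol_simps(2)[OF L]
      by (intro exI[of _ "s + m"] exI[of _ t]) (auto simp: p'_def algebra_simps)
  qed
qed

text \<open>\<open>r\<close> is the degree of \<open>\<alpha>\<close> over \<open>L\<close>,
  obtained as the least exponent at which the power depends on the lower ones. The span
  \<open>L'\<close> of the lower powers contains inverses because a polynomial relation of least
  degree for a nonzero element has nonzero constant term.\<close>

lemma simple_extension:
  assumes L: "subfld L" and p: "pol L p" "p \<noteq> 0" "poly p \<alpha> = 0"
  obtains r f L' where "0 < r" "r \<le> degree p" "\<And>k. f k \<in> L" "\<alpha> ^ r = (\<Sum>k<r. f k * \<alpha> ^ k)"
    "\<And>c. (\<forall>k<r. c k \<in> L) \<Longrightarrow> (\<Sum>k<r. c k * \<alpha> ^ k) = 0 \<Longrightarrow> \<forall>k<r. c k = 0"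
    "subfld L'" "L \<subseteq> L'" "\<alpha> \<in> L'" "\<And>x. x \<in> L' \<longleftrightarrow> (\<exists>c. (\<forall>k<r. c k \<in> L) \<and> x = (\<Sum>k<r. c k * \<alpha> ^ k))"
proof -
  note Ls = subfldD[OF L]
  define S where "S n = {x. \<exists>c. (\<forall>k<n. c k \<in> L) \<and> x = (\<Sum>k<n. c k * \<alpha> ^ k)}" for n
  have dep: "\<alpha> ^ t \<in> S t" if "\<forall>k\<le>t. c k \<in> L" "(\<Sum>k\<le>t. c k * \<alpha> ^ k) = 0" "c t \<noteq> 0" for c t
  proof -
    have "(\<Sum>k<t. c k * \<alpha> ^ k) + c t * \<alpha> ^ t = 0" using that(2) by (simp add: lessThan_Suc_atMost[symmetric])
    hence "\<alpha> ^ t = - (\<Sum>k<t. c k * \<alpha> ^ k) / c t" using that(3) by (simp add: field_simps eq_neg_iff_add_eq_0)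
    also have "\<dots> = (\<Sum>k<t. (- c k / c t) * \<alpha> ^ k)" by (simp add: sum_negf sum_divide_distrib)
    finally show ?thesis unfolding S_def using that by (auto simp: Ls intro!: exI[of _ "\<lambda>k. - c k / c t"])
  qed
  have "\<alpha> ^ degree p \<in> S (degree p)"
    by (rule dep[of _ "coeff p"]) (use p in \<open>auto simp: pol_def poly_altdef\<close>)
  define r where "r = (LEAST r. \<alpha> ^ r \<in> S r)"
  have r: "\<alpha> ^ r \<in> S r" unfolding r_def by (rule LeastI) fact
  have rp: "r \<le> degree p" unfolding r_def by (rule Least_le) fact
  have r0: "0 < r" using r unfolding S_def by (cases r) auto
  obtain f0 where f0: "\<forall>k<r. f0 k \<in> L" "\<alpha> ^ r = (\<Sum>k<r. f0 k * \<alpha> ^ k)" using r unfolding S_def by auto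
  define f where "f k = (if k < r then f0 k else 0)" for k
  have f: "f k \<in> L" "\<alpha> ^ r = (\<Sum>k<r. f k * \<alpha> ^ k)" for k using f0 Ls(1) unfolding f_def by auto
  have indep: "\<forall>k<r. c k = 0" if c: "\<forall>k<r. c k \<in> L" "(\<Sum>k<r. c k * \<alpha> ^ k) = 0" for c
  proof (rule ccontr)
    assume "\<not> (\<forall>k<r. c k = 0)"
    then obtain k where k: "k < r \<and> c k \<noteq> 0" by auto
    define t where "t = (GREATEST k. k < r \<and> c k \<noteq> 0)"
    have t: "t < r \<and> c t \<noteq> 0" unfolding t_def by (rule GreatestI_nat[of _ k r]) (use k in auto)
    have gt: "c j = 0" if "t < j" "j < r" for j
      using Greatest_le_nat[of "\<lambda>k. k < r \<and> c k \<noteq> 0" j r] that unfolding t_def by auto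
    have "(\<Sum>k\<le>t. c k * \<alpha> ^ k) = (\<Sum>k<r. c k * \<alpha> ^ k)"
      by (rule sum.mono_neutral_left) (use t gt in \<open>auto simp: not_le\<close>)
    hence "\<alpha> ^ t \<in> S t" using c t by (intro dep[of t c]) auto
    thus False using not_less_Least[of t "\<lambda>r. \<alpha> ^ r \<in> S r"] t unfolding r_def by blast
  qed
  define L' where "L' = S r"
  have S_add: "x + y \<in> L'" if xy: "x \<in> L'" "y \<in> L'" for x y
  proof -
    obtain c where "\<forall>k<r. c k \<in> L" "x = (\<Sum>k<r. c k * \<alpha> ^ k)"
      using xy(1) unfolding L'_def S_def by blast
    moreover obtain d where "\<forall>k<r. d k \<in> L" "y = (\<Sum>k<r. d k * \<alpha> ^ k)"
      using xy(2) unfolding L'_def S_def by blast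
    ultimately show ?thesis unfolding L'_def S_def
      by (intro CollectI exI[of _ "\<lambda>k. c k + d k"]) (auto simp: Ls sum.distrib distrib_right)
  qed
  have S_scale: "a * x \<in> L'" if ax: "a \<in> L" "x \<in> L'" for a x
  proof -
    obtain c where "\<forall>k<r. c k \<in> L" "x = (\<Sum>k<r. c k * \<alpha> ^ k)"
      using ax(2) unfolding L'_def S_def by blast
    thus ?thesis unfolding L'_def S_def using ax
      by (intro CollectI exI[of _ "\<lambda>k. a * c k"]) (auto simp: Ls sum_distrib_left mult.assoc)
  qed
  have S0: "0 \<in> L'" unfolding L'_def S_def using Ls(1) by (intro CollectI exI[of _ "\<lambda>_. 0"]) auto
  have S_sum: "sum F A \<in> L'" if "\<And>a. a \<in> A \<Longrightarrow> F a \<in> L'" for F and A :: "nat set"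
    using that by (induction A rule: infinite_finite_induct) (auto simp: S0 S_add)
  have pw: "\<alpha> ^ k \<in> L'" if "k < r" for k unfolding L'_def S_def
  proof (intro CollectI exI[of _ "\<lambda>j. if j = k then 1 else 0"] conjI)
    have "(\<Sum>j<r. (if j = k then 1 else 0) * \<alpha> ^ j) = (\<Sum>j<r. if j = k then \<alpha> ^ k else 0)" by (intro sum.cong) auto
    thus "\<alpha> ^ k = (\<Sum>j<r. (if j = k then 1 else 0) * \<alpha> ^ j)" using that by simp
  qed (use Ls in auto)
  have S_alpha: "\<alpha> * x \<in> L'" if x: "x \<in> L'" for x
  proof -
    obtain c where c: "\<forall>k<r. c k \<in> L" "x = (\<Sum>k<r. c k * \<alpha> ^ k)"
      using x unfolding L'_def S_def by blast
    have ar: "\<alpha> ^ r \<in> L'" unfolding L'_def by (rule r)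
    have "\<alpha> ^ Suc k \<in> L'" if "k < r" for k using pw[of "Suc k"] ar that by (cases "Suc k = r") auto
    hence "(\<Sum>k<r. c k * \<alpha> ^ Suc k) \<in> L'" using c by (intro S_sum S_scale) auto
    also have "(\<Sum>k<r. c k * \<alpha> ^ Suc k) = \<alpha> * x" unfolding c(2) sum_distrib_left by (intro sum.cong) auto
    finally show ?thesis .
  qed
  have S_pw: "\<alpha> ^ k * x \<in> L'" if "x \<in> L'" for k x
    by (induction k) (use that S_alpha in \<open>auto simp: mult.assoc\<close>)
  have S_mult: "x * y \<in> L'" if x: "x \<in> L'" "y \<in> L'" for x y
  proof -
    obtain c where c: "\<forall>k<r. c k \<in> L" "x = (\<Sum>k<r. c k * \<alpha> ^ k)"
      using x(1) unfolding L'_def S_def by blast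
    have "x * y = (\<Sum>k<r. c k * (\<alpha> ^ k * y))" unfolding c(2) by (simp add: sum_distrib_right mult.assoc)
    also have "\<dots> \<in> L'" using c x by (intro S_sum S_scale S_pw) auto
    finally show ?thesis .
  qed
  have S1: "1 \<in> L'" using pw[of 0] r0 by simp
  have LL': "L \<subseteq> L'" using S_scale[OF _ S1] by auto
  have S_poly: "poly q x \<in> L'" if "pol L q" "x \<in> L'" for q x
    using that(1) by (induction q) (use LL' that(2) S0 S_add S_mult in \<open>auto simp: pol_simps(6)[OF L]\<close>)
  have inv: "inverse x \<in> L'" if x: "x \<in> L'" "x \<noteq> 0" for x
  proof -
    have "x ^ i \<in> L'" for i by (induction i) (auto simp: S1 S_mult x)
    then obtain c where c: "\<And>i. \<forall>k<r. c i k \<in> L" "\<And>i. x ^ i = (\<Sum>k<r. c i k * \<alpha> ^ k)"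
      unfolding L'_def S_def by (simp add: choice_iff) metis
    \<comment> \<open>The \<open>r + 1\<close> powers of \<open>x\<close> have only \<open>r\<close>
      coordinates each, so they are linearly dependent.\<close>
    have "\<exists>d. (\<forall>i\<in>{..r}. d i \<in> L) \<and> (\<exists>i\<in>{..r}. d i \<noteq> 0) \<and> (\<forall>k\<in>{..<r}. (\<Sum>i\<in>{..r}. c i k * d i) = 0)"
      by (rule linear_system[OF L, where a = "\<lambda>k i. c i k"]) (use c in auto)
    then obtain d where d: "\<And>i. i \<le> r \<Longrightarrow> d i \<in> L" "\<exists>i\<le>r. d i \<noteq> 0" "\<And>k. k < r \<Longrightarrow> (\<Sum>i\<le>r. c i k * d i) = 0"
      by auto
    define q0 where "q0 = (\<Sum>i\<le>r. monom (d i) i)"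
    have cq: "coeff q0 n = (if n \<le> r then d n else 0)" for n
      unfolding q0_def by (auto simp: coeff_sum if_distrib cong: if_cong)
    have "poly q0 x = (\<Sum>i\<le>r. d i * x ^ i)" unfolding q0_def by (simp add: poly_sum poly_monom)
    also have "\<dots> = (\<Sum>i\<le>r. \<Sum>k<r. c i k * d i * \<alpha> ^ k)"
      unfolding c(2) by (simp add: sum_distrib_left mult_ac)
    also have "\<dots> = (\<Sum>k<r. (\<Sum>i\<le>r. c i k * d i) * \<alpha> ^ k)" by (subst sum.swap) (simp add: sum_distrib_right)
    also have "\<dots> = 0" using d by simp
    finally have q0: "poly q0 x = 0" .
    have "pol L q0" unfolding pol_def cq using d Ls by auto
    moreover have "q0 \<noteq> 0" using d(2) cq by (metis coeff_0)
    ultimately have "\<exists>q. (pol L q \<and> q \<noteq> 0 \<and> poly q x = 0) \<and> (\<forall>q'. pol L q' \<and> q' \<noteq> 0 \<and> poly q' x = 0 \<longrightarrow> degree q \<le> degree q')"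
      using q0 by (intro ex_has_least_nat) auto
    then obtain q where q: "pol L q" "q \<noteq> 0" "poly q x = 0"
      and min: "\<And>q'. pol L q' \<Longrightarrow> q' \<noteq> 0 \<Longrightarrow> poly q' x = 0 \<Longrightarrow> degree q \<le> degree q'" by blast
    obtain a q' where aq: "q = pCons a q'" by (cases q) auto
    have aL: "a \<in> L" "pol L q'" using q aq pol_simps(6)[OF L] by auto
    have ax: "a + x * poly q' x = 0" using q aq by simp
    have "a \<noteq> 0"
    proof
      assume "a = 0"
      hence "poly q' x = 0" "q' \<noteq> 0" using ax x q aq by auto
      thus False using min[OF aL(2)] aq by simp
    qed
    hence "inverse x = (- inverse a) * poly q' x" using ax x
      by (simp add: field_simps) (metis add.commute add_eq_0_iff mult.commute)
    moreover have "- inverse a \<in> L" using aL Ls by auto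
    ultimately show ?thesis using S_scale S_poly[OF aL(2) x(1)] by metis
  qed
  have "subfld L'" unfolding subfld_def
  proof (intro conjI ballI)
    show "- x \<in> L'" if "x \<in> L'" for x using S_scale[of "- 1" x] that Ls by simp
    show "inverse x \<in> L'" if "x \<in> L'" for x using inv[OF that] S0 by (cases "x = 0") auto
  qed (use S0 S1 S_add S_mult in auto)
  moreover have "\<alpha> \<in> L'" using S_alpha[OF S1] by simp
  ultimately show ?thesis using that[OF r0 rp f indep _ LL'] unfolding L'_def S_def by blast
qed

lemma extension_coordinates:
  fixes \<alpha> :: "'c::field"
  assumes L: "subfld L"
    and indep: "\<And>c. (\<forall>k<r. c k \<in> L) \<Longrightarrow> (\<Sum>k<r. c k * \<alpha> ^ k) = 0 \<Longrightarrow> \<forall>k<r. c k = 0"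
    and mem: "\<And>x. x \<in> L' \<longleftrightarrow> (\<exists>c. (\<forall>k<r. c k \<in> L) \<and> x = (\<Sum>k<r. c k * \<alpha> ^ k))"
  obtains co where "\<And>k x. k < r \<Longrightarrow> x \<in> L' \<Longrightarrow> co k x \<in> L" "\<And>x. x \<in> L' \<Longrightarrow> x = (\<Sum>k<r. co k x * \<alpha> ^ k)"
    "\<And>c k. (\<forall>k<r. c k \<in> L) \<Longrightarrow> k < r \<Longrightarrow> co k (\<Sum>k<r. c k * \<alpha> ^ k) = c k"
    "\<And>k x y. k < r \<Longrightarrow> x \<in> L' \<Longrightarrow> y \<in> L' \<Longrightarrow> co k (x + y) = co k x + co k y"
    "\<And>k c x. k < r \<Longrightarrow> c \<in> L \<Longrightarrow> x \<in> L' \<Longrightarrow> co k (c * x) = c * co k x"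
proof -
  note Ls = subfldD[OF L]
  define co where "co k x = (SOME c. (\<forall>k<r. c k \<in> L) \<and> x = (\<Sum>k<r. c k * \<alpha> ^ k)) k" for k x
  have co: "(\<forall>k<r. co k x \<in> L) \<and> x = (\<Sum>k<r. co k x * \<alpha> ^ k)" if "x \<in> L'" for x
    unfolding co_def by (rule someI_ex[OF that[unfolded mem]])
  have co1: "co k x \<in> L" if "x \<in> L'" "k < r" for k x using conjunct1[OF co[OF that(1)]] that(2) by blast
  have co2: "(\<Sum>k<r. co k x * \<alpha> ^ k) = x" if "x \<in> L'" for x by (rule conjunct2[OF co[OF that], symmetric])
  have uniq: "co k (\<Sum>k<r. c k * \<alpha> ^ k) = c k" if c: "\<forall>k<r. c k \<in> L" and k: "k < r" for c k
  proof -
    let ?x = "\<Sum>k<r. c k * \<alpha> ^ k"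
    have x: "?x \<in> L'" unfolding mem using c by blast
    define a where "a k = co k ?x" for k
    have a: "\<forall>k<r. a k \<in> L" "?x = (\<Sum>k<r. a k * \<alpha> ^ k)"
      unfolding a_def using co[OF x] by (rule conjunct1, rule conjunct2)
    have "(\<Sum>k<r. (a k - c k) * \<alpha> ^ k) = (\<Sum>k<r. a k * \<alpha> ^ k) - ?x"
      by (simp only: left_diff_distrib sum_subtractf)
    also have "\<dots> = 0" unfolding a(2)[symmetric] by simp
    finally have s: "(\<Sum>k<r. (a k - c k) * \<alpha> ^ k) = 0" .
    have "\<forall>k<r. a k - c k \<in> L" using a(1) c Ls(7) by blast
    from indep[OF this s] have "a k - c k = 0" using k by blast
    thus ?thesis unfolding a_def by simp
  qed
  have 4: "co k (x + y) = co k x + co k y" if k: "k < r" and x: "x \<in> L'" and y: "y \<in> L'" for k x y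
  proof -
    have "(\<Sum>k<r. (co k x + co k y) * \<alpha> ^ k) = x + y" by (simp only: distrib_right sum.distrib co2 x y)
    thus ?thesis using uniq[of "\<lambda>k. co k x + co k y" k] co1[OF x] co1[OF y] k by (simp add: Ls)
  qed
  have 5: "co k (c * x) = c * co k x" if k: "k < r" and c: "c \<in> L" and x: "x \<in> L'" for k c x
  proof -
    have "(\<Sum>k<r. (c * co k x) * \<alpha> ^ k) = c * x" by (simp only: mult.assoc sum_distrib_left[symmetric] co2 x)
    thus ?thesis using uniq[of "\<lambda>k. c * co k x" k] co1[OF x] c k by (simp add: Ls)
  qed
  show ?thesis by (rule that[of co]) (fact co1 4 5 uniq | rule co1 co2[symmetric] uniq 4 5; assumption)+
qed

text \<open>An extension of odd degree \<open>2 m + 1\<close> carries the trace-like functional \<open>lam\<close> (coefficient of the top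
  power of \<open>\<alpha>\<close>), whose bilinear form \<open>lam (x y)\<close> is \<open>\<langle>1\<rangle>\<close> plus \<open>m\<close> hyperbolic planes; \<open>be\<close> is
  an adapted basis.\<close>

lemma odd_extension_basis:
  fixes \<alpha> :: "'c::field"
  assumes L: "subfld L" and two: "(2::'c) \<noteq> 0" and r: "r = 2 * m + 1"
    and f: "\<And>k. f k \<in> L" "\<alpha> ^ r = (\<Sum>k<r. f k * \<alpha> ^ k)"
    and indep: "\<And>c. (\<forall>k<r. c k \<in> L) \<Longrightarrow> (\<Sum>k<r. c k * \<alpha> ^ k) = 0 \<Longrightarrow> \<forall>k<r. c k = 0"
    and L': "subfld L'" "L \<subseteq> L'" "\<alpha> \<in> L'"
    and mem: "\<And>x. x \<in> L' \<longleftrightarrow> (\<exists>c. (\<forall>k<r. c k \<in> L) \<and> x = (\<Sum>k<r. c k * \<alpha> ^ k))"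
  obtains be cf lam where "\<And>k. k < r \<Longrightarrow> be k \<in> L'" "\<And>k x. k < r \<Longrightarrow> x \<in> L' \<Longrightarrow> cf k x \<in> L"
    "\<And>k x y. k < r \<Longrightarrow> x \<in> L' \<Longrightarrow> y \<in> L' \<Longrightarrow> cf k (x + y) = cf k x + cf k y"
    "\<And>k c x. k < r \<Longrightarrow> c \<in> L \<Longrightarrow> x \<in> L' \<Longrightarrow> cf k (c * x) = c * cf k x"
    "\<And>x. x \<in> L' \<Longrightarrow> x = (\<Sum>k<r. cf k x * be k)"
    "\<And>x y. x \<in> L' \<Longrightarrow> y \<in> L' \<Longrightarrow> lam (x + y) = lam x + lam y" "\<And>c x. c \<in> L \<Longrightarrow> x \<in> L' \<Longrightarrow> lam (c * x) = c * lam x"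
    "\<And>k l. k < r \<Longrightarrow> l < r \<Longrightarrow> lam (be k * be l) = (if k + l = 2 * m then 1 else 0)"
proof -
  note Ls = subfldD[OF L] and Ls' = subfldD[OF L'(1)]
  obtain co where co: "\<And>k x. k < r \<Longrightarrow> x \<in> L' \<Longrightarrow> co k x \<in> L" "\<And>x. x \<in> L' \<Longrightarrow> x = (\<Sum>k<r. co k x * \<alpha> ^ k)"
    "\<And>c k. (\<forall>k<r. c k \<in> L) \<Longrightarrow> k < r \<Longrightarrow> co k (\<Sum>k<r. c k * \<alpha> ^ k) = c k"
    "\<And>k x y. k < r \<Longrightarrow> x \<in> L' \<Longrightarrow> y \<in> L' \<Longrightarrow> co k (x + y) = co k x + co k y"
    "\<And>k c x. k < r \<Longrightarrow> c \<in> L \<Longrightarrow> x \<in> L' \<Longrightarrow> co k (c * x) = c * co k x"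
    by (rule extension_coordinates[where L = L and r = r and \<alpha> = \<alpha> and L' = L'])
      (rule L | erule (1) indep | rule mem | blast)+
  have m: "2 * m < r" using r by simp
  define lam where "lam = co (2 * m)"
  have lam_L: "x \<in> L' \<Longrightarrow> lam x \<in> L" for x unfolding lam_def using co(1) m by blast
  have lam_add: "lam (x + y) = lam x + lam y" if "x \<in> L'" "y \<in> L'" for x y unfolding lam_def using co(4) m that by blast
  have lam_sc: "lam (c * x) = c * lam x" if "c \<in> L" "x \<in> L'" for c x unfolding lam_def using co(5) m that by blast
  have lam_sc2: "lam (x * c) = c * lam x" if "c \<in> L" "x \<in> L'" for c x using lam_sc[OF that] by (simp add: mult.commute)
  have lam0: "lam 0 = 0" using lam_sc[OF Ls(1) Ls'(1)] by simp
  have lam_diff: "lam (x - y) = lam x - lam y" if "x \<in> L'" "y \<in> L'" for x y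
    using lam_add[of x "- 1 * y"] lam_sc[of "- 1" y] that by (simp add: Ls Ls')
  have lam_sum: "lam (sum F A) = (\<Sum>a\<in>A. lam (F a))" if "\<And>a. a \<in> A \<Longrightarrow> F a \<in> L'" for F and A :: "nat set"
    using that
  proof (induction A rule: infinite_finite_induct)
    case (insert a A)
    have "sum F A \<in> L'" using insert by (intro subfld_sum[OF L'(1)]) auto
    thus ?case using insert lam_add[of "F a" "sum F A"] by simp
  qed (use lam0 in auto)
  have aL: "\<alpha> ^ k \<in> L'" for k using subfld_power[OF L'(1)] L'(3) .
  have lam_pow: "lam (\<alpha> ^ k) = (if k = 2 * m then 1 else 0)" if "k < r" for k
  proof -
    have "(\<Sum>j<r. (if j = k then 1 else 0) * \<alpha> ^ j) = (\<Sum>j<r. if j = k then \<alpha> ^ k else 0)" by (intro sum.cong) auto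
    hence "\<alpha> ^ k = (\<Sum>j<r. (if j = k then 1 else 0) * \<alpha> ^ j)" using that by simp
    hence "lam (\<alpha> ^ k) = (if 2 * m = k then 1 else 0)" unfolding lam_def
      using co(3)[of "\<lambda>j. if j = k then 1 else 0" "2 * m"] m Ls(1,2) by metis
    thus ?thesis by auto
  qed
  \<comment> \<open>If \<open>t\<close> is the largest exponent occurring in \<open>x\<close>,
    multiplication by \<open>\<alpha> ^ (2 * m - t)\<close> moves it to the top exponent
    \<open>2 * m\<close>, where \<open>lam\<close> reads off its coefficient.\<close>
  have nondeg: "x = 0" if x: "x \<in> L'" "\<And>k. k < r \<Longrightarrow> lam (x * \<alpha> ^ k) = 0" for x
  proof (rule ccontr)
    assume "x \<noteq> 0"
    have xe: "x = (\<Sum>k<r. co k x * \<alpha> ^ k)" by (rule co(2)[OF x(1)])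
    have "\<exists>k. k < r \<and> co k x \<noteq> 0"
    proof (rule ccontr)
      assume "\<not> ?thesis"
      hence "(\<Sum>k<r. co k x * \<alpha> ^ k) = 0" by (intro sum.neutral) auto
      thus False using xe \<open>x \<noteq> 0\<close> by simp
    qed
    then obtain k where k: "k < r \<and> co k x \<noteq> 0" by blast
    define t where "t = (GREATEST k. k < r \<and> co k x \<noteq> 0)"
    have t: "t < r \<and> co t x \<noteq> 0" unfolding t_def by (rule GreatestI_nat[of _ k r]) (use k in auto)
    have gt: "co j x = 0" if "t < j" "j < r" for j
      using Greatest_le_nat[of "\<lambda>k. k < r \<and> co k x \<noteq> 0" j r] that unfolding t_def by auto
    have "x * \<alpha> ^ (2 * m - t) = (\<Sum>k<r. co k x * \<alpha> ^ (k + (2 * m - t)))"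
      by (subst xe) (simp add: sum_distrib_right power_add mult.assoc)
    hence "lam (x * \<alpha> ^ (2 * m - t)) = (\<Sum>k<r. co k x * lam (\<alpha> ^ (k + (2 * m - t))))"
      using lam_sum[of "{..<r}" "\<lambda>k. co k x * \<alpha> ^ (k + (2 * m - t))"] lam_sc[OF co(1)[OF _ x(1)] aL] co(1)[OF _ x(1)] L'(2) aL
      by (simp add: Ls' subset_iff)
    also have "\<dots> = (\<Sum>k<r. if k = t then co t x else 0)"
    proof (intro sum.cong refl)
      fix k assume "k \<in> {..<r}"
      hence "k < r" by simp
      show "co k x * lam (\<alpha> ^ (k + (2 * m - t))) = (if k = t then co t x else 0)"
      proof (cases "k > t")
        case True thus ?thesis using gt \<open>k < r\<close> by simp
      next
        case False
        hence "k + (2 * m - t) < r" using t r by auto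
        thus ?thesis using lam_pow[of "k + (2 * m - t)"] False t r by auto
      qed
    qed
    also have "\<dots> = co t x" using t by simp
    finally show False using x(2)[of "2 * m - t"] t r by simp
  qed
  text \<open>\<open>b j\<close> is the basis dual to the powers of \<open>\<alpha>\<close>.\<close>
  define f' where "f' k = (if k = r then 1 else - f k)" for k
  have f'L: "f' k \<in> L" for k unfolding f'_def using f Ls by auto
  have f'L': "f' k \<in> L'" for k using f'L L' by auto
  have rel: "(\<Sum>k\<le>r. f' k * \<alpha> ^ k) = 0"
  proof -
    have "(\<Sum>k\<le>r. f' k * \<alpha> ^ k) = (\<Sum>k<r. f' k * \<alpha> ^ k) + f' r * \<alpha> ^ r"
      by (simp add: lessThan_Suc_atMost[symmetric])
    also have "(\<Sum>k<r. f' k * \<alpha> ^ k) = - (\<Sum>k<r. f k * \<alpha> ^ k)"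
      unfolding sum_negf[symmetric] by (intro sum.cong) (auto simp: f'_def)
    finally show ?thesis using f(2) by (simp add: f'_def)
  qed
  \<comment> \<open>Horner's scheme: \<open>\<alpha> ^ Suc j * b j\<close> is the relation of
    \<open>\<alpha>\<close> without its terms of degree at most \<open>j\<close>, hence minus these
    terms. So \<open>\<alpha> ^ k * b j\<close> stays below the top exponent for
    \<open>k > j\<close>, and \<open>lam\<close> vanishes there.\<close>
  define b where "b j = (\<Sum>l<r - j. f' (l + j + 1) * \<alpha> ^ l)" for j
  have bL: "b j \<in> L'" for j unfolding b_def by (intro subfld_sum[OF L'(1)] Ls'(5) f'L' aL)
  have dual: "lam (\<alpha> ^ k * b j) = (if k = j then 1 else 0)" if k: "k < r" and j: "j < r" for k j
  proof (cases "k \<le> j")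
    case True
    have "\<alpha> ^ k * b j = (\<Sum>l<r - j. f' (l + j + 1) * \<alpha> ^ (k + l))"
      unfolding b_def sum_distrib_left by (intro sum.cong) (auto simp: power_add)
    hence "lam (\<alpha> ^ k * b j) = (\<Sum>l<r - j. f' (l + j + 1) * lam (\<alpha> ^ (k + l)))"
      using lam_sum[of "{..<r - j}" "\<lambda>l. f' (l + j + 1) * \<alpha> ^ (k + l)"] lam_sc[OF f'L aL] f'L' aL by (simp add: Ls')
    also have "\<dots> = (\<Sum>l<r - j. if l = r - j - 1 then (if k = j then 1 else 0) else 0)"
    proof (intro sum.cong refl)
      fix l assume l: "l \<in> {..<r - j}"
      hence "k + l < r" using True by auto
      thus "f' (l + j + 1) * lam (\<alpha> ^ (k + l)) = (if l = r - j - 1 then (if k = j then 1 else 0) else 0)"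
        using lam_pow[of "k + l"] l True r by (auto simp: f'_def)
    qed
    also have "\<dots> = (if k = j then 1 else 0)"
    proof -
      have "r - j - 1 \<in> {..<r - j}" using j by auto
      thus ?thesis by (subst sum.delta) auto
    qed
    finally show ?thesis .
  next
    case False
    have "(\<Sum>l\<le>j. f' l * \<alpha> ^ l) + (\<Sum>l\<in>{Suc j..r}. f' l * \<alpha> ^ l) = (\<Sum>k\<le>r. f' k * \<alpha> ^ k)"
      using j by (subst sum.union_disjoint[symmetric]) (auto intro!: sum.cong)
    moreover have "(\<Sum>l\<in>{Suc j..r}. f' l * \<alpha> ^ l) = \<alpha> ^ Suc j * b j"
    proof -
      have "(\<Sum>l\<in>{Suc j..r}. f' l * \<alpha> ^ l) = (\<Sum>l\<in>{..<r - j}. f' (l + j + 1) * \<alpha> ^ (l + j + 1))"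
        by (rule sum.reindex_bij_witness[of _ "\<lambda>l. l + j + 1" "\<lambda>l. l - (j + 1)"]) (use j in auto)
      thus ?thesis unfolding b_def sum_distrib_left by (simp add: power_add mult_ac)
    qed
    ultimately have "\<alpha> ^ Suc j * b j = - (\<Sum>l\<le>j. f' l * \<alpha> ^ l)" using rel by (simp add: eq_neg_iff_add_eq_0 add.commute)
    moreover have "\<alpha> ^ k * b j = \<alpha> ^ (k - Suc j) * (\<alpha> ^ Suc j * b j)" using False
      by (simp flip: mult.assoc power_add del: power_Suc)
    ultimately have e: "\<alpha> ^ k * b j = (\<Sum>l\<le>j. (- f' l) * \<alpha> ^ (k - Suc j + l))"
      by (simp add: sum_distrib_left sum_negf power_add mult_ac)
    have "lam (\<alpha> ^ k * b j) = (\<Sum>l\<le>j. (- f' l) * lam (\<alpha> ^ (k - Suc j + l)))"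
      unfolding e using lam_sum[of "{..j}" "\<lambda>l. (- f' l) * \<alpha> ^ (k - Suc j + l)"] lam_sc[OF Ls(4)[OF f'L] aL] f'L' aL by (simp add: Ls')
    also have "\<dots> = 0" using False k r lam_pow by (intro sum.neutral) auto
    finally show ?thesis using False by simp
  qed
  define z where "z i j = lam (b i * b j)" for i j
  have zL: "z i j \<in> L" for i j unfolding z_def using lam_L bL by (simp add: Ls')
  have zL': "z i j \<in> L'" for i j using zL L' by auto
  have hL: "x / 2 \<in> L" if "x \<in> L" for x using that Ls(3)[OF Ls(2,2)] by (simp add: Ls)
  \<comment> \<open>The first \<open>m\<close> powers of \<open>\<alpha>\<close> span a totally
    isotropic space dual to the first \<open>m\<close> vectors \<open>b j\<close>. Subtracting half
    of the Gram matrix of the \<open>b j\<close> inside that space makes the \<open>c j\<close>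
    isotropic as well and keeps the duality.\<close>
  define w where "w j = (\<Sum>i<m. (z i j / 2) * \<alpha> ^ i)" for j
  have wL: "w j \<in> L'" for j unfolding w_def using hL[OF zL] L' by (intro subfld_sum[OF L'(1)] Ls'(5) aL) auto
  define c where "c j = b j - w j" for j
  have cL: "c j \<in> L'" for j unfolding c_def using bL wL by (simp add: Ls')
  have lam_w: "lam (x * w j) = (\<Sum>i<m. z i j / 2 * lam (\<alpha> ^ i * x))" if x: "x \<in> L'" for x j
  proof -
    define zh where "zh i = z i j / 2" for i
    have zh: "zh i \<in> L" for i unfolding zh_def by (rule hL[OF zL])
    have "x * w j = (\<Sum>i<m. zh i * (\<alpha> ^ i * x))"
      unfolding w_def zh_def[symmetric] sum_distrib_left by (intro sum.cong) (auto simp: mult_ac)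
    also have "lam \<dots> = (\<Sum>i<m. zh i * lam (\<alpha> ^ i * x))"
      using lam_sum[of "{..<m}" "\<lambda>i. zh i * (\<alpha> ^ i * x)"] lam_sc[OF zh] aL x zh L'(2)
      by (simp add: Ls' subset_iff)
    finally show ?thesis unfolding zh_def .
  qed
  have ac: "lam (\<alpha> ^ k * c j) = (if k = j then 1 else 0)" if k: "k \<le> m" "j < m" for k j
  proof -
    have "lam (\<alpha> ^ k * w j) = 0" unfolding lam_w[OF aL]
      using k r lam_pow by (intro sum.neutral) (auto simp flip: power_add)
    thus ?thesis unfolding c_def right_diff_distrib using lam_diff[of "\<alpha> ^ k * b j" "\<alpha> ^ k * w j"] aL bL wL dual[of k j] k r
      by (simp add: Ls')
  qed
  have bw: "lam (b i * w j) = z i j / 2" if "i < m" for i j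
  proof -
    have "lam (b i * w j) = (\<Sum>k<m. z k j / 2 * (if k = i then 1 else 0))"
      unfolding lam_w[OF bL] using dual that r by (intro sum.cong) auto
    also have "\<dots> = z i j / 2" using that by (simp add: if_distrib cong: if_cong)
    finally show ?thesis .
  qed
  have ww: "lam (w i * w j) = 0" if "i < m" "j < m" for i j
    unfolding lam_w[OF wL]
  proof (intro sum.neutral ballI)
    fix k assume "k \<in> {..<m}"
    hence "lam (\<alpha> ^ k * w i) = 0" unfolding lam_w[OF aL]
      using r lam_pow by (intro sum.neutral) (auto simp flip: power_add)
    thus "z k j / 2 * lam (\<alpha> ^ k * w i) = 0" by simp
  qed
  have cc: "lam (c i * c j) = 0" if "i < m" "j < m" for i j
  proof -
    have "c i * c j = b i * b j - b i * w j - b j * w i + w i * w j" unfolding c_def by (simp add: algebra_simps)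
    moreover have "lam (b i * b j - b i * w j - b j * w i + w i * w j) = lam (b i * b j) - lam (b i * w j) - lam (b j * w i) + lam (w i * w j)"
      using bL wL by (simp add: lam_add lam_diff Ls')
    moreover have "z j i = z i j" unfolding z_def by (simp add: mult.commute)
    moreover have "x - x / 2 - x / 2 = 0" for x :: 'c using two by (simp add: field_simps)
    ultimately show ?thesis using bw ww that unfolding z_def by (simp add: z_def[symmetric])
  qed
  \<comment> \<open>In the order \<open>1, \<alpha>, ..., \<alpha> ^ m, c (m - 1), ..., c 0\<close>
    the Gram matrix is antidiagonal; the unit form sits in the middle place
    \<open>m\<close>.\<close>
  define be where "be k = (if k \<le> m then \<alpha> ^ k else c (2 * m - k))" for k
  have beL: "be k \<in> L'" for k unfolding be_def using aL cL by auto
  have gram: "lam (be k * be l) = (if k + l = 2 * m then 1 else 0)" if kl: "k < r" "l < r" for k l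
  proof -
    have s: "lam (be k * be l) = (if k + l = 2 * m then 1 else 0)" if kl: "k < r" "l < r" "k \<le> l" for k l
    proof (cases "l \<le> m")
      case True
      thus ?thesis using kl lam_pow[of "k + l"] r by (auto simp: be_def simp flip: power_add)
    next
      case l: False
      show ?thesis
      proof (cases "k \<le> m")
        case True
        thus ?thesis using ac[of k "2 * m - l"] l kl r by (auto simp: be_def)
      qed (use l kl cc r in \<open>auto simp: be_def\<close>)
    qed
    show ?thesis using s[OF kl] s[OF kl(2,1)] by (cases "k \<le> l") (auto simp: mult.commute add.commute)
  qed
  \<comment> \<open>For an antidiagonal Gram matrix the coordinate at \<open>k\<close> is the
    pairing with the opposite basis vector.\<close>
  define cf where "cf k x = lam (x * be (2 * m - k))" for k x
  have expand: "x = (\<Sum>k<r. cf k x * be k)" if x: "x \<in> L'" for x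
  proof -
    define y where "y = x - (\<Sum>k<r. cf k x * be k)"
    have cfL: "cf k x \<in> L" for k unfolding cf_def using x beL by (intro lam_L) (simp add: Ls')
    have sL: "(\<Sum>k<r. cf k x * be k) \<in> L'" using cfL L'(2) beL by (intro subfld_sum[OF L'(1)] Ls'(5)) auto
    have yL: "y \<in> L'" unfolding y_def using x sL by (simp add: Ls')
    have y0: "lam (y * be l) = 0" if l: "l < r" for l
    proof -
      have "lam ((\<Sum>k<r. cf k x * be k) * be l) = (\<Sum>k<r. cf k x * lam (be k * be l))"
        unfolding sum_distrib_right mult.assoc
        using lam_sum[of "{..<r}" "\<lambda>k. cf k x * (be k * be l)"] lam_sc[OF cfL] beL cfL L'(2) by (simp add: Ls' subset_iff)
      also have "\<dots> = (\<Sum>k<r. if k = 2 * m - l then cf k x else 0)"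
        using gram l r by (intro sum.cong) auto
      also have "\<dots> = lam (x * be l)"
      proof -
        have "2 * m - l \<in> {..<r}" "2 * m - (2 * m - l) = l" using l r by auto
        thus ?thesis unfolding cf_def by (simp only: sum.delta finite_lessThan if_True)
      qed
      finally show ?thesis unfolding y_def left_diff_distrib using lam_diff x sL beL by (simp add: Ls')
    qed
    \<comment> \<open>Orthogonality to \<open>be\<close> has to be carried over to the powers of
      \<open>\<alpha>\<close>. Above \<open>m\<close> it goes by induction: for
      \<open>j = 2 * m - k\<close> the vector \<open>b j\<close> is \<open>\<alpha> ^ k\<close> plus
      lower powers, and it differs from \<open>c j\<close> by lower powers.\<close>
    have "lam (y * \<alpha> ^ k) = 0" if "k < r" for k
      using that
    proof (induction k rule: less_induct)
      case (less k)
      show ?case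
      proof (cases "k \<le> m")
        case True
        thus ?thesis using y0[OF less.prems] by (simp add: be_def)
      next
        case False
        define j where "j = 2 * m - k"
        have j: "j < m" "k = 2 * m - j" "r - j = Suc k" using False less.prems r unfolding j_def by auto
        have sums: "lam (y * (\<Sum>l<t. u l * \<alpha> ^ l)) = 0" if "t \<le> k" "\<And>l. u l \<in> L" for t u
        proof -
          have uL': "u l \<in> L'" for l using that L' by auto
          have "y * (\<Sum>l<t. u l * \<alpha> ^ l) = (\<Sum>l<t. u l * (y * \<alpha> ^ l))" by (simp add: sum_distrib_left mult_ac)
          also have "lam \<dots> = (\<Sum>l<t. u l * lam (y * \<alpha> ^ l))"
            using lam_sum[of "{..<t}" "\<lambda>l. u l * (y * \<alpha> ^ l)"] lam_sc[OF that(2)] yL aL uL' by (simp add: Ls')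
          also have "\<dots> = 0" using less.IH less.prems that by (intro sum.neutral) auto
          finally show ?thesis .
        qed
        have "lam (y * w j) = 0" unfolding w_def by (rule sums) (use j hL[OF zL] False in auto)
        moreover have "lam (y * c j) = 0" using y0[of "2 * m - j"] j r less.prems by (auto simp: be_def split: if_splits)
        ultimately have yb: "lam (y * b j) = 0" unfolding c_def right_diff_distrib using lam_diff yL bL wL by (simp add: Ls')
        have "b j = (\<Sum>l<k. f' (l + j + 1) * \<alpha> ^ l) + \<alpha> ^ k"
          unfolding b_def j(3) using j r by (simp add: f'_def)
        hence "lam (y * b j) = lam (y * (\<Sum>l<k. f' (l + j + 1) * \<alpha> ^ l)) + lam (y * \<alpha> ^ k)"
          using yL aL f'L' by (simp add: distrib_left lam_add Ls' subfld_sum[OF L'(1)])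
        moreover have "lam (y * (\<Sum>l<k. f' (l + j + 1) * \<alpha> ^ l)) = 0" by (rule sums) (use f'L in auto)
        ultimately show ?thesis using yb by simp
      qed
    qed
    hence "y = 0" using nondeg yL by blast
    thus ?thesis unfolding y_def by simp
  qed
  show ?thesis
  proof (rule that[of be cf lam])
    show "cf k (x + y) = cf k x + cf k y" if "x \<in> L'" "y \<in> L'" for k x y
      unfolding cf_def distrib_right using that beL by (intro lam_add) (auto simp: Ls')
    show "cf k (c * x) = c * cf k x" if "c \<in> L" "x \<in> L'" for k c x
      unfolding cf_def mult.assoc using that beL by (intro lam_sc) (auto simp: Ls')
    show "cf k x \<in> L" if "x \<in> L'" for k x unfolding cf_def using that beL by (intro lam_L) (auto simp: Ls')
  qed (use beL lam_add lam_sc gram expand in auto)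
qed

section \<open>Maximal extensions without hyperbolic multiples\<close>

context coalg
begin

text \<open>Among powers of 2 any two multiples are comparable by divisibility, so several
  extensions can be treated with one common multiple; see \<open>hyp_power_mono\<close>.\<close>

definition wh :: "'c set \<Rightarrow> bool" where "wh L \<longleftrightarrow> (\<exists>k. hyp L {..<(2::nat) ^ k})"

lemma wh_intro: "finite I \<Longrightarrow> card I = 2 ^ k \<Longrightarrow> hyp L I \<Longrightarrow> wh L"
  unfolding wh_def using hyp_card by metis

lemma hyp_power_mono:
  assumes "hyp L {..<(2::nat) ^ k}" "k \<le> n" "0 \<in> L"
  shows "hyp L {..<(2::nat) ^ n}"
proof -
  have "hyp L ({..<(2::nat) ^ k} \<times> {..<(2::nat) ^ (n - k)})" using hyp_mult assms by blast
  moreover have "(2::nat) ^ k * 2 ^ (n - k) = 2 ^ n" using assms(2) by (simp flip: power_add)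
  ultimately show ?thesis using hyp_card[of "{..<(2::nat) ^ k} \<times> {..<(2::nat) ^ (n - k)}"] by simp
qed

lemma hyp_smat:
  assumes L: "subfld L" "K0 \<subseteq> L" and I: "finite I" and h: "\<And>i j. i \<in> I \<Longrightarrow> j \<in> I \<Longrightarrow> h i j \<in> L"
    "\<And>i j. i \<in> I \<Longrightarrow> j \<in> I \<Longrightarrow> (\<Sum>l\<in>I. h i l * h l j) = h i j"
    "\<And>i j. i \<in> I \<Longrightarrow> j \<in> I \<Longrightarrow> h i j + h j i = (if i = j then 1 else 0)"
  shows "hyp L I"
proof -
  have "mm I (smat I h) (smat I h) = smat I (\<lambda>i j. \<Sum>l\<in>I. h i l * h l j)" by (rule smat_smat[OF L I h(1)])
  also have "\<dots> = smat I h" by (auto simp: smat_def fun_eq_iff h(2))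
  finally have "mm I (smat I h) (smat I h) = smat I h" .
  moreover have "smat I h + sm (smat I h) = Em I"
  proof (intro ext)
    fix i j k
    show "(smat I h + sm (smat I h)) i j k = Em I i j k"
    proof (cases "i \<in> I \<and> j \<in> I")
      case True
      hence "(smat I h + sm (smat I h)) i j k = (h i j + h j i) * e k"
        unfolding smat_st by (simp add: smat_def distrib_right)
      thus ?thesis using True h(3)[of i j] by (simp add: Em_def)
    next
      case False
      hence "smat I h i j k = 0" "smat I (\<lambda>i j. h j i) i j k = 0" "Em I i j k = 0"
        by (auto simp: smat_def Em_def)
      thus ?thesis by (simp add: smat_st)
    qed
  qed
  moreover have "smat I h \<in> Bm L I" by (rule smat_in[OF L h(1)])
  ultimately show ?thesis unfolding hyp_def by blast
qed

lemma direct_sum: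
  fixes R1 R2 :: "nat set" and I :: "'i set"
  assumes L: "subfld L" "K0 \<subseteq> L" and fin: "finite I" "finite R1" "finite R2" and disj: "R1 \<inter> R2 = {}"
    and hL: "\<And>k l. h k l \<in> L" and h0: "\<And>k l. k \<in> R1 \<Longrightarrow> l \<in> R2 \<Longrightarrow> h k l = 0 \<and> h l k = 0"
    and x: "x \<in> Bm L (I \<times> R1)" "mm (I \<times> R1) x x = x"
      "mm (I \<times> R1) (smat (I \<times> R1) (bl h)) x + mm (I \<times> R1) (sm x) (smat (I \<times> R1) (bl h)) = smat (I \<times> R1) (bl h)"
    and y: "y \<in> Bm L (I \<times> R2)" "mm (I \<times> R2) y y = y"
      "mm (I \<times> R2) (smat (I \<times> R2) (bl h)) y + mm (I \<times> R2) (sm y) (smat (I \<times> R2) (bl h)) = smat (I \<times> R2) (bl h)"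
  shows "x + y \<in> Bm L (I \<times> (R1 \<union> R2))" "mm (I \<times> (R1 \<union> R2)) (x + y) (x + y) = x + y"
    "mm (I \<times> (R1 \<union> R2)) (smat (I \<times> (R1 \<union> R2)) (bl h)) (x + y) +
     mm (I \<times> (R1 \<union> R2)) (sm (x + y)) (smat (I \<times> (R1 \<union> R2)) (bl h)) = smat (I \<times> (R1 \<union> R2)) (bl h)"
proof -
  let ?J = "I \<times> (R1 \<union> R2)" and ?J1 = "I \<times> R1" and ?J2 = "I \<times> R2"
  have J: "finite ?J" "?J1 \<subseteq> ?J" "?J2 \<subseteq> ?J" "?J1 \<inter> ?J2 = {}" "?J2 \<inter> ?J1 = {}" using fin disj by auto
  obtain rk where "star_ring (mm ?J) (Bm L ?J) (Em ?J) sm hm rk" using matrix_star_ring[OF L J(1)] by blast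
  then interpret star_ring "mm ?J" "Bm L ?J" "Em ?J" sm hm rk .
  define H1 H2 where "H1 = smat ?J1 (bl h)" and "H2 = smat ?J2 (bl h)"
  have blL: "bl h a b \<in> L" for a b :: "'i \<times> nat" using hL subfldD(1)[OF L(1)] unfolding bl_def by auto
  have H1: "H1 \<in> Bm L ?J1" and H2: "H2 \<in> Bm L ?J2" unfolding H1_def H2_def by (rule smat_in[OF L blL])+
  have H: "smat ?J (bl h) = H1 + H2" unfolding H1_def H2_def
    using h0 disj by (auto simp: smat_def bl_def fun_eq_iff)
  have s1: "sm x \<in> Bm L ?J1" using matrix_star_ring[OF L, of ?J1] fin star_ring.B_st[OF _ x(1)] by blast
  have s2: "sm y \<in> Bm L ?J2" using matrix_star_ring[OF L, of ?J2] fin star_ring.B_st[OF _ y(1)] by blast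
  have xB: "x \<in> Bm L ?J" and yB: "y \<in> Bm L ?J" using x(1) y(1) Bm_mono[OF J(2)] Bm_mono[OF J(3)] by blast+
  show "x + y \<in> Bm L ?J" using xB yB by (rule B_add)
  have m1: "mm ?J Xa Y = mm ?J1 Xa Y" if "Xa \<in> Bm L ?J1" for Xa Y by (rule mm_supp[OF that J(2,1)])
  have m2: "mm ?J Xa Y = mm ?J2 Xa Y" if "Xa \<in> Bm L ?J2" for Xa Y by (rule mm_supp[OF that J(3,1)])
  have z1: "mm ?J Xa Y = 0" if "Xa \<in> Bm L ?J1" "Y \<in> Bm L ?J2" for Xa Y by (rule mm_disjoint[OF that J(4)])
  have z2: "mm ?J Xa Y = 0" if "Xa \<in> Bm L ?J2" "Y \<in> Bm L ?J1" for Xa Y by (rule mm_disjoint[OF that J(5)])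
  show "mm ?J (x + y) (x + y) = x + y"
    by (simp add: add_left add_right m1[OF x(1), of x] m2[OF y(1), of y] z1[OF x(1) y(1)] z2[OF y(1) x(1)] x(2) y(2))
  have "mm ?J (H1 + H2) (x + y) + mm ?J (sm x + sm y) (H1 + H2) =
      (mm ?J1 H1 x + mm ?J1 (sm x) H1) + (mm ?J2 H2 y + mm ?J2 (sm y) H2)"
    by (simp add: add_left add_right m1[OF H1, of x] m2[OF H2, of y] m1[OF s1, of H1] m2[OF s2, of H2]
        z1[OF H1 y(1)] z2[OF H2 x(1)] z1[OF s1 H2] z2[OF s2 H1] algebra_simps)
  also have "\<dots> = H1 + H2" using x(3) y(3) unfolding H1_def H2_def by simp
  finally show "mm ?J (smat ?J (bl h)) (x + y) + mm ?J (sm (x + y)) (smat ?J (bl h)) = smat ?J (bl h)"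
    unfolding H using st_add[OF xB yB] by simp
qed

text \<open>The transfer along the coefficient of 1 in the basis \<open>1, \<alpha>\<close>, whose
  Gram matrix is \<open><1, a>\<close>. The places \<open>p\<close> and \<open>q\<close> are left
  free so that the forms of two such extensions can stand side by side.\<close>

lemma quadratic_transfer:
  assumes L: "subfld L" "K0 \<subseteq> L" and a: "a \<in> L" "\<alpha> * \<alpha> = a" "\<alpha> \<notin> L"
  obtains L' where "subfld L'" "L \<subset> L'"
    "\<And>(I :: 'i set) p q. finite I \<Longrightarrow> hyp L' I \<Longrightarrow> p \<noteq> q \<Longrightarrow> (\<And>k l. k \<in> {p, q} \<Longrightarrow> l \<in> {p, q} \<Longrightarrow> h k l = (if k = l then if k = p then 1 else a else 0)) \<Longrightarrow>
      \<exists>x \<in> Bm L (I \<times> {p, q}). mm (I \<times> {p, q}) x x = x \<and>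
      mm (I \<times> {p, q}) (smat (I \<times> {p, q}) (bl h)) x + mm (I \<times> {p, q}) (sm x) (smat (I \<times> {p, q}) (bl h))
        = smat (I \<times> {p, q}) (bl h)"
proof -
  note Ls = subfldD[OF L(1)]
  have p1: "pol L [:- a, 0, 1:]" using a Ls by (simp add: pol_simps[OF L(1)])
  have p0: "[:- a, 0, 1:] \<noteq> 0" by simp
  have p2: "poly [:- a, 0, 1:] \<alpha> = 0" using a by simp
  obtain r f L' where r: "0 < r" "r \<le> degree [:- a, 0, 1:]" "\<And>k. f k \<in> L" "\<alpha> ^ r = (\<Sum>k<r. f k * \<alpha> ^ k)"
    and indep: "\<And>c. (\<forall>k<r. c k \<in> L) \<Longrightarrow> (\<Sum>k<r. c k * \<alpha> ^ k) = 0 \<Longrightarrow> \<forall>k<r. c k = 0"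
    and L': "subfld L'" "L \<subseteq> L'" "\<alpha> \<in> L'" and mem: "\<And>x. x \<in> L' \<longleftrightarrow> (\<exists>c. (\<forall>k<r. c k \<in> L) \<and> x = (\<Sum>k<r. c k * \<alpha> ^ k))"
    by (rule simple_extension[OF L(1) p1 p0 p2]) (rule that; assumption)
  have "r \<noteq> 1" using r(3,4) a(3) by auto
  hence r2: "r = 2" using r by simp
  obtain co where co: "\<And>k x. k < r \<Longrightarrow> x \<in> L' \<Longrightarrow> co k x \<in> L" "\<And>x. x \<in> L' \<Longrightarrow> x = (\<Sum>k<r. co k x * \<alpha> ^ k)"
    "\<And>c k. (\<forall>k<r. c k \<in> L) \<Longrightarrow> k < r \<Longrightarrow> co k (\<Sum>k<r. c k * \<alpha> ^ k) = c k"
    "\<And>k x y. k < r \<Longrightarrow> x \<in> L' \<Longrightarrow> y \<in> L' \<Longrightarrow> co k (x + y) = co k x + co k y"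
    "\<And>k c x. k < r \<Longrightarrow> c \<in> L \<Longrightarrow> x \<in> L' \<Longrightarrow> co k (c * x) = c * co k x"
    by (rule extension_coordinates[where L = L and r = r and \<alpha> = \<alpha> and L' = L'])
      (rule L | erule (1) indep | rule mem | blast)+
  have ev: "co 0 (u + v * \<alpha>) = u" if "u \<in> L" "v \<in> L" for u v
    using co(3)[of "\<lambda>k. if k = 0 then u else v" 0] that by (simp add: r2 numeral_2_eq_2)
  have c1: "co 0 1 = 1" "co 0 \<alpha> = 0" "co 0 a = a"
    using ev[of 1 0] ev[of 0 1] ev[of a 0] Ls a by simp_all
  show ?thesis
  proof (rule that[OF L'(1)])
    show "L \<subset> L'" using L' a(3) by blast
    fix I :: "'i set" and p q :: nat
    assume I: "finite I" "hyp L' I" and pq: "p \<noteq> q"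
      and h: "\<And>k l. k \<in> {p, q} \<Longrightarrow> l \<in> {p, q} \<Longrightarrow> h k l = (if k = l then if k = p then 1 else a else 0)"
    define be where "be k = (if k = p then 1 else \<alpha>)" for k
    define cf where "cf k = (if k = p then co 0 else co 1)" for k
    have cases: "k = p \<or> k = q" if "k \<in> {p, q}" for k using that by auto
    obtain x where "x \<in> Bm L (I \<times> {p, q})" "mm (I \<times> {p, q}) x x = x"
      "mm (I \<times> {p, q}) (smat (I \<times> {p, q}) (bl h)) x + mm (I \<times> {p, q}) (sm x) (smat (I \<times> {p, q}) (bl h)) = smat (I \<times> {p, q}) (bl h)"
    proof (rule transfer_hyp[OF L L'(1,2) I(1), of "{p, q}" be cf "co 0" h])
      show "be k \<in> L'" for k unfolding be_def using L' subfldD(2)[OF L'(1)] by auto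
      show "cf k x \<in> L" if "x \<in> L'" for k x unfolding cf_def using co(1) r2 that by auto
      show "cf k (x + y) = cf k x + cf k y" if "x \<in> L'" "y \<in> L'" for k x y unfolding cf_def using co(4) r2 that by auto
      show "cf k (c * x) = c * cf k x" if "c \<in> L" "x \<in> L'" for k c x unfolding cf_def using co(5) r2 that by auto
      show "x = (\<Sum>k\<in>{p, q}. cf k x * be k)" if "x \<in> L'" for x
      proof -
        have "x = co 0 x + co 1 x * \<alpha>" using co(2)[OF that] by (simp add: r2 numeral_2_eq_2)
        thus ?thesis using pq by (simp add: cf_def be_def)
      qed
      show "co 0 (x + y) = co 0 x + co 0 y" if "x \<in> L'" "y \<in> L'" for x y using co(4) r2 that by auto
      show "co 0 (c * x) = c * co 0 x" if "c \<in> L" "x \<in> L'" for c x using co(5) r2 that by auto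
      show "h k l = co 0 (be k * be l)" if "k \<in> {p, q}" "l \<in> {p, q}" for k l
        unfolding h[OF that] using that c1 a(2) pq by (auto simp: be_def)
    qed (use I in auto)
    thus "\<exists>x \<in> Bm L (I \<times> {p, q}). mm (I \<times> {p, q}) x x = x \<and>
      mm (I \<times> {p, q}) (smat (I \<times> {p, q}) (bl h)) x + mm (I \<times> {p, q}) (sm x) (smat (I \<times> {p, q}) (bl h))
        = smat (I \<times> {p, q}) (bl h)" by blast
  qed
qed

end

locale maximal_coalg = coalg d g s e K0
  for d g s e and K0 :: "'c::alg_closed_field set" +
  fixes L :: "'c set"
  assumes L: "subfld L" "K0 \<subseteq> L" and not_wh: "\<not> wh L"
    and maximal: "\<And>L'. subfld L' \<Longrightarrow> L \<subset> L' \<Longrightarrow> wh L'"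
begin

lemmas Ls = subfldD[OF L(1)]

lemma two_L: "(2::'c) \<in> L" using Ls(3)[OF Ls(2,2)] by simp

lemma half_add: "(1/2::'c) + 1/2 = 1" using two by (simp add: field_simps flip: mult_2)

text \<open>Otherwise four copies are hyperbolic already by a matrix of scalars: a skew
  \<open>S\<close> with square 1 gives the idempotent \<open>(1 + S) / 2\<close>, whose transpose is
  its complement.\<close>

lemma not_sum_two_squares:
  assumes u: "u \<in> L" "v \<in> L"
  shows "u * u + v * v \<noteq> - 1"
proof
  assume uv: "u * u + v * v = - 1"
  let ?I = "{0, 1, 2, 3 :: nat}"
  \<comment> \<open>In blocks of size 2 the rows of \<open>S\<close> are \<open>(0, N)\<close> and
    \<open>(- N^T, 0)\<close>, where \<open>N\<close> has the rows \<open>(u, v)\<close> and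
    \<open>(- v, u)\<close> and satisfies \<open>N N^T = u^2 + v^2 = -1\<close>.\<close>
  define S :: "nat \<Rightarrow> nat \<Rightarrow> 'c" where "S i j = (if i = 0 then if j = 2 then u else if j = 3 then v else 0
    else if i = 1 then if j = 2 then - v else if j = 3 then u else 0
    else if i = 2 then if j = 0 then - u else if j = 1 then v else 0
    else if i = 3 then if j = 0 then - v else if j = 1 then - u else 0 else 0)" for i j
  define h where "h i j = (if i = j then 1/2 else 0) + (1/2) * S i j" for i j
  have SL: "S i j \<in> L" for i j unfolding S_def using u by (simp add: Ls)
  have hL: "h i j \<in> L" for i j unfolding h_def using SL two_L by (auto simp: Ls)
  have SS: "(\<Sum>l\<in>?I. S i l * S l j) = (if i = j then 1 else 0)" if "i \<in> ?I" "j \<in> ?I" for i j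
  proof -
    have vv: "v * v = - 1 - u * u" using uv by (simp add: eq_diff_eq add.commute)
    show ?thesis using that unfolding S_def by (auto simp: vv)
  qed
  have Sa: "S i j + S j i = 0" for i j unfolding S_def by auto
  have "hyp L ?I"
  proof (rule hyp_smat[OF L _ hL])
    fix i j assume ij: "i \<in> ?I" "j \<in> ?I"
    define t where "t = (1/2 :: 'c)"
    have tt: "t + t = 1" unfolding t_def by (rule half_add)
    define D where "D i j = (if i = j then t else 0)" for i j :: nat
    have hD: "h i j = D i j + t * S i j" for i j unfolding h_def D_def t_def by simp
    have D1: "(\<Sum>l\<in>?I. D i l * Xa l) = t * Xa i" and D2: "(\<Sum>l\<in>?I. Xa l * D l j) = t * Xa j" for Xa
      using ij unfolding D_def by auto
    have "(\<Sum>l\<in>?I. h i l * h l j) = (\<Sum>l\<in>?I. D i l * D l j) + (\<Sum>l\<in>?I. D i l * (t * S l j)) +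
        (\<Sum>l\<in>?I. (t * S i l) * D l j) + t * t * (\<Sum>l\<in>?I. S i l * S l j)"
      unfolding hD by (simp only: sum_distrib_left flip: sum.distrib) (simp add: algebra_simps)
    also have "\<dots> = t * D i j + t * (t * S i j) + t * (t * S i j) + t * D i j"
      unfolding D1 D2 SS[OF ij] by (simp add: D_def)
    also have "\<dots> = (t + t) * D i j + (t + t) * (t * S i j)" by (simp add: algebra_simps)
    finally show "(\<Sum>l\<in>?I. h i l * h l j) = h i j" unfolding tt hD by simp
    have "h i j + h j i = D i j + D j i + t * (S i j + S j i)" unfolding hD by (simp add: algebra_simps)
    thus "h i j + h j i = (if i = j then 1 else 0)" unfolding Sa using tt by (simp add: D_def)
  qed auto
  hence "wh L" by (intro wh_intro[of ?I 2]) auto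
  thus False using not_wh by simp
qed

text \<open>Otherwise maximality applies to both quadratic extensions. Places 0 and 1 carry the
  transfer from the root of \<open>a\<close>, places 2 and 3 the one from the root of
  \<open>- a\<close>; cancelling the plane at the places 1 and 3 makes a multiple by a power of 2
  hyperbolic over \<open>L\<close>.\<close>

lemma square_or_neg:
  assumes a: "a \<in> L"
  shows "a \<in> sqs L \<or> - a \<in> sqs L"
proof (rule ccontr)
  assume n: "\<not> ?thesis"
  obtain \<alpha> where al: "\<alpha> ^ 2 = a" using nth_root_exists[of 2 a] by auto
  obtain \<beta> where be: "\<beta> ^ 2 = - a" using nth_root_exists[of 2 "- a"] by auto
  have al': "\<alpha> * \<alpha> = a" "\<alpha> \<notin> L" "\<beta> * \<beta> = - a" "\<beta> \<notin> L"
    using al be n unfolding sqs_def power2_eq_square by auto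
  have a0: "a \<noteq> 0" using n sqs_zero[OF L(1)] by auto
  define hd :: "nat \<Rightarrow> 'c" where "hd k = (if k = 1 then a else if k = 3 then - a else 1)" for k
  define h where "h k l = (if k = l then hd k else 0)" for k l
  obtain L1 where L1: "subfld L1" "L \<subset> L1"
    "\<And>(I :: nat set) p q. finite I \<Longrightarrow> hyp L1 I \<Longrightarrow> p \<noteq> q \<Longrightarrow> (\<And>k l. k \<in> {p, q} \<Longrightarrow> l \<in> {p, q} \<Longrightarrow> h k l = (if k = l then if k = p then 1 else a else 0)) \<Longrightarrow>
      \<exists>x \<in> Bm L (I \<times> {p, q}). mm (I \<times> {p, q}) x x = x \<and>
      mm (I \<times> {p, q}) (smat (I \<times> {p, q}) (bl h)) x + mm (I \<times> {p, q}) (sm x) (smat (I \<times> {p, q}) (bl h))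
        = smat (I \<times> {p, q}) (bl h)"
    using quadratic_transfer[OF L a al'(1,2), where h = h] by blast
  obtain L2 where L2: "subfld L2" "L \<subset> L2"
    "\<And>(I :: nat set) p q. finite I \<Longrightarrow> hyp L2 I \<Longrightarrow> p \<noteq> q \<Longrightarrow> (\<And>k l. k \<in> {p, q} \<Longrightarrow> l \<in> {p, q} \<Longrightarrow> h k l = (if k = l then if k = p then 1 else - a else 0)) \<Longrightarrow>
      \<exists>x \<in> Bm L (I \<times> {p, q}). mm (I \<times> {p, q}) x x = x \<and>
      mm (I \<times> {p, q}) (smat (I \<times> {p, q}) (bl h)) x + mm (I \<times> {p, q}) (sm x) (smat (I \<times> {p, q}) (bl h))
        = smat (I \<times> {p, q}) (bl h)"
    using quadratic_transfer[OF L Ls(4)[OF a] al'(3,4), where h = h] by blast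
  obtain k1 k2 where k: "hyp L1 {..<(2::nat) ^ k1}" "hyp L2 {..<(2::nat) ^ k2}"
    using maximal[OF L1(1,2)] maximal[OF L2(1,2)] unfolding wh_def by blast
  define I where "I = {..<(2::nat) ^ (k1 + k2)}"
  have I: "finite I" "hyp L1 I" "hyp L2 I" unfolding I_def
    using hyp_power_mono[OF k(1), of "k1 + k2"] hyp_power_mono[OF k(2), of "k1 + k2"] subfldD(1) L1 L2 by auto
  have h01: "h k l = (if k = l then if k = 0 then 1 else a else 0)" if "k \<in> {0, 1}" "l \<in> {0, 1}" for k l
    using that by (auto simp: h_def hd_def)
  have h23: "h k l = (if k = l then if k = 2 then 1 else - a else 0)" if "k \<in> {2, 3}" "l \<in> {2, 3}" for k l
    using that by (auto simp: h_def hd_def)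
  obtain x where x: "x \<in> Bm L (I \<times> {0, 1})" "mm (I \<times> {0, 1}) x x = x"
    "mm (I \<times> {0, 1}) (smat (I \<times> {0, 1}) (bl h)) x + mm (I \<times> {0, 1}) (sm x) (smat (I \<times> {0, 1}) (bl h))
        = smat (I \<times> {0, 1}) (bl h)"
    using L1(3)[OF I(1,2) zero_neq_one h01] by blast
  obtain y where y: "y \<in> Bm L (I \<times> {2, 3})" "mm (I \<times> {2, 3}) y y = y"
    "mm (I \<times> {2, 3}) (smat (I \<times> {2, 3}) (bl h)) y + mm (I \<times> {2, 3}) (sm y) (smat (I \<times> {2, 3}) (bl h))
        = smat (I \<times> {2, 3}) (bl h)"
    using L2(3)[OF I(1,3) _ h23] by (metis num.distinct(5) numeral_eq_iff)
  have hL: "h k l \<in> L" for k l unfolding h_def hd_def using a by (simp add: Ls)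
  have ds: "x + y \<in> Bm L (I \<times> ({0, 1} \<union> {2, 3}))" "mm (I \<times> ({0, 1} \<union> {2, 3})) (x + y) (x + y) = x + y"
    "mm (I \<times> ({0, 1} \<union> {2, 3})) (smat (I \<times> ({0, 1} \<union> {2, 3})) (bl h)) (x + y) +
     mm (I \<times> ({0, 1} \<union> {2, 3})) (sm (x + y)) (smat (I \<times> ({0, 1} \<union> {2, 3})) (bl h)) = smat (I \<times> ({0, 1} \<union> {2, 3})) (bl h)"
    by (rule direct_sum[OF L I(1) _ _ _ hL _ x y]; auto simp: h_def)+
  define h' where "h' k l = (if k = l then inverse (hd k) else 0)" for k l
  define t where "t = (1/2 :: 'c)"
  have tt: "t + t = 1" unfolding t_def by (rule half_add)
  have tL: "t \<in> L" unfolding t_def using two_L by (auto simp: Ls)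
  have ttt: "t * t + t * t = t" using tt by (metis distrib_left mult.right_neutral)
  \<comment> \<open>The projection onto the line through \<open>e1 + e3\<close>, which is isotropic
    for \<open><a, -a>\<close>; the entries 1/2 make it idempotent.\<close>
  define u :: "nat \<Rightarrow> nat \<Rightarrow> 'c" where "u k l = (if k \<in> {1, 3} \<and> l \<in> {1, 3} then t else 0)" for k l
  have hyp02: "hyp L (I \<times> {0, 2 :: nat})"
  proof (rule hyp_cancel[OF L, of I "{0, 1} \<union> {2, 3}" "{0, 2}" h h' u "x + y"])
    let ?R = "{0, 1} \<union> {2, 3 :: nat}"
    have hd0: "hd k \<noteq> 0" for k unfolding hd_def using a0 by auto
    show "h' k l \<in> L" for k l unfolding h'_def hd_def using a by (simp add: Ls)
    show "u k l \<in> L" for k l unfolding u_def using tL by (simp add: Ls)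
    show "h k l = h l k" for k l unfolding h_def by auto
    have dg: "(\<Sum>p\<in>?R. h k p * Xa p) = hd k * Xa k" "(\<Sum>p\<in>?R. h' k p * Xa p) = inverse (hd k) * Xa k"
      "(\<Sum>p\<in>?R. Xa p * h p k) = Xa k * hd k" if "k \<in> ?R" for k Xa
      using that unfolding h_def h'_def by auto
    show "(\<Sum>p\<in>?R. h k p * h' p l) = (if k = l then 1 else 0)" "(\<Sum>p\<in>?R. h' k p * h p l) = (if k = l then 1 else 0)"
      if "k \<in> ?R" "l \<in> ?R" for k l
      unfolding dg[OF that(1)] using hd0 by (auto simp: h_def h'_def)
    show "(\<Sum>p\<in>?R. u k p * u p l) = u k l" if "k \<in> ?R" "l \<in> ?R" for k l
      using that ttt unfolding u_def by auto
    show "(\<Sum>p\<in>?R. u p k * (\<Sum>q\<in>?R. h p q * u q l)) = 0" for k l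
    proof -
      have "(\<Sum>p\<in>?R. u p k * (\<Sum>q\<in>?R. h p q * u q l)) = (\<Sum>p\<in>?R. u p k * (hd p * u p l))"
        by (intro sum.cong refl) (simp only: dg)
      also have "\<dots> = 0" unfolding u_def hd_def by auto
      finally show ?thesis .
    qed
    show "(\<Sum>p\<in>?R. u k p * (\<Sum>q\<in>?R. h' p q * u l q)) = 0" for k l
    proof -
      have "(\<Sum>p\<in>?R. u k p * (\<Sum>q\<in>?R. h' p q * u l q)) = (\<Sum>p\<in>?R. u k p * (inverse (hd p) * u l p))"
        by (intro sum.cong refl) (simp only: dg)
      also have "\<dots> = 0" unfolding u_def hd_def by auto
      finally show ?thesis .
    qed
    show "(if k = l then 1 else 0) - u k l - (\<Sum>q\<in>?R. (\<Sum>p\<in>?R. h' k p * u q p) * h q l) =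
        (if k = l \<and> k \<in> {0, 2} then 1 else 0)" if "k \<in> ?R" "l \<in> ?R" for k l
      unfolding dg[OF that(1)] dg[OF that(2)] using that a0 tt unfolding u_def hd_def by (auto simp: algebra_simps)
    show "h k l = (if k = l then 1 else 0)" if "l \<in> {0, 2}" for k l
      using that unfolding h_def hd_def by auto
  qed (use hL ds I in auto)
  have "card (I \<times> {0, 2 :: nat}) = 2 ^ (k1 + k2 + 1)" unfolding I_def by simp
  hence "wh L" using I(1) hyp02 by (intro wh_intro[of "I \<times> {0, 2 :: nat}" "k1 + k2 + 1"]) auto
  thus False using not_wh by simp
qed

lemma euclidean_L: "euclidean L"
  unfolding euclidean_def
proof (intro conjI ballI allI impI)
  show "subfld L" by (rule L)
  show "x \<in> sqs L \<or> - x \<in> sqs L" if "x \<in> L" for x using square_or_neg that .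
  { fix x assume x: "x \<in> sqs L" "- x \<in> sqs L"
    then obtain a b where ab: "a \<in> L" "b \<in> L" "x = a * a" "- x = b * b" unfolding sqs_def by auto
    show "x = 0"
    proof (rule ccontr)
      assume "x \<noteq> 0"
      hence a0: "a \<noteq> 0" using ab by auto
      have "(b / a) * (b / a) + 0 * 0 = - 1" using ab a0 by (simp add: field_simps)
      thus False using not_sum_two_squares[of "b / a" 0] ab by (simp add: Ls)
    qed }
  fix x y assume "x \<in> sqs L" "y \<in> sqs L"
  then obtain a b where ab: "a \<in> L" "b \<in> L" "x = a * a" "y = b * b" unfolding sqs_def by auto
  show "x + y \<in> sqs L"
  proof (rule ccontr)
    assume n: "x + y \<notin> sqs L"
    hence "- (x + y) \<in> sqs L" using square_or_neg[of "x + y"] ab by (simp add: Ls)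
    then obtain c where c: "c \<in> L" "- (x + y) = c * c" unfolding sqs_def by auto
    have c0: "c \<noteq> 0" using n sqs_zero[OF L(1)] c by (metis add.inverse_neutral equation_minus_iff mult_zero_left)
    have "(a / c) * (a / c) + (b / c) * (b / c) = (x + y) / (c * c)" using ab by (simp add: add_divide_distrib)
    also have "x + y = - (c * c)" using c by (metis add.inverse_inverse)
    finally show False using not_sum_two_squares[of "a / c" "b / c"] ab c c0 by (simp add: Ls)
  qed
qed

text \<open>The transferred form is the unit form plus \<open>m\<close> hyperbolic planes.
  Cancelling the planes leaves the single place \<open>m\<close>, so hyperbolicity over a larger
  \<open>L'\<close> would descend to \<open>L\<close> with the same multiple.\<close>

lemma odd_degree:
  assumes r: "odd r" and f: "\<And>k. f k \<in> L" "\<alpha> ^ r = (\<Sum>k<r. f k * \<alpha> ^ k)"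
    and indep: "\<And>c. (\<forall>k<r. c k \<in> L) \<Longrightarrow> (\<Sum>k<r. c k * \<alpha> ^ k) = 0 \<Longrightarrow> \<forall>k<r. c k = 0"
    and L': "subfld L'" "L \<subseteq> L'" "\<alpha> \<in> L'" and mem: "\<And>x. x \<in> L' \<longleftrightarrow> (\<exists>c. (\<forall>k<r. c k \<in> L) \<and> x = (\<Sum>k<r. c k * \<alpha> ^ k))"
  shows "\<alpha> \<in> L"
proof (rule ccontr)
  assume "\<alpha> \<notin> L"
  hence "wh L'" using maximal[OF L'(1)] L' by blast
  then obtain k where k: "hyp L' {..<(2::nat) ^ k}" unfolding wh_def by blast
  obtain m where m: "r = 2 * m + 1" using r by (elim oddE)
  let ?R = "{..<r}" and ?I = "{..<(2::nat) ^ k}"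
  obtain be cf lam where b: "\<And>k. k < r \<Longrightarrow> be k \<in> L'" "\<And>k x. k < r \<Longrightarrow> x \<in> L' \<Longrightarrow> cf k x \<in> L"
    "\<And>k x y. k < r \<Longrightarrow> x \<in> L' \<Longrightarrow> y \<in> L' \<Longrightarrow> cf k (x + y) = cf k x + cf k y"
    "\<And>k c x. k < r \<Longrightarrow> c \<in> L \<Longrightarrow> x \<in> L' \<Longrightarrow> cf k (c * x) = c * cf k x"
    "\<And>x. x \<in> L' \<Longrightarrow> x = (\<Sum>k<r. cf k x * be k)"
    "\<And>x y. x \<in> L' \<Longrightarrow> y \<in> L' \<Longrightarrow> lam (x + y) = lam x + lam y" "\<And>c x. c \<in> L \<Longrightarrow> x \<in> L' \<Longrightarrow> lam (c * x) = c * lam x"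
    "\<And>k l. k < r \<Longrightarrow> l < r \<Longrightarrow> lam (be k * be l) = (if k + l = 2 * m then 1 else 0)"
    by (rule odd_extension_basis[where L = L and r = r and \<alpha> = \<alpha> and L' = L' and m = m and f = f])
      (rule L two m f L' | erule (1) indep | rule mem | blast)+
  define h :: "nat \<Rightarrow> nat \<Rightarrow> 'c" where "h k l = (if k + l = 2 * m then 1 else 0)" for k l
  obtain x where x: "x \<in> Bm L (?I \<times> ?R)" "mm (?I \<times> ?R) x x = x"
      "mm (?I \<times> ?R) (smat (?I \<times> ?R) (bl h)) x + mm (?I \<times> ?R) (sm x) (smat (?I \<times> ?R) (bl h)) = smat (?I \<times> ?R) (bl h)"
  proof (rule transfer_hyp[OF L L'(1,2), of ?I ?R be cf lam h])
    show "x = (\<Sum>k\<in>?R. cf k x * be k)" if "x \<in> L'" for x using b(5)[OF that] .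
    show "lam (x + y) = lam x + lam y" if "x \<in> L'" "y \<in> L'" for x y by (rule b(6)[OF that])
    show "lam (c * x) = c * lam x" if "c \<in> L" "x \<in> L'" for c x by (rule b(7)[OF that])
    show "cf k x \<in> L" if "k \<in> ?R" "x \<in> L'" for k x using b(2) that by blast
    show "cf k (x + y) = cf k x + cf k y" if "k \<in> ?R" "x \<in> L'" "y \<in> L'" for k x y using b(3) that by blast
    show "cf k (c * x) = c * cf k x" if "k \<in> ?R" "c \<in> L" "x \<in> L'" for k c x using b(4) that by blast
    show "h k l = lam (be k * be l)" if "k \<in> ?R" "l \<in> ?R" for k l using b(8)[of k l] that by (simp add: h_def)
    show "be k \<in> L'" if "k \<in> ?R" for k using b(1) that by blast
  qed (use k in auto)
  \<comment> \<open>The first \<open>m\<close> basis vectors span a Lagrangian of the planes, since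
    the Gram matrix pairs \<open>k\<close> with \<open>2 * m - k\<close>.\<close>
  define u :: "nat \<Rightarrow> nat \<Rightarrow> 'c" where "u k l = (if k = l \<and> k < m then 1 else 0)" for k l
  have "hyp L (?I \<times> {m})"
  proof (rule hyp_cancel[OF L, of ?I ?R "{m}" h h u x])
    have hs: "(\<Sum>p\<in>?R. h k p * Xa p) = Xa (2 * m - k)" "(\<Sum>p\<in>?R. Xa p * h p k) = Xa (2 * m - k)" if "k < r" for k Xa
    proof -
      have in': "2 * m - k \<in> {..<r}" using m by auto
      have "(\<Sum>p\<in>?R. h k p * Xa p) = (\<Sum>p\<in>?R. if p = 2 * m - k then Xa p else 0)"
        using that m by (intro sum.cong) (auto simp: h_def)
      thus "(\<Sum>p\<in>?R. h k p * Xa p) = Xa (2 * m - k)" using in' by (simp only: sum.delta finite_lessThan if_True)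
      have "(\<Sum>p\<in>?R. Xa p * h p k) = (\<Sum>p\<in>?R. if p = 2 * m - k then Xa p else 0)"
        using that m by (intro sum.cong) (auto simp: h_def)
      thus "(\<Sum>p\<in>?R. Xa p * h p k) = Xa (2 * m - k)" using in' by (simp only: sum.delta finite_lessThan if_True)
    qed
    have us: "(\<Sum>p\<in>?R. u k p * Xa p) = (if k < m then Xa k else 0)" "(\<Sum>p\<in>?R. u p k * Xa p) = (if k < m then Xa k else 0)" for k Xa
    proof -
      have mr: "k < m \<Longrightarrow> k \<in> {..<r}" using m by auto
      have "(\<Sum>p\<in>?R. u k p * Xa p) = (\<Sum>p\<in>?R. if p = k then (if k < m then Xa k else 0) else 0)"
        by (intro sum.cong) (auto simp: u_def)
      thus "(\<Sum>p\<in>?R. u k p * Xa p) = (if k < m then Xa k else 0)" using mr by (subst (asm) sum.delta) auto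
      have "(\<Sum>p\<in>?R. u p k * Xa p) = (\<Sum>p\<in>?R. if p = k then (if k < m then Xa k else 0) else 0)"
        by (intro sum.cong) (auto simp: u_def)
      thus "(\<Sum>p\<in>?R. u p k * Xa p) = (if k < m then Xa k else 0)" using mr by (subst (asm) sum.delta) auto
    qed
    show "{m} \<subseteq> ?R" using m by auto
    show "h k l \<in> L" "h k l \<in> L" "u k l \<in> L" for k l unfolding h_def u_def by (simp_all add: Ls)
    show "h k l = h l k" for k l unfolding h_def by (simp add: add.commute)
    show "(\<Sum>p\<in>?R. h k p * h p l) = (if k = l then 1 else 0)" "(\<Sum>p\<in>?R. h k p * h p l) = (if k = l then 1 else 0)"
      if "k \<in> ?R" "l \<in> ?R" for k l
      using that hs(1)[of k "\<lambda>p. h p l"] m by (auto simp: h_def)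
    show "(\<Sum>p\<in>?R. u k p * u p l) = u k l" if "k \<in> ?R" "l \<in> ?R" for k l unfolding us by (auto simp: u_def)
    show "(\<Sum>p\<in>?R. u p k * (\<Sum>q\<in>?R. h p q * u q l)) = 0" if "k \<in> ?R" "l \<in> ?R" for k l
      unfolding us using hs(1)[of k "\<lambda>q. u q l"] that by (auto simp: u_def)
    show "(\<Sum>p\<in>?R. u k p * (\<Sum>q\<in>?R. h p q * u l q)) = 0" if "k \<in> ?R" "l \<in> ?R" for k l
      unfolding us using hs(1)[of k "\<lambda>q. u l q"] that by (auto simp: u_def)
    show "(if k = l then 1 else 0) - u k l - (\<Sum>q\<in>?R. (\<Sum>p\<in>?R. h k p * u q p) * h q l) = (if k = l \<and> k \<in> {m} then 1 else 0)"
      if kl: "k \<in> ?R" "l \<in> ?R" for k l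
    proof -
      have e: "(\<Sum>q\<in>?R. (\<Sum>p\<in>?R. h k p * u q p) * h q l) = u (2 * m - l) (2 * m - k)"
      proof -
        have kr: "k < r" "l < r" using kl by auto
        show ?thesis unfolding hs(2)[OF kr(2)] hs(1)[OF kr(1)] ..
      qed
      have "k \<le> 2 * m" "l \<le> 2 * m" using kl m by auto
      hence c: "(2 * m - l = 2 * m - k \<and> 2 * m - l < m) = (k = l \<and> m < k)" by linarith
      show ?thesis unfolding e unfolding u_def c by auto
    qed
    show "h k l = (if k = l then 1 else 0)" if "k \<in> ?R" "l \<in> {m}" for k l using that by (auto simp: h_def)
  qed (use x in auto)
  hence "wh L" by (intro wh_intro[of "?I \<times> {m}" k]) auto
  thus False using not_wh by simp
qed

text \<open>If the degree \<open>r\<close> of some root is odd, this root lies in \<open>L\<close>.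
  If it is even, dividing by the minimal polynomial \<open>q\<close> of the root leaves a polynomial
  over \<open>L\<close> of smaller odd degree, to which induction applies.\<close>

lemma odd_root:
  "odd (length xs) \<Longrightarrow> pol L (prod_list (map (\<lambda>a. [:- a, 1:]) xs)) \<Longrightarrow> \<exists>a\<in>set xs. a \<in> L"
proof (induction "length xs" arbitrary: xs rule: less_induct)
  case less
  let ?P = "\<lambda>xs. prod_list (map (\<lambda>a. [:- a, 1:]) xs) :: 'c poly"
  obtain \<alpha> where \<alpha>: "\<alpha> \<in> set xs" using less.prems by (cases xs) auto
  have rootP: "poly (?P ys) z = 0 \<longleftrightarrow> z \<in> set ys" for ys z
    by (induction ys) (auto simp: algebra_simps)
  have P0: "?P ys \<noteq> 0" for ys by (auto simp: prod_list_zero_iff)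
  obtain r f L' where r: "0 < r" "r \<le> degree (?P xs)" "\<And>k. f k \<in> L" "\<alpha> ^ r = (\<Sum>k<r. f k * \<alpha> ^ k)"
    and indep: "\<And>c. (\<forall>k<r. c k \<in> L) \<Longrightarrow> (\<Sum>k<r. c k * \<alpha> ^ k) = 0 \<Longrightarrow> \<forall>k<r. c k = 0"
    and L': "subfld L'" "L \<subseteq> L'" "\<alpha> \<in> L'" and mem: "\<And>x. x \<in> L' \<longleftrightarrow> (\<exists>c. (\<forall>k<r. c k \<in> L) \<and> x = (\<Sum>k<r. c k * \<alpha> ^ k))"
    by (rule simple_extension[OF L(1) less.prems(2) P0 iffD2[OF rootP \<alpha>]]) (rule that; assumption)
  show ?case
  proof (cases "odd r")
    case True
    have "\<alpha> \<in> L" by (rule odd_degree[OF True r(3,4) _ L' mem]) (rule indep)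
    thus ?thesis using \<alpha> by blast
  next
    case False
    define q where "q = monom 1 r - (\<Sum>k<r. monom (f k) k)"
    have cq: "coeff q n = (if n = r then 1 else if n < r then - f n else 0)" for n
    proof -
      have "coeff (\<Sum>k<r. monom (f k) k) n = (\<Sum>k<r. if k = n then f n else 0)"
        unfolding coeff_sum by (intro sum.cong) auto
      thus ?thesis unfolding q_def by simp
    qed
    have dq: "degree q = r" by (rule antisym, rule degree_le) (auto simp: cq intro: le_degree)
    have qL: "pol L q" "lead_coeff q = 1" unfolding pol_def dq cq using r(3) by (auto simp: Ls)
    have q\<alpha>: "poly q \<alpha> = 0" unfolding q_def using r(4) by (simp add: poly_sum poly_monom)
    obtain s t where st: "pol L s" "pol L t" "?P xs = q * s + t" "t = 0 \<or> degree t < degree q"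
      using pol_division[OF L(1) qL less.prems(2)] by blast
    have "poly (?P xs) \<alpha> = poly q \<alpha> * poly s \<alpha> + poly t \<alpha>" unfolding st(3) by simp
    moreover have "poly (?P xs) \<alpha> = 0" using rootP \<alpha> by blast
    ultimately have t\<alpha>: "poly t \<alpha> = 0" using q\<alpha> by simp
    have "t = 0"
    proof (rule ccontr)
      assume "t \<noteq> 0"
      hence dt: "degree t < r" using st(4) dq by simp
      have "(\<Sum>k<r. coeff t k * \<alpha> ^ k) = poly t \<alpha>" unfolding poly_altdef
        by (rule sum.mono_neutral_right) (use dt in \<open>auto simp: coeff_eq_0\<close>)
      hence "\<forall>k<r. coeff t k = 0" using t\<alpha> st(2) by (intro indep) (auto simp: pol_def)
      thus False using dt \<open>t \<noteq> 0\<close> by (metis leading_coeff_0_iff)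
    qed
    hence Ps: "?P xs = q * s" using st by simp
    have s0: "s \<noteq> 0" "q \<noteq> 0" using P0[of xs] Ps by auto
    have "lead_coeff (?P xs) = 1" by (induction xs) (simp_all add: lead_coeff_mult del: mult_pCons_left)
    hence ls: "lead_coeff s = 1" using Ps qL by (simp add: lead_coeff_mult)
    obtain A where A: "size A = degree s" "s = smult (lead_coeff s) (\<Prod>x\<in>#A. [:- x, 1:])"
      using alg_closed_imp_factorization[OF s0(1)] by blast
    obtain ys where ys: "mset ys = A" using ex_mset by blast
    have sP: "s = ?P ys" using A(2) ls ys by (metis mset_map prod_mset_prod_list smult_1_left)
    have len: "length xs = r + length ys"
      using arg_cong[OF Ps, of degree] s0 dq degree_prod_roots[of xs] degree_prod_roots[of ys] sP
      by (simp add: degree_mult_eq)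
    have "length ys < length xs" "odd (length ys)" using len r less.prems False by auto
    then obtain b where b: "b \<in> set ys" "b \<in> L" using less.hyps st(1) sP by blast
    have "poly (?P xs) b = 0" unfolding Ps using rootP[of ys b] b sP by simp
    thus ?thesis using rootP b by blast
  qed
qed

lemma of_nat_sqs: "of_nat n \<in> sqs L"
  by (induction n) (auto simp: sqs_zero[OF L(1)] intro: euclideanD(2)[OF euclidean_L] sqs_one[OF L(1)])

lemma of_nat_Suc_nonzero: "of_nat (Suc n) \<noteq> (0::'c)"
proof
  assume "of_nat (Suc n) = (0::'c)"
  hence "of_nat n = (- 1 :: 'c)" by (simp add: eq_neg_iff_add_eq_0 add.commute)
  hence "- 1 \<in> sqs L" using of_nat_sqs[of n] by simp
  thus False using euclideanD(4)[OF euclidean_L sqs_one[OF L(1)]] by simp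
qed

lemma splitting:
  obtains ii where "almost_real_closed L ii"
proof -
  obtain ii :: 'c where "ii ^ 2 = - 1" using nth_root_exists[of 2 "- 1"] by auto
  thus ?thesis using that[of ii] euclidean_L of_nat_Suc_nonzero odd_root
    unfolding almost_real_closed_def power2_eq_square by blast
qed

end

section \<open>Traces of matrices and real quadratic factors of polynomials\<close>

definition mp :: "nat set \<Rightarrow> (nat \<Rightarrow> nat \<Rightarrow> 'c::field) \<Rightarrow> (nat \<Rightarrow> nat \<Rightarrow> 'c) \<Rightarrow> nat \<Rightarrow> nat \<Rightarrow> 'c" where
  "mp S M N = (\<lambda>i j. \<Sum>k\<in>S. M i k * N k j)"

text \<open>\<open>pp S M n\<close> is the power with exponent \<open>n + 1\<close>; starting at
  \<open>M\<close> avoids an identity matrix adapted to \<open>S\<close>.\<close>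

primrec pp :: "nat set \<Rightarrow> (nat \<Rightarrow> nat \<Rightarrow> 'c::field) \<Rightarrow> nat \<Rightarrow> nat \<Rightarrow> nat \<Rightarrow> 'c" where
  "pp S M 0 = M"
| "pp S M (Suc n) = mp S M (pp S M n)"

lemma mp_nassoc: "nassoc (mp S)"
proof
  fix A M N :: "nat \<Rightarrow> nat \<Rightarrow> 'a"
  have "mp S (mp S A M) N i j = mp S A (mp S M N) i j" for i j
    unfolding mp_def sum_distrib_left sum_distrib_right by (subst sum.swap) (simp add: mult.assoc)
  thus "mp S (mp S A M) N = mp S A (mp S M N)" by (intro ext)
  show "mp S (A + M) N = mp S A N + mp S M N" "mp S A (M + N) = mp S A M + mp S A N"
    unfolding mp_def by (auto simp: fun_eq_iff algebra_simps sum.distrib)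
qed

lemma pp_commute:
  shows "pp S M (Suc n) = mp S (pp S M n) M"
    "pp S (mp S A D) (Suc n) = mp S A (mp S (pp S (mp S D A) n) D)"
proof -
  interpret nassoc "mp S" by (rule mp_nassoc)
  show "pp S M (Suc n) = mp S (pp S M n) M"
  proof (induction n)
    case (Suc n)
    have "pp S M (Suc (Suc n)) = mp S M (mp S (pp S M n) M)" using Suc by (simp only: pp.simps)
    thus ?case by (simp only: pp.simps assoc)
  qed simp
  show "pp S (mp S A D) (Suc n) = mp S A (mp S (pp S (mp S D A) n) D)"
    by (induction n) (simp_all add: assoc)
qed

lemma trace_comm: "(\<Sum>i\<in>S. mp S A D i i) = (\<Sum>i\<in>S. mp S D A i i)"
  unfolding mp_def by (subst sum.swap) (simp add: mult.commute)

text \<open>The trace of a matrix all of whose eigenvalues are \<open>0\<close> or \<open>1\<close>. A singular matrix factors through a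
  smaller index set, and interchanging the factors preserves the trace.\<close>

lemma trace_stable:
  fixes M :: "nat \<Rightarrow> nat \<Rightarrow> 'c::field"
  assumes S: "finite S"
  shows "S' \<subseteq> S \<Longrightarrow> (\<And>i j. i \<notin> S' \<or> j \<notin> S' \<Longrightarrow> M i j = 0) \<Longrightarrow> pp S M (Suc n) = pp S M n \<Longrightarrow>
    \<exists>r. (\<Sum>i\<in>S. M i i) = of_nat r \<and> (r = 0 \<longleftrightarrow> pp S M n = 0)"
proof (induction "card S'" arbitrary: S' M n rule: less_induct)
  case less
  interpret nassoc "mp S" by (rule mp_nassoc)
  have S': "finite S'" using less.prems S finite_subset by blast
  show ?case
  proof (cases "\<exists>v. (\<exists>k. v k \<noteq> 0) \<and> (\<forall>k. k \<notin> S' \<longrightarrow> v k = 0) \<and> (\<forall>i. (\<Sum>k\<in>S. M i k * v k) = 0)")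
    case True
    then obtain v j where v: "v j \<noteq> 0" "\<And>k. k \<notin> S' \<Longrightarrow> v k = 0" "\<And>i. (\<Sum>k\<in>S. M i k * v k) = 0" by blast
    have j: "j \<in> S'" "j \<in> S" using v less.prems(1) by auto
    \<comment> \<open>By the kernel vector \<open>v\<close>, column \<open>j\<close> is a
      combination of the others. \<open>A\<close> deletes this column and \<open>D\<close> restores
      it, so \<open>M\<close> is \<open>A\<close> times \<open>D\<close>, whereas \<open>D\<close>
      times \<open>A\<close> is supported on \<open>S' - {j}\<close>.\<close>
    define A where "A i l = (if l = j then 0 else M i l)" for i l
    define D where "D k l = (if k = j \<or> k \<notin> S' then 0 else (if k = l then 1 else 0) - v k / v j * (if l = j then 1 else 0))" for k l
    have M: "M = mp S A D"
    proof (intro ext)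
      fix i p
      have Dj: "D l j = - v l / v j" if "l \<noteq> j" for l using that v(2)[of l] by (auto simp: D_def)
      show "M i p = mp S A D i p"
      proof (cases "p = j")
        case True
        have "mp S A D i p = (\<Sum>l\<in>S - {j}. M i l * (- v l / v j))"
          unfolding mp_def using S j True v(2)
          by (subst sum.remove[of _ j]) (auto simp: A_def Dj intro!: sum.cong)
        also have "\<dots> = - (\<Sum>l\<in>S - {j}. M i l * v l) / v j"
          by (simp add: sum_negf sum_divide_distrib)
        also have "(\<Sum>l\<in>S - {j}. M i l * v l) = - (M i j * v j)"
          using v(3)[of i] S j by (subst (asm) sum.remove[of _ j]) (auto simp: eq_neg_iff_add_eq_0 add.commute)
        finally show ?thesis using True v(1) by simp
      next
        case False
        have "mp S A D i p = (\<Sum>l\<in>S. if l = p then (if p \<in> S' then M i p else 0) else 0)"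
          unfolding mp_def using False by (intro sum.cong) (auto simp: A_def D_def)
        also have "\<dots> = M i p" using S less.prems(1,2) by auto
        finally show ?thesis ..
      qed
    qed
    define N where "N = mp S D A"
    have "card (S' - {j}) < card S'" using j S' by (rule_tac psubset_card_mono) auto
    moreover have "N i k = 0" if "i \<notin> S' - {j} \<or> k \<notin> S' - {j}" for i k
      unfolding N_def mp_def
    proof (intro sum.neutral ballI)
      fix l
      show "D i l * A l k = 0" using that less.prems(2)[of l k] by (auto simp: D_def A_def)
    qed
    moreover have st: "pp S N (Suc (Suc n)) = pp S N (Suc n)"
      unfolding N_def using less.prems(3) by (simp only: pp_commute(2) M[symmetric])
    ultimately obtain r where r: "(\<Sum>i\<in>S. N i i) = of_nat r" "r = 0 \<longleftrightarrow> pp S N (Suc n) = 0"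
      using less.hyps[of "S' - {j}" N "Suc n"] less.prems(1) by blast
    have "pp S M (Suc (Suc n)) = mp S A (mp S (pp S N (Suc n)) D)" unfolding M N_def by (rule pp_commute(2))
    moreover have "pp S M (Suc (Suc n)) = pp S M n" using less.prems(3) by simp
    moreover have "pp S N (Suc n) = mp S D (mp S (pp S M n) A)" unfolding M N_def by (rule pp_commute(2))
    ultimately have "pp S N (Suc n) = 0 \<longleftrightarrow> pp S M n = 0" by (metis zero_left zero_right)
    moreover have "(\<Sum>i\<in>S. M i i) = (\<Sum>i\<in>S. N i i)" unfolding M N_def by (rule trace_comm)
    ultimately show ?thesis using r by metis
  next
    case False
    hence inj: "\<And>v. (\<And>k. k \<notin> S' \<Longrightarrow> v k = 0) \<Longrightarrow> (\<And>i. (\<Sum>k\<in>S. M i k * v k) = 0) \<Longrightarrow> (\<forall>k. v k = 0)" by blast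
    have cancel: "Z = 0" if "mp S M Z = 0" "\<And>i j. i \<notin> S' \<Longrightarrow> Z i j = 0" for Z
    proof (intro ext)
      fix i j
      have "(\<Sum>k\<in>S. M a k * Z k j) = 0" for a using fun_cong[OF fun_cong[OF that(1), of a], of j] unfolding mp_def by simp
      thus "Z i j = 0 i j" using inj[of "\<lambda>k. Z k j"] that(2) by simp
    qed
    have pp_supp: "pp S M k i j = 0" if "i \<notin> S'" for k i j
      by (cases k) (use that less.prems(2) in \<open>auto simp: mp_def\<close>)
    have MZ_supp: "mp S M Z i j = 0" if "i \<notin> S'" for Z i j
      using that less.prems(2) unfolding mp_def by auto
    have cancel_pp: "Z = 0" if "mp S (pp S M k) Z = 0" "\<And>i j. i \<notin> S' \<Longrightarrow> Z i j = 0" for k Z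
      using that
    proof (induction k)
      case (Suc k)
      have "mp S M (mp S (pp S M k) Z) = 0" using Suc.prems(1) by (simp only: pp.simps assoc)
      hence "mp S (pp S M k) Z = 0" by (rule cancel) (use pp_supp in \<open>auto simp: mp_def\<close>)
      thus ?case using Suc by blast
    qed (use cancel in simp)
    \<comment> \<open>\<open>U\<close> is the identity on \<open>S'\<close>. The hypothesis says
      that a power of \<open>M\<close> kills \<open>M - U\<close>, and without kernel vectors this
      power can be cancelled.\<close>
    define U where "U i j = (if i = j \<and> i \<in> S' then 1 else (0::'c))" for i j
    have PU: "mp S (pp S M k) U = pp S M k" for k
    proof (intro ext)
      fix i j
      have "pp S M k i j = 0" if "j \<notin> S'"
        by (induction k arbitrary: i) (use that less.prems(2) in \<open>auto simp: mp_def\<close>)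
      moreover have "mp S (pp S M k) U i j = (\<Sum>l\<in>S. if l = j then (if j \<in> S' then pp S M k i j else 0) else 0)"
        unfolding mp_def U_def by (intro sum.cong) auto
      ultimately show "mp S (pp S M k) U i j = pp S M k i j" using S less.prems(1) by auto
    qed
    have "mp S (pp S M n) (M - U) = 0"
      using less.prems(3) pp_commute(1)[of S M n] by (simp add: diff_right PU)
    hence "M - U = 0" by (rule cancel_pp) (use less.prems(2) in \<open>auto simp: U_def\<close>)
    hence MU: "M = U" by simp
    have "(\<Sum>i\<in>S. M i i) = (\<Sum>i\<in>S. if i \<in> S' then 1 else 0)" unfolding MU U_def by (intro sum.cong) auto
    also have "\<dots> = of_nat (card S')" using S less.prems(1) by (simp add: sum.If_cases Int_absorb1)
    finally have tr: "(\<Sum>i\<in>S. M i i) = of_nat (card S')" .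
    have "pp S M n = U"
    proof (induction n)
      case (Suc n)
      thus ?case using PU[of 0] MU by simp
    qed (simp add: MU)
    moreover have "U = 0 \<longleftrightarrow> S' = {}"
    proof
      assume "U = 0"
      hence "U i i = 0" for i by simp
      thus "S' = {}" unfolding U_def by (metis equals0I zero_neq_one)
    qed (auto simp: U_def fun_eq_iff)
    ultimately show ?thesis using tr S' by auto
  qed
qed

text \<open>A root \<open>u + v ii\<close> of \<open>f\<close> satisfies the quadratic
  \<open>(X - u)^2 + v^2\<close> over \<open>L\<close>. For \<open>v \<noteq> 0\<close> this
  quadratic divides \<open>f\<close>. For \<open>v = 0\<close> one only splits off
  \<open>X - u\<close> and wastes the second factor, which is why divisibility is claimed and not
  equality.\<close>

lemma (in almost_real_closed) divides_quadratics:
  assumes split: "\<And>p :: 'c poly. p \<noteq> 0 \<Longrightarrow> \<exists>A. size A = degree p \<and> p = smult (lead_coeff p) (\<Prod>x\<in>#A. [:- x, 1:])"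
  shows "f \<noteq> 0 \<Longrightarrow> pol L f \<Longrightarrow> \<exists>qs. set qs \<subseteq> L \<times> L \<and> f dvd prod_list (map (\<lambda>(a, b). [:a * a + b * b, - (2 * a), 1:]) qs)"
proof (induction "degree f" arbitrary: f rule: less_induct)
  case less
  show ?case
  proof (cases "degree f = 0")
    case True
    then obtain c where "f = [:c:]" by (elim degree_eq_zeroE)
    hence "f dvd 1" using less.prems(1) by (simp add: is_unit_pCons_iff)
    thus ?thesis by (intro exI[of _ "[]"]) auto
  next
    case False
    obtain A where A: "size A = degree f" "f = smult (lead_coeff f) (\<Prod>x\<in>#A. [:- x, 1:])"
      using split[OF less.prems(1)] by blast
    obtain xs where xs: "mset xs = A" using ex_mset by blast
    let ?P = "prod_list (map (\<lambda>a. [:- a, 1:]) xs)"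
    have fP: "f = smult (lead_coeff f) ?P" using A(2) xs by (metis mset_map prod_mset_prod_list)
    have lf: "lead_coeff f \<noteq> 0" "lead_coeff f \<in> L" using less.prems unfolding pol_def by auto
    have "?P = smult (inverse (lead_coeff f)) f" using lf(1) by (subst (2) fP) simp
    hence PL: "pol L ?P" using pol_simps(4)[OF L] less.prems(2) lf Ls by metis
    have "xs \<noteq> []" using A(1) xs False by auto
    then obtain \<alpha> where \<alpha>: "\<alpha> \<in> set xs" "\<alpha> \<in> M" using root_in_M PL by blast
    have "poly ?P \<alpha> = 0" using \<alpha>(1) by (induction xs) (auto simp: algebra_simps)
    hence f\<alpha>: "poly f \<alpha> = 0" by (subst fP) simp
    obtain u v where uv: "u \<in> L" "v \<in> L" "\<alpha> = u + v * ii" using \<alpha> unfolding M_def by auto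
    let ?Q = "[:u * u + v * v, - (2 * u), 1:]"
    have QL: "pol L ?Q" using uv Ls Ls(3)[OF Ls(2,2)] by (simp add: pol_simps[OF L])
    have Qe: "?Q = [:- u, 1:] * [:- u, 1:] + [:v * v:]" by simp
    have "v * v * (ii * ii) = - (v * v)" unfolding ii by simp
    hence Q\<alpha>: "poly ?Q \<alpha> = 0" unfolding uv(3) by (simp add: algebra_simps)
    have finish: ?thesis if s: "s \<noteq> 0" "pol L s" "degree s < degree f" "f dvd ?Q * s" for s
    proof -
      obtain qs where qs: "set qs \<subseteq> L \<times> L" "s dvd prod_list (map (\<lambda>(a, b). [:a * a + b * b, - (2 * a), 1:]) qs)"
        using less.hyps[OF s(3,1,2)] by blast
      have "f dvd prod_list (map (\<lambda>(a, b). [:a * a + b * b, - (2 * a), 1:]) ((u, v) # qs))"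
        using dvd_trans[OF s(4) mult_dvd_mono[OF dvd_refl qs(2)]] by simp
      thus ?thesis using qs(1) uv by (intro exI[of _ "(u, v) # qs"]) auto
    qed
    show ?thesis
    proof (cases "v = 0")
      case True
      have "pol L [:- u, 1:]" using uv Ls by (simp add: pol_simps[OF L])
      then obtain s t where st: "pol L s" "f = [:- u, 1:] * s + t" "t = 0 \<or> degree t < 1"
        using pol_division[OF L _ _ less.prems(2), of "[:- u, 1:]"] by auto
      have "poly t u = 0" using f\<alpha> uv True unfolding st(2) by simp
      hence "t = 0" using st(3) by (auto elim!: degree_eq_zeroE)
      hence fs: "f = [:- u, 1:] * s" using st by simp
      have s0: "s \<noteq> 0" using fs less.prems by auto
      have "degree f = Suc (degree s)" unfolding fs using s0 by (subst degree_mult_eq) auto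
      moreover have "f dvd ?Q * s"
      proof -
        have "?Q = [:- u, 1:] * [:- u, 1:]" using True by simp
        hence "?Q * s = f * [:- u, 1:]" unfolding fs by (simp only: ac_simps)
        thus ?thesis by (simp only: dvd_triv_left)
      qed
      ultimately show ?thesis using finish[OF s0 st(1)] by simp
    next
      case v0: False
      obtain s t where st: "pol L s" "pol L t" "f = ?Q * s + t" "t = 0 \<or> degree t < 2"
        using pol_division[OF L QL _ less.prems(2)] by auto
      have "poly f \<alpha> = poly ?Q \<alpha> * poly s \<alpha> + poly t \<alpha>" by (subst st(3)) (simp only: poly_add poly_mult)
      hence t\<alpha>: "poly t \<alpha> = 0" unfolding f\<alpha> Q\<alpha> by simp
      \<comment> \<open>A nonzero remainder of degree at most 1 with root \<open>\<alpha>\<close>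
        would put \<open>ii\<close> into \<open>L\<close> and make -1 a square.\<close>
      have "t = 0"
      proof (rule ccontr)
        assume t0: "t \<noteq> 0"
        obtain a t' where t': "t = pCons a t'" by (cases t) auto
        have "degree t' = 0" using st(4) t0 t' by (cases "t' = 0") auto
        then obtain b where b: "t' = [:b:]" by (elim degree_eq_zeroE)
        have abL: "a \<in> L" "b \<in> L" using st(2) unfolding t' b by (simp_all add: pol_simps[OF L])
        have e: "a + b * u + b * v * ii = 0" using t\<alpha> unfolding t' b uv(3) by (simp add: algebra_simps)
        show False
        proof (cases "b = 0")
          case True
          thus False using e t0 t' b by simp
        next
          case False
          hence "ii = - (a + b * u) / (b * v)" using e v0 by (simp add: field_simps eq_neg_iff_add_eq_0)
          hence iL: "ii \<in> L" using abL uv by (simp add: Ls)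
          hence "- 1 \<in> sqs L" unfolding sqs_def using ii by force
          thus False using euclideanD(4)[OF euc sqs_one[OF L]] by simp
        qed
      qed
      hence fs: "f = ?Q * s" using st by simp
      have s0: "s \<noteq> 0" using fs less.prems by auto
      have "degree f = degree s + 2" unfolding fs using s0 by (subst degree_mult_eq) auto
      thus ?thesis using finish[OF s0 st(1)] fs by simp
    qed
  qed
qed

section \<open>The trace form and evaluation of polynomials in coordinates\<close>

context coalg
begin

text \<open>The matrix of left multiplication by \<open>x\<close>, see
  \<open>mA_lmat\<close>.\<close>

definition lmat :: "(nat \<Rightarrow> 'c) \<Rightarrow> nat \<Rightarrow> nat \<Rightarrow> 'c" where
  "lmat x = (\<lambda>p k. if p < d \<and> k < d then \<Sum>i<d. x i * g i k p else 0)"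

definition tr :: "(nat \<Rightarrow> 'c) \<Rightarrow> 'c" where "tr x = (\<Sum>k<d. lmat x k k)"

definition qf :: "(nat \<Rightarrow> 'c) \<Rightarrow> 'c" where "qf x = tr (mA (sA x) x)"

lemma mA_lmat: "mA x y p = (\<Sum>k<d. lmat x p k * y k)"
proof (cases "p < d")
  case True
  have "mA x y p = (\<Sum>k<d. \<Sum>i<d. x i * y k * g i k p)" unfolding ma_def using True by (simp only: if_True) (rule sum.swap)
  also have "\<dots> = (\<Sum>k<d. lmat x p k * y k)"
    using True by (intro sum.cong) (auto simp: lmat_def sum_distrib_left sum_distrib_right mult_ac)
  finally show ?thesis .
qed (simp add: ma_def lmat_def)

lemma lmat_mult: "lmat (mA x y) = mp {..<d} (lmat x) (lmat y)"
proof (intro ext)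
  fix p k
  show "lmat (mA x y) p k = mp {..<d} (lmat x) (lmat y) p k"
  proof (cases "k < d")
    case True
    have col: "mA z (\<lambda>l. if l = k then 1 else 0) p = lmat z p k" for z p
      unfolding mA_lmat using True by (simp add: if_distrib cong: if_cong)
    have "lmat (mA x y) p k = mA x (mA y (\<lambda>l. if l = k then 1 else 0)) p" unfolding col[symmetric] ma_assoc ..
    also have "\<dots> = (\<Sum>l<d. lmat x p l * lmat y l k)" unfolding mA_lmat[of x] col ..
    finally show ?thesis unfolding mp_def .
  qed (simp add: lmat_def mp_def)
qed

lemma lmat_add: "lmat (x + y) p k = lmat x p k + lmat y p k"
  unfolding lmat_def by (simp add: distrib_right sum.distrib)

lemma lmat_scale: "lmat (\<lambda>k. c * x k) p k = c * lmat x p k"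
  unfolding lmat_def by (simp add: sum_distrib_left mult.assoc)

lemma tr_add: "tr (x + y) = tr x + tr y" unfolding tr_def lmat_add by (simp add: sum.distrib)

lemma tr_scale: "tr (\<lambda>k. c * x k) = c * tr x" unfolding tr_def lmat_scale by (simp add: sum_distrib_left)

lemma tr_comm: "tr (mA x y) = tr (mA y x)" unfolding tr_def lmat_mult by (rule trace_comm)

lemma lmat_stable:
  assumes "pp {..<d} (lmat x) (Suc n) = pp {..<d} (lmat x) n"
  shows "\<exists>r. tr x = of_nat r \<and> (r = 0 \<longleftrightarrow> pp {..<d} (lmat x) n = 0)"
  unfolding tr_def by (rule trace_stable[where S' = "{..<d}", OF _ _ _ assms]) (auto simp: lmat_def)

text \<open>Horner evaluation at \<open>y\<close>. The algebra is used as its 1 by 1 matrices, with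
  index set \<open>{0}\<close>, so that the results on matrix rings apply to it directly.\<close>

definition ev :: "(nat \<Rightarrow> nat \<Rightarrow> nat \<Rightarrow> 'c) \<Rightarrow> 'c poly \<Rightarrow> nat \<Rightarrow> nat \<Rightarrow> nat \<Rightarrow> 'c" where
  "ev y f = fold_coeffs (\<lambda>a v. scm a (Em {0::nat}) + mm {0::nat} y v) f 0"

lemma scm_simps:
  "scm 0 x = 0" "scm 1 x = x" "scm c 0 = 0" "scm c (x + y) = scm c x + scm c y"
  "scm (a + b) x = scm a x + scm b x" "scm a (scm b x) = scm (a * b) x"
  unfolding scm_def by (auto simp: fun_eq_iff algebra_simps)

context
  fixes y assumes y: "y \<in> Bm UNIV {0::nat}"
begin

interpretation nassoc "mm {0::nat}" by (rule mm_nassoc)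

lemma ev_pCons: "ev y (pCons c f) = scm c (Em {0::nat}) + mm {0::nat} y (ev y f)"
proof (cases "c = 0 \<and> f = 0")
  case True
  thus ?thesis unfolding ev_def by (simp add: scm_simps zero_right)
next
  case False
  thus ?thesis unfolding ev_def by (cases "f = 0") auto
qed

lemma ev_0: "ev y 0 = 0" unfolding ev_def by simp

lemma ev_in: "ev y f \<in> Bm UNIV {0::nat}"
proof (induction f)
  case 0
  show ?case unfolding ev_0 by (simp add: Bm_def)
next
  case (pCons c f)
  show ?case unfolding ev_pCons using pCons(2) y e_supp
    by (auto simp: Bm_def scm_def Em_def mm_def ma_def)
qed

lemma ev_add: "ev y (f + h) = ev y f + ev y h"
proof (induction f h rule: poly_induct2)
  case 0
  show ?case by (simp only: ev_0 add_0_left)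
next
  case (pCons a p b q)
  show ?case unfolding add_pCons ev_pCons pCons scm_simps add_right by (simp only: ac_simps)
qed

lemma ev_smult: "ev y (smult c f) = scm c (ev y f)"
proof (induction f)
  case 0
  show ?case by (simp only: smult_0_right ev_0 scm_simps)
next
  case (pCons a f)
  show ?case unfolding smult_pCons ev_pCons pCons(2) scm_simps scm_mult ..
qed

lemma ev_mult: "ev y (f * h) = mm {0::nat} (ev y f) (ev y h)"
proof (induction f)
  case 0
  show ?case by (simp only: ev_0 zero_left mult_zero_left)
next
  case (pCons c f)
  have "mm {0::nat} (scm c (Em {0::nat})) (ev y h) = scm c (ev y h)"
    using Em_mult(1)[OF ev_in, of h] by (simp add: scm_mult)
  thus ?case by (simp only: mult_pCons_left ev_add ev_smult ev_pCons add_left assoc scm_simps pCons(2) add_0_left)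
qed

lemma ev_1: "ev y 1 = Em {0::nat}"
  unfolding one_pCons ev_pCons ev_0 by (simp add: scm_simps zero_right)

lemma ev_quadratic:
  "ev y [:a * a + b * b, - (2 * a), 1:] =
     mm {0::nat} (y - scm a (Em {0::nat})) (y - scm a (Em {0::nat})) + scm (b * b) (Em {0::nat})"
proof -
  have yE: "mm {0::nat} y (Em {0::nat}) = y" "mm {0::nat} (Em {0::nat}) y = y" using Em_mult[OF y] by auto
  have EE: "mm {0::nat} (Em {0::nat}) (Em {0::nat}) = Em {0::nat}"
    by (rule Em_mult(1)[where L = UNIV]) (auto simp: Bm_def Em_def e_supp)
  have "ev y [:a * a + b * b, - (2 * a), 1:] = scm (a * a + b * b) (Em {0::nat}) + (scm (- (2 * a)) y + mm {0::nat} y y)"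
    unfolding ev_pCons ev_0 by (simp only: zero_right add_right scm_mult yE scm_simps add_0_right)
  also have "\<dots> = (mm {0} y y - scm a y - (scm a y - scm a (scm a (Em {0})))) + scm (b * b) (Em {0})"
    by (simp add: fun_eq_iff scm_def algebra_simps)
  also have "mm {0} y y - scm a y - (scm a y - scm a (scm a (Em {0}))) = mm {0} (y - scm a (Em {0})) (y - scm a (Em {0}))"
    by (simp only: diff_left diff_right scm_mult yE EE) (simp add: fun_eq_iff scm_def algebra_simps)
  finally show ?thesis .
qed

lemma ev_pw:
  assumes "pw 0 = Em {0::nat}" "\<And>n. pw (Suc n) = mm {0::nat} y (pw n)"
  shows "degree f \<le> N \<Longrightarrow> ev y f 0 0 k = (\<Sum>n\<le>N. coeff f n * pw n 0 0 k)"
proof (induction f arbitrary: N k)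
  case 0
  show ?case by (simp add: ev_0)
next
  case (pCons c f)
  show ?case
  proof (cases N)
    case 0
    hence "f = 0" using pCons by (auto split: if_splits)
    thus ?thesis using 0 by (simp add: ev_pCons ev_0 zero_right scm_def assms(1))
  next
    case (Suc N')
    have IH: "ev y f 0 0 k = (\<Sum>n\<le>N'. coeff f n * pw n 0 0 k)" for k
      using pCons Suc by (intro pCons.IH) (auto split: if_splits)
    have "mm {0::nat} y (ev y f) 0 0 k = (\<Sum>l<d. \<Sum>n\<le>N'. lmat (y 0 0) k l * (coeff f n * pw n 0 0 l))"
      unfolding mm_def mA_lmat by (simp add: IH sum_distrib_left)
    also have "\<dots> = (\<Sum>n\<le>N'. coeff f n * mA (y 0 0) (pw n 0 0) k)"
      unfolding mA_lmat sum_distrib_left by (subst sum.swap) (simp add: mult_ac)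
    also have "\<dots> = (\<Sum>n\<le>N'. coeff f n * pw (Suc n) 0 0 k)"
      unfolding assms(2) mm_def by simp
    finally show ?thesis unfolding ev_pCons Suc
      by (simp add: scm_def sum.atMost_Suc_shift assms(1) del: sum.atMost_Suc)
  qed
qed

end

end

section \<open>The signature over a maximal extension\<close>

context maximal_coalg
begin

text \<open>The powers of \<open>y\<close> up to exponent \<open>d\<close> are \<open>d + 1\<close>
  vectors of length \<open>d\<close>, so some nonzero polynomial over \<open>L\<close> annihilates
  \<open>y\<close>, and it divides a product of quadratics.\<close>

lemma annihilated_by_quadratics:
  assumes y: "y \<in> Bm L {0::nat}"
  shows "\<exists>qs. set qs \<subseteq> L \<times> L \<and>
     foldr (\<lambda>(a, b) z. mm {0::nat} (mm {0::nat} (y - scm a (Em {0::nat})) (y - scm a (Em {0::nat})) + scm (b * b) (Em {0::nat})) z) qs (Em {0::nat}) = 0"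
proof -
  obtain rk where "star_ring (mm {0::nat}) (Bm L {0::nat}) (Em {0::nat}) sm hm rk"
    using matrix_star_ring[OF L, of "{0::nat}"] by auto
  then interpret star_ring "mm {0::nat}" "Bm L {0::nat}" "Em {0::nat}" sm hm rk .
  have yU: "y \<in> Bm UNIV {0::nat}" using y unfolding Bm_def by auto
  have pL: "pw y n \<in> Bm L {0::nat}" for n using y by simp
  have "\<exists>c. (\<forall>n\<in>{..d}. c n \<in> L) \<and> (\<exists>n\<in>{..d}. c n \<noteq> 0) \<and> (\<forall>k\<in>{..<d}. (\<Sum>n\<in>{..d}. pw y n 0 0 k * c n) = 0)"
    by (rule linear_system[OF L(1)]) (use pL in \<open>auto simp: Bm_def\<close>)
  then obtain c where c: "\<And>n. n \<le> d \<Longrightarrow> c n \<in> L" "\<exists>n\<le>d. c n \<noteq> 0" "\<And>k. k < d \<Longrightarrow> (\<Sum>n\<le>d. pw y n 0 0 k * c n) = 0"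
    by auto
  define f where "f = (\<Sum>n\<le>d. monom (c n) n)"
  have cf: "coeff f n = (if n \<le> d then c n else 0)" for n
    unfolding f_def by (simp add: coeff_sum)
  have f0: "f \<noteq> 0" using c(2) cf by (metis coeff_0)
  have fL: "pol L f" unfolding pol_def using c(1) Ls(1) by (simp add: cf)
  have "degree f \<le> d" by (rule degree_le) (simp add: cf)
  hence e0: "ev y f 0 0 k = (\<Sum>n\<le>d. coeff f n * pw y n 0 0 k)" for k
    by (intro ev_pw[OF yU, of "pw y"]) simp_all
  have evf: "ev y f = 0"
  proof (intro ext)
    fix i j k
    show "ev y f i j k = 0 i j k"
    proof (cases "i = 0 \<and> j = 0 \<and> k < d")
      case True
      thus ?thesis using c(3)[of k] by (simp add: e0 cf mult.commute)
    next
      case False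
      thus ?thesis using ev_in[OF yU, of f] unfolding Bm_def by auto
    qed
  qed
  obtain ii where ii: "almost_real_closed L ii" using splitting by blast
  obtain qs where qs: "set qs \<subseteq> L \<times> L" "f dvd prod_list (map (\<lambda>(a, b). [:a * a + b * b, - (2 * a), 1:]) qs)"
    using almost_real_closed.divides_quadratics[OF ii alg_closed_imp_factorization f0 fL] by blast
  obtain h where h: "prod_list (map (\<lambda>(a, b). [:a * a + b * b, - (2 * a), 1:]) qs) = f * h" using qs(2) by (elim dvdE)
  have "foldr (\<lambda>(a, b) z. mm {0::nat} (mm {0::nat} (y - scm a (Em {0::nat})) (y - scm a (Em {0::nat})) + scm (b * b) (Em {0::nat})) z) qs (Em {0::nat}) =
      ev y (prod_list (map (\<lambda>(a, b). [:a * a + b * b, - (2 * a), 1:]) qs))" for qs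
  proof (induction qs)
    case Nil
    show ?case by (simp only: list.map prod_list.Nil foldr_Nil id_apply ev_1[OF yU])
  next
    case (Cons q qs)
    obtain a b where q: "q = (a, b)" by fastforce
    show ?case by (simp only: q foldr_Cons list.map prod_list.Cons case_prod_conv o_apply ev_mult[OF yU] ev_quadratic[OF yU] Cons)
  qed
  hence "foldr (\<lambda>(a, b) z. mm {0::nat} (mm {0::nat} (y - scm a (Em {0::nat})) (y - scm a (Em {0::nat})) + scm (b * b) (Em {0::nat})) z) qs (Em {0::nat}) = 0"
    by (simp only: h ev_mult[OF yU] evf zero_left)
  thus ?thesis using qs(1) by blast
qed

text \<open>The trace axioms come from \<open>lmat_stable\<close>: for nilpotent and idempotent
  elements the powers of the matrix become stationary, so the trace is a natural number, which is a
  square in \<open>L\<close> and is zero only if the matrix is nilpotent.\<close>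

lemma real_ring:
  "\<exists>rk. real_star_ring (mm {0::nat}) (Bm L {0::nat}) (Em {0::nat}) sm hm rk L scm (\<lambda>Xa. tr (Xa 0 0))"
proof -
  obtain rk where "star_ring (mm {0::nat}) (Bm L {0::nat}) (Em {0::nat}) sm hm rk"
    using matrix_star_ring[OF L, of "{0::nat}"] by auto
  then interpret star_ring "mm {0::nat}" "Bm L {0::nat}" "Em {0::nat}" sm hm rk .
  have m1: "mm {0::nat} x y 0 0 = mA (x 0 0) (y 0 0)" for x y unfolding mm_def by (simp add: fun_eq_iff)
  have pp: "pp {..<d} (lmat (x 0 0)) n = lmat (pw x (Suc n) 0 0)" if "x \<in> Bm L {0::nat}" for x n
  proof (induction n)
    case 0
    thus ?case using that by (simp add: unit_right)
  next
    case (Suc n)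
    thus ?case by (simp only: pp.simps pw.simps m1 lmat_mult)
  qed
  show ?thesis
  proof (intro exI[of _ rk] real_star_ring.intro real_star_ring_axioms.intro star_ring_axioms)
    show "euclidean L" by (rule euclidean_L)
    show "(2::'c) \<noteq> 0" by (rule two)
    show "scm c x \<in> Bm L {0::nat}" if "c \<in> L" "x \<in> Bm L {0::nat}" for c x by (rule scm_in[OF L(1) that])
    show "sm (scm c x) = scm c (sm x)" for c x unfolding sm_def scm_def by (simp add: fun_eq_iff sA_scale)
    show "tr (x 0 0) \<in> L" if "x \<in> Bm L {0::nat}" for x
      unfolding tr_def lmat_def using that g_K0 L(2) by (auto simp: Bm_def Ls intro!: subfld_sum[OF L(1)] Ls(5))
    show "tr ((x + y) 0 0) = tr (x 0 0) + tr (y 0 0)" for x y :: "nat \<Rightarrow> nat \<Rightarrow> nat \<Rightarrow> 'c"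
      by (simp add: tr_add)
    show "tr (scm c x 0 0) = c * tr (x 0 0)" for c and x :: "nat \<Rightarrow> nat \<Rightarrow> nat \<Rightarrow> 'c"
      unfolding scm_def by (rule tr_scale)
    show "tr (mm {0::nat} x y 0 0) = tr (mm {0::nat} y x 0 0)" for x y unfolding m1 by (rule tr_comm)
    show "tr (x 0 0) = 0" if x: "x \<in> Bm L {0::nat}" "nilp x" for x
    proof -
      obtain n where n: "pw x n = 0" using x(2) unfolding nilp_def by blast
      have "pw x (Suc n) = 0" "pw x (Suc (Suc n)) = 0" using n by (simp_all add: zero_right)
      moreover have "lmat 0 = 0" unfolding lmat_def by (simp add: fun_eq_iff)
      ultimately have "pp {..<d} (lmat (x 0 0)) n = 0" "pp {..<d} (lmat (x 0 0)) (Suc n) = 0"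
        unfolding pp[OF x(1)] by (simp_all only: zero_fun_apply)
      thus ?thesis using lmat_stable[of "x 0 0" n] by auto
    qed
    show "tr (p 0 0) \<in> sqs L \<and> tr (p 0 0) \<noteq> 0" if p: "p \<in> Bm L {0::nat}" "mm {0::nat} p p = p" "p \<noteq> 0" for p
    proof -
      have "mA (p 0 0) (p 0 0) = p 0 0" using m1[of p p] unfolding p(2) by simp
      hence "pp {..<d} (lmat (p 0 0)) (Suc 0) = pp {..<d} (lmat (p 0 0)) 0"
        by (simp flip: lmat_mult)
      then obtain r where r: "tr (p 0 0) = of_nat r" "r = 0 \<longleftrightarrow> lmat (p 0 0) = 0"
        using lmat_stable[of "p 0 0" 0] by auto
      \<comment> \<open>\<open>p\<close> is recovered from its matrix by applying it to the unit
        \<open>e\<close>.\<close>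
      have "lmat (p 0 0) \<noteq> 0"
      proof
        assume z: "lmat (p 0 0) = 0"
        have "mA (p 0 0) e = p 0 0" using p(1) by (intro ma_unit) (auto simp: Bm_def)
        moreover have "mA (p 0 0) e = 0" unfolding mA_lmat z by (simp add: fun_eq_iff)
        ultimately have "p 0 0 = 0" by simp
        moreover have "\<forall>i j k. i \<notin> {0} \<or> j \<notin> {0} \<or> d \<le> k \<longrightarrow> p i j k = 0"
          using p(1) unfolding Bm_def by blast
        ultimately have "p i j k = 0" for i j k by (metis singleton_iff zero_fun_apply)
        hence "p = 0" by (intro ext) (simp only: zero_fun_apply)
        thus False using p(3) by simp
      qed
      then obtain r' where "r = Suc r'" using r(2) by (cases r) auto
      thus ?thesis unfolding r(1) using of_nat_sqs of_nat_Suc_nonzero by metis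
    qed
  qed (rule annihilated_by_quadratics, assumption | simp add: scm_simps scm_mult)+
qed

text \<open>\<open>card Y\<close> is the dimension of a negative definite space and
  \<open>card Xa\<close> bounds the positive index from above. If the inequality failed,
  \<open>signature_positive\<close> would make two copies hyperbolic over \<open>L\<close>, against
  the choice of \<open>L\<close>.\<close>

theorem more_positive_than_negative:
  assumes Y: "finite Y" "\<And>y k. y \<in> Y \<Longrightarrow> v y k \<in> L" "\<And>y k. y \<in> Y \<Longrightarrow> d \<le> k \<Longrightarrow> v y k = 0"
    and neg: "\<And>c. (\<forall>y\<in>Y. c y \<in> L) \<Longrightarrow> qf (\<lambda>k. \<Sum>y\<in>Y. c y * v y k) \<in> sqs L \<Longrightarrow> \<forall>y\<in>Y. c y = 0"
    and Xa: "finite Xa" "\<And>i k. i \<in> Xa \<Longrightarrow> w i k \<in> L"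
    and npos: "\<And>x. (\<And>k. x k \<in> L) \<Longrightarrow> (\<And>k. d \<le> k \<Longrightarrow> x k = 0) \<Longrightarrow>
      (\<forall>i\<in>Xa. (\<Sum>k<d. w i k * x k) = 0) \<Longrightarrow> - qf x \<in> sqs L"
  shows "card Y < card Xa"
proof (rule ccontr)
  assume "\<not> card Y < card Xa"
  hence card: "card Xa \<le> card Y" by simp
  obtain rk' where rk': "star_ring (mm {0, 1 :: nat}) (Bm L {0, 1}) (Em {0, 1}) sm hm rk'"
    using matrix_star_ring[OF L, of "{0, 1 :: nat}"] by blast
  obtain rk where "real_star_ring (mm {0::nat}) (Bm L {0::nat}) (Em {0::nat}) sm hm rk L scm (\<lambda>Xa. tr (Xa 0 0))"
    using real_ring by blast
  then interpret real_star_ring "mm {0::nat}" "Bm L {0::nat}" "Em {0::nat}" sm hm rk L scm "\<lambda>Xa. tr (Xa 0 0)" .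
  have m1: "mm {0::nat} x y 0 0 = mA (x 0 0) (y 0 0)" for x y unfolding mm_def by (simp add: fun_eq_iff)
  have q: "q x = qf (x 0 0)" for x by (simp only: m1 qf_def sm_def)
  have su: "(\<Sum>y\<in>Y. scm (c y) (\<lambda>i j. if i = 0 \<and> j = 0 then v y else 0)) 0 0 = (\<lambda>k. \<Sum>y\<in>Y. c y * v y k)" for c
  proof
    fix k
    show "(\<Sum>y\<in>Y. scm (c y) (\<lambda>i j. if i = 0 \<and> j = 0 then v y else 0)) 0 0 k = (\<Sum>y\<in>Y. c y * v y k)"
      using Y(1) by (induction Y rule: finite_induct) (auto simp: scm_def)
  qed
  obtain a b where ab: "a \<in> Bm L {0::nat}" "b \<in> Bm L {0::nat}" "sm a = - a" "sm b = b" "mm {0::nat} a b = 0" "mm {0::nat} b a = 0"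
    "mm {0::nat} a a - mm {0::nat} b b = Em {0::nat}"
  proof (rule signature_positive[of Y "\<lambda>y i j. if i = 0 \<and> j = 0 then v y else 0" Xa "\<lambda>i x. \<Sum>k<d. w i k * x 0 0 k"])
    show "(\<lambda>i j. if i = 0 \<and> j = 0 then v y else 0) \<in> Bm L {0::nat}" if "y \<in> Y" for y using Y that unfolding Bm_def by (auto simp: Ls)
    show "\<forall>y\<in>Y. c y = 0" if "\<forall>y\<in>Y. c y \<in> L" "q (\<Sum>y\<in>Y. scm (c y) (\<lambda>i j. if i = 0 \<and> j = 0 then v y else 0)) \<in> sqs L" for c
      using neg[OF that(1)] that(2) unfolding q su .
    show "(\<Sum>k<d. w i k * x 0 0 k) \<in> L" if "i \<in> Xa" "x \<in> Bm L {0::nat}" for i x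
      using Xa(2) that by (auto simp: Bm_def intro!: subfld_sum[OF L(1)] Ls(5))
    show "- q x \<in> sqs L" if "x \<in> Bm L {0::nat}" "\<forall>i\<in>Xa. (\<Sum>k<d. w i k * x 0 0 k) = 0" for x
      unfolding q using that by (intro npos) (auto simp: Bm_def)
  qed (use Y Xa card in \<open>auto simp: distrib_left sum.distrib scm_def sum_distrib_left mult_ac\<close>)
  let ?I = "{0, 1 :: nat}"
  define S where "S i j = (if i = j \<and> i \<in> ?I then a 0 0 else if i = 0 \<and> j = 1 then b 0 0 else if i = 1 \<and> j = 0 then - b 0 0 else 0)" for i j
  have SB: "S \<in> Bm L ?I" using ab(1,2) unfolding S_def Bm_def by (auto simp: Ls)
  have mneg: "mA (- x) y = - mA x y" "mA x (- y) = - mA x y" "mA 0 y = 0" "mA x 0 = 0" for x y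
    unfolding ma_def by (auto simp: fun_eq_iff sum_negf)
  have pr: "mA (a 0 0) (b 0 0) = 0" "mA (b 0 0) (a 0 0) = 0" "mA (a 0 0) (a 0 0) - mA (b 0 0) (b 0 0) = e"
    using arg_cong[OF ab(5), of "\<lambda>x. x 0 0"] arg_cong[OF ab(6), of "\<lambda>x. x 0 0"]
      arg_cong[OF ab(7), of "\<lambda>x. x 0 0"] by (simp_all add: m1 Em_def)
  have SS: "mm ?I S S = Em ?I"
  proof (intro ext)
    fix i j k
    have "mm ?I S S i j = mA (S i 0) (S 0 j) + mA (S i 1) (S 1 j)" unfolding mm_def by (simp add: fun_eq_iff)
    also have "\<dots> = Em ?I i j"
      using pr unfolding S_def Em_def by (auto simp: mneg fun_eq_iff)
    finally show "mm ?I S S i j k = Em ?I i j k" by simp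
  qed
  have sneg: "sA (- x) = - sA x" "sA 0 = 0" for x unfolding sa_def by (auto simp: fun_eq_iff sum_negf)
  have sS: "sm S = - S"
  proof (intro ext)
    fix i j k
    have "sA (a 0 0) = - a 0 0" "sA (b 0 0) = b 0 0"
      using arg_cong[OF ab(3), of "\<lambda>x. x 0 0"] arg_cong[OF ab(4), of "\<lambda>x. x 0 0"] unfolding sm_def by simp_all
    thus "sm S i j k = (- S) i j k" unfolding sm_def S_def by (auto simp: sneg)
  qed
  interpret N: star_ring "mm ?I" "Bm L ?I" "Em ?I" sm hm rk' by (rule rk')
  define v where "v = scm (1/2) (Em ?I + S)"
  have t2: "(1/2 :: 'c) + 1/2 = 1" by (rule half_add)
  have "(1/2 :: 'c) \<in> L" using two_L by (auto simp: Ls)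
  hence "v \<in> Bm L ?I" unfolding v_def by (intro scm_in[OF L(1)] N.B_add N.B_unit SB)
  moreover have "mm ?I v v = v"
  proof -
    have "mm ?I v v = scm (1/2) (scm (1/2) ((Em ?I + S) + (Em ?I + S)))"
      unfolding v_def scm_mult
      by (simp only: N.add_left N.add_right N.unit_left[OF SB] N.unit_right[OF SB] N.unit_left[OF N.B_unit] SS ac_simps)
    also have "\<dots> = scm ((1/2) + (1/2)) (scm (1/2) (Em ?I + S))" by (simp only: scm_simps(4,5) ac_simps)
    finally show ?thesis unfolding t2 scm_simps(2) v_def .
  qed
  moreover have "v + sm v = Em ?I"
  proof -
    have "sm v = scm (1/2) (Em ?I - S)"
    proof -
      have "sm v = scm (1/2) (sm (Em ?I + S))" unfolding v_def sm_def scm_def by (intro ext) (rule sA_scale)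
      thus ?thesis by (simp only: N.st_add[OF N.B_unit SB] N.st_unit sS add_uminus_conv_diff)
    qed
    hence "v + sm v = scm (1/2) (Em ?I + Em ?I)" unfolding v_def by (simp flip: scm_simps(4))
    thus ?thesis unfolding scm_simps(4) using t2 scm_simps(2,5) by metis
  qed
  ultimately have "hyp L ?I" unfolding hyp_def by blast
  thus False using not_wh wh_intro[of ?I 1] by auto
qed

end

text \<open>Totality is not demanded: the notion has to cover the squares of \<open>L\<close> as
  well as the image of an ordering of the base field, and the latter is not total in the algebraic
  closure.\<close>

definition cone :: "'c::field set \<Rightarrow> bool" where
  "cone P \<longleftrightarrow> 0 \<in> P \<and> (\<forall>x\<in>P. \<forall>y\<in>P. x + y \<in> P \<and> x * y \<in> P) \<and> (\<forall>x\<in>P. - x \<in> P \<longrightarrow> x = 0)"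

lemma cone_sum_in: "cone P \<Longrightarrow> (\<And>a. a \<in> A \<Longrightarrow> f a \<in> P) \<Longrightarrow> sum f A \<in> P"
  by (induction A rule: infinite_finite_induct) (auto simp: cone_def)

lemma cone_sum_0:
  assumes P: "cone P" "finite A" "\<And>a. a \<in> A \<Longrightarrow> f a \<in> P" "- sum f A \<in> P" and a: "a \<in> A"
  shows "f a = 0"
proof -
  have "sum f (A - {a}) \<in> P" using P by (intro cone_sum_in) auto
  hence "- sum f A + sum f (A - {a}) \<in> P" using P unfolding cone_def by blast
  hence "- f a \<in> P" using P(2) a by (simp add: sum.remove[of A a])
  thus ?thesis using P(1,3) a unfolding cone_def by blast
qed

lemma cone_sqs: "euclidean L \<Longrightarrow> cone (sqs L)"
  unfolding cone_def using euclideanD sqs_mult sqs_zero by blast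

context coalg
begin

text \<open>A hyperbolic idempotent for \<open>J1\<close>, extended by zero, is isotropic in the
  matrix ring over \<open>J\<close> and adds up with its adjoint to \<open>Em J1\<close>; Witt
  cancellation leaves the complement.\<close>

lemma hyp_diff:
  assumes L: "subfld L" "K0 \<subseteq> L" and J: "finite J" "J1 \<subseteq> J" and h: "hyp L J" "hyp L J1"
  shows "hyp L (J - J1)"
proof -
  obtain rk where "star_ring (mm J) (Bm L J) (Em J) sm hm rk" using matrix_star_ring[OF L J(1)] by blast
  then interpret star_ring "mm J" "Bm L J" "Em J" sm hm rk .
  obtain g where g: "g \<in> Bm L J" "mm J g g = g" "g + sm g = Em J" using h(1) unfolding hyp_def by blast
  obtain u where u1: "u \<in> Bm L J1" "mm J1 u u = u" "u + sm u = Em J1" using h(2) unfolding hyp_def by blast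
  have J1: "finite J1" using J finite_subset by blast
  have uB: "u \<in> Bm L J" using u1(1) Bm_mono[OF J(2)] by blast
  have uu: "mm J u u = u" using mm_supp[OF u1(1) J(2,1)] u1(2) by metis
  have suB: "sm u \<in> Bm L J" using uB by (rule B_st)
  have su: "sm u = Em J1 - u" using u1(3) by (simp only: eq_diff_eq ac_simps)
  have "mm J u (sm u) = mm J1 u (Em J1 - u)" unfolding su using mm_supp[OF u1(1) J(2,1)] by metis
  also have "\<dots> = 0"
    by (simp only: nassoc.diff_right[OF mm_nassoc] Em_mult[OF u1(1) J1] u1(2) diff_self)
  finally have us: "mm J u (sm u) = 0" .
  have suB1: "sm u \<in> Bm L J1"
  proof -
    obtain rk1 where "star_ring (mm J1) (Bm L J1) (Em J1) sm hm rk1" using matrix_star_ring[OF L J1] by blast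
    then interpret S1: star_ring "mm J1" "Bm L J1" "Em J1" sm hm rk1 .
    show ?thesis by (rule S1.B_st[OF u1(1)])
  qed
  have "mm J (sm u) u = mm J1 (sm u) u" using mm_supp[OF suB1 J(2,1)] by metis
  also have "\<dots> = 0"
    by (simp only: su nassoc.diff_left[OF mm_nassoc] Em_mult[OF u1(1) J1] u1(2) diff_self)
  finally have su': "mm J (sm u) u = 0" .
  have iso: "isoid (Em J) u" unfolding isoid_def using uB uu us su' by (simp add: unit_left unit_right)
  obtain v where v: "v \<in> Bm L J" "mm J v v = v" "v + sm v = Em J - u - sm u"
    "mm J (Em J - u - sm u) v = v" "mm J v (Em J - u - sm u) = v"
    using hyperbolic_cancel[OF g(1) _ g(3) iso] g(2) rad_zero by auto
  have Ed: "Em J - u - sm u = Em (J - J1)"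
  proof -
    have "Em J - u - sm u = Em J - Em J1" unfolding u1(3)[symmetric] by (simp only: diff_diff_eq)
    also have "\<dots> = Em (J - J1)" using J(2) by (auto simp: fun_eq_iff Em_def)
    finally show ?thesis .
  qed
  have v0: "v i j = (\<lambda>_. 0)" if "i \<in> J1 \<or> j \<in> J1" for i j
  proof (cases "i \<in> J1")
    case True
    hence "Em (J - J1) i l = (\<lambda>_. 0)" for l unfolding Em_def by (auto simp: fun_eq_iff)
    hence "mm J (Em (J - J1)) v i j = (\<lambda>_. 0)" unfolding mm_def by (simp add: mA_zero)
    thus ?thesis using v(4) unfolding Ed by simp
  next
    case False
    hence "Em (J - J1) l j = (\<lambda>_. 0)" for l using that unfolding Em_def by (auto simp: fun_eq_iff)
    hence "mm J v (Em (J - J1)) i j = (\<lambda>_. 0)" unfolding mm_def by (simp add: mA_zero)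
    thus ?thesis using v(5) unfolding Ed by simp
  qed
  have vB: "v \<in> Bm L (J - J1)" using v(1) v0 unfolding Bm_def by (auto simp: fun_eq_iff)
  have "mm (J - J1) v v = v" using mm_supp[OF vB _ J(1)] v(2) by (metis Diff_subset)
  thus ?thesis unfolding hyp_def using vB v(3) Ed by metis
qed

lemma minimal_hyperbolic_power:
  assumes wh: "wh K0" and n: "0 < n" "hyp K0 {..<n::nat}" "\<And>r. 0 < r \<Longrightarrow> hyp K0 {..<r} \<Longrightarrow> n \<le> r"
  shows "\<exists>k. n = 2 ^ k"
proof -
  obtain k where k: "hyp K0 {..<(2::nat) ^ k}" using wh unfolding wh_def by blast
  define q r where "q = 2 ^ k div n" and "r = 2 ^ k mod n"
  have e: "2 ^ k = n * q + r" unfolding q_def r_def by simp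
  have "hyp K0 ({..<n} \<times> {..<q})" by (rule hyp_mult[OF n(2)]) (auto simp: subfldD[OF K0])
  hence "hyp K0 {..<n * q}" using hyp_card[of "{..<n} \<times> {..<q}"] by simp
  hence "hyp K0 ({..<2 ^ k} - {..<n * q})" by (intro hyp_diff[OF K0] k) (auto simp: e)
  moreover have "{..<2 ^ k} - {..<n * q} = {n * q..<n * q + r}" unfolding e by auto
  ultimately have "hyp K0 {..<r}" using hyp_card[of "{n * q..<n * q + r}"] by simp
  moreover have "r < n" unfolding r_def using n(1) by simp
  ultimately have "r = 0" using n(3)[of r] by (cases "r = 0") auto
  hence "n dvd 2 ^ k" unfolding e by simp
  thus ?thesis using divides_primepow_nat[of 2 n k] by auto
qed

lemma tr_sum: "tr (\<lambda>k. \<Sum>l\<in>I. f l k) = (\<Sum>l\<in>I. tr (f l))"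
proof (induction I rule: infinite_finite_induct)
  case (insert x F)
  have "(\<lambda>k. \<Sum>l\<in>insert x F. f l k) = f x + (\<lambda>k. \<Sum>l\<in>F. f l k)" using insert by (simp add: fun_eq_iff)
  thus ?case using insert tr_add by simp
qed (simp_all add: tr_def lmat_def)

text \<open>The involution of a hyperbolic idempotent \<open>v\<close> makes \<open>2 v - 1\<close> an anti-isometry of the trace form.\<close>

lemma hyperbolic_card_le:
  assumes n: "0 < n" and h: "hyp K0 {..<n::nat}"
    and D: "\<And>x. \<epsilon> * qf x = (\<Sum>k<d. D k * x k * x k)"
    and P: "cone P" "\<And>x. x \<in> K0 \<Longrightarrow> x * x \<in> P"
    and M: "M \<subseteq> {..<d}" "\<And>k. k \<in> M \<Longrightarrow> D k \<in> P - {0}"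
    and N: "N \<subseteq> {..<d}" "\<And>k. k < d \<Longrightarrow> k \<notin> N \<Longrightarrow> D k \<in> P"
  shows "card M \<le> card N"
proof (rule ccontr)
  assume "\<not> card M \<le> card N"
  hence card: "card N < card M" by simp
  let ?I = "{..<n}"
  have fin: "finite M" "finite N" using M(1) N(1) finite_subset by blast+
  obtain rk where "star_ring (mm ?I) (Bm K0 ?I) (Em ?I) sm hm rk" using matrix_star_ring[OF K0, of ?I] by blast
  then interpret star_ring "mm ?I" "Bm K0 ?I" "Em ?I" sm hm rk .
  obtain v where v: "v \<in> Bm K0 ?I" "mm ?I v v = v" "v + sm v = Em ?I" using h unfolding hyp_def by blast
  \<comment> \<open>As \<open>sm v = Em ?I - v\<close>, this is the element
    \<open>2 v - 1\<close>.\<close>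
  define t where "t = v - sm v"
  have tB: "t \<in> Bm K0 ?I" unfolding t_def by (simp only: Bs v(1) B_st)
  have sv: "sm v = Em ?I - v" using v(3) by (simp only: eq_diff_eq ac_simps)
  have st: "sm t = - t" unfolding t_def using v(1) by (simp only: st_simps B_st minus_diff_eq)
  have vs: "mm ?I v (sm v) = 0" "mm ?I (sm v) v = 0" "mm ?I (sm v) (sm v) = sm v"
    using v(1) unfolding sv by (simp_all only: diff_left diff_right unit_left unit_right v(2) B_unit diff_self diff_zero)
  have tt: "mm ?I t t = Em ?I"
    unfolding t_def by (simp only: diff_left diff_right vs v(2) diff_zero diff_0 diff_minus_eq_add v(3))
  \<comment> \<open>Column 0 of a matrix is a vector of the \<open>n\<close>-fold sum, and
    \<open>Q\<close> is the \<open>n\<close>-fold trace form on it.\<close>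
  define Q where "Q y = (\<Sum>i<n. qf (y i 0))" for y :: "nat \<Rightarrow> nat \<Rightarrow> nat \<Rightarrow> 'c"
  have Q: "Q y = tr (mm ?I (sm y) y 0 0)" for y
  proof -
    have "mm ?I (sm y) y 0 0 = (\<lambda>k. \<Sum>l\<in>?I. mA (sA (y l 0)) (y l 0) k)" unfolding mm_def sm_def ..
    thus ?thesis unfolding Q_def qf_def by (simp only: tr_sum)
  qed
  have anti: "Q (mm ?I t x) = - Q x" if "x \<in> Bm K0 ?I" for x
  proof -
    have sx: "sm x \<in> Bm K0 ?I" using that by (rule B_st)
    have "mm ?I (sm (mm ?I t x)) (mm ?I t x) = mm ?I (mm ?I (sm x) (- t)) (mm ?I t x)"
      using that tB st by (simp only: st_mult)
    also have "\<dots> = - mm ?I (sm x) (mm ?I (mm ?I t t) x)" by (simp only: assoc minus_left minus_right)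
    also have "\<dots> = - mm ?I (sm x) x" unfolding tt using that by (simp only: unit_left)
    finally have "Q (mm ?I t x) = tr (- (mm ?I (sm x) x 0 0))" unfolding Q by (simp only: fun_Compl_def)
    moreover have "tr (- y) = - tr y" for y using tr_scale[of "- 1" y] by (simp add: fun_Compl_def)
    ultimately show ?thesis unfolding Q by simp
  qed
  have QD: "\<epsilon> * Q y = (\<Sum>i<n. \<Sum>k<d. D k * y i 0 k * y i 0 k)" for y
    unfolding Q_def sum_distrib_left D ..
  \<comment> \<open>Sought is a nonzero vector supported on the places in \<open>M\<close> whose
    image under \<open>t\<close> vanishes at the places in \<open>N\<close>:
    \<open>n * card N\<close> equations for \<open>n * card M\<close> unknowns.\<close>
  have "\<exists>c. (\<forall>z\<in>?I \<times> M. c z \<in> K0) \<and> (\<exists>z\<in>?I \<times> M. c z \<noteq> 0) \<and>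
    (\<forall>x\<in>?I \<times> N. (\<Sum>z\<in>?I \<times> M. lmat (t (fst x) (fst z)) (snd x) (snd z) * c z) = 0)"
  proof (rule linear_system[OF K0])
    show "card (?I \<times> N) < card (?I \<times> M)" using card n by (simp add: card_cartesian_product)
    show "lmat (t (fst x) (fst z)) (snd x) (snd z) \<in> K0" for x z
      unfolding lmat_def using tB g_K0 by (auto simp: Bm_def subfldD[OF K0] intro!: subfld_sum[OF K0])
  qed (use fin in auto)
  then obtain c where c: "\<forall>z\<in>?I \<times> M. c z \<in> K0" "\<exists>z\<in>?I \<times> M. c z \<noteq> 0"
    "\<forall>x\<in>?I \<times> N. (\<Sum>z\<in>?I \<times> M. lmat (t (fst x) (fst z)) (snd x) (snd z) * c z) = 0"
    by (elim exE conjE) (rule that; assumption)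
  define x where "x i j k = (if j = 0 \<and> i < n \<and> k \<in> M then c (i, k) else 0)" for i j k :: nat
  have xB: "x \<in> Bm K0 ?I" unfolding x_def Bm_def using c(1) M(1) n by (auto simp: subfldD[OF K0])
  have tx: "mm ?I t x i 0 k = 0" if "i < n" "k \<in> N" for i k
  proof -
    have "mm ?I t x i 0 k = (\<Sum>p<n. \<Sum>l<d. lmat (t i p) k l * x p 0 l)" unfolding mm_def mA_lmat ..
    also have "\<dots> = (\<Sum>p<n. \<Sum>l\<in>M. lmat (t i p) k l * c (p, l))"
      using M(1) by (intro sum.cong refl sum.mono_neutral_cong_right) (auto simp: x_def)
    also have "\<dots> = 0" using bspec[OF c(3), of "(i, k)"] that by (simp add: sum.cartesian_product case_prod_unfold)
    finally show ?thesis .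
  qed
  have tP: "D k * y * y \<in> P" if "D k \<in> P" "y \<in> K0" for k y
    using P that unfolding cone_def mult.assoc by blast
  have xK: "y i j k \<in> K0" if "y \<in> Bm K0 ?I" for y i j k using that unfolding Bm_def by auto
  \<comment> \<open>Outside \<open>N\<close> all coefficients are nonnegative, so the scaled form is
    nonnegative at the image. There it is minus its value at \<open>x\<close>, which is a sum of
    nonnegative terms; so all these terms vanish.\<close>
  have "\<epsilon> * Q (mm ?I t x) \<in> P" unfolding QD
  proof (intro cone_sum_in[OF P(1)])
    fix i k assume ik: "i \<in> {..<n}" "k \<in> {..<d}"
    show "D k * mm ?I t x i 0 k * mm ?I t x i 0 k \<in> P"
    proof (cases "k \<in> N")
      case True
      thus ?thesis using tx ik P(1) by (simp add: cone_def)
    next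
      case False
      thus ?thesis using ik N(2) by (intro tP xK B_mult tB xB) auto
    qed
  qed
  hence neg: "- (\<Sum>z\<in>?I \<times> {..<d}. D (snd z) * x (fst z) 0 (snd z) * x (fst z) 0 (snd z)) \<in> P"
    using anti[OF xB] QD[of x] by (simp add: sum.cartesian_product case_prod_unfold)
  have all: "D (snd z) * x (fst z) 0 (snd z) * x (fst z) 0 (snd z) \<in> P" if "z \<in> ?I \<times> {..<d}" for z
  proof (cases "snd z \<in> M")
    case True
    thus ?thesis using M(2) by (intro tP xK xB) auto
  next
    case False
    thus ?thesis using P(1) by (simp add: x_def cone_def)
  qed
  obtain z where z: "z \<in> ?I \<times> M" "c z \<noteq> 0" using c(2) by blast
  hence "D (snd z) * x (fst z) 0 (snd z) * x (fst z) 0 (snd z) = 0"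
    using M(1) by (intro cone_sum_0[OF P(1) _ all neg]) auto
  thus False using z M(2)[of "snd z"] by (auto simp: x_def)
qed

end

text \<open>A hyperbolic idempotent has finitely many nonzero coordinates, so one over the union of
  a chain already lies over some member of the chain; this makes Zorn's lemma applicable.\<close>

lemma maximal_exists:
  fixes K0 :: "'c::alg_closed_field set"
  assumes "coalg d g s e K0" and nw: "\<not> coalg.wh d g s e K0"
  shows "\<exists>L. maximal_coalg d g s e K0 L"
proof -
  interpret coalg d g s e K0 by fact
  let ?A = "{L. subfld L \<and> K0 \<subseteq> L \<and> \<not> wh L}"
  have "\<exists>M\<in>?A. \<forall>Xa\<in>?A. M \<subseteq> Xa \<longrightarrow> Xa = M"
  proof (rule subset_Zorn_nonempty)
    show "?A \<noteq> {}" using K0 nw by blast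
    fix C assume C: "C \<noteq> {}" "subset.chain ?A C"
    have CA: "\<And>L. L \<in> C \<Longrightarrow> subfld L \<and> K0 \<subseteq> L \<and> \<not> wh L" using C(2) unfolding subset_chain_def by blast
    have fin: "\<exists>L\<in>C. F \<subseteq> L" if "finite F" "F \<subseteq> \<Union>C" for F
      using finite_subset_Union_chain[OF that C] by blast
    have "subfld (\<Union>C)" unfolding subfld_def
    proof (intro conjI ballI)
      show "0 \<in> \<Union>C" "1 \<in> \<Union>C" using C(1) CA subfldD(1,2) by blast+
      fix x assume x: "x \<in> \<Union>C"
      show "- x \<in> \<Union>C" "inverse x \<in> \<Union>C" using x CA subfldD(4,6) by blast+
      fix y assume y: "y \<in> \<Union>C"
      obtain L where L: "L \<in> C" "{x, y} \<subseteq> L" using fin[of "{x, y}"] x y by auto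
      have "x + y \<in> L" "x * y \<in> L" using L(2) CA[OF L(1)] by (auto simp: subfldD)
      thus "x + y \<in> \<Union>C" "x * y \<in> \<Union>C" using L(1) by blast+
    qed
    moreover have "\<not> wh (\<Union>C)"
    proof
      assume "wh (\<Union>C)"
      then obtain k v where v: "v \<in> Bm (\<Union>C) {..<(2::nat) ^ k}" "mm {..<2 ^ k} v v = v" "v + sm v = Em {..<2 ^ k}"
        unfolding wh_def hyp_def by blast
      let ?F = "(\<lambda>(i, j, l). v i j l) ` ({..<2 ^ k} \<times> {..<2 ^ k} \<times> {..<d})"
      have vC: "v i j l \<in> \<Union>C" for i j l using v(1) unfolding Bm_def by blast
      have "?F \<subseteq> \<Union>C"
      proof
        fix y assume "y \<in> ?F"
        then obtain i j l where "y = v i j l" by auto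
        thus "y \<in> \<Union>C" using vC by simp
      qed
      hence "\<exists>L\<in>C. ?F \<subseteq> L" by (intro fin) simp_all
      then obtain L where L: "L \<in> C" "?F \<subseteq> L" by (elim bexE)
      have "v i j l \<in> L" for i j l
      proof (cases "i < 2 ^ k \<and> j < 2 ^ k \<and> l < d")
        case True
        hence "v i j l \<in> ?F" by force
        thus ?thesis using L(2) by blast
      next
        case False
        hence "v i j l = 0" using v(1) unfolding Bm_def by auto
        thus ?thesis using CA[OF L(1)] subfldD(1) by metis
      qed
      hence "v \<in> Bm L {..<2 ^ k}" using v(1) unfolding Bm_def by auto
      hence "wh L" unfolding wh_def hyp_def using v by blast
      thus False using CA[OF L(1)] by blast
    qed
    ultimately show "\<Union>C \<in> ?A" using C(1) CA by blast
  qed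
  then obtain L where "subfld L" "K0 \<subseteq> L" "\<not> wh L" "\<And>L'. subfld L' \<Longrightarrow> L \<subset> L' \<Longrightarrow> wh L'"
    by (smt (verit) CollectD CollectI dual_order.trans psubsetE)
  hence "maximal_coalg d g s e K0 L" by unfold_locales
  thus ?thesis by blast
qed

text \<open>The unit vectors with negative coefficient span the negative definite space, and the
  coordinates with positive coefficient are the functionals. All coefficients lie in
  \<open>K0\<close>, so each of them has a sign in \<open>L\<close>.\<close>

lemma positive_ordering_exists:
  fixes K0 :: "'c::alg_closed_field set"
  assumes co: "coalg d g s e K0" and nw: "\<not> coalg.wh d g s e K0"
    and D: "\<And>x. coalg.qf d g s x = (\<Sum>k<d. D k * x k * x k)" "\<And>k. D k \<in> K0"
  shows "\<exists>L. K0 \<subseteq> L \<and> euclidean L \<and>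
    card {k. k < d \<and> - D k \<in> sqs L - {0}} < card {k. k < d \<and> D k \<in> sqs L - {0}}"
proof -
  obtain L where "maximal_coalg d g s e K0 L" using maximal_exists[OF co nw] by blast
  then interpret maximal_coalg d g s e K0 L .
  let ?Y = "{k. k < d \<and> - D k \<in> sqs L - {0}}" and ?Z = "{k. k < d \<and> D k \<in> sqs L - {0}}"
  have cone: "cone (sqs L)" by (rule cone_sqs[OF euclidean_L])
  have sq: "x * x \<in> sqs L" if "x \<in> L" for x using that unfolding sqs_def by blast
  have "card ?Y < card ?Z"
  proof (rule more_positive_than_negative[where v = "\<lambda>y k. if k = y then 1 else 0" and w = "\<lambda>i k. if k = i then 1 else 0"])
    show "\<forall>y\<in>?Y. c y = 0" if c: "\<forall>y\<in>?Y. c y \<in> L" "qf (\<lambda>k. \<Sum>y\<in>?Y. c y * (if k = y then 1 else 0)) \<in> sqs L" for c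
    proof
      fix y assume y: "y \<in> ?Y"
      have "(\<lambda>k. \<Sum>y\<in>?Y. c y * (if k = y then 1 else 0)) = (\<lambda>k. if k \<in> ?Y then c k else 0)"
        by (simp add: fun_eq_iff if_distrib cong: if_cong)
      hence "(\<Sum>k<d. D k * (if k \<in> ?Y then c k else 0) * (if k \<in> ?Y then c k else 0)) \<in> sqs L"
        using c(2) D(1) by simp
      also have "(\<Sum>k<d. D k * (if k \<in> ?Y then c k else 0) * (if k \<in> ?Y then c k else 0)) = (\<Sum>k\<in>?Y. D k * c k * c k)"
        by (intro sum.mono_neutral_cong_right) auto
      also have "\<dots> = - (\<Sum>k\<in>?Y. - D k * (c k * c k))" by (simp add: sum_negf mult.assoc)
      finally have "- (\<Sum>k\<in>?Y. - D k * (c k * c k)) \<in> sqs L" .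
      moreover have "- D k * (c k * c k) \<in> sqs L" if "k \<in> ?Y" for k
        using that c(1) by (intro sqs_mult[OF L(1)] sq) auto
      ultimately have "- D y * (c y * c y) = 0" using y by (intro cone_sum_0[OF cone]) auto
      thus "c y = 0" using y by simp
    qed
    show "- qf x \<in> sqs L" if x: "\<And>k. x k \<in> L" "\<forall>i\<in>?Z. (\<Sum>k<d. (if k = i then 1 else 0) * x k) = 0" for x
    proof -
      have xz: "x i = 0" if "i \<in> ?Z" for i
        using bspec[OF x(2) that] that by (simp add: if_distrib[of "\<lambda>u. u * _"] cong: if_cong)
      have "- D k * (x k * x k) \<in> sqs L" if "k \<in> {..<d}" for k
      proof (cases "k \<in> ?Z")
        case True
        thus ?thesis using xz sqs_zero[OF L(1)] by simp
      next
        case False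
        hence "- D k \<in> sqs L" using that D(2)[of k] L(2) euclideanD(3)[OF euclidean_L, of "D k"] sqs_zero[OF L(1)] by auto
        thus ?thesis by (intro sqs_mult[OF L(1)] sq x)
      qed
      hence "(\<Sum>k<d. - D k * (x k * x k)) \<in> sqs L" by (rule cone_sum_in[OF cone])
      thus ?thesis unfolding D(1) by (simp add: sum_negf mult.assoc)
    qed
  qed (auto simp: Ls)
  thus ?thesis using L(2) euclidean_L by blast
qed

section \<open>Orthogonal bases and signatures\<close>

context fin_dim_space
begin

lemma finite_independent: "independent C \<Longrightarrow> finite C"
  using finite_dim independent_span_bound by (metis subset_UNIV)

lemma subspace_eq_span:
  assumes "subspace U"
  obtains C where "finite C" "independent C" "span C = U"
proof -
  obtain C where "C \<subseteq> U" "independent C" "U \<subseteq> span C" using maximal_independent_subset[of U] by blast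
  thus ?thesis using that[of C] finite_independent span_minimal[of C U] assms by blast
qed

context
  fixes b :: "'v \<Rightarrow> 'v \<Rightarrow> 'k"
  assumes b_sym: "b x y = b y x" and b_add: "b (x + y) z = b x z + b y z"
    and b_scale: "b (scale c x) z = c * b x z" and two: "(2::'k) \<noteq> 0"
begin

lemma b_add_right: "b z (x + y) = b z x + b z y" using b_sym b_add by metis

lemma b_scale_right: "b z (scale c x) = c * b z x" using b_sym b_scale by metis

lemma b_zero: "b 0 z = 0" "b z 0 = 0" using b_scale[of 0 0 z] b_scale_right[of z 0 0] by auto

lemma b_sum: "b (\<Sum>x\<in>A. f x) z = (\<Sum>x\<in>A. b (f x) z)"
  by (induction A rule: infinite_finite_induct) (auto simp: b_zero b_add)

text \<open>Split off a vector with \<open>b x x \<noteq> 0\<close> and continue in its orthogonal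
  complement; if there is none, polarization shows that the form vanishes, as 2 is
  invertible.\<close>

lemma orthogonal_basis_aux:
  assumes "finite C" "independent C"
  shows "\<exists>B. finite B \<and> independent B \<and> span B = span C \<and> (\<forall>x\<in>B. \<forall>y\<in>B. x \<noteq> y \<longrightarrow> b x y = 0)"
  using assms
proof (induction "card C" arbitrary: C rule: less_induct)
  case less
  show ?case
  proof (cases "\<forall>x\<in>span C. b x x = 0")
    case True
    have "b x y = 0" if "x \<in> span C" "y \<in> span C" for x y
    proof -
      have "b x x = 0" "b y y = 0" using True that by blast+
      hence "b (x + y) (x + y) = 2 * b x y"
        by (simp only: b_add b_add_right b_sym[of y x] mult_2 add_0_left add_0_right)
      moreover have "b (x + y) (x + y) = 0" using True that span_add by blast
      ultimately show ?thesis using two by simp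
    qed
    hence "\<forall>x\<in>C. \<forall>y\<in>C. x \<noteq> y \<longrightarrow> b x y = 0" using span_base by metis
    thus ?thesis using less.prems by (intro exI[of _ C] conjI refl)
  next
    case False
    then obtain x where x: "x \<in> span C" "b x x \<noteq> 0" by blast
    define U where "U = {y \<in> span C. b x y = 0}"
    have sU: "subspace U" unfolding U_def
      by (intro subspaceI) (auto simp: b_zero b_add_right b_scale_right span_add span_scale span_zero)
    obtain C' where C': "finite C'" "independent C'" "span C' = U" using subspace_eq_span[OF sU] by blast
    have xC': "x \<notin> span C'" unfolding C'(3) U_def using x by auto
    have "independent (insert x C')" using C'(2) xC' by (simp add: independent_insertI)
    moreover have "insert x C' \<subseteq> span C" using x C'(3) span_superset[of C'] unfolding U_def by blast
    ultimately have "card (insert x C') \<le> card C" using independent_span_bound[OF less.prems(1)] by blast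
    moreover have "x \<notin> C'" using xC' span_base by blast
    ultimately have "card C' < card C" using C'(1) by simp
    then obtain B where B: "finite B" "independent B" "span B = span C'" "\<forall>x\<in>B. \<forall>y\<in>B. x \<noteq> y \<longrightarrow> b x y = 0"
      using less.hyps[of C'] C' by blast
    have BU: "y \<in> U" if "y \<in> B" for y using that B(3) C'(3) span_base by blast
    have xB: "x \<notin> span B" using xC' B(3) by simp
    have "span (insert x B) = span C"
    proof
      show "span (insert x B) \<subseteq> span C"
        using x BU unfolding U_def by (intro span_minimal) auto
      show "span C \<subseteq> span (insert x B)"
      proof
        fix y assume y: "y \<in> span C"
        define c where "c = b x y / b x x"
        have "y - scale c x = y + scale (- c) x" by simp
        moreover have "b x (y + scale (- c) x) = 0" unfolding b_add_right b_scale_right c_def using x(2) by simp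
        moreover have "y - scale c x \<in> span C" using x y by (intro span_diff span_scale)
        ultimately have "y - scale c x \<in> U" unfolding U_def by simp
        hence "y - scale c x \<in> span B" using B(3) C'(3) by simp
        thus "y \<in> span (insert x B)" unfolding span_insert by blast
      qed
    qed
    moreover have "\<forall>y\<in>insert x B. \<forall>z\<in>insert x B. y \<noteq> z \<longrightarrow> b y z = 0"
      using B(4) BU b_sym unfolding U_def by fastforce
    moreover have "independent (insert x B)" using B(2) xB by (simp add: independent_insertI)
    ultimately show ?thesis using B(1) by blast
  qed
qed

lemma orthogonal_basis:
  obtains B where "finite B" "independent B" "span B = UNIV" "\<And>x y. x \<in> B \<Longrightarrow> y \<in> B \<Longrightarrow> x \<noteq> y \<Longrightarrow> b x y = 0"
proof -
  obtain C where "finite C" "independent C" "span C = UNIV" using subspace_eq_span[OF subspace_UNIV] by blast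
  thus ?thesis using orthogonal_basis_aux[of C] that by metis
qed

lemma form_expand:
  assumes B: "finite B" "independent B" "span B = UNIV" "\<And>x y. x \<in> B \<Longrightarrow> y \<in> B \<Longrightarrow> x \<noteq> y \<Longrightarrow> b x y = 0"
  shows "b u u = (\<Sum>x\<in>B. b x x * (representation B u x * representation B u x))"
proof -
  let ?r = "representation B u"
  have u: "u = (\<Sum>x\<in>B. scale (?r x) x)" using sum_representation_eq[of B u B] B by simp
  have "b x u = ?r x * b x x" if "x \<in> B" for x
  proof -
    have "b u x = (\<Sum>y\<in>B. ?r y * b y x)" by (subst (1) u) (simp add: b_sum b_scale)
    also have "\<dots> = (\<Sum>y\<in>{x}. ?r y * b y x)" using B that by (intro sum.mono_neutral_right) auto
    finally show ?thesis using b_sym[of x u] by simp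
  qed
  moreover have "b u u = (\<Sum>x\<in>B. ?r x * b x u)" by (subst (1) u) (simp add: b_sum b_scale)
  ultimately show ?thesis by (simp add: mult_ac)
qed

text \<open>Sylvester's law of inertia: a positive definite subspace of larger dimension would
  contain a nonzero vector whose coordinates at positive basis vectors all vanish, and there the
  form is not positive.\<close>

lemma max_pos_def:
  assumes P: "field_ordering P"
    and B: "finite B" "independent B" "span B = UNIV" "\<And>x y. x \<in> B \<Longrightarrow> y \<in> B \<Longrightarrow> x \<noteq> y \<Longrightarrow> b x y = 0"
  shows "Max {dim U | U. subspace U \<and> pos_def_on P (\<lambda>x. b x x) U} = card {x \<in> B. b x x \<in> P - {0}}"
proof -
  let ?p = "{x \<in> B. b x x \<in> P - {0}}"
  have Pc: "\<And>x y. x \<in> P \<Longrightarrow> y \<in> P \<Longrightarrow> x + y \<in> P" "\<And>x y. x \<in> P \<Longrightarrow> y \<in> P \<Longrightarrow> x * y \<in> P"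
    "\<And>x. x \<in> P \<or> - x \<in> P" "\<And>x. x \<in> P \<Longrightarrow> - x \<in> P \<Longrightarrow> x = 0" "0 \<in> P"
  proof -
    have o: "P \<union> uminus ` P = UNIV" "P \<inter> uminus ` P = {0}" "\<forall>x\<in>P. \<forall>y\<in>P. x + y \<in> P" "\<forall>x\<in>P. \<forall>y\<in>P. x * y \<in> P"
      using P unfolding field_ordering_def by blast+
    show "\<And>x y. x \<in> P \<Longrightarrow> y \<in> P \<Longrightarrow> x + y \<in> P" "\<And>x y. x \<in> P \<Longrightarrow> y \<in> P \<Longrightarrow> x * y \<in> P" using o by blast+
    show "x \<in> P \<or> - x \<in> P" for x
    proof -
      have "x \<in> P \<or> x \<in> uminus ` P" using o(1) by blast
      thus ?thesis by auto
    qed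
    show "x = 0" if "x \<in> P" "- x \<in> P" for x
    proof -
      have "x \<in> uminus ` P" using that(2) by (intro image_eqI[of _ _ "- x"]) auto
      thus ?thesis using o(2) that(1) by blast
    qed
    show "0 \<in> P" using o(2) by blast
  qed
  have cone: "cone P" unfolding cone_def using Pc by blast
  have sq: "x * x \<in> P" for x using Pc(2)[of x x] Pc(2)[of "- x" "- x"] Pc(3)[of x] by auto
  have rep: "representation B u x = 0" if "u \<in> span S" "S \<subseteq> B" "x \<notin> S" for u x S
    using that representation_extend[OF B(2) that(1,2)] representation_ne_zero[of S u x] by metis
  have top: "dim (span ?p) = card ?p" "pos_def_on P (\<lambda>x. b x x) (span ?p)"
  proof -
    have ip: "independent ?p" by (rule independent_mono[OF B(2)]) auto
    show "dim (span ?p) = card ?p" using dim_span dim_eq_card_independent[OF ip] by simp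
    show "pos_def_on P (\<lambda>x. b x x) (span ?p)" unfolding pos_def_on_def
    proof (intro ballI impI)
      fix u assume u: "u \<in> span ?p" "u \<noteq> 0"
      let ?r = "representation B u"
      have e: "b u u = (\<Sum>x\<in>B. b x x * (?r x * ?r x))" by (rule form_expand[OF B])
      have in_P: "b x x * (?r x * ?r x) \<in> P" if "x \<in> B" for x
        using rep[OF u(1), of x] Pc(2,5) sq that by (cases "x \<in> ?p") auto
      have "b u u \<in> P" unfolding e by (rule cone_sum_in[OF cone in_P])
      moreover have "b u u \<noteq> 0"
      proof
        assume "b u u = 0"
        hence neg: "- (\<Sum>x\<in>B. b x x * (?r x * ?r x)) \<in> P" using e Pc(5) by simp
        have z: "b x x * (?r x * ?r x) = 0" if "x \<in> B" for x
          by (rule cone_sum_0[where f = "\<lambda>x. b x x * (?r x * ?r x)", OF cone B(1) _ neg that]) (rule in_P)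
        have "?r x = 0" if "x \<in> B" for x using z[OF that] rep[OF u(1), of x] by (cases "x \<in> ?p") auto
        hence "(\<Sum>x\<in>B. scale (?r x) x) = 0" by simp
        thus False using sum_representation_eq[of B u B] B u(2) by simp
      qed
      ultimately show "b u u \<in> P - {0}" by simp
    qed
  qed
  have le: "dim U \<le> card ?p" if U: "subspace U" "pos_def_on P (\<lambda>x. b x x) U" for U
  proof (rule ccontr)
    assume "\<not> dim U \<le> card ?p"
    obtain C where C: "finite C" "independent C" "span C = U" using subspace_eq_span[OF U(1)] by blast
    have "dim U = card C" using C dim_span dim_eq_card_independent by metis
    hence "card ?p < card C" using \<open>\<not> dim U \<le> card ?p\<close> by simp
    hence "\<exists>c. (\<forall>y\<in>C. c y \<in> UNIV) \<and> (\<exists>y\<in>C. c y \<noteq> 0) \<and> (\<forall>x\<in>?p. (\<Sum>y\<in>C. representation B y x * c y) = 0)"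
      using C(1) B(1) by (intro linear_system) (auto simp: subfld_def)
    then obtain c where c: "\<exists>y\<in>C. c y \<noteq> 0" "\<And>x. x \<in> ?p \<Longrightarrow> (\<Sum>y\<in>C. representation B y x * c y) = 0" by blast
    define u where "u = (\<Sum>y\<in>C. scale (c y) y)"
    have u0: "u \<noteq> 0" using c(1) C(1,2) unfolding u_def independent_explicit_finite_subsets by blast
    have uU: "u \<in> U" unfolding u_def C(3)[symmetric] by (intro span_sum span_scale span_base)
    let ?r = "representation B u"
    have "?r x = (\<Sum>y\<in>C. c y * representation B y x)" for x
      unfolding u_def using B by (simp add: representation_sum representation_scale)
    hence r0: "?r x = 0" if "x \<in> ?p" for x using c(2)[OF that] by (simp add: mult.commute)
    have "- b x x * (?r x * ?r x) \<in> P" if "x \<in> B" for x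
    proof (cases "x \<in> ?p")
      case True
      thus ?thesis using r0 Pc(5) by simp
    next
      case False
      hence "- b x x \<in> P" using that Pc(3)[of "b x x"] Pc(5) by auto
      thus ?thesis using Pc(2) sq by blast
    qed
    hence "(\<Sum>x\<in>B. - b x x * (?r x * ?r x)) \<in> P" by (rule cone_sum_in[OF cone])
    hence "- (\<Sum>x\<in>B. b x x * (?r x * ?r x)) \<in> P" by (simp add: sum_negf)
    hence "- b u u \<in> P" by (subst form_expand[where u = u, OF B])
    moreover have "b u u \<in> P - {0}" using U(2) uU u0 unfolding pos_def_on_def by blast
    ultimately show False using Pc(4) by blast
  qed
  show ?thesis
  proof (rule Max_eqI)
    have "{dim U | U. subspace U \<and> pos_def_on P (\<lambda>x. b x x) U} \<subseteq> {..card ?p}" using le by blast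
    thus "finite {dim U | U. subspace U \<and> pos_def_on P (\<lambda>x. b x x) U}" using finite_subset by blast
    show "card ?p \<in> {dim U | U. subspace U \<and> pos_def_on P (\<lambda>x. b x x) U}"
      using top subspace_span[of ?p] by (intro CollectI exI[of _ "span ?p"]) simp
  qed (use le in blast)
qed

end

lemma sgn_form_diagonal:
  fixes b :: "'v \<Rightarrow> 'v \<Rightarrow> 'k"
  assumes b: "\<And>x y. b x y = b y x" "\<And>x y z. b (x + y) z = b x z + b y z"
    "\<And>c x z. b (scale c x) z = c * b x z"
    and P: "field_ordering P" and two: "(2::'k) \<noteq> 0"
    and B: "finite B" "independent B" "span B = UNIV" "\<And>x y. x \<in> B \<Longrightarrow> y \<in> B \<Longrightarrow> x \<noteq> y \<Longrightarrow> b x y = 0"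
  shows "sgn_form P (\<lambda>x. b x x) =
    int (card {x \<in> B. b x x \<in> P - {0}}) - int (card {x \<in> B. - b x x \<in> P - {0}})"
proof -
  have pn: "neg_def_on P (\<lambda>x. b x x) U \<longleftrightarrow> pos_def_on P (\<lambda>x. - b x x) U" for U
    unfolding neg_def_on_def pos_def_on_def by simp
  have "Max {dim U | U. subspace U \<and> pos_def_on P (\<lambda>x. b x x) U} = card {x \<in> B. b x x \<in> P - {0}}"
    by (rule max_pos_def[OF b two P B])
  moreover have "Max {dim U | U. subspace U \<and> pos_def_on P (\<lambda>x. - b x x) U} = card {x \<in> B. - b x x \<in> P - {0}}"
  proof (rule max_pos_def[where b = "\<lambda>x y. - b x y", OF _ _ _ two P B(1-3)])
    show "- b x y = - b y x" for x y using b(1)[of x y] by simp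
  qed (use b B(4) in auto)
  ultimately show ?thesis unfolding sgn_form_def pn by simp
qed

end

section \<open>Coordinates of an algebra with involution\<close>

lemma sum4: "(\<Sum>p\<in>A. \<Sum>l\<in>A. \<Sum>i\<in>A. \<Sum>j\<in>A. F p l i j) = (\<Sum>i\<in>A. \<Sum>j\<in>A. \<Sum>l\<in>A. \<Sum>p\<in>A. F p l i j)"
proof -
  have "(\<Sum>p\<in>A. \<Sum>l\<in>A. \<Sum>i\<in>A. \<Sum>j\<in>A. F p l i j) = (\<Sum>l\<in>A. \<Sum>p\<in>A. \<Sum>i\<in>A. \<Sum>j\<in>A. F p l i j)" by (rule sum.swap)
  also have "\<dots> = (\<Sum>l\<in>A. \<Sum>i\<in>A. \<Sum>p\<in>A. \<Sum>j\<in>A. F p l i j)" by (intro sum.cong[OF refl] sum.swap)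
  also have "\<dots> = (\<Sum>l\<in>A. \<Sum>i\<in>A. \<Sum>j\<in>A. \<Sum>p\<in>A. F p l i j)" by (intro sum.cong[OF refl] sum.swap)
  also have "\<dots> = (\<Sum>i\<in>A. \<Sum>l\<in>A. \<Sum>j\<in>A. \<Sum>p\<in>A. F p l i j)" by (rule sum.swap)
  also have "\<dots> = (\<Sum>i\<in>A. \<Sum>j\<in>A. \<Sum>l\<in>A. \<Sum>p\<in>A. F p l i j)" by (intro sum.cong[OF refl] sum.swap)
  finally show ?thesis .
qed

locale based_algebra = algebra_with_involution scale \<sigma>
  for scale :: "'k::field \<Rightarrow> 'a::{ring, monoid_mult} \<Rightarrow> 'a" and \<sigma> +
  fixes B :: "'a set" and bs :: "nat \<Rightarrow> 'a" and d :: nat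
  assumes B: "finite B" "independent B" "span B = UNIV" and bs: "bij_betw bs {..<d} B"
    and two: "(2::'k) \<noteq> 0"
begin

interpretation sg: Vector_Spaces.linear scale scale \<sigma> by (rule involution_linear)

definition crd :: "'a \<Rightarrow> nat \<Rightarrow> 'k" where
  "crd x k = (if k < d then representation B x (bs k) else 0)"

lemma crd_add: "crd (x + y) k = crd x k + crd y k"
  unfolding crd_def using B by (simp add: representation_add)

lemma crd_scale: "crd (scale c x) k = c * crd x k"
  unfolding crd_def using B by (simp add: representation_scale)

lemma crd_bs: "i < d \<Longrightarrow> crd (bs i) k = (if k = i then 1 else 0)"
  unfolding crd_def using B bs representation_basis[of B "bs i"]
  by (auto simp: bij_betw_def inj_on_def)

lemma crd_zero: "crd 0 k = 0" using crd_scale[of 0 0 k] by simp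

lemma crd_expand: "x = (\<Sum>k<d. scale (crd x k) (bs k))"
proof -
  have "x = (\<Sum>b\<in>B. scale (representation B x b) b)" using sum_representation_eq[of B x B] B by simp
  also have "\<dots> = (\<Sum>k<d. scale (representation B x (bs k)) (bs k))"
    by (rule sum.reindex_bij_betw[OF bs, symmetric])
  finally show ?thesis by (simp add: crd_def)
qed

lemma crd_inj: "(\<And>k. crd x k = crd y k) \<Longrightarrow> x = y"
  using crd_expand[of x] crd_expand[of y] by simp

lemma linear_crd:
  fixes F :: "'a \<Rightarrow> 'k"
  assumes F: "\<And>x y. F (x + y) = F x + F y" "\<And>c x. F (scale c x) = c * F x"
  shows "F x = (\<Sum>i<d. crd x i * F (bs i))"
proof -
  have "F 0 = 0" using F(2)[of 0 0] by simp
  hence "F (\<Sum>k\<in>S. f k) = (\<Sum>k\<in>S. F (f k))" for S and f :: "nat \<Rightarrow> 'a"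
    by (induction S rule: infinite_finite_induct) (auto simp: F)
  thus ?thesis by (subst crd_expand[of x]) (simp add: F)
qed

lemma crd_sum: "crd (\<Sum>i\<in>S. f i) k = (\<Sum>i\<in>S. crd (f i) k)"
  by (induction S rule: infinite_finite_induct) (auto simp: crd_add crd_zero)

lemma crd_mult_left: "crd (x * y) k = (\<Sum>i<d. crd x i * crd (bs i * y) k)"
  by (rule linear_crd) (simp_all add: distrib_right crd_add scale_mult_left crd_scale)

lemma crd_mult_right: "crd (x * y) k = (\<Sum>i<d. crd y i * crd (x * bs i) k)"
  by (rule linear_crd) (simp_all add: distrib_left crd_add scale_mult_right crd_scale)

lemma crd_sigma: "crd (\<sigma> x) k = (\<Sum>i<d. crd x i * crd (\<sigma> (bs i)) k)"
  by (rule linear_crd) (simp_all add: sg.add sg.scale crd_add crd_scale)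

lemma alg_trace_crd: "alg_trace x = (\<Sum>k<d. crd (x * bs k) k)"
proof -
  have "Vector_Spaces.linear scale scale (\<lambda>y. x * y)"
    by unfold_locales (simp_all add: distrib_left scale_mult_right)
  hence "alg_trace x = (\<Sum>b\<in>B. representation B (x * b) b)"
    unfolding alg_trace_def by (rule lin_trace_eq[OF _ B])
  also have "\<dots> = (\<Sum>k<d. representation B (x * bs k) (bs k))"
    by (rule sum.reindex_bij_betw[OF bs, symmetric])
  finally show ?thesis by (simp add: crd_def)
qed

lemma alg_trace_linear: "alg_trace (x + y) = alg_trace x + alg_trace y" "alg_trace (scale c x) = c * alg_trace x"
  unfolding alg_trace_crd
  by (simp_all add: distrib_right crd_add sum.distrib scale_mult_left crd_scale sum_distrib_left)

definition g :: "nat \<Rightarrow> nat \<Rightarrow> nat \<Rightarrow> 'k alg_closure" where "g i j k = to_ac (crd (bs i * bs j) k)"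
definition s :: "nat \<Rightarrow> nat \<Rightarrow> 'k alg_closure" where "s i k = to_ac (crd (\<sigma> (bs i)) k)"
definition emb :: "'a \<Rightarrow> nat \<Rightarrow> 'k alg_closure" where "emb x k = to_ac (crd x k)"

lemma emb_mult: "emb (x * y) = ma d g (emb x) (emb y)"
proof
  fix k
  have "crd (x * y) k = (\<Sum>i<d. \<Sum>j<d. crd x i * (crd y j * crd (bs i * bs j) k))"
    by (subst crd_mult_left, subst crd_mult_right) (simp add: sum_distrib_left)
  thus "emb (x * y) k = ma d g (emb x) (emb y) k"
    by (cases "k < d") (simp_all add: emb_def ma_def g_def to_ac_sum mult.assoc, simp add: crd_def)
qed

lemma emb_sigma: "emb (\<sigma> x) = sa d s (emb x)"
proof
  fix k
  show "emb (\<sigma> x) k = sa d s (emb x) k"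
  proof (cases "k < d")
    case True
    thus ?thesis unfolding emb_def sa_def s_def by (subst crd_sigma) (simp add: to_ac_sum)
  qed (simp add: emb_def sa_def crd_def)
qed

text \<open>Every axiom reduces to an identity between structure constants, read off from products
  of basis vectors over the base field; multilinearity carries it to coordinates in the
  closure.\<close>

lemma coalg: "coalg d g s (emb 1) (range to_ac)"
proof
  have ext: "(if k < d then f k else 0) = (if k < d then h k else 0)" if "k < d \<Longrightarrow> f k = h k" for k :: nat and f h :: "nat \<Rightarrow> 'k alg_closure"
    using that by simp
  have "to_ac (2::'k) \<noteq> 0" using two by (simp del: to_ac_numeral)
  thus "(2 :: 'k alg_closure) \<noteq> 0" by simp
  show "subfld (range to_ac :: 'k alg_closure set)" unfolding subfld_def
    using rangeI[of to_ac "0::'k"] rangeI[of to_ac "1::'k"]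
    by (auto simp flip: to_ac_add to_ac_minus to_ac_mult to_ac_inverse simp del: rangeI)
  show "g i j k \<in> range to_ac" "s i k \<in> range to_ac" "emb 1 k \<in> range to_ac" for i j k
    unfolding g_def s_def emb_def by auto
  show "emb 1 k = 0" if "d \<le> k" for k unfolding emb_def crd_def using that by simp
  show "ma d g (ma d g x y) z = ma d g x (ma d g y z)" for x y z :: "nat \<Rightarrow> 'k alg_closure"
  proof
    fix k
    have c: "(\<Sum>p<d. g i j p * g p l k) = (\<Sum>p<d. g j l p * g i p k)" if "i < d" "j < d" "l < d" for i j l
    proof -
      have "(\<Sum>p<d. crd (bs i * bs j) p * crd (bs p * bs l) k) = (\<Sum>p<d. crd (bs j * bs l) p * crd (bs i * bs p) k)"
        unfolding crd_mult_left[symmetric] crd_mult_right[symmetric] by (simp add: mult.assoc)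
      thus ?thesis unfolding g_def by (simp flip: to_ac_mult to_ac_sum)
    qed
    have "(\<Sum>p<d. \<Sum>l<d. ma d g x y p * z l * g p l k) = (\<Sum>p<d. \<Sum>l<d. \<Sum>i<d. \<Sum>j<d. x i * y j * g i j p * z l * g p l k)"
      by (intro sum.cong refl) (simp add: ma_def sum_distrib_right)
    also have "\<dots> = (\<Sum>i<d. \<Sum>j<d. \<Sum>l<d. \<Sum>p<d. x i * y j * g i j p * z l * g p l k)" by (rule sum4)
    also have "\<dots> = (\<Sum>i<d. \<Sum>j<d. \<Sum>l<d. x i * y j * z l * (\<Sum>p<d. g i j p * g p l k))"
      by (intro sum.cong refl) (simp add: sum_distrib_left mult_ac)
    also have "\<dots> = (\<Sum>i<d. \<Sum>j<d. \<Sum>l<d. x i * y j * z l * (\<Sum>p<d. g j l p * g i p k))"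
      by (intro sum.cong refl) (simp add: c)
    also have "\<dots> = (\<Sum>i<d. \<Sum>j<d. \<Sum>l<d. \<Sum>p<d. x i * (y j * z l * g j l p) * g i p k)"
      by (intro sum.cong refl) (simp add: sum_distrib_left mult_ac)
    also have "\<dots> = (\<Sum>i<d. \<Sum>j<d. \<Sum>p<d. \<Sum>l<d. x i * (y j * z l * g j l p) * g i p k)"
      by (intro sum.cong[OF refl] sum.swap)
    also have "\<dots> = (\<Sum>i<d. \<Sum>p<d. \<Sum>j<d. \<Sum>l<d. x i * (y j * z l * g j l p) * g i p k)"
      by (intro sum.cong[OF refl] sum.swap)
    also have "\<dots> = (\<Sum>i<d. \<Sum>p<d. x i * ma d g y z p * g i p k)"
      by (intro sum.cong refl) (simp add: ma_def sum_distrib_right sum_distrib_left)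
    finally show "ma d g (ma d g x y) z k = ma d g x (ma d g y z) k"
      unfolding ma_def[of d g "ma d g x y"] ma_def[of d g x "ma d g y z"] by simp
  qed
  have unit: "(\<Sum>i<d. emb 1 i * g i j k) = (if j = k then 1 else 0)" "(\<Sum>i<d. emb 1 i * g j i k) = (if j = k then 1 else 0)"
    if "j < d" for j k
  proof -
    have "crd (1 * bs j) k = (if j = k then 1 else 0)" "crd (bs j * 1) k = (if j = k then 1 else 0)"
      using crd_bs[OF that] by auto
    hence "(\<Sum>i<d. crd 1 i * crd (bs i * bs j) k) = (if j = k then 1 else 0)"
      "(\<Sum>i<d. crd 1 i * crd (bs j * bs i) k) = (if j = k then 1 else 0)"
      unfolding crd_mult_left[of 1] crd_mult_right[of _ 1] by auto
    hence "to_ac (\<Sum>i<d. crd 1 i * crd (bs i * bs j) k) = (if j = k then 1 else 0)"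
      "to_ac (\<Sum>i<d. crd 1 i * crd (bs j * bs i) k) = (if j = k then 1 else 0)" by simp_all
    thus "(\<Sum>i<d. emb 1 i * g i j k) = (if j = k then 1 else 0)" "(\<Sum>i<d. emb 1 i * g j i k) = (if j = k then 1 else 0)"
      unfolding emb_def g_def by (simp_all add: to_ac_sum)
  qed
  fix x :: "nat \<Rightarrow> 'k alg_closure" assume x: "\<forall>k\<ge>d. x k = 0"
  have delta: "(\<Sum>j<d. x j * (if j = k then 1 else 0)) = x k" for k using x by (simp add: if_distrib cong: if_cong)
  show "ma d g (emb 1) x = x"
  proof
    fix k
    have "(\<Sum>i<d. \<Sum>j<d. emb 1 i * x j * g i j k) = (\<Sum>j<d. \<Sum>i<d. x j * (emb 1 i * g i j k))"
      by (subst sum.swap) (simp add: mult_ac)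
    also have "\<dots> = (\<Sum>j<d. x j * (if j = k then 1 else 0))"
      by (intro sum.cong refl) (simp only: unit lessThan_iff flip: sum_distrib_left)
    finally show "ma d g (emb 1) x k = x k" unfolding delta ma_def using x by simp
  qed
  show "ma d g x (emb 1) = x"
  proof
    fix k
    have "(\<Sum>i<d. \<Sum>j<d. x i * emb 1 j * g i j k) = (\<Sum>j<d. \<Sum>i<d. x j * (emb 1 i * g j i k))"
      by (simp add: mult_ac)
    also have "\<dots> = (\<Sum>j<d. x j * (if j = k then 1 else 0))"
      by (intro sum.cong refl) (simp only: unit lessThan_iff flip: sum_distrib_left)
    finally show "ma d g x (emb 1) k = x k" unfolding delta ma_def using x by simp
  qed
  show "sa d s (sa d s x) = x"
  proof
    fix k
    have c: "(\<Sum>p<d. s i p * s p k) = (if i = k then 1 else 0)" if "i < d" for i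
    proof -
      have "(\<Sum>p<d. crd (\<sigma> (bs i)) p * crd (\<sigma> (bs p)) k) = (if i = k then 1 else 0)"
        unfolding crd_sigma[symmetric] involution_involutive using crd_bs[OF that] by auto
      hence "to_ac (\<Sum>p<d. crd (\<sigma> (bs i)) p * crd (\<sigma> (bs p)) k) = (if i = k then 1 else 0)" by simp
      thus ?thesis unfolding s_def by (simp add: to_ac_sum)
    qed
    have "(\<Sum>p<d. sa d s x p * s p k) = (\<Sum>p<d. \<Sum>i<d. x i * (s i p * s p k))"
      by (intro sum.cong refl) (simp add: sa_def sum_distrib_right mult.assoc)
    also have "\<dots> = (\<Sum>i<d. x i * (\<Sum>p<d. s i p * s p k))" by (subst sum.swap) (simp only: sum_distrib_left)
    also have "\<dots> = (\<Sum>i<d. x i * (if i = k then 1 else 0))" by (intro sum.cong refl) (simp only: c lessThan_iff)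
    finally show "sa d s (sa d s x) k = x k" unfolding delta sa_def[of d s "sa d s x"] using x by simp
  qed
next
  fix x y :: "nat \<Rightarrow> 'k alg_closure"
  show "sa d s (ma d g x y) = ma d g (sa d s y) (sa d s x)"
  proof
    fix k
    have c: "(\<Sum>p<d. g i j p * s p k) = (\<Sum>q<d. \<Sum>p<d. s j p * s i q * g p q k)" for i j
    proof -
      have "(\<Sum>p<d. crd (bs i * bs j) p * crd (\<sigma> (bs p)) k) = crd (\<sigma> (bs j) * \<sigma> (bs i)) k"
        unfolding crd_sigma[symmetric] involution_mult ..
      also have "\<dots> = (\<Sum>q<d. \<Sum>p<d. crd (\<sigma> (bs j)) p * crd (\<sigma> (bs i)) q * crd (bs p * bs q) k)"
        by (subst crd_mult_right, subst crd_mult_left) (simp add: sum_distrib_left mult_ac)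
      finally have "to_ac (\<Sum>p<d. crd (bs i * bs j) p * crd (\<sigma> (bs p)) k) =
        to_ac (\<Sum>q<d. \<Sum>p<d. crd (\<sigma> (bs j)) p * crd (\<sigma> (bs i)) q * crd (bs p * bs q) k)" by simp
      thus ?thesis unfolding s_def g_def by (simp add: to_ac_sum)
    qed
    have "(\<Sum>p<d. ma d g x y p * s p k) = (\<Sum>p<d. \<Sum>i<d. \<Sum>j<d. x i * y j * (g i j p * s p k))"
      by (intro sum.cong refl) (simp add: ma_def sum_distrib_right mult.assoc)
    also have "\<dots> = (\<Sum>i<d. \<Sum>p<d. \<Sum>j<d. x i * y j * (g i j p * s p k))" by (rule sum.swap)
    also have "\<dots> = (\<Sum>i<d. \<Sum>j<d. \<Sum>p<d. x i * y j * (g i j p * s p k))" by (intro sum.cong[OF refl] sum.swap)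
    also have "\<dots> = (\<Sum>i<d. \<Sum>j<d. \<Sum>q<d. \<Sum>p<d. x i * y j * (s j p * s i q * g p q k))"
      by (simp only: sum_distrib_left[symmetric] c)
    also have "\<dots> = (\<Sum>p<d. \<Sum>q<d. \<Sum>i<d. \<Sum>j<d. x i * y j * (s j p * s i q * g p q k))" by (rule sum4[symmetric])
    also have "\<dots> = (\<Sum>p<d. \<Sum>q<d. sa d s y p * sa d s x q * g p q k)"
    proof (intro sum.cong refl)
      fix p q assume pq: "p \<in> {..<d}" "q \<in> {..<d}"
      have e: "sa d s x q * sa d s y p = (\<Sum>i<d. \<Sum>j<d. (x i * s i q) * (y j * s j p))"
        unfolding sa_def using pq by (simp add: sum_product)
      have "(\<Sum>i<d. \<Sum>j<d. x i * y j * (s j p * s i q * g p q k)) = (\<Sum>i<d. \<Sum>j<d. (x i * s i q) * (y j * s j p)) * g p q k"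
        by (simp only: sum_distrib_right sum_distrib_left mult_ac)
      thus "(\<Sum>i<d. \<Sum>j<d. x i * y j * (s j p * s i q * g p q k)) = sa d s y p * sa d s x q * g p q k"
        unfolding e[symmetric] by (simp only: mult.commute[of "sa d s x q"])
    qed
    finally show "sa d s (ma d g x y) k = ma d g (sa d s y) (sa d s x) k"
      unfolding sa_def[of d s "ma d g x y"] ma_def[of d g "sa d s y"] by simp
  qed
qed

end

text \<open>Needed for Gram matrices that are not symmetric: orthogonality only says that the
  symmetrized off-diagonal entries vanish.\<close>

lemma sum_off_diagonal:
  fixes C :: "nat \<Rightarrow> nat \<Rightarrow> 'c::field"
  assumes two: "(2::'c) \<noteq> 0" and C: "\<And>i j. i < d \<Longrightarrow> j < d \<Longrightarrow> i \<noteq> j \<Longrightarrow> C i j + C j i = 0"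
  shows "(\<Sum>i<d. \<Sum>j<d. x i * x j * C i j) = (\<Sum>i<d. x i * x i * C i i)"
proof -
  let ?S = "\<Sum>i<d. \<Sum>j<d. x i * x j * C i j"
  have "?S + ?S = ?S + (\<Sum>i<d. \<Sum>j<d. x j * x i * C j i)" by (subst (3) sum.swap) simp
  also have "\<dots> = (\<Sum>i<d. \<Sum>j<d. x i * x j * (C i j + C j i))"
    by (simp add: sum.distrib[symmetric] algebra_simps)
  also have "\<dots> = (\<Sum>i<d. \<Sum>j<d. if j = i then x i * x i * C i i + x i * x i * C i i else 0)"
  proof (intro sum.cong refl)
    fix i j assume "i \<in> {..<d}" "j \<in> {..<d}"
    thus "x i * x j * (C i j + C j i) = (if j = i then x i * x i * C i i + x i * x i * C i i else 0)"
      using C[of i j] by (cases "i = j") (simp_all add: distrib_left)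
  qed
  also have "\<dots> = (\<Sum>i<d. x i * x i * C i i) + (\<Sum>i<d. x i * x i * C i i)" by (simp add: sum.distrib sum_distrib_left mult.assoc)
  finally have "2 * ?S = 2 * (\<Sum>i<d. x i * x i * C i i)" unfolding mult_2 .
  thus ?thesis using two by simp
qed

context algebra_with_involution
begin

text \<open>\<open>alg_trace (\<sigma> x * y)\<close> need not be symmetric, since
  \<open>\<sigma>\<close> exchanges left and right multiplications and their traces can differ.
  Averaging gives the symmetric form belonging to \<open>inv_trace_form\<close>.\<close>

definition bf :: "'a \<Rightarrow> 'a \<Rightarrow> 'k" where
  "bf x y = (alg_trace (\<sigma> x * y) + alg_trace (\<sigma> y * x)) / 2"

end

context based_algebra
begin

interpretation sg: Vector_Spaces.linear scale scale \<sigma> by (rule involution_linear)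

interpretation C: coalg d g s "emb 1" "range to_ac" by (rule coalg)

lemma emb_add: "emb (x + y) = emb x + emb y" by (rule ext) (simp add: emb_def crd_add)

lemma emb_inj: "emb x = emb y \<longleftrightarrow> x = y"
proof
  assume e: "emb x = emb y"
  have "crd x k = crd y k" for k using fun_cong[OF e, of k] unfolding emb_def by simp
  thus "x = y" by (rule crd_inj)
qed simp

lemma emb_zero: "emb 0 = 0" by (rule ext) (simp add: emb_def crd_zero)

lemma emb_sum: "emb (\<Sum>i\<in>S. f i) k = (\<Sum>i\<in>S. emb (f i) k)"
  unfolding emb_def by (simp add: crd_sum to_ac_sum)

lemma emb_surj:
  assumes "\<And>k. x k \<in> range to_ac" "\<And>k. d \<le> k \<Longrightarrow> x k = 0"
  shows "\<exists>y. emb y = x"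
proof -
  have "\<exists>a. x k = to_ac a" for k using assms(1)[of k] by blast
  hence "\<forall>k. \<exists>a. x k = to_ac a" by blast
  from choice[OF this] obtain c where c: "\<And>k. x k = to_ac (c k)" by blast
  have "crd (\<Sum>i<d. scale (c i) (bs i)) k = (\<Sum>i<d. if i = k then c k else 0)" for k
    unfolding crd_sum by (intro sum.cong refl) (simp add: crd_scale crd_bs)
  hence "crd (\<Sum>i<d. scale (c i) (bs i)) k = (if k < d then c k else 0)" for k by simp
  hence "emb (\<Sum>i<d. scale (c i) (bs i)) k = x k" for k
    unfolding emb_def using assms(2)[of k] c[of k] by (cases "k < d") simp_all
  thus ?thesis by blast
qed

lemma tr_eq: "C.tr z = (\<Sum>i<d. z i * to_ac (alg_trace (bs i)))"
proof -
  have "C.tr z = (\<Sum>k<d. \<Sum>i<d. z i * g i k k)" unfolding C.tr_def C.lmat_def by simp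
  also have "\<dots> = (\<Sum>i<d. z i * (\<Sum>k<d. g i k k))" by (subst sum.swap) (simp add: sum_distrib_left)
  finally show ?thesis unfolding alg_trace_crd g_def by (simp add: to_ac_sum)
qed

lemma qf_diagonal:
  assumes ort: "\<And>x y. x \<in> B \<Longrightarrow> y \<in> B \<Longrightarrow> x \<noteq> y \<Longrightarrow> bf x y = 0"
  shows "C.qf x = (\<Sum>k<d. to_ac (bf (bs k) (bs k)) * x k * x k)"
proof -
  define D where "D j l = to_ac (alg_trace (\<sigma> (bs l) * bs j))" for j l
  have Ds: "(\<Sum>i<d. \<Sum>p<d. s l i * g i j p * to_ac (alg_trace (bs p))) = D j l" for j l
  proof -
    have "alg_trace (\<sigma> (bs l) * bs j) = (\<Sum>i<d. crd (\<sigma> (bs l)) i * alg_trace (bs i * bs j))"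
      by (rule linear_crd) (simp_all add: distrib_right alg_trace_linear scale_mult_left)
    also have "\<dots> = (\<Sum>i<d. \<Sum>p<d. crd (\<sigma> (bs l)) i * crd (bs i * bs j) p * alg_trace (bs p))"
    proof (intro sum.cong refl)
      fix i
      have "alg_trace (bs i * bs j) = (\<Sum>p<d. crd (bs i * bs j) p * alg_trace (bs p))"
        by (rule linear_crd) (simp_all add: alg_trace_linear)
      thus "crd (\<sigma> (bs l)) i * alg_trace (bs i * bs j) =
          (\<Sum>p<d. crd (\<sigma> (bs l)) i * crd (bs i * bs j) p * alg_trace (bs p))"
        by (simp add: sum_distrib_left mult.assoc)
    qed
    finally show ?thesis unfolding D_def s_def g_def by (simp add: to_ac_sum)
  qed
  have "C.qf x = (\<Sum>p<d. \<Sum>i<d. \<Sum>j<d. \<Sum>l<d. x j * x l * (s l i * g i j p * to_ac (alg_trace (bs p))))"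
    unfolding C.qf_def tr_eq
  proof (intro sum.cong refl)
    fix p assume p: "p \<in> {..<d}"
    have "ma d g (sa d s x) x p = (\<Sum>i<d. \<Sum>j<d. (\<Sum>l<d. x l * s l i) * x j * g i j p)"
      unfolding ma_def using p by (simp add: sa_def)
    hence "ma d g (sa d s x) x p * to_ac (alg_trace (bs p)) =
        (\<Sum>i<d. \<Sum>j<d. (\<Sum>l<d. x l * s l i) * x j * g i j p) * to_ac (alg_trace (bs p))" by (rule arg_cong)
    thus "ma d g (sa d s x) x p * to_ac (alg_trace (bs p)) =
        (\<Sum>i<d. \<Sum>j<d. \<Sum>l<d. x j * x l * (s l i * g i j p * to_ac (alg_trace (bs p))))"
      by (simp only: sum_distrib_right sum_distrib_left mult_ac)
  qed
  also have "\<dots> = (\<Sum>j<d. \<Sum>l<d. \<Sum>i<d. \<Sum>p<d. x j * x l * (s l i * g i j p * to_ac (alg_trace (bs p))))"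
    by (rule sum4)
  also have "\<dots> = (\<Sum>j<d. \<Sum>l<d. x j * x l * D j l)" by (simp only: sum_distrib_left[symmetric] Ds)
  also have "\<dots> = (\<Sum>j<d. x j * x j * D j j)"
  proof (rule sum_off_diagonal[OF C.two])
    fix i j assume ij: "i < d" "j < d" "i \<noteq> j"
    hence "bf (bs i) (bs j) = 0" using bs by (intro ort) (auto simp: bij_betw_def inj_on_def)
    hence "alg_trace (\<sigma> (bs j) * bs i) + alg_trace (\<sigma> (bs i) * bs j) = 0"
      using two unfolding bf_def by (simp add: add.commute)
    thus "D i j + D j i = 0" unfolding D_def by (simp flip: to_ac_add)
  qed
  also have "\<dots> = (\<Sum>k<d. to_ac (bf (bs k) (bs k)) * x k * x k)"
  proof (intro sum.cong refl)
    fix k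
    have "bf (bs k) (bs k) = alg_trace (\<sigma> (bs k) * bs k)" using two unfolding bf_def by (simp flip: mult_2)
    thus "x k * x k * D k k = to_ac (bf (bs k) (bs k)) * x k * x k" unfolding D_def by simp
  qed
  finally show ?thesis .
qed

lemma multiple_hyperbolic_iff: "multiple_hyperbolic n \<sigma> \<longleftrightarrow> C.hyp (range to_ac) {..<n}"
proof -
  define em where "em M i j = (if i < n \<and> j < n then emb (M $$ (i, j)) else 0)" for M :: "'a mat" and i j
  let ?I = "{..<n}"
  have emk: "em M i j k = emb (M $$ (i, j)) k" if "i < n" "j < n" for M i j k unfolding em_def using that by simp
  have em_eq: "em M = em N \<longleftrightarrow> M = N" if "M \<in> carrier_mat n n" "N \<in> carrier_mat n n" for M N
  proof
    assume e: "em M = em N"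
    have "M $$ (i, j) = N $$ (i, j)" if "i < n" "j < n" for i j
      using fun_cong[OF fun_cong[OF e, of i], of j] that unfolding em_def by (simp add: emb_inj)
    thus "M = N" using that by (intro eq_matI) auto
  qed simp
  have em_mult: "em (M * M) = C.mm ?I (em M) (em M)" if M: "M \<in> carrier_mat n n" for M
  proof (intro ext)
    fix i j k
    show "em (M * M) i j k = C.mm ?I (em M) (em M) i j k"
    proof (cases "i < n \<and> j < n")
      case True
      hence "(M * M) $$ (i, j) = (\<Sum>l<n. M $$ (i, l) * M $$ (l, j))"
        using M by (auto simp: scalar_prod_def atLeast0LessThan intro!: sum.cong)
      hence "em (M * M) i j k = (\<Sum>l<n. ma d g (emb (M $$ (i, l))) (emb (M $$ (l, j))) k)"
        using True by (simp only: emk emb_sum emb_mult)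
      also have "\<dots> = C.mm ?I (em M) (em M) i j k" unfolding C.mm_def using True by (simp add: em_def)
      finally show ?thesis .
    next
      case False
      have z: "(0 :: nat \<Rightarrow> 'k alg_closure) = (\<lambda>_. 0)" by (simp add: fun_eq_iff)
      show ?thesis using False unfolding C.mm_def em_def z by (auto simp: C.mA_zero)
    qed
  qed
  have em_sum: "em (matrix_involution \<sigma> M + M) = em M + C.sm (em M)" if M: "M \<in> carrier_mat n n" for M
  proof (intro ext)
    fix i j k
    show "em (matrix_involution \<sigma> M + M) i j k = (em M + C.sm (em M)) i j k"
    proof (cases "i < n \<and> j < n")
      case True
      hence "(matrix_involution \<sigma> M + M) $$ (i, j) = \<sigma> (M $$ (j, i)) + M $$ (i, j)"
        using M unfolding matrix_involution_def by auto
      thus ?thesis using True by (simp add: em_def C.sm_def emb_add emb_sigma add.commute)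
    next
      case False
      have z: "(0 :: nat \<Rightarrow> 'k alg_closure) = (\<lambda>_. 0)" by (simp add: fun_eq_iff)
      show ?thesis using False unfolding C.sm_def em_def by (auto simp: z C.sA_zero)
    qed
  qed
  have em_one: "em (1\<^sub>m n) = C.Em ?I"
  proof (intro ext)
    fix i j k
    show "em (1\<^sub>m n) i j k = C.Em ?I i j k" unfolding em_def C.Em_def by (auto simp: emb_zero)
  qed
  have em_in: "em M \<in> C.Bm (range to_ac) ?I" for M
    unfolding C.Bm_def em_def emb_def using subfldD(1)[OF C.K0] by (auto simp: crd_def)
  have em_surj: "\<exists>M\<in>carrier_mat n n. em M = v" if v: "v \<in> C.Bm (range to_ac) ?I" for v
  proof -
    have "\<exists>y. emb y = v i j" for i j using v unfolding C.Bm_def by (intro emb_surj) auto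
    hence "\<forall>i. \<forall>j. \<exists>y. emb y = v i j" by blast
    hence "\<forall>i. \<exists>y. \<forall>j. emb (y j) = v i j" by (intro allI choice) blast
    from choice[OF this] obtain y where y: "\<And>i j. emb (y i j) = v i j" by blast
    have v0: "v i j = 0" if "\<not> (i < n \<and> j < n)" for i j using v that unfolding C.Bm_def by (auto simp: fun_eq_iff)
    have "em (mat n n (\<lambda>(i, j). y i j)) i j = v i j" for i j
      unfolding em_def using v0[of i j] y by auto
    thus ?thesis by (intro bexI[of _ "mat n n (\<lambda>(i, j). y i j)"]) auto
  qed
  have "multiple_hyperbolic n \<sigma> \<longleftrightarrow> (\<exists>M\<in>carrier_mat n n. M * M = M \<and> matrix_involution \<sigma> M + M = 1\<^sub>m n)"
    unfolding multiple_hyperbolic_def hyperbolic_def matrix_algebra_def by simp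
  also have "\<dots> \<longleftrightarrow> (\<exists>M\<in>carrier_mat n n. C.mm ?I (em M) (em M) = em M \<and> em M + C.sm (em M) = C.Em ?I)"
  proof (intro bex_cong refl)
    fix M :: "'a mat" assume M: "M \<in> carrier_mat n n"
    have "M * M \<in> carrier_mat n n" "matrix_involution \<sigma> M + M \<in> carrier_mat n n" "1\<^sub>m n \<in> carrier_mat n n"
      using M unfolding matrix_involution_def by auto
    thus "(M * M = M \<and> matrix_involution \<sigma> M + M = 1\<^sub>m n) \<longleftrightarrow>
        (C.mm ?I (em M) (em M) = em M \<and> em M + C.sm (em M) = C.Em ?I)"
      using em_eq M unfolding em_mult[OF M, symmetric] em_sum[OF M, symmetric] em_one[symmetric] by blast
  qed
  also have "\<dots> \<longleftrightarrow> C.hyp (range to_ac) ?I" unfolding C.hyp_def using em_in em_surj by metis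
  finally show ?thesis .
qed

end

context algebra_with_involution
begin

text \<open>Linearity of the trace is taken from coordinates in an arbitrary basis
  \<open>B0\<close>; an orthogonal basis can be chosen only once \<open>bf\<close> is known to be
  bilinear.\<close>

lemma bf_properties:
  assumes "(2::'k) \<noteq> 0"
  shows "bf x y = bf y x" "bf (x + y) z = bf x z + bf y z" "bf (scale c x) z = c * bf x z" "inv_trace_form x = bf x x"
proof -
  interpret sg: Vector_Spaces.linear scale scale \<sigma> by (rule involution_linear)
  obtain B0 where B0: "finite B0" "independent B0" "span B0 = UNIV" using subspace_eq_span[OF subspace_UNIV] by blast
  obtain h where "bij_betw h {..<card B0} B0"
    using ex_bij_betw_nat_finite[OF B0(1)] by (auto simp: atLeast0LessThan)
  then interpret based_algebra scale \<sigma> B0 h "card B0" by unfold_locales (use B0 assms in auto)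
  show "bf x y = bf y x" unfolding bf_def by (simp add: add.commute)
  show "bf (x + y) z = bf x z + bf y z"
    unfolding bf_def by (simp add: sg.add distrib_left distrib_right alg_trace_linear add_divide_distrib)
  show "bf (scale c x) z = c * bf x z"
    unfolding bf_def by (simp add: sg.scale scale_mult_left scale_mult_right alg_trace_linear distrib_left flip: mult_divide_mult_cancel_left)
  show "inv_trace_form x = bf x x" using assms unfolding bf_def inv_trace_form_def by (simp flip: mult_2)
qed

end

theorem theorem3p3:
  fixes scale :: "'k::field \<Rightarrow> 'a::{ring, monoid_mult} \<Rightarrow> 'a"
    and \<sigma> :: "'a \<Rightarrow> 'a"
  assumes "CHAR('k) \<noteq> 2"
    and "algebra_with_involution scale \<sigma>"
  shows "((\<exists>n\<ge>1. multiple_hyperbolic n \<sigma>) \<longleftrightarrow>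
          (\<forall>P. field_ordering P \<longrightarrow>
             fin_dim_space.sgn_form scale P (algebra_with_involution.inv_trace_form scale \<sigma>) = 0)) \<and>
         ((\<exists>n\<ge>1. multiple_hyperbolic n \<sigma>) \<longrightarrow>
          (\<exists>k. (LEAST n. n \<ge> 1 \<and> multiple_hyperbolic n \<sigma>) = 2 ^ k))"
proof -
  interpret A: algebra_with_involution scale \<sigma> by fact
  have two: "(2::'k) \<noteq> 0"
  proof
    assume "(2::'k) = 0"
    hence "of_nat 2 = (0::'k)" by simp
    hence "CHAR('k) dvd 2" by (simp only: of_nat_eq_0_iff_char_dvd)
    hence "CHAR('k) = 1 \<or> CHAR('k) = 2" using prime_nat_iff two_is_prime_nat by blast
    thus False using assms(1) CHAR_not_1' by auto
  qed
  note bf = A.bf_properties[OF two]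
  obtain B where B: "finite B" "A.independent B" "A.span B = UNIV" "\<And>x y. x \<in> B \<Longrightarrow> y \<in> B \<Longrightarrow> x \<noteq> y \<Longrightarrow> A.bf x y = 0"
    using A.orthogonal_basis[OF bf(1-3) two] by blast
  note BB = B
  define d where "d = card B"
  obtain bs where bs: "bij_betw bs {..<d} B"
    using ex_bij_betw_nat_finite[OF B(1)] unfolding d_def by (auto simp: atLeast0LessThan)
  interpret based_algebra scale \<sigma> B bs d by unfold_locales (use B bs two in auto)
  interpret C: coalg d g s "emb 1" "range to_ac" by (rule coalg)
  let ?D = "\<lambda>k. A.bf (bs k) (bs k)"
  have qf: "C.qf x = (\<Sum>k<d. to_ac (?D k) * x k * x k)" for x by (rule qf_diagonal[OF BB(4)])
  have q: "A.inv_trace_form = (\<lambda>x. A.bf x x)" by (rule ext) (rule bf(4))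
  have cards: "card {x \<in> B. Q (A.bf x x)} = card {k. k < d \<and> Q (?D k)}" for Q
  proof -
    have "bij_betw bs {k. k < d \<and> Q (?D k)} {x \<in> B. Q (A.bf x x)}"
      using bs unfolding bij_betw_def inj_on_def by auto
    thus ?thesis by (rule bij_betw_same_card[symmetric])
  qed
  have sgn: "A.sgn_form P A.inv_trace_form =
      int (card {k. k < d \<and> ?D k \<in> P - {0}}) - int (card {k. k < d \<and> - ?D k \<in> P - {0}})" if "field_ordering P" for P
  proof -
    have "A.sgn_form P (\<lambda>x. A.bf x x) =
        int (card {x \<in> B. A.bf x x \<in> P - {0}}) - int (card {x \<in> B. - A.bf x x \<in> P - {0}})"
      by (rule A.sgn_form_diagonal[OF bf(1-3) that two BB])
    thus ?thesis unfolding q cards[of "\<lambda>y. y \<in> P - {0}"] cards[of "\<lambda>y. - y \<in> P - {0}"] .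
  qed
  have hyp_sgn: "A.sgn_form P A.inv_trace_form = 0" if n: "n \<ge> 1" "multiple_hyperbolic n \<sigma>" and P: "field_ordering P" for n P
  proof -
    have h: "C.hyp (range to_ac) {..<n}" "0 < n" using n multiple_hyperbolic_iff by auto
    have o: "P \<union> uminus ` P = UNIV" "P \<inter> uminus ` P = {0}" "\<forall>x\<in>P. \<forall>y\<in>P. x + y \<in> P" "\<forall>x\<in>P. \<forall>y\<in>P. x * y \<in> P"
      using P unfolding field_ordering_def by blast+
    have total: "x \<in> P \<or> - x \<in> P" for x
    proof -
      have "x \<in> P \<or> x \<in> uminus ` P" using o(1) by blast
      thus ?thesis by auto
    qed
    have anti: "x = 0" if "x \<in> P" "- x \<in> P" for x
    proof -
      have "x \<in> uminus ` P" using that(2) by (intro image_eqI[of _ _ "- x"]) auto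
      thus ?thesis using o(2) that(1) by blast
    qed
    have P0: "0 \<in> P" using o(2) by blast
    have "x * x \<in> P" for x using total[of x] o(4) by (metis minus_mult_minus)
    hence sq: "x * x \<in> to_ac ` P" if "x \<in> range to_ac" for x :: "'k alg_closure" using that by (auto simp flip: to_ac_mult)
    have mem: "to_ac x \<in> to_ac ` P \<longleftrightarrow> x \<in> P" for x :: 'k by (auto simp: image_iff)
    have cone: "cone (to_ac ` P :: 'k alg_closure set)" unfolding cone_def
    proof (intro conjI ballI impI)
      show "0 \<in> (to_ac ` P :: 'k alg_closure set)" using mem[of 0] P0 by simp
      fix x :: "'k alg_closure" assume "x \<in> to_ac ` P"
      then obtain a where a: "a \<in> P" "x = to_ac a" by blast
      show "x = 0" if "- x \<in> to_ac ` P" using that anti[OF a(1)] mem[of "- a"] unfolding a(2) by simp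
      fix y :: "'k alg_closure" assume "y \<in> to_ac ` P"
      then obtain b where b: "b \<in> P" "y = to_ac b" by blast
      show "x + y \<in> to_ac ` P" "x * y \<in> to_ac ` P"
        unfolding a(2) b(2) to_ac_add[symmetric] to_ac_mult[symmetric] mem using a b o by blast+
    qed
    \<comment> \<open>One inequality serves both signs: \<open>\<epsilon> = 1\<close> bounds the
      number of positive coefficients by that of the negative ones, \<open>\<epsilon> = - 1\<close>
      conversely.\<close>
    have le: "card {k. k < d \<and> \<epsilon> * ?D k \<in> P - {0}} \<le> card {k. k < d \<and> - (\<epsilon> * ?D k) \<in> P - {0}}" for \<epsilon>
    proof (rule C.hyperbolic_card_le[OF h(2,1) _ cone sq, where D = "\<lambda>k. to_ac (\<epsilon> * ?D k)" and \<epsilon> = "to_ac \<epsilon>"])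
      show "to_ac \<epsilon> * C.qf x = (\<Sum>k<d. to_ac (\<epsilon> * ?D k) * x k * x k)" for x
        unfolding qf by (simp add: sum_distrib_left mult.assoc)
      show "to_ac (\<epsilon> * ?D k) \<in> to_ac ` P - {0}" if "k \<in> {k. k < d \<and> \<epsilon> * ?D k \<in> P - {0}}" for k
        using that mem[of "\<epsilon> * ?D k"] by simp
      show "to_ac (\<epsilon> * ?D k) \<in> to_ac ` P" if "k < d" "k \<notin> {k. k < d \<and> - (\<epsilon> * ?D k) \<in> P - {0}}" for k
        unfolding mem using that total[of "\<epsilon> * ?D k"] P0 by auto
    qed auto
    show ?thesis using sgn[OF P] le[of 1] le[of "- 1"] by simp
  qed
  have wh: "C.wh (range to_ac)" if z: "\<forall>P. field_ordering P \<longrightarrow> A.sgn_form P A.inv_trace_form = 0"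
  proof (rule ccontr)
    assume nw: "\<not> C.wh (range to_ac)"
    obtain L where L: "range to_ac \<subseteq> L" "euclidean L"
      "card {k. k < d \<and> - to_ac (?D k) \<in> sqs L - {0}} < card {k. k < d \<and> to_ac (?D k) \<in> sqs L - {0}}"
      using positive_ordering_exists[OF coalg nw qf] by blast
    note eL = euclideanD[OF L(2)]
    \<comment> \<open>Pulling back the squares of \<open>L\<close> preserves the sign of every
      diagonal coefficient, so the strict inequality between the two counts carries over.\<close>
    define P where "P = {x :: 'k. to_ac x \<in> sqs L}"
    have "field_ordering P" unfolding field_ordering_def
    proof (intro conjI ballI)
      have "x \<in> P \<union> uminus ` P" for x
      proof -
        have "to_ac x \<in> sqs L \<or> - to_ac x \<in> sqs L" using eL(3) L(1) by blast
        hence "x \<in> P \<or> - x \<in> P" unfolding P_def by simp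
        thus ?thesis by (metis UnCI image_eqI minus_minus)
      qed
      thus "P \<union> uminus ` P = UNIV" by blast
      have "x = 0" if "x \<in> P \<inter> uminus ` P" for x
      proof -
        have "to_ac x \<in> sqs L" "- to_ac x \<in> sqs L" using that unfolding P_def by auto
        thus ?thesis using eL(4) by (metis to_ac_eq_0_iff)
      qed
      moreover have "0 \<in> P \<inter> uminus ` P" unfolding P_def using sqs_zero[OF eL(1)] by force
      ultimately show "P \<inter> uminus ` P = {0}" by blast
    qed (auto simp: P_def eL(2) sqs_mult[OF eL(1)])
    hence "A.sgn_form P A.inv_trace_form = 0" using z by blast
    moreover have "{k. k < d \<and> ?D k \<in> P - {0}} = {k. k < d \<and> to_ac (?D k) \<in> sqs L - {0}}"
      "{k. k < d \<and> - ?D k \<in> P - {0}} = {k. k < d \<and> - to_ac (?D k) \<in> sqs L - {0}}"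
      unfolding P_def by auto
    ultimately show False using sgn[OF \<open>field_ordering P\<close>] L(3) by simp
  qed
  have wh_hyp: "\<exists>n\<ge>1. multiple_hyperbolic n \<sigma>" if w: "C.wh (range to_ac)"
  proof -
    obtain k where "multiple_hyperbolic (2 ^ k) \<sigma>" using w unfolding C.wh_def multiple_hyperbolic_iff by blast
    thus ?thesis by (intro exI[of _ "2 ^ k"]) simp
  qed
  have eq: "(\<exists>n\<ge>1. multiple_hyperbolic n \<sigma>) \<longleftrightarrow> (\<forall>P. field_ordering P \<longrightarrow> A.sgn_form P A.inv_trace_form = 0)"
    using hyp_sgn wh wh_hyp by blast
  moreover have "\<exists>k. (LEAST n. n \<ge> 1 \<and> multiple_hyperbolic n \<sigma>) = 2 ^ k" if ex: "\<exists>n\<ge>1. multiple_hyperbolic n \<sigma>"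
  proof (rule C.minimal_hyperbolic_power)
    show "C.wh (range to_ac)" using wh eq ex by blast
    have "(LEAST n. n \<ge> 1 \<and> multiple_hyperbolic n \<sigma>) \<ge> 1 \<and> multiple_hyperbolic (LEAST n. n \<ge> 1 \<and> multiple_hyperbolic n \<sigma>) \<sigma>"
      using ex by (rule LeastI_ex)
    thus "0 < (LEAST n. n \<ge> 1 \<and> multiple_hyperbolic n \<sigma>)"
      "C.hyp (range to_ac) {..<LEAST n. n \<ge> 1 \<and> multiple_hyperbolic n \<sigma>}" unfolding multiple_hyperbolic_iff by auto
    show "(LEAST n. n \<ge> 1 \<and> multiple_hyperbolic n \<sigma>) \<le> r" if "0 < r" "C.hyp (range to_ac) {..<r}" for r
      using that by (intro Least_le) (simp add: multiple_hyperbolic_iff)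
  qed
  ultimately show ?thesis by blast
qed

end
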